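(* The decision problem \textsc{Routing Plan} is in $\mathsf{NP}$.
   Context: An instance of \textsc{Routing Plan} consists of a finite set $A$ of $m$ assets (listed explicitly), a finite undirected graph $G=(V,E)$ (the topology), distinct vertices $s,t\in V$ (initial and target), a set of traps $R\subseteq V\setminus\{s,t\}$, a reload time function $c\colon R\to\mathbb{N}$ (positive integers), and a goal $k\in\{1,\dots,|A|\}$. The question is whether there is a valid plan with at least $k$ surviving assets. A plan is a map $\rho\colon A\times\mathbb{N}_0\to V\cup\{\dagger\}$, where $\dagger\notin V$ is a special location for eliminated assets. Given $\rho$, define recursively: a trap $r\in R$ is active at time $j\ge 0$ if there is no $j'$ with $\max\{0,j-c(r)\}\le j'\le j-1$ at which $r$ was triggered; and $r$ is triggered at time $j$ if $r$ is active at time $j$ and some asset $a$ has $\rho(a,j)=r$. (So every trap is initially active, and after being triggered at time $j$ it is inactive exactly at times $j+1,\dots,j+c(r)$.) The plan $\rho$ is valid if: (1) $\rho(a,0)=s$ for all $a\in A$, and for $j>0$, $\rho(a,j)=s$ implies $\rho(a,j-1)=s$; (2) if $\rho(a,j)\in\{t,\dagger\}$ then $\rho(a,j+1)=\rho(a,j)$; (3) for all $a\in A$, $j\ge 1$: if $\rho(a,j)\ne\dagger$ then $\rho(a,j)$ is equal or adjacent to $\rho(a,j-1)$; (4) for distinct $a,a'\in A$ and $j\ge 0$: if $\rho(a,j)=\rho(a',j)$ then $\rho(a,j)\in\{s,t,\dagger\}$; (5) if $\rho(a,j)=r\in R$ and $r$ is active at time $j$, then $\rho(a,j+1)=\dagger$;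 and this is the only way an asset not yet at $\dagger$ moves to $\dagger$; (6) for every $j\ge 1$, if some $a\in A$ has $\rho(a,j)\notin\{t,\dagger\}$, then some $a'\in A$ has $\rho(a',j)\ne\rho(a',j+1)$; (7) there is $\mathrm{len}(\rho)\in\mathbb{N}$ (the length of $\rho$) such that $\rho(a,\mathrm{len}(\rho))\in\{t,\dagger\}$ for all $a\in A$, and some $a\in A$ has $\rho(a,\mathrm{len}(\rho)-1)\notin\{t,\dagger\}$. An asset $a$ survives in a valid plan $\rho$ if $\rho(a,\mathrm{len}(\rho))=t$. *)

theory Defs
  imports "HOL-Computational_Algebra.Polynomial"
begin

section \<open>Routing plans\<close>

record ('a, 'v) routing_instance =
  assets :: "'a set"
  vertices :: "'v set"
  edges :: "'v set set"
  source :: 'v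
  target :: 'v
  traps :: "'v set"
  reload :: "'v \<Rightarrow> nat"
  goal :: nat

definition routing_instance :: "('a, 'v) routing_instance \<Rightarrow> bool" where
  "routing_instance I \<longleftrightarrow>
     finite (assets I) \<and> finite (vertices I) \<and>
     edges I \<subseteq> {e. e \<subseteq> vertices I \<and> card e = 2} \<and>
     source I \<in> vertices I \<and> target I \<in> vertices I \<and> source I \<noteq> target I \<and>
     traps I \<subseteq> vertices I - {source I, target I} \<and>
     (\<forall>r\<in>traps I. 0 < reload I r) \<and>
     1 \<le> goal I \<and> goal I \<le> card (assets I)"

text \<open>The location \<open>None\<close> is the special location of eliminated assets. Only the values at
  members of \<open>assets I\<close> are relevant.\<close>

type_synonym ('a, 'v) plan = "'a \<Rightarrow> nat \<Rightarrow> 'v option"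

text \<open>Subtraction on \<open>nat\<close> truncates, so \<open>j - reload I r\<close> is \<open>max {0, j - reload I r}\<close>.\<close>

function active :: "('a, 'v) routing_instance \<Rightarrow> ('a, 'v) plan \<Rightarrow> 'v \<Rightarrow> nat \<Rightarrow> bool"
  and triggered :: "('a, 'v) routing_instance \<Rightarrow> ('a, 'v) plan \<Rightarrow> 'v \<Rightarrow> nat \<Rightarrow> bool" where
  "active I \<rho> r j \<longleftrightarrow> \<not> (\<exists>j'\<in>{j - reload I r..<j}. triggered I \<rho> r j')"
| "triggered I \<rho> r j \<longleftrightarrow> active I \<rho> r j \<and> (\<exists>a\<in>assets I. \<rho> a j = Some r)"
  by pat_completeness auto
termination
  by (relation "measure (\<lambda>x. case x of Inl (I, \<rho>, r, j) \<Rightarrow> 2 * j | Inr (I, \<rho>, r, j) \<Rightarrow> 2 * j + 1)") auto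

declare active.simps [simp del] triggered.simps [simp del]

definition finished :: "('a, 'v) routing_instance \<Rightarrow> 'v option \<Rightarrow> bool" where
  "finished I x \<longleftrightarrow> x \<in> {Some (target I), None}"

definition is_length :: "('a, 'v) routing_instance \<Rightarrow> ('a, 'v) plan \<Rightarrow> nat \<Rightarrow> bool" where
  "is_length I \<rho> l \<longleftrightarrow> 1 \<le> l \<and>
     (\<forall>a\<in>assets I. finished I (\<rho> a l)) \<and>
     (\<exists>a\<in>assets I. \<not> finished I (\<rho> a (l - 1)))"

definition valid_plan :: "('a, 'v) routing_instance \<Rightarrow> ('a, 'v) plan \<Rightarrow> bool" where
  "valid_plan I \<rho> \<longleftrightarrow>
     (\<forall>a\<in>assets I. \<forall>j. \<rho> a j \<in> Some ` vertices I \<union> {None}) \<and>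
     (\<forall>a\<in>assets I. \<rho> a 0 = Some (source I) \<and>
        (\<forall>j>0. \<rho> a j = Some (source I) \<longrightarrow> \<rho> a (j - 1) = Some (source I))) \<and>
     (\<forall>a\<in>assets I. \<forall>j. finished I (\<rho> a j) \<longrightarrow> \<rho> a (j + 1) = \<rho> a j) \<and>
     (\<forall>a\<in>assets I. \<forall>j\<ge>1. \<rho> a j \<noteq> None \<longrightarrow>
        \<rho> a j = \<rho> a (j - 1) \<or>
        (\<exists>u v. \<rho> a (j - 1) = Some u \<and> \<rho> a j = Some v \<and> {u, v} \<in> edges I)) \<and>
     (\<forall>a\<in>assets I. \<forall>a'\<in>assets I. \<forall>j. a \<noteq> a' \<longrightarrow> \<rho> a j = \<rho> a' j \<longrightarrow>
        \<rho> a j \<in> {Some (source I), Some (target I), None}) \<and>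
     (\<forall>a\<in>assets I. \<forall>j. \<forall>r\<in>traps I. \<rho> a j = Some r \<longrightarrow> active I \<rho> r j \<longrightarrow>
        \<rho> a (j + 1) = None) \<and>
     (\<forall>a\<in>assets I. \<forall>j. \<rho> a j \<noteq> None \<longrightarrow> \<rho> a (j + 1) = None \<longrightarrow>
        (\<exists>r\<in>traps I. \<rho> a j = Some r \<and> active I \<rho> r j)) \<and>
     (\<forall>j\<ge>1. (\<exists>a\<in>assets I. \<not> finished I (\<rho> a j)) \<longrightarrow>
        (\<exists>a'\<in>assets I. \<rho> a' j \<noteq> \<rho> a' (j + 1))) \<and>
     (\<exists>l. is_length I \<rho> l)"

definition plan_length :: "('a, 'v) routing_instance \<Rightarrow> ('a, 'v) plan \<Rightarrow> nat" where
  "plan_length I \<rho> = (THE l. is_length I \<rho> l)"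

lemma plan_length_eq:
  assumes "valid_plan I \<rho>" "is_length I \<rho> l"
  shows "plan_length I \<rho> = l"
proof -
  have stay: "finished I (\<rho> a (i + d))" if "a \<in> assets I" "finished I (\<rho> a i)" for a i d
  proof (induction d)
    case (Suc d)
    then show ?case using assms(1) that(1) unfolding valid_plan_def by fastforce
  qed (use that in simp)
  have "i \<le> i'" if "is_length I \<rho> i" "is_length I \<rho> i'" for i i'
  proof (rule ccontr)
    assume "\<not> i \<le> i'"
    then have "i - 1 = i' + (i - 1 - i')" by simp
    then show False using that stay unfolding is_length_def by metis
  qed
  then show ?thesis
    unfolding plan_length_def using assms(2) by (intro the_equality) (auto intro: le_antisym)
qed

definition survives :: "('a, 'v) routing_instance \<Rightarrow> ('a, 'v) plan \<Rightarrow> 'a \<Rightarrow> bool" where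
  "survives I \<rho> a \<longleftrightarrow> \<rho> a (plan_length I \<rho>) = Some (target I)"

definition yes_instance :: "('a, 'v) routing_instance \<Rightarrow> bool" where
  "yes_instance I \<longleftrightarrow>
     (\<exists>\<rho>. valid_plan I \<rho> \<and> goal I \<le> card {a \<in> assets I. survives I \<rho> a})"


section \<open>Encoding instances as binary words\<close>

text \<open>Names of assets and vertices, reload times and the goal are written in binary (least
  significant bit first, no leading zeros). Numbers and lists are made self-delimiting by
  marking every bit, respectively every entry, with \<open>True\<close> and the end with \<open>False\<close>.\<close>

fun bits :: "nat \<Rightarrow> bool list" where
  "bits n = (if n = 0 then [] else odd n # bits (n div 2))"

declare bits.simps [simp del]

definition enc_list :: "('x \<Rightarrow> bool list) \<Rightarrow> 'x list \<Rightarrow> bool list" where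
  "enc_list f xs = concat (map (\<lambda>x. True # f x) xs) @ [False]"

definition enc_nat :: "nat \<Rightarrow> bool list" where
  "enc_nat n = enc_list (\<lambda>b. [b]) (bits n)"

definition enc_pair :: "nat \<times> nat \<Rightarrow> bool list" where
  "enc_pair p = enc_nat (fst p) @ enc_nat (snd p)"

text \<open>The finite sets of an instance are listed without repetition, in any order; so an
  instance has several encodings, and its size is at least the number of its assets.\<close>

definition encodes :: "bool list \<Rightarrow> (nat, nat) routing_instance \<Rightarrow> bool" where
  "encodes w I \<longleftrightarrow> (\<exists>as vs es rs.
     distinct as \<and> set as = assets I \<and>
     distinct vs \<and> set vs = vertices I \<and>
     distinct (map (\<lambda>(u, v). {u, v}) es) \<and> set (map (\<lambda>(u, v). {u, v}) es) = edges I \<and>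
     distinct rs \<and> set rs = traps I \<and>
     w = enc_list enc_nat as @ enc_list enc_nat vs @ enc_list enc_pair es @
         enc_nat (source I) @ enc_nat (target I) @
         enc_list enc_pair (map (\<lambda>r. (r, reload I r)) rs) @ enc_nat (goal I))"

definition ROUTING_PLAN :: "bool list set" where
  "ROUTING_PLAN = {w. \<exists>I. encodes w I \<and> routing_instance I \<and> yes_instance I}"

text \<open>The encoding is unambiguous.\<close>

lemma enc_list_append_inject:
  assumes "\<And>x y u v. f x @ u = f y @ v \<Longrightarrow> x = y \<and> u = v"
    and "enc_list f xs @ u = enc_list f ys @ v"
  shows "xs = ys \<and> u = v"
  using assms(2)
proof (induction xs arbitrary: ys)
  case Nil
  then show ?case by (cases ys) (auto simp: enc_list_def)
next
  case (Cons x xs)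
  show ?case
  proof (cases ys)
    case Nil
    with Cons.prems show ?thesis by (simp add: enc_list_def)
  next
    case (Cons y zs)
    with Cons.prems have "f x @ (enc_list f xs @ u) = f y @ (enc_list f zs @ v)"
      by (simp add: enc_list_def)
    from assms(1)[OF this] Cons.IH[of zs] Cons show ?thesis by simp
  qed
qed

lemma bits_inject: "bits m = bits n \<Longrightarrow> m = n"
proof (induction m arbitrary: n rule: less_induct)
  case (less m)
  show ?case
  proof (cases "m = 0 \<or> n = 0")
    case True
    with less.prems show ?thesis by (auto simp: bits.simps[of m] bits.simps[of n] split: if_splits)
  next
    case False
    with less.prems have "odd m = odd n" "bits (m div 2) = bits (n div 2)"
      by (auto simp: bits.simps[of m] bits.simps[of n])
    with less.IH[of "m div 2" "n div 2"] False have "m div 2 = n div 2" "m mod 2 = n mod 2"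
      by (auto simp: odd_iff_mod_2_eq_one)
    then show ?thesis by (metis div_mult_mod_eq)
  qed
qed

lemma enc_nat_append_inject:
  assumes "enc_nat m @ u = enc_nat n @ v"
  shows "m = n \<and> u = v"
proof -
  have "bits m = bits n \<and> u = v"
    using enc_list_append_inject[where f = "\<lambda>b. [b]", OF _ assms[unfolded enc_nat_def]] by simp
  then show ?thesis using bits_inject by blast
qed

lemma enc_pair_append_inject:
  assumes "enc_pair p @ u = enc_pair q @ v"
  shows "p = q \<and> u = v"
proof -
  have "enc_nat (fst p) @ (enc_nat (snd p) @ u) = enc_nat (fst q) @ (enc_nat (snd q) @ v)"
    using assms by (simp add: enc_pair_def)
  then have "fst p = fst q" "enc_nat (snd p) @ u = enc_nat (snd q) @ v"
    using enc_nat_append_inject by blast+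
  then show ?thesis using enc_nat_append_inject by (blast intro: prod_eqI)
qed

lemma encodes_inject:
  assumes "encodes w I" "encodes w J"
  shows "assets I = assets J" "vertices I = vertices J" "edges I = edges J"
    "source I = source J" "target I = target J" "traps I = traps J"
    "\<forall>r\<in>traps I. reload I r = reload J r" "goal I = goal J"
proof -
  have list_nat: "xs = ys \<and> u = v" if "enc_list enc_nat xs @ u = enc_list enc_nat ys @ v" for xs ys u v
    by (rule enc_list_append_inject[OF _ that]) (rule enc_nat_append_inject)
  have list_pair: "xs = ys \<and> u = v" if "enc_list enc_pair xs @ u = enc_list enc_pair ys @ v" for xs ys u v
    by (rule enc_list_append_inject[OF _ that]) (rule enc_pair_append_inject)
  have last: "enc_nat m = enc_nat n \<Longrightarrow> m = n" for m n
    using enc_nat_append_inject[of m "[]" n "[]"] by simp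
  obtain as vs es rs where I:
    "set as = assets I" "set vs = vertices I"
    "set (map (\<lambda>(u, v). {u, v}) es) = edges I" "set rs = traps I"
    "w = enc_list enc_nat as @ enc_list enc_nat vs @ enc_list enc_pair es @
         enc_nat (source I) @ enc_nat (target I) @
         enc_list enc_pair (map (\<lambda>r. (r, reload I r)) rs) @ enc_nat (goal I)"
    using assms(1) unfolding encodes_def by blast
  obtain as' vs' es' rs' where J:
    "set as' = assets J" "set vs' = vertices J"
    "set (map (\<lambda>(u, v). {u, v}) es') = edges J" "set rs' = traps J"
    "w = enc_list enc_nat as' @ enc_list enc_nat vs' @ enc_list enc_pair es' @
         enc_nat (source J) @ enc_nat (target J) @
         enc_list enc_pair (map (\<lambda>r. (r, reload J r)) rs') @ enc_nat (goal J)"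
    using assms(2) unfolding encodes_def by blast
  note 1 = list_nat[OF trans[OF I(5)[symmetric] J(5)]]
  note 2 = list_nat[OF conjunct2[OF 1]]
  note 3 = list_pair[OF conjunct2[OF 2]]
  note 4 = enc_nat_append_inject[OF conjunct2[OF 3]]
  note 5 = enc_nat_append_inject[OF conjunct2[OF 4]]
  note 6 = list_pair[OF conjunct2[OF 5]]
  have eq: "as = as' \<and> vs = vs' \<and> es = es' \<and> source I = source J \<and> target I = target J \<and>
    map (\<lambda>r. (r, reload I r)) rs = map (\<lambda>r. (r, reload J r)) rs' \<and> goal I = goal J"
    using 1 2 3 4 5 6 last by simp
  then have "rs = rs'"
    using map_map[of fst "\<lambda>r. (r, reload I r)" rs] map_map[of fst "\<lambda>r. (r, reload J r)" rs']
    by (simp add: comp_def)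
  with eq show "assets I = assets J" "vertices I = vertices J" "edges I = edges J"
    "source I = source J" "target I = target J" "traps I = traps J"
    "\<forall>r\<in>traps I. reload I r = reload J r" "goal I = goal J"
    using I J by auto
qed


section \<open>Turing machines and the class NP\<close>

text \<open>Deterministic multi-tape machines with two-way infinite tapes. Tapes, symbols and states
  are numbered \<open>0, 1, \<dots>\<close>. Symbol \<open>0\<close> is the blank, \<open>1\<close> and \<open>2\<close> are the bits, \<open>3\<close> is a
  separator. State \<open>0\<close> is initial, state \<open>1\<close> accepts, state \<open>2\<close> rejects.\<close>

datatype direction = Left | Stay | Right

record turing_machine =
  num_tapes :: nat
  num_symbols :: nat
  num_states :: nat
  transition :: "nat \<Rightarrow> nat list \<Rightarrow> nat \<times> (nat \<times> direction) list"

definition turing_machine :: "turing_machine \<Rightarrow> bool" where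
  "turing_machine M \<longleftrightarrow>
     1 \<le> num_tapes M \<and> 4 \<le> num_symbols M \<and> 3 \<le> num_states M \<and>
     (\<forall>q ss. q < num_states M \<longrightarrow> length ss = num_tapes M \<longrightarrow> set ss \<subseteq> {..<num_symbols M} \<longrightarrow>
        (case transition M q ss of (q', as) \<Rightarrow>
           q' < num_states M \<and> length as = num_tapes M \<and> fst ` set as \<subseteq> {..<num_symbols M}))"

type_synonym tape = "(int \<Rightarrow> nat) \<times> int"
type_synonym config = "nat \<times> tape list"

fun read :: "tape \<Rightarrow> nat" where
  "read (t, i) = t i"

fun act :: "nat \<times> direction \<Rightarrow> tape \<Rightarrow> tape" where
  "act (s, d) (t, i) = (t(i := s), case d of Left \<Rightarrow> i - 1 | Stay \<Rightarrow> i | Right \<Rightarrow> i + 1)"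

fun step :: "turing_machine \<Rightarrow> config \<Rightarrow> config" where
  "step M (q, ts) =
     (if q = 1 \<or> q = 2 then (q, ts)
      else case transition M q (map read ts) of (q', as) \<Rightarrow> (q', map2 act as ts))"

definition start :: "turing_machine \<Rightarrow> nat list \<Rightarrow> config" where
  "start M w =
     (0, (\<lambda>i. if 0 \<le> i \<and> i < int (length w) then w ! nat i else 0, 0)
         # replicate (num_tapes M - 1) (\<lambda>_. 0, 0))"

definition state_after :: "turing_machine \<Rightarrow> nat list \<Rightarrow> nat \<Rightarrow> nat" where
  "state_after M w n = fst ((step M ^^ n) (start M w))"

definition halts_within :: "turing_machine \<Rightarrow> nat list \<Rightarrow> nat \<Rightarrow> bool" where
  "halts_within M w n \<longleftrightarrow> state_after M w n \<in> {1, 2}"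

definition accepts :: "turing_machine \<Rightarrow> nat list \<Rightarrow> bool" where
  "accepts M w \<longleftrightarrow> (\<exists>n. state_after M w n = 1)"

definition pair_word :: "bool list \<Rightarrow> bool list \<Rightarrow> nat list" where
  "pair_word x y = map (\<lambda>b. if b then 2 else 1) x @ [3] @ map (\<lambda>b. if b then 2 else 1) y"

text \<open>A language is in NP if membership of \<open>x\<close> is witnessed by a certificate \<open>y\<close> of polynomial
  length that is checked by a polynomial-time machine.\<close>

definition NP :: "bool list set set" where
  "NP = {L. \<exists>M (p :: nat poly) (q :: nat poly). turing_machine M \<and>
     (\<forall>x y. halts_within M (pair_word x y) (poly q (length (pair_word x y)))) \<and>
     (\<forall>x. x \<in> L \<longleftrightarrow> (\<exists>y. length y \<le> poly p (length x) \<and> accepts M (pair_word x y)))}"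

end

theory Submission
  imports Defs
begin

text \<open>Reload times are written in binary, so plans may be exponentially long, and a certificate has to
  compress them. A configuration consists of the locations of the assets and of the numbers of steps
  until the traps are active again. Call a step quiet if no asset leaves the source, reaches the target
  or is eliminated, and no trap is triggered or becomes active. An integer potential, bounded by a
  polynomial, drops in every step that is not quiet, so there are few of these. During quiet steps the assets that
  are on their way are interchangeable, hence they are pebbles without identity that move on a graph.
  Between the same two configurations of the pebbles there is a walk of polynomial length and of the same
  parity, and the time that is saved can be spent in one stretch by going back and forth between two
  consecutive configurations. So an instance is solvable iff it has a run of polynomially many long steps, each
  with a duration written in binary.

  Whether a word describes an instance and such a run can be said by a first-order formula over the
  positions of the word whose atoms are linear inequalities between binary numbers starting at
  these positions. A fixed formula of this kind is decided in polynomial time by a machine with one head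
  per variable, and this yields membership in NP.\<close>

section \<open>Machines with an arbitrary finite control\<close>

text \<open>The obstacle is that time can neither be skipped nor passed by waiting. After the first
  step some asset has to move in every step until all are finished, so saved time must be spent on
  moves, and going back and forth spends an even number of steps; this is why walks are shortened
  with their parity. It is possible because moves of pebbles can be undone. If a configuration with
  a short closed walk of odd length can be reached, a detour through it corrects the parity;
  otherwise only one pebble can move at all, and there are few configurations to visit. The time has
  to be kept exactly because waiting traps count down; but then it is bounded by a reload time and
  has few binary digits. The logic avoids programming a verifier for the explicit machine model: the
  evaluator is proved correct once for all formulas. Inequalities between sums of binary numbers are
  decided by automata because carries stay bounded. Facts that are not first-order, such as the
  number of survivors, become so by additional data in the certificate.\<close>

type_synonym 's control = "'s \<Rightarrow> nat list \<Rightarrow> 's \<times> (nat \<times> direction) list"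

definition cstep :: "'s control \<Rightarrow> 's \<Rightarrow> 's \<Rightarrow> 's \<times> tape list \<Rightarrow> 's \<times> tape list" where
  "cstep \<delta> qa qr = (\<lambda>(q, ts). if q = qa \<or> q = qr then (q, ts)
     else case \<delta> q (map read ts) of (q', as) \<Rightarrow> (q', map2 act as ts))"

definition control_on :: "nat \<Rightarrow> nat \<Rightarrow> 's set \<Rightarrow> 's control \<Rightarrow> bool" where
  "control_on k G Q \<delta> \<longleftrightarrow> finite Q \<and> (\<forall>q\<in>Q. \<forall>ss. fst (\<delta> q ss) \<in> Q) \<and>
     (\<forall>q\<in>Q. \<forall>ss. length ss = k \<longrightarrow> set ss \<subseteq> {..<G} \<longrightarrow>
        length (snd (\<delta> q ss)) = k \<and> fst ` set (snd (\<delta> q ss)) \<subseteq> {..<G})"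

text \<open>The machine model prescribes the numbers of three states and takes all states from an
  initial segment of the naturals, so the control states are numbered by an injection. What is
  reported back is when the two halting states are assumed, which is all that halting and acceptance
  speak of.\<close>

lemma turing_machine_of_control:
  assumes ctl: "control_on k G Q \<delta>" and Q: "q0 \<in> Q" "qa \<in> Q" "qr \<in> Q"
    and dist: "q0 \<noteq> qa" "q0 \<noteq> qr" "qa \<noteq> qr" and k: "1 \<le> k" and G: "4 \<le> G"
  obtains M where "turing_machine M" "num_tapes M = k"
    "\<And>w n. state_after M w n = 1 \<longleftrightarrow> fst ((cstep \<delta> qa qr ^^ n) (q0, snd (start M w))) = qa"
    "\<And>w n. state_after M w n = 2 \<longleftrightarrow> fst ((cstep \<delta> qa qr ^^ n) (q0, snd (start M w))) = qr"
proof -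
  from ctl have fin: "finite Q" and closed: "\<And>q ss. q \<in> Q \<Longrightarrow> fst (\<delta> q ss) \<in> Q"
    and wf: "\<And>q ss. q \<in> Q \<Longrightarrow> length ss = k \<Longrightarrow> set ss \<subseteq> {..<G} \<Longrightarrow>
        length (snd (\<delta> q ss)) = k \<and> fst ` set (snd (\<delta> q ss)) \<subseteq> {..<G}"
    unfolding control_on_def by auto
  obtain f :: "'a \<Rightarrow> nat" where f: "bij_betw f Q {0..<card Q}"
    using ex_bij_betw_finite_nat[OF fin] by blast
  \<comment> \<open>The initial, accepting and rejecting states get the prescribed numbers 0, 1 and
    2. The offset 3 keeps the other states clear of them, and \<open>f q < card Q\<close> gives the
    bound \<open>N\<close>.\<close>
  define h where "h q = (if q = q0 then 0 else if q = qa then 1 else if q = qr then 2 else 3 + f q)" for q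
  define g where "g = inv_into Q h"
  define N where "N = 3 + card Q"
  have inj: "inj_on h Q"
    using bij_betw_imp_inj_on[OF f] by (auto simp: inj_on_def h_def)
  have lt: "h q < N" if "q \<in> Q" for q
    using bij_betwE[OF f] that by (auto simp: h_def N_def)
  have g: "g (h q) = q" if "q \<in> Q" for q
    using inj that unfolding g_def by simp
  have gQ: "g n \<in> Q" if "n \<in> h ` Q" for n
    using that unfolding g_def by (rule inv_into_into)
  \<comment> \<open>Numbers below \<open>N\<close> that name no state still need a well-formed
    transition; the filler goes to state 0 and rewrites what it reads.\<close>
  define T where "T n ss = (if n \<in> h ` Q then map_prod h id (\<delta> (g n) ss)
      else (0, map (\<lambda>s. (s, Stay)) ss))" for n ss
  define M where "M = \<lparr>num_tapes = k, num_symbols = G, num_states = N, transition = T\<rparr>"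
  have M: "turing_machine M"
    unfolding turing_machine_def
  proof (intro conjI allI impI)
    fix q ss assume a: "q < num_states M" "length ss = num_tapes M" "set ss \<subseteq> {..<num_symbols M}"
    show "case transition M q ss of (q', as) \<Rightarrow>
           q' < num_states M \<and> length as = num_tapes M \<and> fst ` set as \<subseteq> {..<num_symbols M}"
    proof (cases "q \<in> h ` Q")
      case True
      obtain q' as where "\<delta> (g q) ss = (q', as)" by fastforce
      with True a wf[OF gQ[OF True], of ss] lt closed[OF gQ[OF True], of ss] show ?thesis
        by (simp add: M_def T_def)
    next
      case False
      with a show ?thesis by (auto simp: M_def T_def N_def)
    qed
  qed (use k G in \<open>auto simp: M_def N_def\<close>)
  have h12: "h q = 1 \<longleftrightarrow> q = qa" "h q = 2 \<longleftrightarrow> q = qr" if "q \<in> Q" for q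
    using dist by (auto simp: h_def)
  have step1: "step M (h q, ts) = map_prod h id (cstep \<delta> qa qr (q, ts)) \<and> fst (cstep \<delta> qa qr (q, ts)) \<in> Q"
    if "q \<in> Q" for q ts
    using that h12[OF that] g[OF that] closed[OF that, of "map read ts"]
    by (auto simp: cstep_def M_def T_def split: prod.splits)
  have run: "(step M ^^ n) (h q0, ts) = map_prod h id ((cstep \<delta> qa qr ^^ n) (q0, ts)) \<and>
      fst ((cstep \<delta> qa qr ^^ n) (q0, ts)) \<in> Q" for n ts
  proof (induction n)
    case (Suc n)
    obtain q ts' where "(cstep \<delta> qa qr ^^ n) (q0, ts) = (q, ts')" by fastforce
    with Suc step1[of q ts'] show ?case by (simp del: step.simps add: id_def)
  qed (use Q in simp)
  have "start M w = (h q0, snd (start M w))" for w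
    by (simp add: start_def h_def)
  then have state: "state_after M w n = h (fst ((cstep \<delta> qa qr ^^ n) (q0, snd (start M w)))) \<and>
      fst ((cstep \<delta> qa qr ^^ n) (q0, snd (start M w))) \<in> Q" for w n
    unfolding state_after_def using run[of n "snd (start M w)"] by (metis fst_map_prod)
  show ?thesis
    by (rule that[OF M]) (use state h12 in \<open>auto simp: M_def\<close>)
qed

section \<open>Evaluating first-order formulas over the positions of a word\<close>

text \<open>Symbols \<open>8, \<dots>, 15\<close> carry three bits; the symbols from \<open>16\<close> on are heads of records.\<close>

definition is_digit :: "nat \<Rightarrow> bool" where "is_digit s \<longleftrightarrow> 8 \<le> s \<and> s < 16"

definition is_head :: "nat \<Rightarrow> bool" where "is_head s \<longleftrightarrow> 16 \<le> s"

text \<open>\<open>Lin ls c\<close> asserts that \<open>c\<close> plus the sum of \<open>k\<close> times the number on track \<open>j\<close> of record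
  \<open>x\<close>, for \<open>(k, x, j)\<close> in \<open>ls\<close>, is nonnegative.\<close>

datatype atom = Tag nat nat | Less nat nat | Lin "(int \<times> nat \<times> nat) list" int

datatype fm = At atom | Neg fm | And fm fm | Ex nat fm

fun atom_vars :: "atom \<Rightarrow> nat set" where
  "atom_vars (Tag x T) = {x}"
| "atom_vars (Less x y) = {x, y}"
| "atom_vars (Lin ls c) = (fst \<circ> snd) ` set ls"

text \<open>Each atom is decided by a finite automaton that reads the suffixes starting at the
  positions of its variables simultaneously. For \<open>Lin\<close>, least significant bits coming first,
  the integer component is the carry, rounded down, and the set collects the variables whose
  record has ended.\<close>

type_synonym atom_state = "int \<times> nat set \<times> bool"

fun atom_init :: "atom \<Rightarrow> atom_state" where
  "atom_init (Lin ls c) = (c, {}, False)"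
| "atom_init _ = (-1, {}, False)"

definition atom_acc :: "atom_state \<Rightarrow> bool" where "atom_acc = (\<lambda>(c, E, b). 0 \<le> c)"

definition lin_digit :: "(nat \<Rightarrow> nat) \<Rightarrow> nat set \<Rightarrow> nat \<Rightarrow> nat \<Rightarrow> int" where
  "lin_digit v E x j = of_bool (x \<notin> E \<and> is_digit (v x) \<and> bit (v x) j)"

text \<open>The flag \<open>b\<close> tells that the head of the record has been passed:
  \<open>Tag\<close> decides at this first symbol, \<open>Lin\<close> skips it. For
  \<open>Less\<close>, all heads advance in step, so \<open>y\<close> is to the right of
  \<open>x\<close> iff at some moment \<open>y\<close> has run off the word while \<open>x\<close>
  has not.\<close>

fun atom_step :: "atom \<Rightarrow> (nat \<Rightarrow> nat) \<Rightarrow> atom_state \<Rightarrow> atom_state" where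
  "atom_step (Tag x T) v (c, E, b) = (if b then c else of_bool (v x = T) - 1, {}, True)"
| "atom_step (Less x y) v (c, E, b) = (if v x \<noteq> 0 \<and> v y = 0 then 0 else c, {}, False)"
| "atom_step (Lin ls c0) v (c, E, b) =
     (if b then ((c + (\<Sum>(k, x, j)\<leftarrow>ls. k * lin_digit v E x j)) div 2,
                 E \<union> {x \<in> atom_vars (Lin ls c0). \<not> is_digit (v x)}, True)
      else (c, {}, True))"

section \<open>Finiteness of the automata that decide atoms\<close>

definition atom_states :: "atom \<Rightarrow> atom_state set" where
  "atom_states a = (let B = (case a of Lin ls c \<Rightarrow> \<bar>c\<bar> + (\<Sum>(k, x, j)\<leftarrow>ls. \<bar>k\<bar>) | _ \<Rightarrow> 1)
     in {-B..B} \<times> Pow (atom_vars a) \<times> UNIV)"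

lemma finite_atom_states: "finite (atom_states a)"
proof -
  have "finite (atom_vars a)" by (cases a) auto
  then show ?thesis unfolding atom_states_def Let_def by (intro finite_cartesian_product) auto
qed

lemma sum_list_abs_nonneg: "0 \<le> (\<Sum>(k :: int, x, j)\<leftarrow>ls. \<bar>k\<bar>)"
  by (induction ls) auto

lemma atom_init_states: "atom_init a \<in> atom_states a"
  using sum_list_abs_nonneg[of "case a of Lin ls c \<Rightarrow> ls | _ \<Rightarrow> []"] by (cases a) (auto simp: atom_states_def)

lemma lin_sum_bound: "\<bar>\<Sum>(k, x, j)\<leftarrow>ls. k * lin_digit v E x j\<bar> \<le> (\<Sum>(k, x, j)\<leftarrow>ls. \<bar>k\<bar>)"
proof (induction ls)
  case (Cons l ls)
  obtain k x j where l: "l = (k, x, j)" by (cases l)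
  have "\<bar>k * lin_digit v E x j\<bar> \<le> \<bar>k\<bar>" by (simp add: lin_digit_def)
  with Cons show ?case unfolding l by simp
qed simp

text \<open>The new carry is the floor of half the sum of two integers of absolute value at most
  \<open>B\<close>, so carries never leave the interval.\<close>

lemma atom_step_states:
  assumes "q \<in> atom_states a"
  shows "atom_step a v q \<in> atom_states a"
proof (cases a)
  case (Lin ls c0)
  obtain c E b where q: "q = (c, E, b)" by (cases q)
  define s where "s = (\<Sum>(k, x, j)\<leftarrow>ls. k * lin_digit v E x j)"
  define B where "B = \<bar>c0\<bar> + (\<Sum>(k, x, j)\<leftarrow>ls. \<bar>k\<bar>)"
  have "\<bar>s\<bar> \<le> B" "\<bar>c\<bar> \<le> B" "E \<subseteq> atom_vars a"
    using lin_sum_bound[of v E ls] assms unfolding s_def B_def q Lin by (auto simp: atom_states_def)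
  then have "\<bar>(c + s) div 2\<bar> \<le> B" by linarith
  moreover have "\<bar>c\<bar> \<le> B" by fact
  ultimately show ?thesis
    using \<open>E \<subseteq> atom_vars a\<close> unfolding q Lin atom_states_def
    by (auto simp: s_def[symmetric] B_def[symmetric] abs_le_iff)
qed (use assms in \<open>cases q; auto simp: atom_states_def\<close>)+

definition atom_run :: "atom \<Rightarrow> (nat \<Rightarrow> int \<Rightarrow> nat) \<Rightarrow> (nat \<Rightarrow> int) \<Rightarrow> nat \<Rightarrow> atom_state" where
  "atom_run a T e n = fold (\<lambda>t. atom_step a (\<lambda>i. T i (e i + int t))) [0..<n] (atom_init a)"

text \<open>Every atom is run for \<open>L\<close> steps, the length of the word, so that from any
  position of the word the record is read to its end.\<close>

fun sat :: "(nat \<Rightarrow> int \<Rightarrow> nat) \<Rightarrow> nat \<Rightarrow> (nat \<Rightarrow> int) \<Rightarrow> fm \<Rightarrow> bool" where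
  "sat T L e (At a) \<longleftrightarrow> atom_acc (atom_run a T e L)"
| "sat T L e (Neg f) \<longleftrightarrow> \<not> sat T L e f"
| "sat T L e (And f g) \<longleftrightarrow> sat T L e f \<and> sat T L e g"
| "sat T L e (Ex x f) \<longleftrightarrow> (\<exists>p<L. is_head (T x (int p)) \<and> sat T L (e(x := int p)) f)"

text \<open>Tape \<open>0\<close> is the input, and tape \<open>1\<close>, on which no variable lives, tells when the head has moved
  by the length of the word. So variables are numbered from \<open>2\<close>.\<close>

fun wf_fm :: "nat \<Rightarrow> nat set \<Rightarrow> fm \<Rightarrow> bool" where
  "wf_fm K V (At a) \<longleftrightarrow> atom_vars a \<subseteq> V"
| "wf_fm K V (Neg f) \<longleftrightarrow> wf_fm K V f"
| "wf_fm K V (And f g) \<longleftrightarrow> wf_fm K V f \<and> wf_fm K V g"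
| "wf_fm K V (Ex x f) \<longleftrightarrow> 2 \<le> x \<and> x < K \<and> x \<notin> V \<and> wf_fm K (insert x V) f"

text \<open>The control is a recursive evaluator whose stack of pending operations, being bounded by
  the formula, is kept in the state.\<close>

datatype frame = FNeg | FAnd fm | FEx nat fm

datatype state = Eval fm "frame list" | Ret bool "frame list"
  | Loop nat fm "frame list" | Home bool nat "frame list"
  | Scan atom atom_state "frame list" | Back bool "frame list"

definition move_only :: "nat \<Rightarrow> direction \<Rightarrow> nat \<Rightarrow> direction" where
  "move_only x d = (\<lambda>i. if i = x then d else Stay)"

text \<open>A head that belongs to no bound variable rests at position 0, and every operation
  restores the heads it has moved. \<open>Home\<close> takes a single head back to the left end.
  \<open>Scan\<close> and \<open>Back\<close> move all heads together; the head of tape 1, which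
  starts at 0, tells when they have gone as far as the word is long and when they are back, so no
  position has to be remembered.\<close>

fun estep :: "state \<Rightarrow> (nat \<Rightarrow> nat) \<Rightarrow> state \<times> (nat \<Rightarrow> direction)" where
  "estep (Eval (At a) k) v = (Scan a (atom_init a) k, \<lambda>_. Stay)"
| "estep (Eval (Neg f) k) v = (Eval f (FNeg # k), \<lambda>_. Stay)"
| "estep (Eval (And f g) k) v = (Eval f (FAnd g # k), \<lambda>_. Stay)"
| "estep (Eval (Ex x f) k) v = (Loop x f k, \<lambda>_. Stay)"
| "estep (Ret b (FNeg # k)) v = (Ret (\<not> b) k, \<lambda>_. Stay)"
| "estep (Ret b (FAnd g # k)) v = (if b then Eval g k else Ret False k, \<lambda>_. Stay)"
| "estep (Ret b (FEx x f # k)) v =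
     (if b then (Home True x k, move_only x Left) else (Loop x f k, move_only x Right))"
| "estep (Loop x f k) v =
     (if v x = 0 then (Home False x k, move_only x Left)
      else if is_head (v x) then (Eval f (FEx x f # k), \<lambda>_. Stay)
      else (Loop x f k, move_only x Right))"
| "estep (Home b x k) v =
     (if v x = 0 then (Ret b k, move_only x Right) else (Home b x k, move_only x Left))"
| "estep (Scan a q k) v =
     (if v 1 = 0 then (Back (atom_acc q) k, \<lambda>_. Left) else (Scan a (atom_step a v q) k, \<lambda>_. Right))"
| "estep (Back b k) v = (if v 1 = 0 then (Ret b k, \<lambda>_. Right) else (Back b k, \<lambda>_. Left))"
| "estep q v = (q, \<lambda>_. Stay)"

fun offset :: "direction \<Rightarrow> int" where
  "offset Left = -1" | "offset Stay = 0" | "offset Right = 1"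

definition pstep :: "(nat \<Rightarrow> int \<Rightarrow> nat) \<Rightarrow> state \<times> (nat \<Rightarrow> int) \<Rightarrow> state \<times> (nat \<Rightarrow> int)" where
  "pstep T = (\<lambda>(q, p). case estep q (\<lambda>i. T i (p i)) of (q', d) \<Rightarrow> (q', \<lambda>i. p i + offset (d i)))"

section \<open>Correctness and running time of the evaluator\<close>

lemma funpow_reach_trans:
  assumes "(f ^^ m) x = y" "(f ^^ n) y = z"
  shows "(f ^^ (n + m)) x = z"
  using assms by (simp add: funpow_add)

definition reach :: "(nat \<Rightarrow> int \<Rightarrow> nat) \<Rightarrow> nat \<Rightarrow> state \<times> (nat \<Rightarrow> int) \<Rightarrow> state \<times> (nat \<Rightarrow> int) \<Rightarrow> bool" where
  "reach T n c c' \<longleftrightarrow> (\<exists>m\<le>n. (pstep T ^^ m) c = c')"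

lemma reach_refl: "reach T n c c"
  unfolding reach_def by (intro exI[of _ 0]) simp

lemma reach_trans:
  assumes "reach T m c c'" "reach T n c' c''" "m + n \<le> l"
  shows "reach T l c c''"
proof -
  from assms(1,2) obtain m' n' where "m' \<le> m" "(pstep T ^^ m') c = c'" "n' \<le> n" "(pstep T ^^ n') c' = c''"
    unfolding reach_def by blast
  then show ?thesis
    unfolding reach_def using assms(3) funpow_reach_trans[of m' "pstep T" c c' n' c'']
    by (intro exI[of _ "n' + m'"]) auto
qed

lemma reach_step:
  assumes "pstep T c = c1" "reach T n c1 c'" "Suc n \<le> l"
  shows "reach T l c c'"
proof -
  have "reach T 1 c c1" unfolding reach_def using assms(1) by (intro exI[of _ 1]) simp
  from reach_trans[OF this assms(2)] assms(3) show ?thesis by simp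
qed

text \<open>Bounds with some slack. A quantifier multiplies the time by the number of positions, so
  the degree grows with the nesting of quantifiers; for a fixed formula the bound is a
  polynomial.\<close>

primrec fm_time :: "fm \<Rightarrow> nat poly" where
  "fm_time (At a) = [:5, 2:]"
| "fm_time (Neg f) = fm_time f + [:2:]"
| "fm_time (And f g) = fm_time f + fm_time g + [:3:]"
| "fm_time (Ex x f) = [:1, 1:] * (fm_time f + [:5:]) + [:6, 2:]"

locale word_tapes =
  fixes T :: "nat \<Rightarrow> int \<Rightarrow> nat" and L K :: nat
  assumes word: "\<And>i j. 1 \<le> i \<Longrightarrow> i < K \<Longrightarrow> T i j = 0 \<longleftrightarrow> j < 0 \<or> int L \<le> j"
    and K: "2 \<le> K"
begin

lemma fun_upd_offset: "(\<lambda>i. (e(x := p)) i + offset (move_only x d i)) = e(x := p + offset d)"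
  by (auto simp: move_only_def)

lemma reach_Home:
  assumes "1 \<le> x" "x < K" "n \<le> L"
  shows "reach T (n + 1) (Home b x k, e(x := int n - 1)) (Ret b k, e(x := 0))"
  using assms(3)
proof (induction n)
  case 0
  have "pstep T (Home b x k, e(x := -1)) = (Ret b k, e(x := 0))"
    using word[of x "-1"] assms fun_upd_offset[of e x "-1" Right] by (simp add: pstep_def)
  from reach_step[OF this reach_refl[of T 0] order_refl] show ?case by (simp del: fun_upd_apply)
next
  case (Suc n)
  have "pstep T (Home b x k, e(x := int n)) = (Home b x k, e(x := int n - 1))"
    using word[of x "int n"] assms Suc.prems fun_upd_offset[of e x "int n" Left] by (simp add: pstep_def)
  from reach_step[OF this Suc.IH] Suc.prems show ?case by (simp del: fun_upd_apply)
qed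

lemma reach_Back:
  assumes "n \<le> L" "e 1 = 0"
  shows "reach T (n + 1) (Back b k, \<lambda>i. e i + int n - 1) (Ret b k, e)"
  using assms(1)
proof (induction n)
  case 0
  have "pstep T (Back b k, \<lambda>i. e i - 1) = (Ret b k, e)"
    using word[of 1 "-1"] K assms by (simp add: pstep_def)
  from reach_step[OF this reach_refl[of T 0] order_refl] show ?case by simp
next
  case (Suc n)
  have "pstep T (Back b k, \<lambda>i. e i + int n) = (Back b k, \<lambda>i. e i + int n - 1)"
    using word[of 1 "int n"] K assms Suc.prems by (simp add: pstep_def)
  from reach_step[OF this Suc.IH] Suc.prems show ?case by simp
qed

text \<open>Induction on the number \<open>n\<close> of cells still to be scanned. The remaining
  \<open>L + 3\<close> steps pay for noticing the blank, for the way back and for the turn at the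
  left end.\<close>

lemma reach_Scan:
  assumes "n \<le> L" "e 1 = 0"
  shows "reach T (n + L + 3) (Scan a (atom_run a T e (L - n)) k, \<lambda>i. e i + int (L - n))
     (Ret (atom_acc (atom_run a T e L)) k, e)"
  using assms(1)
proof (induction n)
  case 0
  have "pstep T (Scan a (atom_run a T e L) k, \<lambda>i. e i + int L) =
      (Back (atom_acc (atom_run a T e L)) k, \<lambda>i. e i + int L - 1)"
    using word[of 1 "int L"] K assms by (simp add: pstep_def)
  from reach_step[OF this reach_Back[of L e], of "L + 3"] assms show ?case by simp
next
  case (Suc n)
  define t where "t = L - Suc n"
  have t: "L - n = Suc t" "t < L" using Suc.prems by (auto simp: t_def)
  have "pstep T (Scan a (atom_run a T e t) k, \<lambda>i. e i + int t) =
      (Scan a (atom_run a T e (Suc t)) k, \<lambda>i. e i + int (Suc t))"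
    using word[of 1 "int t"] K assms t by (simp add: pstep_def atom_run_def algebra_simps)
  from reach_step[OF this Suc.IH[unfolded t], of "Suc n + L + 3"] Suc.prems show ?case
    unfolding t_def[symmetric] by simp
qed

text \<open>Induction on the number \<open>n\<close> of positions not yet tried, the current one
  being \<open>L - n\<close>. A position costs the body and up to three further steps.
  \<open>S p\<close> is the verdict of the body at \<open>p\<close>; the body has to return the
  heads to where it found them.\<close>

lemma reach_Loop:
  assumes x: "2 \<le> x" "x < K"
    and body: "\<And>p k. reach T B (Eval f k, e(x := int p)) (Ret (S p) k, e(x := int p))"
    and "n \<le> L"
  shows "reach T (n * (B + 3) + L + 3) (Loop x f k, e(x := int (L - n)))
    (Ret (\<exists>p<L. L - n \<le> p \<and> is_head (T x (int p)) \<and> S p) k, e(x := 0))"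
  using assms(4)
proof (induction n)
  case 0
  have "pstep T (Loop x f k, e(x := int L)) = (Home False x k, e(x := int L - 1))"
    using word[of x "int L"] x fun_upd_offset[of e x "int L" Left] by (simp add: pstep_def)
  from reach_step[OF this reach_Home[of x L], of "L + 3"] x
  have "reach T (L + 3) (Loop x f k, e(x := int L)) (Ret False k, e(x := 0))"
    by (simp del: fun_upd_apply)
  moreover have none: "(\<exists>p<L. L - 0 \<le> p \<and> is_head (T x (int p)) \<and> S p) = False" by auto
  ultimately show ?case unfolding none by (simp del: fun_upd_apply)
next
  case (Suc n)
  define R where "R n \<longleftrightarrow> (\<exists>p<L. L - n \<le> p \<and> is_head (T x (int p)) \<and> S p)" for n
  define p where "p = L - Suc n"
  have p: "L - n = Suc p" "p < L" using Suc.prems by (auto simp: p_def)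
  have Tp: "T x (int p) \<noteq> 0" using word[of x "int p"] x p by auto
  have IH: "reach T (n * (B + 3) + L + 3) (Loop x f k, e(x := int (Suc p))) (Ret (R n) k, e(x := 0))"
    using Suc p unfolding R_def by (simp del: fun_upd_apply)
  have le: "p \<le> p' \<longleftrightarrow> p' = p \<or> Suc p \<le> p'" for p' by auto
  have R: "R (Suc n) \<longleftrightarrow> is_head (T x (int p)) \<and> S p \<or> R n"
    unfolding R_def p(1) p_def[symmetric] le using p(2) by blast
  have "reach T (Suc n * (B + 3) + L + 3) (Loop x f k, e(x := int p)) (Ret (R (Suc n)) k, e(x := 0))"
  proof (cases "is_head (T x (int p))")
    case False
    then have "pstep T (Loop x f k, e(x := int p)) = (Loop x f k, e(x := int (Suc p)))"
      using Tp fun_upd_offset[of e x "int p" Right] by (simp add: pstep_def add.commute)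
    from reach_step[OF this IH] False R show ?thesis by (simp del: fun_upd_apply)
  next
    case True
    have "pstep T (Loop x f k, e(x := int p)) = (Eval f (FEx x f # k), e(x := int p))"
      using Tp True by (simp add: pstep_def fun_eq_iff)
    from reach_step[OF this body order_refl]
    have 1: "reach T (Suc B) (Loop x f k, e(x := int p)) (Ret (S p) (FEx x f # k), e(x := int p))" .
    have 2: "reach T (Suc (n * (B + 3) + L + 3)) (Ret (S p) (FEx x f # k), e(x := int p))
        (Ret (R (Suc n)) k, e(x := 0))"
    proof (cases "S p")
      case S: True
      have "pstep T (Ret True (FEx x f # k), e(x := int p)) = (Home True x k, e(x := int p - 1))"
        using fun_upd_offset[of e x "int p" Left] by (simp add: pstep_def)
      from reach_step[OF this reach_Home[of x p]] S R x p True show ?thesis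
        by (simp del: fun_upd_apply)
    next
      case S: False
      have "pstep T (Ret False (FEx x f # k), e(x := int p)) = (Loop x f k, e(x := int (Suc p)))"
        using fun_upd_offset[of e x "int p" Right] by (simp add: pstep_def add.commute)
      from reach_step[OF this IH order_refl] S R show ?thesis by (simp del: fun_upd_apply)
    qed
    show ?thesis by (rule reach_trans[OF 1 2]) simp
  qed
  then show ?case unfolding R_def p_def .
qed

lemma reach_Eval:
  assumes "wf_fm K V f" "\<And>i. 1 \<le> i \<Longrightarrow> i \<notin> V \<Longrightarrow> e i = 0" "1 \<notin> V"
  shows "reach T (poly (fm_time f) L) (Eval f k, e) (Ret (sat T L e f) k, e)"
  using assms
proof (induction f arbitrary: V e k)
  case (At a)
  have "pstep T (Eval (At a) k, e) = (Scan a (atom_run a T e 0) k, e)"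
    by (simp add: pstep_def atom_run_def)
  moreover have "reach T (L + L + 3) (Scan a (atom_run a T e 0) k, e) (Ret (sat T L e (At a)) k, e)"
    using reach_Scan[of L e a k] At by simp
  ultimately show ?case by (rule reach_step) simp
next
  case (Neg f)
  have "pstep T (Eval (Neg f) k, e) = (Eval f (FNeg # k), e)" by (simp add: pstep_def)
  from reach_step[OF this Neg.IH[of V e "FNeg # k"] order_refl] Neg.prems
  have 1: "reach T (Suc (poly (fm_time f) L)) (Eval (Neg f) k, e) (Ret (sat T L e f) (FNeg # k), e)"
    by simp
  have "pstep T (Ret (sat T L e f) (FNeg # k), e) = (Ret (\<not> sat T L e f) k, e)"
    by (simp add: pstep_def)
  from reach_trans[OF 1 reach_step[OF this reach_refl[of T 0] order_refl]] show ?case by simp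
next
  case (And f g)
  have "pstep T (Eval (And f g) k, e) = (Eval f (FAnd g # k), e)" by (simp add: pstep_def)
  from reach_step[OF this And.IH(1)[of V e "FAnd g # k"] order_refl] And.prems
  have 1: "reach T (Suc (poly (fm_time f) L)) (Eval (And f g) k, e) (Ret (sat T L e f) (FAnd g # k), e)"
    by simp
  have "reach T (poly (fm_time g) L) (Eval g k, e) (Ret (sat T L e g) k, e)"
    using And.IH(2)[of V e k] And.prems by simp
  from reach_step[of T "(Ret (sat T L e f) (FAnd g # k), e)", OF _ this order_refl]
  have 2: "reach T (Suc (poly (fm_time g) L)) (Ret (sat T L e f) (FAnd g # k), e)
      (Ret (sat T L e f \<and> sat T L e g) k, e)" if "sat T L e f"
    using that by (simp add: pstep_def)
  have 3: "reach T (Suc (poly (fm_time g) L)) (Ret (sat T L e f) (FAnd g # k), e)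
      (Ret (sat T L e f \<and> sat T L e g) k, e)" if "\<not> sat T L e f"
    by (rule reach_step[OF _ reach_refl[of T 0]]) (use that in \<open>simp_all add: pstep_def\<close>)
  have "reach T (Suc (poly (fm_time g) L)) (Ret (sat T L e f) (FAnd g # k), e)
      (Ret (sat T L e f \<and> sat T L e g) k, e)"
    using 2 3 by blast
  from reach_trans[OF 1 this] show ?case by simp
next
  case (Ex x f)
  then have x: "2 \<le> x" "x < K" "x \<notin> V" "wf_fm K (insert x V) f" by auto
  define B where "B = poly (fm_time f) L"
  have body: "reach T B (Eval f k', e(x := int p)) (Ret (sat T L (e(x := int p)) f) k', e(x := int p))"
    for p k'
    unfolding B_def by (rule Ex.IH[of "insert x V"]) (use x Ex.prems in auto)
  \<comment> \<open>The head of \<open>x\<close> ends at 0, where it was before, because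
    \<open>x\<close> is not bound outside.\<close>
  have e: "e(x := 0) = e" using Ex.prems(2)[OF _ x(3)] x by auto
  have "pstep T (Eval (Ex x f) k, e) = (Loop x f k, e)" by (simp add: pstep_def)
  moreover have "reach T (L * (B + 3) + L + 3) (Loop x f k, e) (Ret (sat T L e (Ex x f)) k, e)"
    using reach_Loop[OF x(1,2) body, of L k] e by (simp del: fun_upd_apply)
  ultimately show ?case
    by (rule reach_step) (simp add: B_def algebra_simps)
qed

end

section \<open>Deciding formulas by Turing machines\<close>

text \<open>The states that occur while \<open>f\<close> is evaluated with the pending frames
  \<open>k\<close>. The stack depends only on the place of the current subformula in
  \<open>f\<close>; therefore the set is finite although stacks are lists.\<close>

fun fm_states :: "fm \<Rightarrow> frame list \<Rightarrow> state set" where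
  "fm_states (At a) k = {Eval (At a) k} \<union> (\<lambda>q. Scan a q k) ` atom_states a \<union>
     range (\<lambda>b. Back b k) \<union> range (\<lambda>b. Ret b k)"
| "fm_states (Neg f) k = {Eval (Neg f) k} \<union> range (\<lambda>b. Ret b k) \<union> fm_states f (FNeg # k)"
| "fm_states (And f g) k = {Eval (And f g) k} \<union> range (\<lambda>b. Ret b k) \<union>
     fm_states f (FAnd g # k) \<union> fm_states g k"
| "fm_states (Ex x f) k = {Eval (Ex x f) k, Loop x f k} \<union> range (\<lambda>b. Home b x k) \<union>
     range (\<lambda>b. Ret b k) \<union> fm_states f (FEx x f # k)"

lemma finite_fm_states: "finite (fm_states f k)"
  by (induction f k rule: fm_states.induct) (simp_all add: finite_atom_states)

lemma Eval_fm_states: "Eval f k \<in> fm_states f k"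
  by (cases f) auto

lemma Ret_fm_states: "Ret b k \<in> fm_states f k"
  by (cases f) auto

text \<open>An evaluation can be left only from \<open>Ret b k\<close>, by returning to the frame
  that called it; inside a compound formula this state is one of the enclosing formula, which takes
  over.\<close>

lemma fm_states_closed:
  "q \<in> fm_states f k \<Longrightarrow> (\<exists>b. q = Ret b k) \<or> fst (estep q v) \<in> fm_states f k"
proof (induction f k rule: fm_states.induct)
  case (1 a k)
  then show ?case using atom_init_states atom_step_states by auto
next
  case (2 f k)
  from "2.prems" consider "q = Eval (Neg f) k" | b where "q = Ret b k" | "q \<in> fm_states f (FNeg # k)"
    by auto
  then show ?case
  proof cases
    case 3
    from "2.IH"[OF this] show ?thesis by auto
  qed (use Eval_fm_states in auto)
next
  case (3 f g k)
  from "3.prems" consider "q = Eval (And f g) k" | b where "q = Ret b k"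
    | "q \<in> fm_states f (FAnd g # k)" | "q \<in> fm_states g k" by auto
  then show ?case
  proof cases
    case 3
    from "3.IH"(1)[OF this] show ?thesis using Eval_fm_states[of g k] by auto
  next
    case 4
    from "3.IH"(2)[OF this] show ?thesis by auto
  qed (use Eval_fm_states in auto)
next
  case (4 x f k)
  from "4.prems" consider "q = Eval (Ex x f) k" | b where "q = Ret b k" | "q = Loop x f k"
    | b where "q = Home b x k" | "q \<in> fm_states f (FEx x f # k)" by auto
  then show ?case
  proof cases
    case 3
    then show ?thesis using Eval_fm_states[of f "FEx x f # k"] by auto
  next
    case 5
    from "4.IH"[OF this] show ?thesis by auto
  qed auto
qed

lemma poly_nat_mono:
  fixes p :: "nat poly"
  assumes "m \<le> n"
  shows "poly p m \<le> poly p n"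
  using assms by (induction p) (auto intro: add_mono mult_mono)

lemma atom_step_cong:
  assumes "\<And>x. x \<in> atom_vars a \<Longrightarrow> v x = w x"
  shows "atom_step a v q = atom_step a w q"
proof (cases a)
  case (Lin ls c0)
  obtain c E b where q: "q = (c, E, b)" by (cases q)
  have "lin_digit v E x j = lin_digit w E x j" if "(k, x, j) \<in> set ls" for k x j
    using assms[of x] that unfolding Lin lin_digit_def by force
  then have "(\<Sum>(k, x, j)\<leftarrow>ls. k * lin_digit v E x j) = (\<Sum>(k, x, j)\<leftarrow>ls. k * lin_digit w E x j)"
    by (intro arg_cong[of _ _ sum_list] map_cong) auto
  moreover have "{x \<in> atom_vars a. \<not> is_digit (v x)} = {x \<in> atom_vars a. \<not> is_digit (w x)}"
    using assms by auto
  ultimately show ?thesis unfolding q Lin by simp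
qed (use assms in \<open>cases q; simp\<close>)+

lemma sat_cong:
  assumes "wf_fm K V f" "\<And>x. x \<in> V \<Longrightarrow> e x = e' x" "\<And>x. 2 \<le> x \<Longrightarrow> x < K \<Longrightarrow> T x = T' x"
    "V \<subseteq> {2..<K}"
  shows "sat T L e f = sat T' L e' f"
  using assms
proof (induction f arbitrary: V e e')
  case (At a)
  have "atom_step a (\<lambda>i. T i (e i + int t)) = atom_step a (\<lambda>i. T' i (e' i + int t))" for t
  proof (rule ext, rule atom_step_cong)
    fix x assume "x \<in> atom_vars a"
    with At.prems have "x \<in> V" "2 \<le> x" "x < K" by auto
    with At.prems show "T x (e x + int t) = T' x (e' x + int t)" by simp
  qed
  then show ?case by (simp add: atom_run_def)
next
  case (Ex x f)
  have "sat T L (e(x := int p)) f = sat T' L (e'(x := int p)) f" for p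
    by (rule Ex.IH[of "insert x V"]) (use Ex.prems in auto)
  moreover have "T x = T' x" using Ex.prems by simp
  ultimately show ?case by simp
qed (simp_all, blast+)

definition word_tape :: "nat list \<Rightarrow> int \<Rightarrow> nat" where
  "word_tape w j = (if 0 \<le> j \<and> j < int (length w) then w ! nat j else 0)"

definition holds :: "fm \<Rightarrow> nat list \<Rightarrow> bool" where
  "holds f w \<longleftrightarrow> sat (\<lambda>_. word_tape w) (length w) (\<lambda>_. 0) f"

text \<open>The output symbol \<open>0\<close> of a transducer means that nothing is written.\<close>

fun transduce :: "('t \<Rightarrow> nat \<Rightarrow> 't \<times> nat) \<Rightarrow> 't \<Rightarrow> nat list \<Rightarrow> nat list" where
  "transduce \<tau> s [] = []"
| "transduce \<tau> s (a # w) = (case \<tau> s a of (s', c) \<Rightarrow> (if c = 0 then [] else [c]) @ transduce \<tau> s' w)"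

lemma length_transduce: "length (transduce \<tau> s w) \<le> length w"
  by (induction w arbitrary: s) (auto split: prod.splits intro: le_SucI)

lemma transduce_nonzero: "0 \<notin> set (transduce \<tau> s w)"
  by (induction w arbitrary: s) (auto split: prod.splits)

section \<open>A machine that translates its input, distributes it to all tapes and evaluates a
  formula\<close>

datatype 't copy_state = Copy 't | Rewind | Run state

definition keep :: "nat list \<Rightarrow> (nat \<Rightarrow> direction) \<Rightarrow> (nat \<times> direction) list" where
  "keep ss d = map (\<lambda>i. (ss ! i, d i)) [0..<length ss]"

text \<open>All tapes except the input tape receive the same output of the transducer in the same
  steps. So every variable has a copy of the word to itself, and tape 1 has one to measure its
  length. The default 0 beyond the last tape extends the finite list of symbols to the function that
  \<open>estep\<close> expects.\<close>

fun fm_control :: "('t \<Rightarrow> nat \<Rightarrow> 't \<times> nat) \<Rightarrow> fm \<Rightarrow> 't copy_state control" where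
  "fm_control \<tau> f (Copy s) ss =
     (if ss ! 0 = 0 then (Rewind, keep ss (\<lambda>i. if i = 0 then Stay else Left))
      else case \<tau> s (ss ! 0) of (s', c) \<Rightarrow>
        (Copy s', map (\<lambda>i. if i = 0 then (ss ! 0, Right)
           else if c = 0 then (ss ! i, Stay) else (c, Right)) [0..<length ss]))"
| "fm_control \<tau> f Rewind ss =
     (if ss ! 1 = 0 then (Run (Eval f []), keep ss (\<lambda>i. if i = 0 then Stay else Right))
      else (Rewind, keep ss (\<lambda>i. if i = 0 then Stay else Left)))"
| "fm_control \<tau> f (Run q) ss =
     (case estep q (\<lambda>i. if i < length ss then ss ! i else 0) of (q', d) \<Rightarrow> (Run q', keep ss d))"

abbreviation "fm_cstep \<tau> f \<equiv> cstep (fm_control \<tau> f) (Run (Ret True [])) (Run (Ret False []))"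

lemma cstep_eq:
  assumes "q \<noteq> qa" "q \<noteq> qr" "\<delta> q (map read ts) = (q', as)" "map2 act as ts = ts'"
  shows "cstep \<delta> qa qr (q, ts) = (q', ts')"
  using assms by (simp add: cstep_def)

lemma act_keep: "act (t j, d) (t, j) = (t, j + offset d)"
  by (cases d) auto

lemma map2_keep:
  assumes "ts = map (\<lambda>i. (T i, p i)) [0..<K]"
  shows "map2 act (keep (map read ts) d) ts = map (\<lambda>i. (T i, p i + offset (d i))) [0..<K]"
  unfolding keep_def assms by (rule nth_equalityI) (simp_all add: act_keep del: act.simps)

lemma cstep_Run:
  assumes "\<And>i. K \<le> i \<Longrightarrow> T i = (\<lambda>_. 0)" "pstep T (q, p) = (q', p')"
  shows "fm_cstep \<tau> f (Run q, map (\<lambda>i. (T i, p i)) [0..<K]) = (Run q', map (\<lambda>i. (T i, p' i)) [0..<K])"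
proof (cases "q = Ret True [] \<or> q = Ret False []")
  case True
  then show ?thesis using assms(2) by (auto simp: cstep_def pstep_def)
next
  case False
  let ?ts = "map (\<lambda>i. (T i, p i)) [0..<K]"
  have v: "(\<lambda>i. if i < length (map read ?ts) then map read ?ts ! i else 0) = (\<lambda>i. T i (p i))"
    using assms(1) by (auto simp: fun_eq_iff)
  obtain d where d: "estep q (\<lambda>i. T i (p i)) = (q', d)" "p' = (\<lambda>i. p i + offset (d i))"
    using assms(2) by (auto simp: pstep_def split: prod.splits)
  have "fm_control \<tau> f (Run q) (map read ?ts) = (Run q', keep (map read ?ts) d)"
    unfolding fm_control.simps v d by simp
  then show ?thesis using False map2_keep[of ?ts T p K d] unfolding d(2) by (intro cstep_eq) auto
qed

lemma cstep_Run_pow: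
  assumes "\<And>i. K \<le> i \<Longrightarrow> T i = (\<lambda>_. 0)" "(pstep T ^^ n) (q, p) = (q', p')"
  shows "(fm_cstep \<tau> f ^^ n) (Run q, map (\<lambda>i. (T i, p i)) [0..<K]) =
    (Run q', map (\<lambda>i. (T i, p' i)) [0..<K])"
  using assms(2)
proof (induction n arbitrary: q' p')
  case (Suc n)
  obtain q1 p1 where 1: "(pstep T ^^ n) (q, p) = (q1, p1)" by fastforce
  with Suc.prems have "pstep T (q1, p1) = (q', p')" by simp
  from cstep_Run[OF assms(1) this] Suc.IH[OF 1] show ?case by simp
qed simp

definition copy_tapes :: "nat \<Rightarrow> nat list \<Rightarrow> nat \<Rightarrow> nat list \<Rightarrow> int \<Rightarrow> tape list" where
  "copy_tapes K w m u j = map (\<lambda>i. if i = 0 then (word_tape w, int m) else (word_tape u, j)) [0..<K]"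

lemma word_tape_snoc: "(word_tape u)(int (length u) := c) = word_tape (u @ [c])"
  by (auto simp: word_tape_def fun_eq_iff nth_append nat_less_iff)

lemma cstep_Copy:
  assumes "m < length w" "w ! m \<noteq> 0" "\<tau> s (w ! m) = (s', c)" "u' = u @ (if c = 0 then [] else [c])" "1 \<le> K"
  shows "fm_cstep \<tau> f (Copy s, copy_tapes K w m u (int (length u))) =
    (Copy s', copy_tapes K w (Suc m) u' (int (length u')))"
proof -
  let ?ts = "copy_tapes K w m u (int (length u))"
  have r0: "map read ?ts ! 0 = w ! m" using assms(1,5) by (simp add: copy_tapes_def word_tape_def)
  have "fm_control \<tau> f (Copy s) (map read ?ts) =
        (Copy s', map (\<lambda>i. if i = 0 then (w ! m, Right)
           else if c = 0 then (map read ?ts ! i, Stay) else (c, Right)) [0..<K])"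
    unfolding fm_control.simps r0 using assms(2,3) by (simp add: copy_tapes_def)
  moreover have "map2 act (map (\<lambda>i. if i = 0 then (w ! m, Right)
           else if c = 0 then (map read ?ts ! i, Stay) else (c, Right)) [0..<K]) ?ts =
      copy_tapes K w (Suc m) u' (int (length u'))"
    using word_tape_snoc[of u c] assms
    by (intro nth_equalityI) (auto simp: copy_tapes_def fun_upd_idem word_tape_def)
  ultimately show ?thesis by (intro cstep_eq) auto
qed

lemma cstep_Copy_pow:
  assumes "0 \<notin> set w" "w = w1 @ w2" "1 \<le> K"
  shows "\<exists>s'. (fm_cstep \<tau> f ^^ length w2) (Copy s, copy_tapes K w (length w1) u (int (length u))) =
    (Copy s', copy_tapes K w (length w) (u @ transduce \<tau> s w2) (int (length (u @ transduce \<tau> s w2))))"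
  using assms(2)
proof (induction w2 arbitrary: w1 s u)
  case (Cons a w2)
  obtain s' c where \<tau>: "\<tau> s a = (s', c)" by fastforce
  define u' where "u' = u @ (if c = 0 then [] else [c])"
  have a: "w ! length w1 = a" "length w1 < length w" "a \<noteq> 0" using Cons.prems assms(1) by auto
  from Cons.IH[of "w1 @ [a]" s' u'] Cons.prems obtain s'' where
    "(fm_cstep \<tau> f ^^ length w2) (Copy s', copy_tapes K w (Suc (length w1)) u' (int (length u'))) =
    (Copy s'', copy_tapes K w (length w) (u' @ transduce \<tau> s' w2) (int (length (u' @ transduce \<tau> s' w2))))"
    by auto
  note IH = this
  have "(fm_cstep \<tau> f ^^ 1) (Copy s, copy_tapes K w (length w1) u (int (length u))) =
      (Copy s', copy_tapes K w (Suc (length w1)) u' (int (length u')))"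
    using cstep_Copy[OF a(2) _ _ u'_def assms(3), of \<tau> s s' f] a \<tau> by simp
  from funpow_reach_trans[OF this IH] have
    "(fm_cstep \<tau> f ^^ length (a # w2)) (Copy s, copy_tapes K w (length w1) u (int (length u))) =
    (Copy s'', copy_tapes K w (length w) (u' @ transduce \<tau> s' w2) (int (length (u' @ transduce \<tau> s' w2))))"
    by (simp only: list.size add_0_right One_nat_def add_Suc_right)
  moreover have "u' @ transduce \<tau> s' w2 = u @ transduce \<tau> s (a # w2)"
    by (simp add: u'_def \<tau>)
  ultimately show ?case by metis
qed auto

lemma cstep_rewind:
  assumes "q = Copy s \<and> m = length w \<or> q = Rewind \<and> word_tape u j \<noteq> 0" "2 \<le> K"
  shows "fm_cstep \<tau> f (q, copy_tapes K w m u j) = (Rewind, copy_tapes K w m u (j - 1))"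
proof -
  let ?ts = "copy_tapes K w m u j" and ?d = "\<lambda>i. if i = 0 then Stay else Left"
  let ?T = "\<lambda>i. if i = 0 then word_tape w else word_tape u" and ?p = "\<lambda>i. if i = (0 :: nat) then int m else j"
  have ts: "copy_tapes K w m u k = map (\<lambda>i. (?T i, if i = 0 then int m else k)) [0..<K]" for k
    unfolding copy_tapes_def by (intro map_cong) auto
  have "fm_control \<tau> f q (map read ?ts) = (Rewind, keep (map read ?ts) ?d)"
    using assms by (auto simp: copy_tapes_def word_tape_def)
  moreover have "map2 act (keep (map read ?ts) ?d) ?ts = copy_tapes K w m u (j - 1)"
    unfolding map2_keep[OF ts] by (auto simp: copy_tapes_def)
  ultimately show ?thesis using assms by (intro cstep_eq) auto
qed

lemma cstep_rewind_end:
  assumes "2 \<le> K"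
  shows "fm_cstep \<tau> f (Rewind, copy_tapes K w m u (-1)) = (Run (Eval f []), copy_tapes K w m u 0)"
proof -
  let ?ts = "copy_tapes K w m u (-1)" and ?d = "\<lambda>i. if i = 0 then Stay else Right"
  let ?T = "\<lambda>i. if i = 0 then word_tape w else word_tape u"
  have ts: "copy_tapes K w m u k = map (\<lambda>i. (?T i, if i = 0 then int m else k)) [0..<K]" for k
    unfolding copy_tapes_def by (intro map_cong) auto
  have "fm_control \<tau> f Rewind (map read ?ts) = (Run (Eval f []), keep (map read ?ts) ?d)"
    using assms by (auto simp: copy_tapes_def word_tape_def)
  moreover have "map2 act (keep (map read ?ts) ?d) ?ts = copy_tapes K w m u 0"
    unfolding map2_keep[OF ts] by (auto simp: copy_tapes_def)
  ultimately show ?thesis by (intro cstep_eq) auto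
qed

lemma cstep_rewind_pow:
  assumes "2 \<le> K" "0 \<notin> set u" "n \<le> length u"
  shows "(fm_cstep \<tau> f ^^ Suc n) (Rewind, copy_tapes K w m u (int n - 1)) =
    (Run (Eval f []), copy_tapes K w m u 0)"
  using assms(3)
proof (induction n)
  case 0
  then show ?case using cstep_rewind_end[OF assms(1)] by simp
next
  case (Suc n)
  have "word_tape u (int n) \<noteq> 0"
    using Suc.prems assms(2) by (auto simp: word_tape_def in_set_conv_nth)
  then have "(fm_cstep \<tau> f ^^ 1) (Rewind, copy_tapes K w m u (int n)) = (Rewind, copy_tapes K w m u (int n - 1))"
    using cstep_rewind[of Rewind _ m w u "int n" K \<tau> f] assms(1) by simp
  from funpow_reach_trans[OF this Suc.IH] Suc.prems show ?case
    by (simp del: funpow.simps)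
qed

text \<open>Copying takes \<open>length w\<close> steps and rewinding \<open>length u + 2\<close>.
  The rest of \<open>N\<close> is left to the evaluator and may exceed its needs, because a final
  verdict is kept.\<close>

lemma fm_control_decides:
  fixes \<tau> :: "'t \<Rightarrow> nat \<Rightarrow> 't \<times> nat" and s0 :: 't
  assumes "2 \<le> K" "wf_fm K {} f" "0 \<notin> set w"
  defines "u \<equiv> transduce \<tau> s0 w"
  assumes N: "length w + length u + 2 + poly (fm_time f) (length u) \<le> N"
  shows "fst ((fm_cstep \<tau> f ^^ N) (Copy s0, copy_tapes K w 0 [] 0)) = Run (Ret (holds f u) [])"
proof -
  define L where "L = length u"
  define T where "T i = (if i = 0 then word_tape w else if i < K then word_tape u else (\<lambda>_. 0))" for i
  define p where "p i = (if i = 0 then int (length w) else 0)" for i :: nat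
  have u0: "0 \<notin> set u" unfolding u_def by (rule transduce_nonzero)
  obtain s' where 1: "(fm_cstep \<tau> f ^^ length w) (Copy s0, copy_tapes K w 0 [] 0) =
      (Copy s', copy_tapes K w (length w) u (int L))"
    using cstep_Copy_pow[of w "[]" w K \<tau> f s0 "[]"] assms(1,3) unfolding u_def L_def by auto
  have 2: "(fm_cstep \<tau> f ^^ Suc (Suc L)) (Copy s', copy_tapes K w (length w) u (int L)) =
      (Run (Eval f []), copy_tapes K w (length w) u 0)"
  proof -
    have "(fm_cstep \<tau> f ^^ 1) (Copy s', copy_tapes K w (length w) u (int L)) =
        (Rewind, copy_tapes K w (length w) u (int L - 1))"
      using cstep_rewind[of "Copy s'" s' "length w" w u "int L" K \<tau> f] assms(1) by simp
    from funpow_reach_trans[OF this cstep_rewind_pow[of K u L \<tau> f w "length w"]] assms(1) u0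
    show ?thesis by (simp add: L_def del: funpow.simps)
  qed
  interpret word_tapes T L K
    by unfold_locales (use assms(1) u0 in \<open>auto simp: T_def word_tape_def L_def in_set_conv_nth nat_less_iff\<close>)
  have "sat T L p f = sat (\<lambda>_. word_tape u) L (\<lambda>_. 0) f"
    by (rule sat_cong[OF assms(2)]) (auto simp: T_def)
  then have sat: "sat T L p f = holds f u" by (simp add: holds_def L_def)
  obtain m where m: "m \<le> poly (fm_time f) L" "(pstep T ^^ m) (Eval f [], p) = (Ret (holds f u) [], p)"
    using reach_Eval[OF assms(2), of p "[]"] unfolding sat reach_def p_def by auto
  have stay: "(pstep T ^^ n) (Ret b [], p) = (Ret b [], p)" for n b
    by (induction n) (simp_all add: pstep_def)
  define n where "n = N - (Suc (Suc L) + length w)"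
  have n: "N = n + (Suc (Suc L) + length w)" "m \<le> n" using N m(1) by (auto simp: n_def L_def)
  have "n - m + m = n" using n(2) by simp
  then have "(pstep T ^^ n) (Eval f [], p) = (Ret (holds f u) [], p)"
    using funpow_reach_trans[OF m(2) stay[where n = "n - m"]] by metis
  from cstep_Run_pow[of K T n _ p _ p \<tau> f, OF _ this]
  have "(fm_cstep \<tau> f ^^ n) (Run (Eval f []), map (\<lambda>i. (T i, p i)) [0..<K]) =
      (Run (Ret (holds f u) []), map (\<lambda>i. (T i, p i)) [0..<K])"
    using assms(1) by (simp add: T_def)
  moreover have "map (\<lambda>i. (T i, p i)) [0..<K] = copy_tapes K w (length w) u 0"
    unfolding copy_tapes_def by (intro map_cong) (auto simp: T_def p_def)
  ultimately have 3: "(fm_cstep \<tau> f ^^ n) (Run (Eval f []), copy_tapes K w (length w) u 0) =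
      (Run (Ret (holds f u) []), copy_tapes K w (length w) u 0)"
    by metis
  show ?thesis
    unfolding n(1) funpow_reach_trans[OF funpow_reach_trans[OF 1 2] 3] by simp
qed

lemma fm_control_on:
  assumes "finite S" "\<And>s a. s \<in> S \<Longrightarrow> fst (\<tau> s a) \<in> S" "\<And>s a. s \<in> S \<Longrightarrow> snd (\<tau> s a) < G"
  shows "control_on K G (Copy ` S \<union> {Rewind} \<union> Run ` fm_states f []) (fm_control \<tau> f)"
  unfolding control_on_def
proof (intro conjI ballI allI impI)
  show "finite (Copy ` S \<union> {Rewind} \<union> Run ` fm_states f [])"
    using assms(1) finite_fm_states by auto
  fix q ss assume q: "q \<in> Copy ` S \<union> {Rewind} \<union> Run ` fm_states f []"
  show "fst (fm_control \<tau> f q ss) \<in> Copy ` S \<union> {Rewind} \<union> Run ` fm_states f []"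
  proof (cases q)
    case (Copy s)
    with q assms(2)[of s "ss ! 0"] show ?thesis by (auto split: prod.splits)
  next
    case (Run q')
    let ?v = "\<lambda>i. if i < length ss then ss ! i else 0"
    obtain q1 d where q1: "estep q' ?v = (q1, d)" by fastforce
    from Run q have "q' \<in> fm_states f []" by auto
    from fm_states_closed[OF this, of ?v] have "q1 \<in> fm_states f []"
    proof
      assume "\<exists>b. q' = Ret b []"
      with q1 Ret_fm_states show ?thesis by auto
    qed (simp add: q1)
    with q1 show ?thesis unfolding Run by simp
  qed (use Eval_fm_states in auto)
  assume ss: "length ss = K" "set ss \<subseteq> {..<G}"
  then have nth: "ss ! i < G" if "i < length ss" for i
    using that nth_mem by blast
  then have keep: "length (keep ss d) = K \<and> (\<forall>x\<in>set (keep ss d). fst x < G)" for d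
    using ss by (auto simp: keep_def)
  have acts: "length (snd (fm_control \<tau> f q ss)) = K \<and> (\<forall>x\<in>set (snd (fm_control \<tau> f q ss)). fst x < G)"
  proof (cases q)
    case (Copy s)
    show ?thesis
    proof (cases "ss ! 0 = 0")
      case True
      with keep show ?thesis unfolding Copy by simp
    next
      case False
      obtain s' c where \<tau>: "\<tau> s (ss ! 0) = (s', c)" by fastforce
      with Copy q assms(3)[of s "ss ! 0"] have "c < G" by auto
      with nth False ss \<tau> show ?thesis unfolding Copy by auto
    qed
  next
    case Rewind
    obtain d where "snd (fm_control \<tau> f q ss) = keep ss d" by (cases "ss ! 1 = 0") (auto simp: Rewind)
    with keep show ?thesis by simp
  next
    case (Run q')
    obtain q1 d where "estep q' (\<lambda>i. if i < length ss then ss ! i else 0) = (q1, d)" by fastforce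
    with keep show ?thesis unfolding Run by simp
  qed
  then show "length (snd (fm_control \<tau> f q ss)) = K" "fst ` set (snd (fm_control \<tau> f q ss)) \<subseteq> {..<G}"
    by auto
qed

text \<open>Membership in NP without programming a machine: it suffices to give a finite transducer
  that rewrites the input and a formula about its output. The transducer never lengthens the word,
  so the time is polynomial in the length of the input.\<close>

theorem NP_of_formula:
  fixes \<tau> :: "'t \<Rightarrow> nat \<Rightarrow> 't \<times> nat" and p :: "nat poly"
  assumes S: "finite S" "s0 \<in> S" "\<And>s a. s \<in> S \<Longrightarrow> fst (\<tau> s a) \<in> S" "\<And>s a. s \<in> S \<Longrightarrow> snd (\<tau> s a) < G"
    and "4 \<le> G" "2 \<le> K" "wf_fm K {} f"
    and A: "\<And>x. x \<in> A \<longleftrightarrow>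
      (\<exists>y. length y \<le> poly p (length x) \<and> holds f (transduce \<tau> s0 (pair_word x y)))"
  shows "A \<in> NP"
proof -
  let ?Q = "Copy ` S \<union> {Rewind} \<union> Run ` fm_states f []"
  obtain M where M: "turing_machine M" "num_tapes M = K"
    and acc: "\<And>w n. state_after M w n = 1 \<longleftrightarrow>
      fst ((fm_cstep \<tau> f ^^ n) (Copy s0, snd (start M w))) = Run (Ret True [])"
    and rej: "\<And>w n. state_after M w n = 2 \<longleftrightarrow>
      fst ((fm_cstep \<tau> f ^^ n) (Copy s0, snd (start M w))) = Run (Ret False [])"
    by (rule turing_machine_of_control[OF fm_control_on[of S \<tau> G K f, OF S(1,3,4)], of "Copy s0"
          "Run (Ret True [])" "Run (Ret False [])"])
      (use assms(2,5,6) Eval_fm_states Ret_fm_states in auto)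
  have start: "snd (start M w) = copy_tapes K w 0 [] 0" for w
  proof -
    have "word_tape [] = (\<lambda>_. 0)" by (auto simp: word_tape_def)
    with assms(6) show ?thesis
      unfolding start_def copy_tapes_def M(2)
      by (intro nth_equalityI) (auto simp: word_tape_def fun_eq_iff nth_Cons split: nat.split)
  qed
  define q where "q = [:2, 2:] + fm_time f"
  have run: "fst ((fm_cstep \<tau> f ^^ N) (Copy s0, snd (start M w))) = Run (Ret (holds f (transduce \<tau> s0 w)) [])"
    if "0 \<notin> set w" "poly q (length w) \<le> N" for w N
    unfolding start
  proof (rule fm_control_decides)
    have "poly (fm_time f) (length (transduce \<tau> s0 w)) \<le> poly (fm_time f) (length w)"
      by (rule poly_nat_mono) (rule length_transduce)
    then show "length w + length (transduce \<tau> s0 w) + 2 + poly (fm_time f) (length (transduce \<tau> s0 w)) \<le> N"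
      using that(2) length_transduce[of \<tau> s0 w] by (simp add: q_def mult_2)
  qed (use that assms in auto)
  have w: "0 \<notin> set (pair_word x y)" for x y by (auto simp: pair_word_def)
  have "halts_within M (pair_word x y) (poly q (length (pair_word x y)))" for x y
    unfolding halts_within_def using run[OF w order_refl, of x y] acc rej by simp
  moreover have "accepts M (pair_word x y) \<longleftrightarrow> holds f (transduce \<tau> s0 (pair_word x y))" for x y
  proof
    assume "accepts M (pair_word x y)"
    then obtain n where "state_after M (pair_word x y) n = 1" by (auto simp: accepts_def)
    then have n: "fst ((fm_cstep \<tau> f ^^ n) (Copy s0, snd (start M (pair_word x y)))) = Run (Ret True [])"
      using acc by simp
    \<comment> \<open>Acceptance at some time agrees with the verdict at the time bound, since the
      accepting state is never left.\<close>
    have stay: "fst ((fm_cstep \<tau> f ^^ k) c) = Run (Ret True [])" if "fst c = Run (Ret True [])" for k c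
    proof (induction k)
      case (Suc k)
      then show ?case by (auto simp: cstep_def split: prod.splits)
    qed (use that in simp)
    from stay[OF n, of "poly q (length (pair_word x y))"] run[OF w, of x y "poly q (length (pair_word x y)) + n"]
    show "holds f (transduce \<tau> s0 (pair_word x y))" by (simp add: funpow_add)
  next
    assume "holds f (transduce \<tau> s0 (pair_word x y))"
    then show "accepts M (pair_word x y)"
      using run[OF w order_refl, of x y] acc unfolding accepts_def by metis
  qed
  ultimately show ?thesis
    unfolding NP_def using M(1) A by (intro CollectI exI[of _ M] exI[of _ p] exI[of _ q]) simp
qed

section \<open>Words as databases\<close>

text \<open>A record of a word is a head together with the digits that follow it, and carries a number
  on each track. An entry consists of its position, its head and these numbers.\<close>

fun val :: "nat \<Rightarrow> nat list \<Rightarrow> nat" where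
  "val j [] = 0"
| "val j (s # w) = (if is_digit s then of_bool (bit s j) + 2 * val j w else 0)"

type_synonym entry = "nat \<times> nat \<times> (nat \<Rightarrow> nat)"

definition entry :: "nat list \<Rightarrow> nat \<Rightarrow> entry" where
  "entry w p = (p, w ! p, \<lambda>j. val j (drop (Suc p) w))"

definition db :: "nat list \<Rightarrow> entry set" where
  "db w = entry w ` {p. p < length w \<and> is_head (w ! p)}"

definition pos :: "entry \<Rightarrow> nat" where "pos z = fst z"
definition tag :: "entry \<Rightarrow> nat" where "tag z = fst (snd z)"
definition num :: "nat \<Rightarrow> entry \<Rightarrow> nat" where "num j z = snd (snd z) j"

text \<open>From here on formulas speak of records and numbers rather than of head positions and
  digits; \<open>sat_iff_dsat\<close> is the bridge between the two readings.\<close>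

fun dsat :: "entry set \<Rightarrow> (nat \<Rightarrow> entry) \<Rightarrow> fm \<Rightarrow> bool" where
  "dsat D \<eta> (At (Tag x T)) \<longleftrightarrow> tag (\<eta> x) = T"
| "dsat D \<eta> (At (Less x y)) \<longleftrightarrow> pos (\<eta> x) < pos (\<eta> y)"
| "dsat D \<eta> (At (Lin ls c)) \<longleftrightarrow> 0 \<le> c + (\<Sum>(k, x, j)\<leftarrow>ls. k * int (num j (\<eta> x)))"
| "dsat D \<eta> (Neg f) \<longleftrightarrow> \<not> dsat D \<eta> f"
| "dsat D \<eta> (And f g) \<longleftrightarrow> dsat D \<eta> f \<and> dsat D \<eta> g"
| "dsat D \<eta> (Ex x f) \<longleftrightarrow> (\<exists>z\<in>D. dsat D (\<eta>(x := z)) f)"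

section \<open>The automata compute what the atoms mean\<close>

lemma val_take_Suc:
  "val j (take (Suc n) u) = val j (take n u) +
     2 ^ n * of_bool (n < length u \<and> (\<forall>t\<le>n. is_digit (u ! t)) \<and> bit (u ! n) j)"
proof (induction u arbitrary: n)
  case (Cons s u)
  show ?case
  proof (cases n)
    case (Suc m)
    have "(\<forall>t\<le>Suc m. is_digit ((s # u) ! t)) \<longleftrightarrow> is_digit s \<and> (\<forall>t\<le>m. is_digit (u ! t))"
      unfolding less_Suc_eq_le[symmetric] All_less_Suc2 by simp
    with Cons[of m] Suc show ?thesis by (simp add: algebra_simps)
  qed simp
qed simp

lemma not_digit_0: "\<not> is_digit 0" "is_head s \<Longrightarrow> \<not> is_digit s" "\<not> is_head 0"
  by (auto simp: is_digit_def is_head_def)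

lemma atom_run_Suc:
  "atom_run a T e (Suc n) = atom_step a (\<lambda>i. T i (e i + int n)) (atom_run a T e n)"
  by (simp add: atom_run_def)

text \<open>The first step skips the head, so \<open>Suc n\<close> steps read \<open>n\<close>
  digits. The invariant is that the carry equals the constant plus the sum of the truncated numbers,
  divided by \<open>2 ^ n\<close> and rounded down. Successive halvings with rounding compose, and
  rounding down preserves whether a number is nonnegative; hence no digits of the sum have to be
  stored.\<close>

lemma atom_run_Lin:
  fixes ls :: "(int \<times> nat \<times> nat) list" and c :: int and w :: "nat list" and p :: "nat \<Rightarrow> nat"
  defines "u x \<equiv> drop (Suc (p x)) w"
  shows "atom_run (Lin ls c) (\<lambda>_. word_tape w) (\<lambda>x. int (p x)) (Suc n) =
    ((c + (\<Sum>(k, x, j)\<leftarrow>ls. k * int (val j (take n (u x))))) div 2 ^ n,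
     {x \<in> atom_vars (Lin ls c). \<exists>t<n. \<not> (t < length (u x) \<and> is_digit (u x ! t))}, True)"
proof (induction n)
  case 0
  have "(\<Sum>(k, x, j)\<leftarrow>ls. k * int (val j (take 0 (u x)))) = 0"
    by (induction ls) auto
  then show ?case unfolding atom_run_Suc by (simp add: atom_run_def)
next
  case (Suc n)
  let ?v = "\<lambda>x. word_tape w (int (p x) + int (Suc n))"
  define E where "E = {x \<in> atom_vars (Lin ls c). \<exists>t<n. \<not> (t < length (u x) \<and> is_digit (u x ! t))}"
  define s where "s = (\<Sum>(k, x, j)\<leftarrow>ls. k * lin_digit ?v E x j)"
  define S where "S n = (\<Sum>(k, x, j)\<leftarrow>ls. k * int (val j (take n (u x))))" for n
  have v: "?v x = (if n < length (u x) then u x ! n else 0)" for x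
    by (auto simp: word_tape_def u_def nat_add_distrib)
  have digit: "lin_digit ?v E x j =
      of_bool (n < length (u x) \<and> (\<forall>t\<le>n. is_digit (u x ! t)) \<and> bit (u x ! n) j)"
    if "(k, x, j) \<in> set ls" for k x j
  proof -
    have "x \<in> atom_vars (Lin ls c)" using that by force
    then have "x \<notin> E \<longleftrightarrow> (\<forall>t<n. t < length (u x) \<and> is_digit (u x ! t))" unfolding E_def by auto
    then have "x \<notin> E \<and> is_digit (?v x) \<longleftrightarrow> n < length (u x) \<and> (\<forall>t\<le>n. is_digit (u x ! t))"
      unfolding v using not_digit_0 by (auto simp: le_less)
    then show ?thesis unfolding lin_digit_def v by (auto simp: not_digit_0)
  qed
  \<comment> \<open>The new digits enter with weight \<open>2 ^ n\<close>, and only those of records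
    that have not ended.\<close>
  have "S (Suc n) = S n + 2 ^ n * s"
  proof -
    have "(\<Sum>(k, x, j)\<leftarrow>l. k * int (val j (take (Suc n) (u x)))) =
        (\<Sum>(k, x, j)\<leftarrow>l. k * int (val j (take n (u x)))) + 2 ^ n * (\<Sum>(k, x, j)\<leftarrow>l. k * lin_digit ?v E x j)"
      if "set l \<subseteq> set ls" for l
      using that
    proof (induction l)
      case (Cons a l)
      obtain k x j where a: "a = (k, x, j)" by (cases a)
      with Cons digit[of k x j] show ?case by (simp add: val_take_Suc algebra_simps)
    qed simp
    then show ?thesis by (simp add: S_def s_def)
  qed
  then have "(c + S n) div 2 ^ n + s = (c + S (Suc n)) div 2 ^ n"
    by (simp add: add.assoc[symmetric])
  then have "((c + S n) div 2 ^ n + s) div 2 = (c + S (Suc n)) div (2 ^ n * 2)"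
    by (simp add: zdiv_zmult2_eq)
  then have "((c + S n) div 2 ^ n + s) div 2 = (c + S (Suc n)) div 2 ^ Suc n"
    by (simp add: mult.commute)
  moreover have "E \<union> {x \<in> atom_vars (Lin ls c). \<not> is_digit (?v x)} =
      {x \<in> atom_vars (Lin ls c). \<exists>t<Suc n. \<not> (t < length (u x) \<and> is_digit (u x ! t))}"
    unfolding E_def v by (auto simp: less_Suc_eq not_digit_0)
  ultimately show ?case
    unfolding atom_run_Suc[of _ _ _ "Suc n"] Suc.IH S_def[symmetric] E_def[symmetric]
    by (simp add: s_def)
qed

lemma atom_run_Tag:
  "atom_run (Tag x T) t e (Suc n) = (of_bool (t x (e x) = T) - 1, {}, True)"
  by (induction n) (simp_all add: atom_run_def)

lemma atom_run_Less:
  assumes "0 \<notin> set w" "p x < length w"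
  shows "atom_run (Less x y) (\<lambda>_. word_tape w) (\<lambda>x. int (p x)) n =
    (if \<exists>t<n. p x + t < length w \<and> length w \<le> p y + t then 0 else -1, {}, False)"
proof (induction n)
  case (Suc n)
  have "word_tape w (int q + int n) = 0 \<longleftrightarrow> length w \<le> q + n" for q
  proof (cases "q + n < length w")
    case True
    have "w ! (q + n) \<noteq> 0" using assms(1) nth_mem[OF True] by metis
    with True show ?thesis by (simp add: word_tape_def nat_add_distrib)
  qed (auto simp: word_tape_def)
  then show ?case unfolding atom_run_Suc Suc.IH by (auto simp: Ex_less_Suc not_le)
qed (simp add: atom_run_def)

lemma sat_iff_dsat:
  assumes "wf_fm K V f" "0 \<notin> set w"
    "\<And>x. x \<in> V \<Longrightarrow> \<eta> x = entry w (p x) \<and> p x < length w \<and> is_head (w ! p x)"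
  shows "sat (\<lambda>_. word_tape w) (length w) (\<lambda>x. int (p x)) f \<longleftrightarrow> dsat (db w) \<eta> f"
  using assms(1,3)
proof (induction f arbitrary: V \<eta> p)
  case (At a)
  then have vars: "atom_vars a \<subseteq> V" by simp
  show ?case
  proof (cases a)
    case (Tag x T)
    with At vars have x: "\<eta> x = entry w (p x)" "p x < length w" by auto
    obtain n where n: "length w = Suc n" using x(2) by (cases "length w") auto
    have "word_tape w (int (p x)) = w ! p x" using x by (simp add: word_tape_def)
    then show ?thesis using x(1) unfolding Tag sat.simps n atom_run_Tag
      by (simp add: atom_acc_def tag_def entry_def)
  next
    case (Less x y)
    with At vars have xy: "\<eta> x = entry w (p x)" "p x < length w" "\<eta> y = entry w (p y)" "p y < length w"
      by auto
    have "(\<exists>t<length w. p x + t < length w \<and> length w \<le> p y + t) \<longleftrightarrow> p x < p y"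
    proof
      assume "p x < p y"
      with xy show "\<exists>t<length w. p x + t < length w \<and> length w \<le> p y + t"
        by (intro exI[of _ "length w - p y"]) auto
    qed auto
    then show ?thesis using xy assms(2) unfolding Less sat.simps
      by (simp add: atom_run_Less atom_acc_def pos_def entry_def)
  next
    case (Lin ls c)
    show ?thesis
    proof (cases "ls = []")
      \<comment> \<open>Without a variable nothing guarantees that the word is nonempty, so the run
        of length 0 has to be covered as well.\<close>
      case True
      have "fst (atom_run (Lin [] c) (\<lambda>_. word_tape w) (\<lambda>x. int (p x)) n) = 
         (if n = 0 then c else c div 2 ^ (n - 1))" for n
        using atom_run_Lin[of "[]" c w p "n - 1"] by (cases n) (simp_all add: atom_run_def)
      then show ?thesis unfolding Lin True
        by (auto simp: atom_acc_def case_prod_beta pos_imp_zdiv_nonneg_iff)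
    next
      case False
      then obtain k x j where "(k, x, j) \<in> set ls" by (cases ls) auto
      then have "x \<in> atom_vars a" unfolding Lin by force
      with At vars have "p x < length w" by auto
      then obtain n where n: "length w = Suc n" by (cases "length w") auto
      \<comment> \<open>At most \<open>n\<close> symbols follow a head in a word of length
        \<open>Suc n\<close>, so the truncation loses nothing.\<close>
      have "val j (take n (drop (Suc (p x)) w)) = num j (\<eta> x)" if "(k, x, j) \<in> set ls" for k x j
      proof -
        have "x \<in> V" using that vars unfolding Lin by force
        with At.prems(2) n show ?thesis by (simp add: num_def entry_def)
      qed
      then have "(\<Sum>(k, x, j)\<leftarrow>ls. k * int (val j (take n (drop (Suc (p x)) w)))) =
          (\<Sum>(k, x, j)\<leftarrow>ls. k * int (num j (\<eta> x)))"
        by (intro arg_cong[of _ _ sum_list] map_cong) auto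
      then show ?thesis unfolding Lin sat.simps n atom_run_Lin
        by (simp add: atom_acc_def pos_imp_zdiv_nonneg_iff)
    qed
  qed
next
  case (Ex x f)
  have step: "sat (\<lambda>_. word_tape w) (length w) ((\<lambda>x. int (p x))(x := int q)) f \<longleftrightarrow>
      dsat (db w) (\<eta>(x := entry w q)) f" if "q < length w" "is_head (w ! q)" for q
  proof -
    have "(\<lambda>x. int (p x))(x := int q) = (\<lambda>y. int ((p(x := q)) y))" by auto
    moreover have "sat (\<lambda>_. word_tape w) (length w) (\<lambda>y. int ((p(x := q)) y)) f \<longleftrightarrow>
        dsat (db w) (\<eta>(x := entry w q)) f"
      by (rule Ex.IH[of "insert x V"]) (use Ex.prems that in auto)
    ultimately show ?thesis by simp
  qed
  have "word_tape w (int q) = w ! q" if "q < length w" for q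
    using that by (simp add: word_tape_def)
  then show ?case using step by (auto simp: db_def)
next
  case (Neg f)
  then show ?case using Neg.IH[of V \<eta> p] by simp
next
  case (And f g)
  then show ?case using And.IH(1,2)[of V \<eta> p] by simp
qed

lemma holds_iff_dsat:
  assumes "wf_fm K {} f" "0 \<notin> set w"
  shows "holds f w \<longleftrightarrow> dsat (db w) \<eta> f"
  using sat_iff_dsat[OF assms, of \<eta> "\<lambda>_. 0"] by (simp add: holds_def)

section \<open>Reading instances and certificates\<close>

abbreviation (input) "asset_tag \<equiv> 24 :: nat"
abbreviation (input) "vertex_tag \<equiv> 25 :: nat"
abbreviation (input) "edge_tag \<equiv> 26 :: nat"
abbreviation (input) "source_tag \<equiv> 28 :: nat"
abbreviation (input) "target_tag \<equiv> 29 :: nat"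
abbreviation (input) "trap_tag \<equiv> 30 :: nat"
abbreviation (input) "goal_tag \<equiv> 32 :: nat"
abbreviation (input) "error_tag \<equiv> 33 :: nat"
abbreviation (input) "cert_tag \<equiv> 34 :: nat"

text \<open>\<open>List r\<close> is the state at the marker of a list entry whose first number gets the head
  \<open>r\<close>; the second number of a pair gets the head \<open>r + 1\<close>. \<open>Number r c\<close> is the state at the marker
  of a digit, where \<open>c\<close> tells whether the number may end here without having a leading zero.\<close>

datatype parse_state = List nat | Number nat bool | Digit nat | Done | Error | Cert "bool list"

definition after_list :: "nat \<Rightarrow> parse_state \<times> nat" where
  "after_list r =
    (if r = asset_tag then (List vertex_tag, 0)
     else if r = vertex_tag then (List edge_tag, 0)
     else if r = edge_tag then (Number source_tag True, source_tag)
     else (Number goal_tag True, goal_tag))"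

definition after_number :: "nat \<Rightarrow> parse_state \<times> nat" where
  "after_number r =
    (if r = asset_tag \<or> r = vertex_tag then (List r, 0)
     else if r = edge_tag \<or> r = trap_tag then (Number (r + 1) True, r + 1)
     else if r = edge_tag + 1 \<or> r = trap_tag + 1 then (List (r - 1), 0)
     else if r = source_tag then (Number target_tag True, target_tag)
     else if r = target_tag then (List trap_tag, 0)
     else (Done, 0))"

definition digit :: "bool \<Rightarrow> bool \<Rightarrow> bool \<Rightarrow> nat" where
  "digit b0 b1 b2 = 8 + of_bool b0 + 2 * of_bool b1 + 4 * of_bool b2"

text \<open>A certificate is cut into blocks of four bits, the last of which separates digits from
  heads. Adding 8 to a digit symbol gives the heads 16, ..., 23 only, so a certificate can forge
  neither a record of the instance nor an error token.\<close>

fun decode :: "bool list \<Rightarrow> nat" where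
  "decode [b0, b1, b2, b3] = (if b3 then digit b0 b1 b2 else 8 + digit b0 b1 b2)"
| "decode _ = 0"

text \<open>Only the shape of the input is checked here. A violation produces the token
  \<open>error_tag\<close>, which the formula forbids. The separator produces a head of its own, so
  that digits at the beginning of a certificate cannot lengthen the number of the goal.\<close>

fun parse :: "parse_state \<Rightarrow> nat \<Rightarrow> parse_state \<times> nat" where
  "parse (List r) a =
     (if a = 2 then (Number r True, r) else if a = 1 then after_list r else (Error, error_tag))"
| "parse (Number r c) a =
     (if a = 2 then (Digit r, 0) else if a = 1 \<and> c then after_number r else (Error, error_tag))"
| "parse (Digit r) a =
     (if a = 1 \<or> a = 2 then (Number r (a = 2), digit (a = 2) False False) else (Error, error_tag))"
| "parse Done a = (if a = 3 then (Cert [], cert_tag) else (Error, error_tag))"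
| "parse Error a = (Error, error_tag)"
| "parse (Cert bs) a =
     (if a = 1 \<or> a = 2 then
        (if length bs = 3 then (Cert [], decode (bs @ [a = 2])) else (Cert (bs @ [a = 2]), 0))
      else (Error, error_tag))"

definition parse_states :: "parse_state set" where
  "parse_states = List ` {..32} \<union> case_prod Number ` ({..32} \<times> UNIV) \<union> Digit ` {..32} \<union>
     {Done, Error} \<union> Cert ` {bs. length bs \<le> 3}"

lemma finite_parse_states: "finite parse_states"
proof -
  have "finite {bs :: bool list. length bs \<le> 3}"
    using finite_lists_length_le[of "UNIV :: bool set" 3] by simp
  then show ?thesis unfolding parse_states_def by auto
qed

lemma digit_less: "8 \<le> digit b0 b1 b2" "digit b0 b1 b2 < 16"
  by (auto simp: digit_def)

lemma decode_less: "decode bs < 24"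
  by (cases bs rule: decode.cases) (auto simp: digit_def)

lemma parse_closed:
  assumes "s \<in> parse_states"
  shows "fst (parse s a) \<in> parse_states" "snd (parse s a) < 64"
proof -
  have "fst (parse s a) \<in> parse_states \<and> snd (parse s a) < 64"
  proof (cases s)
    case (Cert bs)
    then show ?thesis using assms decode_less[of "bs @ [a = 2]"] by (auto simp: parse_states_def)
  next
    case (Digit r)
    then show ?thesis using assms digit_less(2)[of "a = 2" False False] by (auto simp: parse_states_def)
  next
    case (List r)
    then show ?thesis using assms by (auto simp: parse_states_def after_list_def)
  next
    case (Number r c)
    then show ?thesis using assms by (auto simp: parse_states_def after_number_def)
  qed (auto simp: parse_states_def)
  then show "fst (parse s a) \<in> parse_states" "snd (parse s a) < 64" by auto
qed

abbreviation "bit_code \<equiv> \<lambda>b :: bool. if b then 2 else 1 :: nat"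

section \<open>The output of the transducer on correctly encoded instances\<close>

definition tokens :: "parse_state \<Rightarrow> bool list \<Rightarrow> bool list \<Rightarrow> nat list" where
  "tokens s x y = transduce parse s (map bit_code x @ [3] @ map bit_code y)"

definition emit :: "parse_state \<times> nat \<Rightarrow> bool list \<Rightarrow> bool list \<Rightarrow> nat list" where
  "emit sc x y = (if snd sc = 0 then [] else [snd sc]) @ tokens (fst sc) x y"

lemma tokens_Cons: "tokens s (b # x) y = emit (parse s (bit_code b)) x y"
  by (simp add: tokens_def emit_def split: prod.split)

lemma tokens_Nil: "tokens Done [] y = cert_tag # transduce parse (Cert []) (map bit_code y)"
  by (simp add: tokens_def)

lemma error_tokens_Nil: "s \<noteq> Done \<Longrightarrow> (\<forall>bs. s \<noteq> Cert bs) \<Longrightarrow> error_tag \<in> set (tokens s [] y)"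
  by (cases s) (auto simp: tokens_def)

lemma error_tokens_Error: "error_tag \<in> set (tokens Error x y)"
  by (cases x) (simp_all add: tokens_Cons emit_def, simp add: tokens_def)

definition digits :: "nat \<Rightarrow> nat list" where
  "digits n = map (\<lambda>b. digit b False False) (bits n)"

lemma last_bits: "bits n \<noteq> [] \<Longrightarrow> last (bits n)"
proof (induction n rule: less_induct)
  case (less n)
  have "n \<noteq> 0" using less.prems by (metis bits.simps)
  then have n: "n \<noteq> 0" "bits n = odd n # bits (n div 2)" by (simp_all add: bits.simps[of n])
  show ?case
  proof (cases "bits (n div 2) = []")
    case True
    then have "n div 2 = 0" by (metis bits.simps list.distinct(1))
    then have "n = 1" using n by auto
    with True n show ?thesis by simp
  next
    case False
    with less n show ?thesis by simp
  qed
qed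

lemma enc_nat_Nil: "bits n = ds \<Longrightarrow> enc_nat n = concat (map (\<lambda>b. [True, b]) ds) @ [False]"
  by (simp add: enc_nat_def enc_list_def)

lemma digit_nonzero: "digit b0 b1 b2 \<noteq> 0"
  using digit_less(1)[of b0 b1 b2] by simp

text \<open>Stated for the remaining digits of a number, to make the induction work:
  \<open>c\<close> tells whether the digit before was a one, or none was read yet, so that the
  number may end here.\<close>

lemma tokens_digits:
  assumes "if ds = [] then c else last ds"
  shows "tokens (Number r c) (concat (map (\<lambda>b. [True, b]) ds) @ False # x) y =
    map (\<lambda>b. digit b False False) ds @ emit (after_number r) x y"
  using assms
proof (induction ds arbitrary: c)
  case Nil
  then show ?case by (simp add: tokens_Cons)
next
  case (Cons b ds)
  have "if ds = [] then b else last ds" using Cons.prems by (auto split: if_splits)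
  from Cons.IH[OF this] show ?case by (cases b) (simp_all add: tokens_Cons emit_def digit_nonzero)
qed

lemma tokens_nat: "tokens (Number r True) (enc_nat n @ x) y = digits n @ emit (after_number r) x y"
  using tokens_digits[of "bits n" True r x y] last_bits[of n]
  by (simp add: enc_nat_def enc_list_def digits_def comp_def)

lemma tokens_list:
  assumes "\<And>e x. e \<in> set es \<Longrightarrow> tokens (Number r True) (f e @ x) y = g e @ tokens (List r) x y" "r \<noteq> 0"
  shows "tokens (List r) (enc_list f es @ x) y =
    concat (map (\<lambda>e. r # g e) es) @ emit (after_list r) x y"
  using assms(1)
proof (induction es)
  case Nil
  then show ?case by (simp add: enc_list_def tokens_Cons)
next
  case (Cons e es)
  have "tokens (List r) (enc_list f (e # es) @ x) y = r # tokens (Number r True) (f e @ (enc_list f es @ x)) y"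
    using assms(2) by (simp add: enc_list_def tokens_Cons emit_def)
  with Cons show ?case by simp
qed

lemma tokens_nats:
  assumes "r = asset_tag \<or> r = vertex_tag"
  shows "tokens (List r) (enc_list enc_nat ns @ x) y =
    concat (map (\<lambda>n. r # digits n) ns) @ emit (after_list r) x y"
  by (rule tokens_list) (use assms in \<open>auto simp: tokens_nat after_number_def emit_def\<close>)

lemma tokens_pairs:
  assumes "r = edge_tag \<or> r = trap_tag"
  shows "tokens (List r) (enc_list enc_pair ps @ x) y =
    concat (map (\<lambda>p. r # digits (fst p) @ (r + 1) # digits (snd p)) ps) @ emit (after_list r) x y"
  by (rule tokens_list) (use assms in \<open>auto simp: enc_pair_def tokens_nat after_number_def emit_def\<close>)

definition encoding :: "nat list \<Rightarrow> nat list \<Rightarrow> (nat \<times> nat) list \<Rightarrow> nat \<Rightarrow> nat \<Rightarrow> (nat \<times> nat) list \<Rightarrow> nat \<Rightarrow> bool list" where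
  "encoding as vs es s t rs k = enc_list enc_nat as @ enc_list enc_nat vs @ enc_list enc_pair es @
     enc_nat s @ enc_nat t @ enc_list enc_pair rs @ enc_nat k"

lemma tokens_encoding:
  "tokens (List asset_tag) (encoding as vs es s t rs k) y =
    concat (map (\<lambda>n. asset_tag # digits n) as) @
    concat (map (\<lambda>n. vertex_tag # digits n) vs) @
    concat (map (\<lambda>p. edge_tag # digits (fst p) @ (edge_tag + 1) # digits (snd p)) es) @
    source_tag # digits s @ target_tag # digits t @
    concat (map (\<lambda>p. trap_tag # digits (fst p) @ (trap_tag + 1) # digits (snd p)) rs) @
    goal_tag # digits k @ cert_tag # transduce parse (Cert []) (map bit_code y)"
proof -
  have "tokens (Number goal_tag True) (enc_nat k) y =
      digits k @ cert_tag # transduce parse (Cert []) (map bit_code y)"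
    using tokens_nat[of goal_tag k "[]" y] by (simp add: after_number_def emit_def tokens_Nil)
  then show ?thesis
    unfolding encoding_def
    by (simp add: tokens_nats tokens_pairs tokens_nat emit_def after_list_def after_number_def)
qed

section \<open>Input without an error token is an encoding\<close>

lemma bits_of_digits: "ds = [] \<or> last ds \<Longrightarrow> \<exists>n. bits n = ds \<and> (ds \<noteq> [] \<longrightarrow> 0 < n)"
proof (induction ds)
  case Nil
  show ?case by (intro exI[of _ 0]) (simp add: bits.simps)
next
  case (Cons b ds)
  then obtain n where n: "bits n = ds" "ds \<noteq> [] \<longrightarrow> 0 < n" by (auto split: if_splits)
  have "0 < of_bool b + 2 * n" using Cons.prems n(2) by (cases "ds = []") auto
  with n(1) show ?case by (intro exI[of _ "of_bool b + 2 * n"]) (simp add: bits.simps[of "of_bool b + 2 * n"])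
qed

text \<open>The condition on the last digit makes numbers canonical: by
  \<open>bits_of_digits\<close>, a list of digits that is empty or ends in a one is the binary form
  of some number, so what passes the parser has a preimage under the encoding.\<close>

lemma error_free_digits:
  assumes "error_tag \<notin> set (tokens (Number r c) x y)"
  obtains ds x' where "x = concat (map (\<lambda>b. [True, b]) ds) @ False # x'" "if ds = [] then c else last ds"
    "error_tag \<notin> set (emit (after_number r) x' y)"
proof -
  have "\<exists>ds x'. x = concat (map (\<lambda>b. [True, b]) ds) @ False # x' \<and> (if ds = [] then c else last ds)"
    using assms
  proof (induction "length x" arbitrary: x c rule: less_induct)
    case less
    show ?case
    proof (cases x)
      case Nil
      with less.prems error_tokens_Nil show ?thesis by blast
    next
      case (Cons b x1)
      show ?thesis
      proof (cases b)
        case False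
        with Cons less.prems error_tokens_Error have c by (auto simp: tokens_Cons emit_def split: if_splits)
        with False Cons show ?thesis by (intro exI[of _ "[]"] exI[of _ x1]) simp
      next
        case b: True
        show ?thesis
        proof (cases x1)
          case Nil
          with b Cons less.prems error_tokens_Nil[of "Digit r" y] show ?thesis
            by (simp add: tokens_Cons emit_def)
        next
          case (Cons d x2)
          have "error_tag \<notin> set (tokens (Number r d) x2 y)"
            using less.prems unfolding \<open>x = b # x1\<close> Cons
            by (cases d) (auto simp: tokens_Cons emit_def b)
          with less.hyps[of x2 d] \<open>x = b # x1\<close> Cons obtain ds x' where
            "x2 = concat (map (\<lambda>b. [True, b]) ds) @ False # x'" "if ds = [] then d else last ds" by auto
          then show ?thesis using \<open>x = b # x1\<close> Cons b
            by (intro exI[of _ "d # ds"] exI[of _ x']) (auto split: if_splits)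
        qed
      qed
    qed
  qed
  then obtain ds x' where "x = concat (map (\<lambda>b. [True, b]) ds) @ False # x'" "if ds = [] then c else last ds"
    by blast
  with tokens_digits[OF this(2), of r x' y] assms show ?thesis by (intro that) auto
qed

lemma error_free_nat:
  assumes "error_tag \<notin> set (tokens (Number r True) x y)"
  obtains n x' where "x = enc_nat n @ x'" "error_tag \<notin> set (emit (after_number r) x' y)"
proof -
  from error_free_digits[OF assms] obtain ds x' where
    *: "x = concat (map (\<lambda>b. [True, b]) ds) @ False # x'" "if ds = [] then True else last ds"
    "error_tag \<notin> set (emit (after_number r) x' y)" by metis
  from bits_of_digits[of ds] *(2) obtain n where "bits n = ds" by (auto split: if_splits)
  with * show ?thesis by (intro that[of n x']) (auto simp: enc_nat_Nil)
qed

lemma error_free_list: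
  assumes "error_tag \<notin> set (tokens (List r) x y)"
    and "\<And>x. error_tag \<notin> set (tokens (Number r True) x y) \<Longrightarrow>
      \<exists>e x'. x = f e @ x' \<and> error_tag \<notin> set (tokens (List r) x' y)"
  shows "\<exists>es x'. x = enc_list f es @ x' \<and> error_tag \<notin> set (emit (after_list r) x' y)"
  using assms(1)
proof (induction "length x" arbitrary: x rule: less_induct)
  case less
  show ?case
  proof (cases x)
    case Nil
    with less.prems error_tokens_Nil show ?thesis by blast
  next
    case (Cons b x1)
    show ?thesis
    proof (cases b)
      case False
      with Cons less.prems show ?thesis
        by (intro exI[of _ "[]"] exI[of _ x1]) (simp add: enc_list_def tokens_Cons)
    next
      case True
      with Cons less.prems have "error_tag \<notin> set (tokens (Number r True) x1 y)"
        by (auto simp: tokens_Cons emit_def)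
      from assms(2)[OF this] obtain e x2 where e: "x1 = f e @ x2" "error_tag \<notin> set (tokens (List r) x2 y)"
        by blast
      with less.hyps[of x2] Cons obtain es x' where
        "x2 = enc_list f es @ x'" "error_tag \<notin> set (emit (after_list r) x' y)" by auto
      with e Cons True show ?thesis
        by (intro exI[of _ "e # es"] exI[of _ x']) (simp add: enc_list_def)
    qed
  qed
qed

lemma error_free_nats:
  assumes "error_tag \<notin> set (tokens (List r) x y)" "r = asset_tag \<or> r = vertex_tag"
  obtains ns x' where "x = enc_list enc_nat ns @ x'" "error_tag \<notin> set (emit (after_list r) x' y)"
proof -
  have "\<exists>n x'. x = enc_nat n @ x' \<and> error_tag \<notin> set (tokens (List r) x' y)"
    if x: "error_tag \<notin> set (tokens (Number r True) x y)" for x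
  proof -
    from error_free_nat[OF x] obtain n x' where "x = enc_nat n @ x'"
      "error_tag \<notin> set (emit (after_number r) x' y)" by metis
    with assms(2) show ?thesis by (auto simp: after_number_def emit_def)
  qed
  from error_free_list[where f = enc_nat, OF assms(1) this] that show ?thesis by blast
qed

lemma error_free_pairs:
  assumes "error_tag \<notin> set (tokens (List r) x y)" "r = edge_tag \<or> r = trap_tag"
  obtains ps x' where "x = enc_list enc_pair ps @ x'" "error_tag \<notin> set (emit (after_list r) x' y)"
proof -
  have "\<exists>p x'. x = enc_pair p @ x' \<and> error_tag \<notin> set (tokens (List r) x' y)"
    if x: "error_tag \<notin> set (tokens (Number r True) x y)" for x
  proof -
    from error_free_nat[OF x] obtain m x1 where m: "x = enc_nat m @ x1"
      "error_tag \<notin> set (emit (after_number r) x1 y)" by metis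
    then have "error_tag \<notin> set (tokens (Number (r + 1) True) x1 y)"
      using assms(2) by (auto simp: after_number_def emit_def)
    from error_free_nat[OF this] obtain n x2 where n: "x1 = enc_nat n @ x2"
      "error_tag \<notin> set (emit (after_number (r + 1)) x2 y)" by metis
    with m assms(2) show ?thesis
      by (intro exI[of _ "(m, n)"] exI[of _ x2]) (auto simp: after_number_def emit_def enc_pair_def)
  qed
  from error_free_list[where f = enc_pair, OF assms(1) this] that show ?thesis by blast
qed

lemma error_free_encoding:
  assumes "error_tag \<notin> set (tokens (List asset_tag) x y)"
  obtains as vs es s t rs k where "x = encoding as vs es s t rs k"
proof -
  from error_free_nats[OF assms] obtain as x1 where 1: "x = enc_list enc_nat as @ x1"
    "error_tag \<notin> set (tokens (List vertex_tag) x1 y)" by (auto simp: after_list_def emit_def)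
  from error_free_nats[OF 1(2)] obtain vs x2 where 2: "x1 = enc_list enc_nat vs @ x2"
    "error_tag \<notin> set (tokens (List edge_tag) x2 y)" by (auto simp: after_list_def emit_def)
  from error_free_pairs[OF 2(2)] obtain es x3 where 3: "x2 = enc_list enc_pair es @ x3"
    "error_tag \<notin> set (tokens (Number source_tag True) x3 y)" by (auto simp: after_list_def emit_def)
  from error_free_nat[OF 3(2)] obtain s x4 where 4: "x3 = enc_nat s @ x4"
    "error_tag \<notin> set (tokens (Number target_tag True) x4 y)" by (auto simp: after_number_def emit_def)
  from error_free_nat[OF 4(2)] obtain t x5 where 5: "x4 = enc_nat t @ x5"
    "error_tag \<notin> set (tokens (List trap_tag) x5 y)" by (auto simp: after_number_def emit_def)
  from error_free_pairs[OF 5(2)] obtain rs x6 where 6: "x5 = enc_list enc_pair rs @ x6"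
    "error_tag \<notin> set (tokens (Number goal_tag True) x6 y)" by (auto simp: after_list_def emit_def)
  from error_free_nat[OF 6(2)] obtain k x7 where 7: "x6 = enc_nat k @ x7"
    "error_tag \<notin> set (tokens Done x7 y)" by (auto simp: after_number_def emit_def)
  \<comment> \<open>After the goal the parser accepts nothing but the separator, so leftover bits
    would have produced an error token.\<close>
  have "x7 = []"
  proof (cases x7)
    case (Cons b x')
    with 7(2) show ?thesis by (cases b) (simp_all add: tokens_Cons emit_def)
  qed
  with 1 2 3 4 5 6 7 show ?thesis by (intro that) (simp add: encoding_def)
qed

section \<open>Words as sequences of records\<close>

definition flat :: "(nat \<times> nat list) list \<Rightarrow> nat list" where
  "flat recs = concat (map (\<lambda>(h, ds). h # ds) recs)"

definition wf_recs :: "(nat \<times> nat list) list \<Rightarrow> bool" where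
  "wf_recs recs \<longleftrightarrow> (\<forall>(h, ds)\<in>set recs. is_head h \<and> (\<forall>s\<in>set ds. is_digit s))"

definition rec_pos :: "(nat \<times> nat list) list \<Rightarrow> nat \<Rightarrow> nat" where
  "rec_pos recs i = length (flat (take i recs))"

definition rec_entry :: "(nat \<times> nat list) list \<Rightarrow> nat \<Rightarrow> entry" where
  "rec_entry recs i = (rec_pos recs i, fst (recs ! i), \<lambda>j. val j (snd (recs ! i)))"

lemma flat_simps [simp]:
  "flat [] = []" "flat ((h, ds) # recs) = h # ds @ flat recs" "flat (r @ r') = flat r @ flat r'"
  by (simp_all add: flat_def)

lemma wf_recs_simps [simp]:
  "wf_recs []"
  "wf_recs ((h, ds) # recs) \<longleftrightarrow> is_head h \<and> (\<forall>s\<in>set ds. is_digit s) \<and> wf_recs recs"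
  "wf_recs (r @ r') \<longleftrightarrow> wf_recs r \<and> wf_recs r'"
  by (auto simp: wf_recs_def)

lemma val_append_flat:
  assumes "\<forall>s\<in>set ds. is_digit s" "wf_recs recs"
  shows "val j (ds @ flat recs) = val j ds"
  using assms(1)
proof (induction ds)
  case Nil
  then show ?case using assms(2) not_digit_0(2) by (cases recs) auto
qed simp

text \<open>Digits are not heads, so heads occur exactly where records begin, and each number stops
  at the next head.\<close>

lemma db_flat:
  assumes "wf_recs recs"
  shows "db (flat recs) = rec_entry recs ` {..<length recs}"
  using assms
proof (induction recs)
  case Nil
  then show ?case by (simp add: db_def)
next
  case (Cons r recs)
  obtain h ds where r: "r = (h, ds)" by (cases r)
  let ?u = "flat recs" and ?n = "Suc (length ds)"
  define shift where "shift = (\<lambda>(p, t, v :: nat \<Rightarrow> nat). (?n + p, t :: nat, v))"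
  from Cons.prems r have wf: "is_head h" "\<forall>s\<in>set ds. is_digit s" "wf_recs recs" by auto
  have heads: "{p. p < length (flat (r # recs)) \<and> is_head (flat (r # recs) ! p)} =
      insert 0 ((+) ?n ` {p. p < length ?u \<and> is_head (?u ! p)})"
  proof (intro set_eqI iffI)
    fix p assume p: "p \<in> {p. p < length (flat (r # recs)) \<and> is_head (flat (r # recs) ! p)}"
    show "p \<in> insert 0 ((+) ?n ` {p. p < length ?u \<and> is_head (?u ! p)})"
    proof (cases "p < ?n")
      case True
      have "p = 0"
      proof (rule ccontr)
        assume "p \<noteq> 0"
        with True have "p - 1 < length ds" by simp
        with \<open>p \<noteq> 0\<close> p r have "is_head (ds ! (p - 1))" "p - 1 < length ds"
          by (auto simp: nth_Cons' nth_append)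
        with wf(2) not_digit_0(2) nth_mem show False by blast
      qed
      then show ?thesis by simp
    next
      case False
      then obtain q where q: "p = ?n + q" by (metis le_iff_add not_less)
      with p r have "q \<in> {p. p < length ?u \<and> is_head (?u ! p)}"
        by (auto simp: nth_append)
      with q show ?thesis by blast
    qed
  next
    fix p assume "p \<in> insert 0 ((+) ?n ` {p. p < length ?u \<and> is_head (?u ! p)})"
    then show "p \<in> {p. p < length (flat (r # recs)) \<and> is_head (flat (r # recs) ! p)}"
      using wf(1) r by (auto simp: nth_append)
  qed
  have "entry (flat (r # recs)) 0 = rec_entry (r # recs) 0"
    using val_append_flat[OF wf(2,3)] by (simp add: entry_def rec_entry_def rec_pos_def r)
  moreover have "entry (flat (r # recs)) (?n + p) = shift (entry ?u p)" for p
    by (simp add: entry_def shift_def r nth_append)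
  moreover have "rec_entry (r # recs) (Suc i) = shift (rec_entry recs i)" for i
    by (simp add: rec_entry_def shift_def rec_pos_def r)
  ultimately show ?case
    unfolding db_def heads using Cons.IH[OF wf(3), unfolded db_def]
    by (simp add: image_image lessThan_Suc_eq_insert_0 image_insert del: flat_simps)
      (metis image_image)
qed

lemma rec_pos_less: "rec_pos recs i < rec_pos recs j \<longleftrightarrow> i < j" if "i < length recs" "j < length recs"
proof -
  have "rec_pos recs i < rec_pos recs j" if "i < j" "j < length recs" for i j
  proof -
    have "take j recs = take i recs @ drop i (take j recs)"
      using that by (metis append_take_drop_id less_imp_le min.absorb1 take_take)
    moreover have "drop i (take j recs) \<noteq> []" using that by simp
    then obtain h ds rs where "drop i (take j recs) = (h, ds) # rs" by (metis list.exhaust surj_pair)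
    ultimately have "take j recs = take i recs @ (h, ds) # rs" by simp
    then show ?thesis unfolding rec_pos_def by simp
  qed
  then show ?thesis using that by (metis less_asym linorder_neqE_nat)
qed

section \<open>Repetitions and neighbouring records, seen in the list and in the database\<close>

lemma distinct_map_filter_iff:
  "distinct (map f (filter P xs)) \<longleftrightarrow>
    (\<forall>i<length xs. \<forall>j<length xs. i < j \<longrightarrow> P (xs ! i) \<longrightarrow> P (xs ! j) \<longrightarrow> f (xs ! i) \<noteq> f (xs ! j))"
proof (induction xs)
  case (Cons x xs)
  have "f x \<in> f ` {y \<in> set xs. P y} \<longleftrightarrow> (\<exists>j<length xs. P (xs ! j) \<and> f x = f (xs ! j))"
    by (auto simp: in_set_conv_nth)
  then show ?case unfolding length_Cons All_less_Suc2 using Cons by auto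
qed simp

text \<open>Edges and traps consist of two numbers each and are stored as two neighbouring records
  with the heads \<open>T\<close> and \<open>T + 1\<close>. Being neighbours is expressed by
  comparing positions, which a formula is able to do.\<close>

definition paired :: "entry set \<Rightarrow> nat \<Rightarrow> entry \<Rightarrow> entry \<Rightarrow> bool" where
  "paired D T z z' \<longleftrightarrow> tag z = T \<and> tag z' = T + 1 \<and> pos z < pos z' \<and>
     \<not> (\<exists>z''\<in>D. pos z < pos z'' \<and> pos z'' < pos z')"

definition pairs :: "nat \<Rightarrow> (nat \<times> nat list) list \<Rightarrow> ((nat \<times> nat list) \<times> nat \<times> nat list) list" where
  "pairs T recs = filter (\<lambda>(u, v). fst u = T \<and> fst v = T + 1) (zip recs (tl recs))"

abbreviation "pair_nums \<equiv> map_prod (val 0 \<circ> snd) (val 0 \<circ> snd)"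

lemma pairs_skip: "(\<And>u. u \<in> set us \<Longrightarrow> fst u \<noteq> T) \<Longrightarrow> pairs T (us @ recs) = pairs T recs"
proof (induction us)
  case (Cons u us)
  then show ?case by (cases "us @ recs") (auto simp: pairs_def)
qed simp

lemma pairs_block:
  "pairs T (concat (map (\<lambda>p. [(T, a p), (T + 1, b p)]) ps) @ recs) =
    map (\<lambda>p. ((T, a p), (T + 1, b p))) ps @ pairs T recs"
proof (induction ps)
  case (Cons p ps)
  let ?us = "concat (map (\<lambda>p. [(T, a p), (T + 1, b p)]) ps) @ recs"
  have "pairs T ((T, a p) # (T + 1, b p) # ?us) = ((T, a p), (T + 1, b p)) # pairs T ([(T + 1, b p)] @ ?us)"
    by (simp add: pairs_def)
  also have "pairs T ([(T + 1, b p)] @ ?us) = pairs T ?us"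
    by (rule pairs_skip) simp
  finally show ?case using Cons by simp
qed simp

context
  fixes recs :: "(nat \<times> nat list) list" and D :: "entry set"
  assumes wf: "wf_recs recs" and D: "D = db (flat recs)"
begin

lemma ball_db: "(\<forall>z\<in>D. Q z) \<longleftrightarrow> (\<forall>i<length recs. Q (rec_entry recs i))"
  unfolding D db_flat[OF wf] by auto

lemma bex_db: "(\<exists>z\<in>D. Q z) \<longleftrightarrow> (\<exists>i<length recs. Q (rec_entry recs i))"
  unfolding D db_flat[OF wf] by auto

lemma entry_sel: "tag (rec_entry recs i) = fst (recs ! i)" "num j (rec_entry recs i) = val j (snd (recs ! i))"
  "pos (rec_entry recs i) = rec_pos recs i"
  by (simp_all add: rec_entry_def tag_def num_def pos_def)

lemma bex_db_rec:
  "(\<exists>z\<in>D. Q (tag z) (\<lambda>j. num j z)) \<longleftrightarrow> (\<exists>r\<in>set recs. Q (fst r) (\<lambda>j. val j (snd r)))"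
  unfolding bex_db entry_sel set_conv_nth by blast

lemma distinct_db:
  "(\<forall>z\<in>D. \<forall>z'\<in>D. tag z = T \<longrightarrow> tag z' = T \<longrightarrow> pos z < pos z' \<longrightarrow> num 0 z \<noteq> num 0 z') \<longleftrightarrow>
    distinct (map (val 0 \<circ> snd) (filter (\<lambda>r. fst r = T) recs))"
  unfolding ball_db entry_sel distinct_map_filter_iff using rec_pos_less by auto

lemma paired_db:
  assumes "i < length recs" "j < length recs"
  shows "paired D T (rec_entry recs i) (rec_entry recs j) \<longleftrightarrow>
    j = Suc i \<and> fst (recs ! i) = T \<and> fst (recs ! j) = T + 1"
proof -
  have "(rec_pos recs i < rec_pos recs j \<and>
      \<not> (\<exists>l<length recs. rec_pos recs i < rec_pos recs l \<and> rec_pos recs l < rec_pos recs j)) \<longleftrightarrow>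
    i < j \<and> \<not> (\<exists>l<length recs. i < l \<and> l < j)"
    using rec_pos_less assms by auto
  also have "\<dots> \<longleftrightarrow> j = Suc i" using assms by (auto intro: ccontr)
  finally show ?thesis unfolding paired_def bex_db entry_sel by blast
qed

lemma nth_zip_tl: "i < length (zip recs (tl recs)) \<Longrightarrow> zip recs (tl recs) ! i = (recs ! i, recs ! Suc i)"
  by (simp add: nth_tl)

lemma bex_paired:
  "(\<exists>z\<in>D. \<exists>z'\<in>D. paired D T z z' \<and> Q (num 0 z) (num 0 z')) \<longleftrightarrow>
    (\<exists>(a, b)\<in>set (map pair_nums (pairs T recs)). Q a b)"
proof -
  have "(\<exists>z\<in>D. \<exists>z'\<in>D. paired D T z z' \<and> Q (num 0 z) (num 0 z')) \<longleftrightarrow>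
    (\<exists>i. Suc i < length recs \<and> fst (recs ! i) = T \<and> fst (recs ! Suc i) = T + 1 \<and>
       Q (val 0 (snd (recs ! i))) (val 0 (snd (recs ! Suc i))))"
    (is "?L \<longleftrightarrow> ?R")
  proof
    assume ?L
    then show ?R unfolding bex_db entry_sel using paired_db by auto
  next
    assume ?R
    then obtain i where i: "Suc i < length recs" "fst (recs ! i) = T" "fst (recs ! Suc i) = T + 1"
       "Q (val 0 (snd (recs ! i))) (val 0 (snd (recs ! Suc i)))" by blast
    with paired_db[of i "Suc i" T] show ?L
      unfolding bex_db entry_sel by (intro exI[of _ i] conjI exI[of _ "Suc i"]) auto
  qed
  also have "\<dots> \<longleftrightarrow> (\<exists>(a, b)\<in>set (map pair_nums (pairs T recs)). Q a b)"
  proof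
    assume "\<exists>i. Suc i < length recs \<and> fst (recs ! i) = T \<and> fst (recs ! Suc i) = T + 1 \<and>
       Q (val 0 (snd (recs ! i))) (val 0 (snd (recs ! Suc i)))"
    then obtain i where i: "Suc i < length recs" "fst (recs ! i) = T" "fst (recs ! Suc i) = T + 1"
       "Q (val 0 (snd (recs ! i))) (val 0 (snd (recs ! Suc i)))" by blast
    have len: "i < length (zip recs (tl recs))" using i(1) by simp
    from nth_mem[OF len] nth_zip_tl[OF len] i have "(recs ! i, recs ! Suc i) \<in> set (pairs T recs)"
      by (simp add: pairs_def)
    with i(4) show "\<exists>(a, b)\<in>set (map pair_nums (pairs T recs)). Q a b" by force
  next
    assume "\<exists>(a, b)\<in>set (map pair_nums (pairs T recs)). Q a b"
    then obtain u v where uv: "(u, v) \<in> set (zip recs (tl recs))" "fst u = T" "fst v = T + 1"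
      "Q (val 0 (snd u)) (val 0 (snd v))" by (auto simp: pairs_def)
    then obtain i where i: "i < length (zip recs (tl recs))" "(u, v) = zip recs (tl recs) ! i"
      by (metis in_set_conv_nth)
    with nth_zip_tl[OF i(1)] uv show "\<exists>i. Suc i < length recs \<and> fst (recs ! i) = T \<and>
        fst (recs ! Suc i) = T + 1 \<and> Q (val 0 (snd (recs ! i))) (val 0 (snd (recs ! Suc i)))"
      by (intro exI[of _ i]) auto
  qed
  finally show ?thesis .
qed

text \<open>\<open>f\<close> is left open because for edges the repetitions that matter are those of
  unordered pairs.\<close>

lemma distinct_paired:
  "(\<forall>z\<in>D. \<forall>z'\<in>D. \<forall>y\<in>D. \<forall>y'\<in>D. paired D T z z' \<longrightarrow> paired D T y y' \<longrightarrow> pos z < pos y \<longrightarrow>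
      f (num 0 z, num 0 z') \<noteq> f (num 0 y, num 0 y')) \<longleftrightarrow>
    distinct (map f (map pair_nums (pairs T recs)))"
proof -
  let ?zs = "zip recs (tl recs)"
  have "(\<forall>z\<in>D. \<forall>z'\<in>D. \<forall>y\<in>D. \<forall>y'\<in>D. paired D T z z' \<longrightarrow> paired D T y y' \<longrightarrow> pos z < pos y \<longrightarrow>
      f (num 0 z, num 0 z') \<noteq> f (num 0 y, num 0 y')) \<longleftrightarrow>
    (\<forall>i j. Suc i < length recs \<longrightarrow> Suc j < length recs \<longrightarrow> i < j \<longrightarrow>
       fst (recs ! i) = T \<and> fst (recs ! Suc i) = T + 1 \<longrightarrow> fst (recs ! j) = T \<and> fst (recs ! Suc j) = T + 1 \<longrightarrow>
       f (val 0 (snd (recs ! i)), val 0 (snd (recs ! Suc i))) \<noteq>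
       f (val 0 (snd (recs ! j)), val 0 (snd (recs ! Suc j))))"
    (is "?L \<longleftrightarrow> ?R")
  proof
    assume L: ?L
    show ?R
    proof (intro allI impI)
      fix i j
      assume "Suc i < length recs" "Suc j < length recs" "i < j"
        "fst (recs ! i) = T \<and> fst (recs ! Suc i) = T + 1" "fst (recs ! j) = T \<and> fst (recs ! Suc j) = T + 1"
      with L[unfolded ball_db entry_sel, rule_format, of i "Suc i" j "Suc j"]
        paired_db[of i "Suc i" T] paired_db[of j "Suc j" T] rec_pos_less[of i recs j]
      show "f (val 0 (snd (recs ! i)), val 0 (snd (recs ! Suc i))) \<noteq>
          f (val 0 (snd (recs ! j)), val 0 (snd (recs ! Suc j)))" by simp
    qed
  next
    assume ?R
    then have R: "f (val 0 (snd (recs ! i)), val 0 (snd (recs ! Suc i))) \<noteq>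
        f (val 0 (snd (recs ! j)), val 0 (snd (recs ! Suc j)))"
      if "Suc i < length recs" "Suc j < length recs" "i < j" "fst (recs ! i) = T"
        "fst (recs ! Suc i) = T + 1" "fst (recs ! j) = T" "fst (recs ! Suc j) = T + 1" for i j
      using that by blast
    show ?L
      unfolding ball_db entry_sel
    proof (intro allI impI)
      fix i i' j j'
      assume lt: "i < length recs" "i' < length recs" "j < length recs" "j' < length recs"
        and "paired D T (rec_entry recs i) (rec_entry recs i')"
          "paired D T (rec_entry recs j) (rec_entry recs j')" "rec_pos recs i < rec_pos recs j"
      then show "f (val 0 (snd (recs ! i)), val 0 (snd (recs ! i'))) \<noteq>
          f (val 0 (snd (recs ! j)), val 0 (snd (recs ! j')))"
        using R[of i j] unfolding paired_db[OF lt(1,2)] paired_db[OF lt(3,4)] rec_pos_less[OF lt(1,3)]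
        by auto
    qed
  qed
  also have "\<dots> \<longleftrightarrow> (\<forall>i<length ?zs. \<forall>j<length ?zs. i < j \<longrightarrow>
       (\<lambda>(u, v). fst u = T \<and> fst v = T + 1) (?zs ! i) \<longrightarrow> (\<lambda>(u, v). fst u = T \<and> fst v = T + 1) (?zs ! j) \<longrightarrow>
       (f \<circ> pair_nums) (?zs ! i) \<noteq> (f \<circ> pair_nums) (?zs ! j))"
    using nth_zip_tl by (auto simp: less_diff_conv)
  also have "\<dots> \<longleftrightarrow> distinct (map f (map pair_nums (pairs T recs)))"
    unfolding distinct_map_filter_iff[symmetric] pairs_def map_map ..
  finally show ?thesis .
qed

end

text \<open>A certificate is an arbitrary word and may begin with digits that follow no head of its
  own; these are split off as \<open>ds\<close>.\<close>

lemma flat_decompose: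
  assumes "\<forall>s\<in>set u. is_digit s \<or> is_head s"
  obtains ds recs where "u = ds @ flat recs" "\<forall>s\<in>set ds. is_digit s" "wf_recs recs"
    "fst ` set recs \<subseteq> set u"
proof -
  have "\<exists>ds recs. u = ds @ flat recs \<and> (\<forall>s\<in>set ds. is_digit s) \<and> wf_recs recs \<and> fst ` set recs \<subseteq> set u"
    using assms
  proof (induction u)
    case (Cons s u)
    then obtain ds recs where IH: "u = ds @ flat recs" "\<forall>s\<in>set ds. is_digit s" "wf_recs recs"
      "fst ` set recs \<subseteq> set u" by auto
    show ?case
    proof (cases "is_digit s")
      case True
      with IH show ?thesis by (intro exI[of _ "s # ds"] exI[of _ recs]) auto
    next
      case False
      with IH Cons.prems show ?thesis by (intro exI[of _ "[]"] exI[of _ "(s, ds) # recs"]) auto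
    qed
  qed (auto intro: exI[of _ "[]"])
  then show ?thesis using that by blast
qed

lemma set_cert_tokens:
  "set (transduce parse (Cert bs) (map bit_code y)) \<subseteq> {8..<24}"
proof (induction y arbitrary: bs)
  case (Cons b y)
  have "0 < decode cs \<Longrightarrow> 8 \<le> decode cs" for cs
    by (cases cs rule: decode.cases) (auto simp: digit_def)
  with Cons decode_less show ?case by auto
qed simp

lemma val_digits: "val 0 (digits n) = n"
proof (induction n rule: less_induct)
  case (less n)
  show ?case
  proof (cases "n = 0")
    case False
    then have "digits n = digit (odd n) False False # digits (n div 2)"
      by (simp add: digits_def bits.simps[of n])
    moreover have "bit (digit b False False) 0 = b" for b by (simp add: digit_def bit_0)
    ultimately show ?thesis using False less[of "n div 2"] digit_less[of "odd n" False False]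
      by (simp add: is_digit_def)
  qed (simp add: digits_def bits.simps)
qed

lemma val_digits_0: "val 1 (digits n) = 0" "val 2 (digits n) = 0"
proof -
  have b: "\<not> bit (digit b False False) (Suc 0)" "\<not> bit (digit b False False) 2" for b
    by (cases b; simp add: digit_def bit_iff_odd)+
  have "val 1 (map (\<lambda>b. digit b False False) bs) = 0 \<and> val 2 (map (\<lambda>b. digit b False False) bs) = 0" for bs
    using b by (induction bs) auto
  then show "val 1 (digits n) = 0" "val 2 (digits n) = 0" by (auto simp: digits_def)
qed

lemma digits_digit: "\<forall>s\<in>set (digits n). is_digit s"
  by (auto simp: digits_def is_digit_def digit_less)

section \<open>The database of an instance together with arbitrary certificate records\<close>

definition instance_recs ::
  "nat list \<Rightarrow> nat list \<Rightarrow> (nat \<times> nat) list \<Rightarrow> nat \<Rightarrow> nat \<Rightarrow> (nat \<times> nat) list \<Rightarrow> nat \<Rightarrow> (nat \<times> nat list) list" where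
  "instance_recs as vs es s t rs k =
    map (\<lambda>n. (asset_tag, digits n)) as @ map (\<lambda>n. (vertex_tag, digits n)) vs @
    concat (map (\<lambda>p. [(edge_tag, digits (fst p)), (edge_tag + 1, digits (snd p))]) es) @
    [(source_tag, digits s), (target_tag, digits t)] @
    concat (map (\<lambda>p. [(trap_tag, digits (fst p)), (trap_tag + 1, digits (snd p))]) rs) @
    [(goal_tag, digits k)]"

lemma flat_maps:
  "flat (map (\<lambda>n. (h, d n)) ns) = concat (map (\<lambda>n. h # d n) ns)"
  "flat (concat (map g ps)) = concat (map (\<lambda>p. flat (g p)) ps)"
  by (induction ns, simp_all, induction ps, simp_all)

lemma flat_instance_recs:
  "tokens (List asset_tag) (encoding as vs es s t rs k) y =
    flat (instance_recs as vs es s t rs k) @ cert_tag # transduce parse (Cert []) (map bit_code y)"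
  unfolding tokens_encoding instance_recs_def
  by (simp add: flat_maps)

lemma wf_instance_recs: "wf_recs (instance_recs as vs es s t rs k)"
  using digits_digit by (auto simp: instance_recs_def wf_recs_def is_head_def)

text \<open>What has to be known about the instance part of a database in order to interpret the
  formula, whatever certificate records are present. The records of the instance carry one number
  each, so their tracks 1 and 2 read 0.\<close>

locale instance_db =
  fixes D :: "entry set" and as vs :: "nat list" and es :: "(nat \<times> nat) list" and s t :: nat
    and rs :: "(nat \<times> nat) list" and k :: nat
  assumes single: "\<And>Q. (\<exists>z\<in>D. tag z = asset_tag \<and> Q (num 0 z) (num 1 z) (num 2 z)) \<longleftrightarrow> (\<exists>a\<in>set as. Q a 0 0)"
      "\<And>Q. (\<exists>z\<in>D. tag z = vertex_tag \<and> Q (num 0 z) (num 1 z) (num 2 z)) \<longleftrightarrow> (\<exists>v\<in>set vs. Q v 0 0)"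
      "\<And>Q. (\<exists>z\<in>D. tag z = source_tag \<and> Q (num 0 z) (num 1 z) (num 2 z)) \<longleftrightarrow> Q s 0 0"
      "\<And>Q. (\<exists>z\<in>D. tag z = target_tag \<and> Q (num 0 z) (num 1 z) (num 2 z)) \<longleftrightarrow> Q t 0 0"
      "\<And>Q. (\<exists>z\<in>D. tag z = goal_tag \<and> Q (num 0 z) (num 1 z) (num 2 z)) \<longleftrightarrow> Q k 0 0"
      "\<And>Q. (\<exists>z\<in>D. tag z = trap_tag \<and> Q (num 0 z) (num 1 z) (num 2 z)) \<longleftrightarrow> (\<exists>p\<in>set rs. Q (fst p) 0 0)"
      "\<And>Q. (\<exists>z\<in>D. tag z = error_tag \<and> Q (num 0 z) (num 1 z) (num 2 z)) \<longleftrightarrow> False"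
    and pair: "\<And>Q. (\<exists>z\<in>D. \<exists>z'\<in>D. paired D edge_tag z z' \<and> Q (num 0 z) (num 0 z')) \<longleftrightarrow> (\<exists>(a, b)\<in>set es. Q a b)"
      "\<And>Q. (\<exists>z\<in>D. \<exists>z'\<in>D. paired D trap_tag z z' \<and> Q (num 0 z) (num 0 z')) \<longleftrightarrow> (\<exists>(a, b)\<in>set rs. Q a b)"
    and dist: "(\<forall>z\<in>D. \<forall>z'\<in>D. tag z = asset_tag \<longrightarrow> tag z' = asset_tag \<longrightarrow> pos z < pos z' \<longrightarrow> num 0 z \<noteq> num 0 z') \<longleftrightarrow> distinct as"
      "(\<forall>z\<in>D. \<forall>z'\<in>D. tag z = vertex_tag \<longrightarrow> tag z' = vertex_tag \<longrightarrow> pos z < pos z' \<longrightarrow> num 0 z \<noteq> num 0 z') \<longleftrightarrow> distinct vs"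
      "(\<forall>z\<in>D. \<forall>z'\<in>D. tag z = trap_tag \<longrightarrow> tag z' = trap_tag \<longrightarrow> pos z < pos z' \<longrightarrow> num 0 z \<noteq> num 0 z') \<longleftrightarrow> distinct (map fst rs)"
      "(\<forall>z\<in>D. \<forall>z'\<in>D. \<forall>y\<in>D. \<forall>y'\<in>D. paired D edge_tag z z' \<longrightarrow> paired D edge_tag y y' \<longrightarrow> pos z < pos y \<longrightarrow>
          {num 0 z, num 0 z'} \<noteq> {num 0 y, num 0 y'}) \<longleftrightarrow> distinct (map (\<lambda>(u, v). {u, v}) es)"

lemma filter_singles:
  "filter (\<lambda>r. fst r = T) (map (\<lambda>n. (T', f n)) ns) = (if T = T' then map (\<lambda>n. (T', f n)) ns else [])"
  by (induction ns) auto

lemma filter_doubles: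
  "filter (\<lambda>r. fst r = T) (concat (map (\<lambda>p. [(T1, f p), (T2, g p)]) ps)) =
    concat (map (\<lambda>p. (if T = T1 then [(T1, f p)] else []) @ (if T = T2 then [(T2, g p)] else [])) ps)"
  by (induction ps) auto

lemma concat_map_Nil: "concat (map (\<lambda>x. []) xs) = []"
  by (induction xs) auto

lemma filter_none: "(\<And>x. x \<in> set xs \<Longrightarrow> \<not> P x) \<Longrightarrow> filter P xs = []"
  by (simp add: filter_empty_conv)

text \<open>Apart from the record of the separator, the added records have heads below
  \<open>asset_tag\<close>, so they are invisible to all statements about heads of the
  instance.\<close>

lemma instance_db:
  assumes "recs = instance_recs as vs es s t rs k @ yrecs" "wf_recs yrecs"
    "\<And>r. r \<in> set yrecs \<Longrightarrow> fst r = cert_tag \<or> fst r < asset_tag"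
  shows "instance_db (db (flat recs)) as vs es s t rs k"
proof -
  let ?D = "db (flat recs)" and ?x = "instance_recs as vs es s t rs k"
  have wf: "wf_recs recs" using assms wf_instance_recs by simp
  note bex = bex_db_rec[OF wf refl]
  have y: "fst r \<noteq> T" if "r \<in> set yrecs" "asset_tag \<le> T" "T < cert_tag" for r T
    using assms(3)[OF that(1)] that(2,3) by auto
  have single: "(\<exists>z\<in>?D. tag z = T \<and> Q (num 0 z) (num 1 z) (num 2 z)) \<longleftrightarrow>
      (\<exists>r\<in>set ?x. fst r = T \<and> Q (val 0 (snd r)) (val 1 (snd r)) (val 2 (snd r)))"
    if "asset_tag \<le> T" "T < cert_tag" for T Q
    using bex[of "\<lambda>u f. u = T \<and> Q (f 0) (f 1) (f 2)"] y that unfolding assms(1) by auto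
  have filter: "filter (\<lambda>r. fst r = T) recs = filter (\<lambda>r. fst r = T) ?x"
    if "asset_tag \<le> T" "T < cert_tag" for T
    using y that unfolding assms(1) by (simp add: filter_none)
  have skip: "pairs T yrecs = []" if "asset_tag \<le> T" "T < cert_tag" for T
    using pairs_skip[of yrecs T "[]"] y that by (auto simp: pairs_def)
  \<comment> \<open>The blocks of the word are peeled off from the left; blocks without the head of
    an edge contribute no pair.\<close>
  have p1: "map pair_nums (pairs edge_tag recs) = es"
    unfolding assms(1) instance_recs_def append_assoc
    apply (subst pairs_skip, force)
    apply (subst pairs_skip, force)
    apply (subst pairs_block)
    apply (subst pairs_skip, force)
    apply (subst pairs_skip, force)
    apply (subst pairs_skip, force)
    by (simp add: skip comp_def val_digits)
  have p2: "map pair_nums (pairs trap_tag recs) = rs"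
    unfolding assms(1) instance_recs_def append_assoc
    apply (subst pairs_skip, force)
    apply (subst pairs_skip, force)
    apply (subst pairs_skip, force)
    apply (subst pairs_skip, force)
    apply (subst pairs_block)
    apply (subst pairs_skip, force)
    by (simp add: skip comp_def val_digits)
  show ?thesis
  proof
    show "(\<exists>z\<in>?D. tag z = asset_tag \<and> Q (num 0 z) (num 1 z) (num 2 z)) \<longleftrightarrow> (\<exists>a\<in>set as. Q a 0 0)"
      "(\<exists>z\<in>?D. tag z = vertex_tag \<and> Q (num 0 z) (num 1 z) (num 2 z)) \<longleftrightarrow> (\<exists>v\<in>set vs. Q v 0 0)"
      "(\<exists>z\<in>?D. tag z = source_tag \<and> Q (num 0 z) (num 1 z) (num 2 z)) \<longleftrightarrow> Q s 0 0"
      "(\<exists>z\<in>?D. tag z = target_tag \<and> Q (num 0 z) (num 1 z) (num 2 z)) \<longleftrightarrow> Q t 0 0"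
      "(\<exists>z\<in>?D. tag z = goal_tag \<and> Q (num 0 z) (num 1 z) (num 2 z)) \<longleftrightarrow> Q k 0 0"
      "(\<exists>z\<in>?D. tag z = trap_tag \<and> Q (num 0 z) (num 1 z) (num 2 z)) \<longleftrightarrow> (\<exists>p\<in>set rs. Q (fst p) 0 0)"
      "(\<exists>z\<in>?D. tag z = error_tag \<and> Q (num 0 z) (num 1 z) (num 2 z)) \<longleftrightarrow> False" for Q
      by (simp_all add: single[unfolded One_nat_def],
          auto simp: instance_recs_def val_digits val_digits_0[unfolded One_nat_def] bex_Un)
    show "(\<exists>z\<in>?D. \<exists>z'\<in>?D. paired ?D edge_tag z z' \<and> Q (num 0 z) (num 0 z')) \<longleftrightarrow> (\<exists>(a, b)\<in>set es. Q a b)"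
      "(\<exists>z\<in>?D. \<exists>z'\<in>?D. paired ?D trap_tag z z' \<and> Q (num 0 z) (num 0 z')) \<longleftrightarrow> (\<exists>(a, b)\<in>set rs. Q a b)" for Q
      unfolding bex_paired[OF wf refl] p1 p2 by auto
    show "(\<forall>z\<in>?D. \<forall>z'\<in>?D. tag z = asset_tag \<longrightarrow> tag z' = asset_tag \<longrightarrow> pos z < pos z' \<longrightarrow> num 0 z \<noteq> num 0 z') \<longleftrightarrow> distinct as"
      "(\<forall>z\<in>?D. \<forall>z'\<in>?D. tag z = vertex_tag \<longrightarrow> tag z' = vertex_tag \<longrightarrow> pos z < pos z' \<longrightarrow> num 0 z \<noteq> num 0 z') \<longleftrightarrow> distinct vs"
      "(\<forall>z\<in>?D. \<forall>z'\<in>?D. tag z = trap_tag \<longrightarrow> tag z' = trap_tag \<longrightarrow> pos z < pos z' \<longrightarrow> num 0 z \<noteq> num 0 z') \<longleftrightarrow> distinct (map fst rs)"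
      unfolding distinct_db[OF wf refl]
      by (simp_all add: filter instance_recs_def filter_singles filter_doubles comp_def val_digits map_concat concat_map_Nil)
    show "(\<forall>z\<in>?D. \<forall>z'\<in>?D. \<forall>y\<in>?D. \<forall>y'\<in>?D. paired ?D edge_tag z z' \<longrightarrow> paired ?D edge_tag y y' \<longrightarrow> pos z < pos y \<longrightarrow>
          {num 0 z, num 0 z'} \<noteq> {num 0 y, num 0 y'}) \<longleftrightarrow> distinct (map (\<lambda>(u, v). {u, v}) es)"
      using distinct_paired[OF wf refl, of edge_tag "\<lambda>(u, v). {u, v}"] unfolding p1 by simp
  qed
qed

section \<open>Plans as runs of a transition system\<close>

text \<open>The state consists of the locations of the assets and the number of steps until each trap is
  active again.\<close>

definition occupied :: "('a, 'v) routing_instance \<Rightarrow> ('a \<Rightarrow> 'v option) \<Rightarrow> 'v \<Rightarrow> bool" where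
  "occupied I X v \<longleftrightarrow> (\<exists>a\<in>assets I. X a = Some v)"

definition separated :: "('a, 'v) routing_instance \<Rightarrow> ('a \<Rightarrow> 'v option) \<Rightarrow> bool" where
  "separated I X \<longleftrightarrow> (\<forall>a\<in>assets I. \<forall>a'\<in>assets I. a \<noteq> a' \<longrightarrow> X a = X a' \<longrightarrow>
     X a \<in> {Some (source I), Some (target I), None})"

definition asset_move :: "('a, 'v) routing_instance \<Rightarrow> ('v \<Rightarrow> nat) \<Rightarrow> 'v option \<Rightarrow> 'v option \<Rightarrow> bool" where
  "asset_move I \<beta> x x' \<longleftrightarrow>
     (if finished I x then x' = x
      else if \<exists>r\<in>traps I. x = Some r \<and> \<beta> r = 0 then x' = None
      else x' = x \<or> (\<exists>u v. x = Some u \<and> x' = Some v \<and> {u, v} \<in> edges I \<and> v \<noteq> source I))"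

definition move :: "('a, 'v) routing_instance \<Rightarrow> ('a \<Rightarrow> 'v option) \<Rightarrow> ('v \<Rightarrow> nat) \<Rightarrow> ('a \<Rightarrow> 'v option) \<Rightarrow> bool" where
  "move I X \<beta> X' \<longleftrightarrow> separated I X \<and> separated I X' \<and>
     (\<forall>a\<in>assets I. asset_move I \<beta> (X a) (X' a)) \<and> (\<exists>a\<in>assets I. X' a \<noteq> X a)"

text \<open>In an ordinary step \<open>d\<close> is 1. A trap triggered at time j then has its full
  reload time as timer at time j + 1 and is active again when this has run down to 0, so it is
  inactive at exactly \<open>reload I r\<close> times. Long steps of another duration do not trigger
  traps, since the traps occupied in them have to be waiting.\<close>

definition countdown :: "('a, 'v) routing_instance \<Rightarrow> nat \<Rightarrow> ('a \<Rightarrow> 'v option) \<Rightarrow> ('v \<Rightarrow> nat) \<Rightarrow> ('v \<Rightarrow> nat) \<Rightarrow> bool" where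
  "countdown I d X \<beta> \<beta>' \<longleftrightarrow>
     (\<forall>r\<in>traps I. \<beta>' r = (if \<beta> r = 0 \<and> occupied I X r then reload I r else \<beta> r - d))"

definition final :: "('a, 'v) routing_instance \<Rightarrow> ('a \<Rightarrow> 'v option) \<Rightarrow> bool" where
  "final I X \<longleftrightarrow> (\<forall>a\<in>assets I. finished I (X a)) \<and> goal I \<le> card {a \<in> assets I. X a = Some (target I)}"

fun wins :: "('a, 'v) routing_instance \<Rightarrow> nat \<Rightarrow> ('a \<Rightarrow> 'v option) \<Rightarrow> ('v \<Rightarrow> nat) \<Rightarrow> bool" where
  "wins I 0 X \<beta> \<longleftrightarrow> final I X"
| "wins I (Suc n) X \<beta> \<longleftrightarrow> (\<exists>X' \<beta>'. move I X \<beta> X' \<and> countdown I 1 X \<beta> \<beta>' \<and> wins I n X' \<beta>')"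

section \<open>Permuting the assets\<close>

definition relabels :: "('a, 'v) routing_instance \<Rightarrow> ('a \<Rightarrow> 'a) \<Rightarrow> ('a \<Rightarrow> 'v option) \<Rightarrow> ('a \<Rightarrow> 'v option) \<Rightarrow> bool" where
  "relabels I \<pi> X Y \<longleftrightarrow> bij_betw \<pi> (assets I) (assets I) \<and> (\<forall>a\<in>assets I. Y a = X (\<pi> a))"

lemma relabelsD:
  assumes "relabels I \<pi> X Y"
  shows "a \<in> assets I \<Longrightarrow> \<pi> a \<in> assets I" "a \<in> assets I \<Longrightarrow> Y a = X (\<pi> a)"
    "a \<in> assets I \<Longrightarrow> \<exists>b\<in>assets I. \<pi> b = a"
    "a \<in> assets I \<Longrightarrow> b \<in> assets I \<Longrightarrow> \<pi> a = \<pi> b \<Longrightarrow> a = b"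
  using assms unfolding relabels_def bij_betw_def inj_on_def by (auto, metis image_iff)

lemma occupied_relabel: "relabels I \<pi> X Y \<Longrightarrow> occupied I Y v \<longleftrightarrow> occupied I X v"
  unfolding occupied_def using relabelsD(1,2) relabelsD(3)[of I \<pi> X Y] by (metis (no_types))

lemma separated_relabel:
  assumes "relabels I \<pi> X Y" "separated I X"
  shows "separated I Y"
  unfolding separated_def
proof (intro ballI impI)
  fix a a' assume a: "a \<in> assets I" "a' \<in> assets I" "a \<noteq> a'" "Y a = Y a'"
  have "\<pi> a \<noteq> \<pi> a'" using relabelsD(4)[OF assms(1) a(1,2)] a(3) by blast
  with assms(2) a relabelsD(1,2)[OF assms(1) a(1)] relabelsD(1,2)[OF assms(1) a(2)]
  show "Y a \<in> {Some (source I), Some (target I), None}" by (simp add: separated_def)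
qed

lemma move_relabel:
  assumes "move I X \<beta> X'" "relabels I \<pi> X Y" "\<And>r. r \<in> traps I \<Longrightarrow> \<gamma> r = \<beta> r"
  shows "move I Y \<gamma> (X' \<circ> \<pi>)"
proof -
  have 2: "relabels I \<pi> X' (X' \<circ> \<pi>)" using assms(2) by (simp add: relabels_def)
  have am: "asset_move I \<gamma> x x' = asset_move I \<beta> x x'" for x x'
    using assms(3) by (auto simp: asset_move_def)
  have "\<exists>a\<in>assets I. X' a \<noteq> X a" using assms(1) by (simp add: move_def)
  then obtain a b where "b \<in> assets I" "\<pi> b = a" "X' a \<noteq> X a" using relabelsD(3)[OF assms(2)] by blast
  then have "\<exists>b\<in>assets I. (X' \<circ> \<pi>) b \<noteq> Y b" using relabelsD(2)[OF assms(2)] by (intro bexI[of _ b]) auto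
  moreover have "asset_move I \<gamma> (Y a) ((X' \<circ> \<pi>) a)" if "a \<in> assets I" for a
    using assms(1) relabelsD(1,2)[OF assms(2) that] unfolding am move_def by simp
  ultimately show ?thesis
    using assms(1) separated_relabel[OF assms(2)] separated_relabel[OF 2] unfolding move_def by blast
qed

lemma countdown_relabel:
  assumes "countdown I d X \<beta> \<beta>'" "relabels I \<pi> X Y" "\<And>r. r \<in> traps I \<Longrightarrow> \<gamma> r = \<beta> r"
  shows "countdown I d Y \<gamma> \<beta>'"
  using assms occupied_relabel[OF assms(2)] by (simp add: countdown_def)

lemma final_relabel:
  assumes "final I X" "relabels I \<pi> X Y"
  shows "final I Y"
proof -
  have "bij_betw \<pi> {a \<in> assets I. Y a = Some (target I)} {a \<in> assets I. X a = Some (target I)}"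
    unfolding bij_betw_def
  proof
    show "inj_on \<pi> {a \<in> assets I. Y a = Some (target I)}"
      using relabelsD(4)[OF assms(2)] by (auto simp: inj_on_def)
    show "\<pi> ` {a \<in> assets I. Y a = Some (target I)} = {a \<in> assets I. X a = Some (target I)}"
    proof (intro equalityI subsetI)
      fix a assume a: "a \<in> {a \<in> assets I. X a = Some (target I)}"
      then obtain b where "b \<in> assets I" "\<pi> b = a" using relabelsD(3)[OF assms(2)] by blast
      with a show "a \<in> \<pi> ` {a \<in> assets I. Y a = Some (target I)}" using relabelsD(2)[OF assms(2)] by force
    qed (use relabelsD(1,2)[OF assms(2)] in auto)
  qed
  from bij_betw_same_card[OF this] assms(1) relabelsD(1,2)[OF assms(2)] show ?thesis
    by (simp add: final_def)
qed

text \<open>The rules do not distinguish assets, so after a permutation of the assets a run is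
  continued by permuting the rest of it. This makes up for the identities that are lost when assets
  are treated as pebbles.\<close>

lemma wins_relabel:
  assumes "wins I n X \<beta>" "relabels I \<pi> X Y" "\<And>r. r \<in> traps I \<Longrightarrow> \<gamma> r = \<beta> r"
  shows "wins I n Y \<gamma>"
  using assms
proof (induction n arbitrary: X \<beta> Y \<gamma>)
  case (Suc n)
  then obtain X' \<beta>' where *: "move I X \<beta> X'" "countdown I 1 X \<beta> \<beta>'" "wins I n X' \<beta>'" by auto
  have "relabels I \<pi> X' (X' \<circ> \<pi>)" using Suc.prems(2) by (simp add: relabels_def)
  from Suc.IH[OF *(3) this refl] have "wins I n (X' \<circ> \<pi>) \<beta>'" .
  moreover have "move I Y \<gamma> (X' \<circ> \<pi>)" by (rule move_relabel[OF *(1)]) (use Suc.prems in auto)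
  moreover have "countdown I 1 Y \<gamma> \<beta>'" by (rule countdown_relabel[OF *(2)]) (use Suc.prems in auto)
  ultimately show ?case by auto
qed (use final_relabel in auto)

lemma relabels_id: "(\<And>a. a \<in> assets I \<Longrightarrow> Y a = X a) \<Longrightarrow> relabels I id X Y"
  by (simp add: relabels_def)

section \<open>Timers, and the passage between plans and winning runs\<close>

primrec timer :: "('a, 'v) routing_instance \<Rightarrow> ('a, 'v) plan \<Rightarrow> nat \<Rightarrow> 'v \<Rightarrow> nat" where
  "timer I \<rho> 0 r = 0"
| "timer I \<rho> (Suc j) r = (if timer I \<rho> j r = 0 \<and> occupied I (\<lambda>a. \<rho> a j) r then reload I r else timer I \<rho> j r - 1)"

text \<open>The mutually recursive definition looks back over a window of past times; the timer
  summarizes this window by the number of steps until the trap is active again, so that the next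
  state depends on the present one alone.\<close>

lemma active_iff_timer: "active I \<rho> r j \<longleftrightarrow> timer I \<rho> j r = 0"
proof (induction j rule: less_induct)
  case (less j)
  have trig: "triggered I \<rho> r i \<longleftrightarrow> timer I \<rho> i r = 0 \<and> occupied I (\<lambda>a. \<rho> a i) r" if "i < j" for i
    using less[OF that] by (simp add: triggered.simps occupied_def)
  \<comment> \<open>At time \<open>m\<close> the timer is the maximum of
    \<open>i + reload I r + 1 - m\<close> over the times \<open>i < m\<close> at which the trap was
    triggered, or 0 if there are none. The number is positive iff \<open>i\<close> lies in the
    window of the definition.\<close>
  have inv: "(\<forall>i<m. triggered I \<rho> r i \<longrightarrow> i + reload I r + 1 - m \<le> timer I \<rho> m r) \<and>
      (0 < timer I \<rho> m r \<longrightarrow> (\<exists>i<m. triggered I \<rho> r i \<and> timer I \<rho> m r = i + reload I r + 1 - m))"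
    if "m \<le> j" for m
    using that
  proof (induction m)
    case (Suc m)
    then have IH: "\<And>i. i < m \<Longrightarrow> triggered I \<rho> r i \<Longrightarrow> i + reload I r + 1 - m \<le> timer I \<rho> m r"
      "0 < timer I \<rho> m r \<Longrightarrow> \<exists>i<m. triggered I \<rho> r i \<and> timer I \<rho> m r = i + reload I r + 1 - m"
      by auto
    show ?case
    proof (cases "triggered I \<rho> r m")
      case True
      then have t: "timer I \<rho> (Suc m) r = reload I r" using trig[of m] Suc.prems by simp
      have "i + reload I r + 1 - Suc m \<le> reload I r" if "i < Suc m" for i using that by simp
      with True t show ?thesis by (auto intro!: exI[of _ m])
    next
      case False
      then have t: "timer I \<rho> (Suc m) r = timer I \<rho> m r - 1" using trig[of m] Suc.prems by auto
      have "i + reload I r + 1 - Suc m \<le> timer I \<rho> m r - 1" if "i < Suc m" "triggered I \<rho> r i" for i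
      proof -
        have "i < m" using that False by (cases "i = m") auto
        from IH(1)[OF this that(2)] show ?thesis by simp
      qed
      moreover have "\<exists>i<Suc m. triggered I \<rho> r i \<and> timer I \<rho> m r - 1 = i + reload I r + 1 - Suc m"
        if pos: "0 < timer I \<rho> m r - 1"
      proof -
        have "0 < timer I \<rho> m r" using pos by simp
        from IH(2)[OF this] obtain i where "i < m" "triggered I \<rho> r i" "timer I \<rho> m r = i + reload I r + 1 - m"
          by blast
        then show ?thesis by (intro exI[of _ i]) simp
      qed
      ultimately show ?thesis unfolding t by blast
    qed
  qed simp
  show ?case
  proof
    assume act: "active I \<rho> r j"
    show "timer I \<rho> j r = 0"
    proof (rule ccontr)
      assume "timer I \<rho> j r \<noteq> 0"
      with inv[of j] obtain i where i: "i < j" "triggered I \<rho> r i" "timer I \<rho> j r = i + reload I r + 1 - j"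
        by auto
      then have "i \<in> {j - reload I r..<j}" using \<open>timer I \<rho> j r \<noteq> 0\<close> by auto
      with i(2) act show False by (subst (asm) active.simps) blast
    qed
  next
    assume t: "timer I \<rho> j r = 0"
    show "active I \<rho> r j"
    proof (rule ccontr)
      assume "\<not> active I \<rho> r j"
      then obtain i where "i \<in> {j - reload I r..<j}" "triggered I \<rho> r i" by (subst (asm) active.simps) blast
      then have "i < j" "triggered I \<rho> r i" "0 < i + reload I r + 1 - j" by auto
      with inv[of j] t show False by fastforce
    qed
  qed
qed

lemma valid_planD:
  assumes "valid_plan I \<rho>" "a \<in> assets I"
  shows "\<rho> a 0 = Some (source I)" "\<rho> a (Suc j) = Some (source I) \<Longrightarrow> \<rho> a j = Some (source I)"
    "finished I (\<rho> a j) \<Longrightarrow> \<rho> a (Suc j) = \<rho> a j"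
    "\<rho> a (Suc j) \<noteq> None \<Longrightarrow> \<rho> a (Suc j) = \<rho> a j \<or>
        (\<exists>u v. \<rho> a j = Some u \<and> \<rho> a (Suc j) = Some v \<and> {u, v} \<in> edges I)"
    "r \<in> traps I \<Longrightarrow> \<rho> a j = Some r \<Longrightarrow> active I \<rho> r j \<Longrightarrow> \<rho> a (Suc j) = None"
    "\<rho> a j \<noteq> None \<Longrightarrow> \<rho> a (Suc j) = None \<Longrightarrow> \<exists>r\<in>traps I. \<rho> a j = Some r \<and> active I \<rho> r j"
  subgoal using assms unfolding valid_plan_def by blast
  subgoal using assms unfolding valid_plan_def by (metis diff_Suc_1 zero_less_Suc)
  subgoal using assms unfolding valid_plan_def by (metis Suc_eq_plus1)
  subgoal using assms unfolding valid_plan_def by (metis diff_Suc_1 le_add1 plus_1_eq_Suc)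
  subgoal using assms unfolding valid_plan_def by (metis Suc_eq_plus1)
  subgoal using assms unfolding valid_plan_def by (metis Suc_eq_plus1)
  done

lemma plan_separated: "valid_plan I \<rho> \<Longrightarrow> separated I (\<lambda>a. \<rho> a j)"
  unfolding valid_plan_def separated_def by blast

lemma plan_asset_move:
  assumes "valid_plan I \<rho>" "a \<in> assets I"
  shows "asset_move I (timer I \<rho> j) (\<rho> a j) (\<rho> a (Suc j))"
proof (cases "finished I (\<rho> a j)")
  case True
  then show ?thesis using valid_planD(3)[OF assms] by (simp add: asset_move_def)
next
  case False
  show ?thesis
  proof (cases "\<exists>r\<in>traps I. \<rho> a j = Some r \<and> timer I \<rho> j r = 0")
    case True
    then show ?thesis using False valid_planD(5)[OF assms] by (auto simp: asset_move_def active_iff_timer)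
  next
    case not_killed: False
    have "\<rho> a j \<noteq> None" using False by (auto simp: finished_def)
    then have "\<rho> a (Suc j) \<noteq> None"
      using not_killed valid_planD(6)[OF assms, of j] unfolding active_iff_timer by metis
    from valid_planD(4)[OF assms this] have "\<rho> a (Suc j) = \<rho> a j \<or>
        (\<exists>u v. \<rho> a j = Some u \<and> \<rho> a (Suc j) = Some v \<and> {u, v} \<in> edges I \<and> v \<noteq> source I)"
      using valid_planD(2)[OF assms, of j] by auto
    then show ?thesis unfolding asset_move_def if_not_P[OF False] if_not_P[OF not_killed] .
  qed
qed

lemma plan_countdown: "countdown I 1 (\<lambda>a. \<rho> a j) (timer I \<rho> j) (timer I \<rho> (Suc j))"
  by (simp add: countdown_def)

lemma wins_of_plan:
  assumes inst: "routing_instance I" and yes: "yes_instance I"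
  shows "\<exists>n. wins I n (\<lambda>_. Some (source I)) (\<lambda>_. 0)"
proof -
  obtain \<rho> where \<rho>: "valid_plan I \<rho>" "goal I \<le> card {a \<in> assets I. survives I \<rho> a}"
    using yes by (auto simp: yes_instance_def)
  then obtain l where l: "is_length I \<rho> l" by (auto simp: valid_plan_def)
  have fin: "final I (\<lambda>a. \<rho> a l)"
    using l \<rho>(2) plan_length_eq[OF \<rho>(1) l] by (simp add: final_def is_length_def survives_def)
  have unfinished: "\<exists>a\<in>assets I. \<not> finished I (\<rho> a j)" if "j < l" for j
  proof -
    obtain a where a: "a \<in> assets I" "\<not> finished I (\<rho> a (l - 1))" using l by (auto simp: is_length_def)
    have "finished I (\<rho> a (j + d))" if "finished I (\<rho> a j)" for d
      using that valid_planD(3)[OF \<rho>(1) a(1)] by (induction d) auto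
    from this[of "l - 1 - j"] a that show ?thesis by auto
  qed
  have step: "move I (\<lambda>a. \<rho> a j) (timer I \<rho> j) (\<lambda>a. \<rho> a (Suc j))" if "\<exists>a\<in>assets I. \<rho> a (Suc j) \<noteq> \<rho> a j" for j
    using that plan_asset_move[OF \<rho>(1)] plan_separated[OF \<rho>(1)] by (simp add: move_def)
  have nontrivial: "\<exists>a\<in>assets I. \<rho> a (Suc j) \<noteq> \<rho> a j" if "1 \<le> j" "j < l" for j
    using \<rho>(1) unfinished[OF that(2)] that(1) unfolding valid_plan_def by (metis Suc_eq_plus1)
  have tail: "wins I d (\<lambda>a. \<rho> a (l - d)) (timer I \<rho> (l - d))" if "d \<le> l - 1" for d
    using that
  proof (induction d)
    case (Suc d)
    define j where "j = l - Suc d"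
    have j: "l - d = Suc j" "1 \<le> j" "j < l" using Suc.prems by (auto simp: j_def)
    from Suc step[OF nontrivial[OF j(2,3)]] plan_countdown[of I \<rho> j] show ?case
      unfolding j_def[symmetric] j(1) wins.simps by (meson Suc_leD)
  qed (use fin in simp)
  have l1: "1 \<le> l" using l by (simp add: is_length_def)
  then have tail1: "wins I (l - 1) (\<lambda>a. \<rho> a 1) (timer I \<rho> 1)" using tail[of "l - 1"] by simp
  have start: "relabels I id (\<lambda>a. \<rho> a 0) (\<lambda>_. Some (source I))"
    by (rule relabels_id) (use valid_planD(1)[OF \<rho>(1)] in simp)
  show ?thesis
  \<comment> \<open>Before its end a plan may be idle only between the times 0 and 1, and a run may
    not be idle at all. An idle first step is dropped: all assets are still at the source, which is
    not a trap, so the timers are still 0.\<close>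
  proof (cases "\<exists>a\<in>assets I. \<rho> a 1 \<noteq> \<rho> a 0")
    case True
    have "wins I (Suc (l - 1)) (\<lambda>a. \<rho> a 0) (timer I \<rho> 0)"
      using step[of 0] True plan_countdown[of I \<rho> 0] tail1 by auto
    from wins_relabel[OF this start, of "\<lambda>_. 0"] show ?thesis by fastforce
  next
    case False
    have t: "timer I \<rho> 1 r = 0" if "r \<in> traps I" for r
    proof -
      have "r \<noteq> source I" using inst that by (auto simp: routing_instance_def)
      then have "\<not> occupied I (\<lambda>a. \<rho> a 0) r" using valid_planD(1)[OF \<rho>(1)] by (auto simp: occupied_def)
      then show ?thesis by simp
    qed
    have "relabels I id (\<lambda>a. \<rho> a 1) (\<lambda>_. Some (source I))"
      by (rule relabels_id) (use valid_planD(1)[OF \<rho>(1)] False in auto)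
    from wins_relabel[OF tail1 this, of "\<lambda>_. 0"] t show ?thesis by auto
  qed
qed

lemma wins_run:
  assumes "wins I n X \<beta>"
  shows "\<exists>Xs \<beta>s. Xs 0 = X \<and> \<beta>s 0 = \<beta> \<and> (\<forall>j<n. move I (Xs j) (\<beta>s j) (Xs (Suc j)) \<and>
      countdown I 1 (Xs j) (\<beta>s j) (\<beta>s (Suc j))) \<and> final I (Xs n)"
  using assms
proof (induction n arbitrary: X \<beta>)
  case (Suc n)
  then obtain X' \<beta>' where *: "move I X \<beta> X'" "countdown I 1 X \<beta> \<beta>'" "wins I n X' \<beta>'" by auto
  from Suc.IH[OF *(3)] obtain Xs \<beta>s where "Xs 0 = X'" "\<beta>s 0 = \<beta>'" "final I (Xs n)"
    "\<forall>j<n. move I (Xs j) (\<beta>s j) (Xs (Suc j)) \<and> countdown I 1 (Xs j) (\<beta>s j) (\<beta>s (Suc j))" by blast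
  with * show ?case
    by (intro exI[of _ "case_nat X Xs"] exI[of _ "case_nat \<beta> \<beta>s"]) (auto simp: less_Suc_eq_0_disj)
next
  case 0
  then show ?case by (intro exI[of _ "\<lambda>_. X"] exI[of _ "\<lambda>_. \<beta>"]) simp
qed

lemma plan_of_wins:
  assumes inst: "routing_instance I" and wins: "wins I n (\<lambda>_. Some (source I)) (\<lambda>_. 0)"
  shows "yes_instance I"
proof -
  from wins_run[OF wins] obtain Xs \<beta>s where init: "Xs 0 = (\<lambda>_. Some (source I))" "\<beta>s 0 = (\<lambda>_. 0)"
    and mv: "\<And>j. j < n \<Longrightarrow> move I (Xs j) (\<beta>s j) (Xs (Suc j))"
    and cd: "\<And>j. j < n \<Longrightarrow> countdown I 1 (Xs j) (\<beta>s j) (\<beta>s (Suc j))"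
    and fin: "final I (Xs n)" by blast
  have inst': "source I \<noteq> target I" "source I \<in> vertices I" "traps I \<subseteq> vertices I - {source I, target I}"
    "edges I \<subseteq> {e. e \<subseteq> vertices I \<and> card e = 2}" "assets I \<noteq> {}"
    using inst by (auto simp: routing_instance_def)
  have "n \<noteq> 0"
  proof
    assume "n = 0"
    with fin init inst' show False by (auto simp: final_def finished_def)
  qed
  \<comment> \<open>A plan is defined at all times, so the last configuration is repeated for
    ever.\<close>
  define \<rho> where "\<rho> a j = Xs (min j n) a" for a j
  have am: "asset_move I (\<beta>s j) (\<rho> a j) (\<rho> a (Suc j))" if "a \<in> assets I" "j < n" for a j
    using mv[OF that(2)] that by (simp add: \<rho>_def move_def min_def)
  have stay: "\<rho> a (Suc j) = \<rho> a j" "finished I (\<rho> a j)" if "a \<in> assets I" "n \<le> j" for a j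
    using that fin by (auto simp: \<rho>_def final_def min_def)
  have timer: "timer I \<rho> j r = \<beta>s j r" if "r \<in> traps I" "j \<le> n" for j r
    using that(2)
  proof (induction j)
    case (Suc j)
    then have "timer I \<rho> j r = \<beta>s j r" by simp
    moreover have "(\<lambda>a. \<rho> a j) = Xs j" using Suc.prems by (simp add: \<rho>_def)
    ultimately show ?case using cd[of j] Suc.prems that(1) by (simp add: countdown_def)
  qed (simp add: init)
  have cases: "(finished I (\<rho> a j) \<and> \<rho> a (Suc j) = \<rho> a j) \<or>
      (\<not> finished I (\<rho> a j) \<and> (\<exists>r\<in>traps I. \<rho> a j = Some r \<and> active I \<rho> r j) \<and> \<rho> a (Suc j) = None) \<or>
      (\<not> finished I (\<rho> a j) \<and> \<not> (\<exists>r\<in>traps I. \<rho> a j = Some r \<and> active I \<rho> r j) \<and> (\<rho> a (Suc j) = \<rho> a j \<or>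
        (\<exists>u v. \<rho> a j = Some u \<and> \<rho> a (Suc j) = Some v \<and> {u, v} \<in> edges I \<and> v \<noteq> source I)))"
    if a: "a \<in> assets I" for a j
  proof (cases "j < n")
    case True
    have "active I \<rho> r j \<longleftrightarrow> \<beta>s j r = 0" if "r \<in> traps I" for r
      using timer[OF that] True by (simp add: active_iff_timer)
    with am[OF a True] show ?thesis unfolding asset_move_def by (auto split: if_splits)
  next
    case False
    with stay[OF a, of j] show ?thesis by simp
  qed
  have fin_not_trap: "\<not> finished I (Some r)" if "r \<in> traps I" for r
    using inst' that by (auto simp: finished_def)
  have sep: "separated I (\<lambda>a. \<rho> a j)" for j
  proof -
    have "separated I (Xs i)" if "i \<le> n" for i
    proof (cases "i = n")
      case True
      with mv[of "n - 1"] \<open>n \<noteq> 0\<close> show ?thesis by (simp add: move_def)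
    next
      case False
      with mv[of i] that show ?thesis by (simp add: move_def)
    qed
    then show ?thesis by (simp add: \<rho>_def)
  qed
  have verts: "\<rho> a j \<in> Some ` vertices I \<union> {None}" if "a \<in> assets I" for a j
  proof (induction j)
    case 0
    then show ?case using inst' by (simp add: \<rho>_def init)
  next
    case (Suc j)
    with cases[OF that, of j] inst'(4) show ?case by (elim disjE conjE exE) auto
  qed
  \<comment> \<open>The last step moves some asset, and finished assets do not move; so
    \<open>n\<close> is the exact length.\<close>
  have len: "is_length I \<rho> n"
    unfolding is_length_def
  proof (intro conjI)
    show "\<forall>a\<in>assets I. finished I (\<rho> a n)" using stay by blast
    obtain a where a: "a \<in> assets I" "Xs n a \<noteq> Xs (n - 1) a"
      using mv[of "n - 1"] \<open>n \<noteq> 0\<close> by (auto simp: move_def)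
    with am[OF a(1), of "n - 1"] \<open>n \<noteq> 0\<close> have "\<not> finished I (\<rho> a (n - 1))"
      by (auto simp: asset_move_def \<rho>_def)
    with a show "\<exists>a\<in>assets I. \<not> finished I (\<rho> a (n - 1))" by blast
  qed (use \<open>n \<noteq> 0\<close> in simp)
  have valid: "valid_plan I \<rho>"
    unfolding valid_plan_def
  proof (intro conjI ballI allI impI)
    fix a j assume a: "a \<in> assets I"
    show "\<rho> a j \<in> Some ` vertices I \<union> {None}" by (rule verts[OF a])
    show "\<rho> a 0 = Some (source I)" by (simp add: \<rho>_def init)
    show "\<rho> a (j + 1) = \<rho> a j" if "finished I (\<rho> a j)" using cases[OF a, of j] that by auto
    show "\<rho> a (j - 1) = Some (source I)" if "0 < j" "\<rho> a j = Some (source I)"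
      using cases[OF a, of "j - 1"] that by auto
    show "\<rho> a j = \<rho> a (j - 1) \<or> (\<exists>u v. \<rho> a (j - 1) = Some u \<and> \<rho> a j = Some v \<and> {u, v} \<in> edges I)"
      if "1 \<le> j" "\<rho> a j \<noteq> None"
      using cases[OF a, of "j - 1"] that by auto
    show "\<rho> a (j + 1) = None" if "r \<in> traps I" "\<rho> a j = Some r" "active I \<rho> r j" for r
      using cases[OF a, of j] that fin_not_trap[OF that(1)] by auto
    show "\<exists>r\<in>traps I. \<rho> a j = Some r \<and> active I \<rho> r j" if "\<rho> a j \<noteq> None" "\<rho> a (j + 1) = None"
      using cases[OF a, of j] that by auto
    show "\<rho> a j \<in> {Some (source I), Some (target I), None}"
      if "a' \<in> assets I" "a \<noteq> a'" "\<rho> a j = \<rho> a' j" for a'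
      using sep[of j] a that by (simp add: separated_def)
  next
    fix j assume "1 \<le> j" "\<exists>a\<in>assets I. \<not> finished I (\<rho> a j)"
    then have "j < n" using stay(2) by (meson not_le)
    with mv[of j] obtain a where "a \<in> assets I" "Xs (Suc j) a \<noteq> Xs j a" by (auto simp: move_def)
    with \<open>j < n\<close> show "\<exists>a'\<in>assets I. \<rho> a' j \<noteq> \<rho> a' (j + 1)"
      by (intro bexI[of _ a]) (auto simp: \<rho>_def min_def)
  qed (use len in blast)
  have "survives I \<rho> a \<longleftrightarrow> Xs n a = Some (target I)" for a
    using plan_length_eq[OF valid len] by (simp add: survives_def \<rho>_def)
  with valid fin show ?thesis by (auto simp: yes_instance_def final_def)
qed

section \<open>Indistinguishable pebbles on a graph\<close>

lemma relpow_card_bound: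
  assumes "finite r" "(x, y) \<in> r\<^sup>*"
  shows "\<exists>l\<le>card r. (x, y) \<in> r ^^ l"
  using assms rtrancl_finite_eq_relpow[of r] by auto

lemma relpow_first_step:
  fixes r :: "('a \<times> 'a) set"
  assumes "(x, y) \<in> r ^^ d" "1 \<le> d"
  obtains z where "(x, z) \<in> r"
proof (cases d)
  case (Suc n)
  from relpow_Suc_D2[OF assms(1)[unfolded Suc]] that show ?thesis by blast
qed (use assms(2) in simp)

lemma relpow_trans: "(x, y) \<in> r ^^ k \<Longrightarrow> (y, z) \<in> r ^^ l \<Longrightarrow> (x, z) \<in> r ^^ (k + l)"
  by (auto simp: relpow_add)

locale pebbles =
  fixes U :: "'v set" and E :: "'v set set"
  assumes finite_U: "finite U" and edge_card: "\<And>e. e \<in> E \<Longrightarrow> card e = 2"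
begin

definition adj :: "('v \<times> 'v) set" where
  "adj = {(x, y). x \<in> U \<and> y \<in> U \<and> {x, y} \<in> E}"

text \<open>All pebbles move simultaneously, and at least one does move. Two adjacent pebbles may
  exchange places, since plans forbid meeting at a vertex but not crossing on an edge; such an
  exchange leads from a configuration to itself.\<close>

definition shift :: "('v set \<times> 'v set) set" where
  "shift = {(C, C'). C \<subseteq> U \<and> C' \<subseteq> U \<and>
     (\<exists>f. bij_betw f C C' \<and> (\<forall>x\<in>C. f x = x \<or> (x, f x) \<in> adj) \<and> (\<exists>x\<in>C. f x \<noteq> x))}"

lemma adj_sym: "(x, y) \<in> adj \<Longrightarrow> (y, x) \<in> adj"
  by (auto simp: adj_def insert_commute)

lemma adj_neq: "(x, y) \<in> adj \<Longrightarrow> x \<noteq> y"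
  using edge_card by (force simp: adj_def)

lemma shiftI:
  assumes "C \<subseteq> U" "inj_on f C" "\<And>x. x \<in> C \<Longrightarrow> f x = x \<or> (x, f x) \<in> adj" "x \<in> C" "f x \<noteq> x" "C' = f ` C"
  shows "(C, C') \<in> shift"
proof -
  have "C' \<subseteq> U" using assms(1,3,6) by (force simp: adj_def)
  then show ?thesis using assms unfolding shift_def bij_betw_def by blast
qed

lemma shift_sym: "(C, C') \<in> shift \<Longrightarrow> (C', C) \<in> shift"
proof -
  assume "(C, C') \<in> shift"
  then obtain f x where f: "bij_betw f C C'" "\<And>x. x \<in> C \<Longrightarrow> f x = x \<or> (x, f x) \<in> adj" "x \<in> C" "f x \<noteq> x"
    "C \<subseteq> U" "C' \<subseteq> U" by (auto simp: shift_def)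
  let ?g = "inv_into C f"
  have inv: "?g (f z) = z" if "z \<in> C" for z using f(1) that by (simp add: bij_betw_def)
  have g: "bij_betw ?g C' C" using f(1) by (rule bij_betw_inv_into)
  show "(C', C) \<in> shift"
  proof (rule shiftI[of _ ?g "f x"])
    fix y assume "y \<in> C'"
    then obtain z where "z \<in> C" "y = f z" using f(1) by (auto simp: bij_betw_def)
    with f(2) inv adj_sym show "?g y = y \<or> (y, ?g y) \<in> adj" by metis
  qed (use f inv g in \<open>auto simp: bij_betw_def\<close>)
qed

lemma relpow_shift_sym: "(C, C') \<in> shift ^^ k \<Longrightarrow> (C', C) \<in> shift ^^ k"
proof (induction k arbitrary: C')
  case (Suc k)
  then obtain C1 where "(C, C1) \<in> shift ^^ k" "(C1, C') \<in> shift" by auto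
  with Suc.IH shift_sym show ?case by (blast intro: relpow_Suc_I2)
qed auto

section \<open>Elementary shifts, and walks of cubic length\<close>

lemma shift_single:
  assumes "C \<subseteq> U" "x \<in> C" "y \<notin> C" "(x, y) \<in> adj"
  shows "(C, insert y (C - {x})) \<in> shift"
  by (rule shiftI[of _ "id(x := y)" x]) (use assms in \<open>auto simp: inj_on_def\<close>)

lemma shift_swap:
  assumes "C \<subseteq> U" "x \<in> C" "y \<in> C" "(x, y) \<in> adj"
  shows "(C, C) \<in> shift"
  by (rule shiftI[of _ "id(x := y, y := x)" x])
    (use assms adj_sym[OF assms(4)] adj_neq[OF assms(4)] in \<open>auto simp: inj_on_def\<close>)

lemma shift_double:
  assumes "C \<subseteq> U" "x \<in> C" "y \<in> C" "x \<noteq> y" "x' \<notin> C" "y' \<notin> C" "x' \<noteq> y'" "(x, x') \<in> adj" "(y, y') \<in> adj"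
  shows "(C, insert x' (insert y' (C - {x, y}))) \<in> shift"
  by (rule shiftI[of _ "id(x := x', y := y')" x]) (use assms in \<open>auto simp: inj_on_def\<close>)

text \<open>No pebble leaves its connected component. \<open>short_walk_aux\<close> shows that these
  numbers are the only obstruction to reachability.\<close>

lemma shift_card_component:
  assumes "(C, C') \<in> shift"
  shows "card (C \<inter> adj\<^sup>* `` {z}) = card (C' \<inter> adj\<^sup>* `` {z})"
proof -
  let ?K = "adj\<^sup>* `` {z}"
  obtain f where f: "bij_betw f C C'" "\<And>x. x \<in> C \<Longrightarrow> f x = x \<or> (x, f x) \<in> adj"
    using assms by (auto simp: shift_def)
  have K: "f x \<in> ?K \<longleftrightarrow> x \<in> ?K" if "x \<in> C" for x
  proof (cases "f x = x")
    case False
    with f(2)[OF that] have "(x, f x) \<in> adj" by blast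
    then have "(z, x) \<in> adj\<^sup>* \<longleftrightarrow> (z, f x) \<in> adj\<^sup>*"
      using rtrancl_into_rtrancl[of z x adj "f x"] rtrancl_into_rtrancl[of z "f x" adj x] adj_sym by blast
    then show ?thesis by simp
  qed simp
  have C': "C' = f ` C" using f(1) by (simp add: bij_betw_def)
  have "bij_betw f (C \<inter> ?K) (C' \<inter> ?K)"
  proof (rule bij_betw_subset[OF f(1)])
    show "f ` (C \<inter> ?K) = C' \<inter> ?K"
    proof (intro equalityI subsetI)
      fix y assume "y \<in> C' \<inter> ?K"
      then obtain x where "x \<in> C" "y = f x" "f x \<in> ?K" unfolding C' by blast
      with K show "y \<in> f ` (C \<inter> ?K)" by blast
    next
      fix y assume "y \<in> f ` (C \<inter> ?K)"
      then obtain x where "x \<in> C" "x \<in> ?K" "y = f x" by blast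
      with K show "y \<in> C' \<inter> ?K" unfolding C' by blast
    qed
  qed simp
  then show ?thesis by (rule bij_betw_same_card)
qed

lemma relpow_card_component:
  "(C, C') \<in> shift ^^ k \<Longrightarrow> card (C \<inter> adj\<^sup>* `` {z}) = card (C' \<inter> adj\<^sup>* `` {z})"
proof (induction k arbitrary: C')
  case (Suc k)
  then obtain C1 where "(C, C1) \<in> shift ^^ k" "(C1, C') \<in> shift" by auto
  with Suc.IH shift_card_component show ?case by metis
qed simp

lemma relpow_subset: "(C, C') \<in> shift ^^ k \<Longrightarrow> C \<subseteq> U \<Longrightarrow> C' \<subseteq> U"
proof (induction k arbitrary: C')
  case (Suc k)
  then obtain C1 where "(C1, C') \<in> shift" by auto
  then show ?case unfolding shift_def by blast
qed simp

text \<open>If the next vertex of the path is occupied, the pebble there is sent on to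
  \<open>y\<close> instead, and the pebble at \<open>x\<close> then moves into the gap. As pebbles
  have no identity, the outcome is the same, and the path pays for it with its number of
  edges.\<close>

lemma push:
  "(x, y) \<in> adj ^^ l \<Longrightarrow> C \<subseteq> U \<Longrightarrow> x \<in> C \<Longrightarrow> y \<notin> C \<Longrightarrow> \<exists>k\<le>l. (C, insert y (C - {x})) \<in> shift ^^ k"
proof (induction l arbitrary: x C)
  case (Suc l)
  obtain x1 where x1: "(x, x1) \<in> adj" "(x1, y) \<in> adj ^^ l" using relpow_Suc_D2[OF Suc.prems(1)] by blast
  have "x \<noteq> x1" "x1 \<in> U" using adj_neq[OF x1(1)] x1(1) by (auto simp: adj_def)
  show ?case
  proof (cases "x1 \<in> C")
    case False
    note 1 = shift_single[OF Suc.prems(2,3) False x1(1)]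
    show ?thesis
    proof (cases "x1 = y")
      case True
      with 1 show ?thesis by (intro exI[of _ 1]) simp
    next
      case neq: False
      let ?C = "insert x1 (C - {x})"
      have "?C \<subseteq> U" "x1 \<in> ?C" "y \<notin> ?C" using Suc.prems neq \<open>x1 \<in> U\<close> by auto
      from Suc.IH[OF x1(2) this] obtain k where "k \<le> l" "(?C, insert y (?C - {x1})) \<in> shift ^^ k" by blast
      moreover have "insert y (?C - {x1}) = insert y (C - {x})" using False by auto
      ultimately have "(C, insert y (C - {x})) \<in> shift ^^ Suc k" using 1 relpow_Suc_I2 by metis
      with \<open>k \<le> l\<close> show ?thesis by (intro exI[of _ "Suc k"]) simp
    qed
  next
    case True
    let ?C = "insert y (C - {x1})"
    from Suc.IH[OF x1(2) Suc.prems(2) True Suc.prems(4)] obtain k where k: "k \<le> l" "(C, ?C) \<in> shift ^^ k"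
      by blast
    have "x1 \<noteq> y" using True Suc.prems(4) by blast
    then have "(?C, insert x1 (?C - {x})) \<in> shift"
      using relpow_subset[OF k(2) Suc.prems(2)] Suc.prems(3) \<open>x \<noteq> x1\<close> x1(1) by (intro shift_single) auto
    moreover have "insert x1 (?C - {x}) = insert y (C - {x})"
      using True Suc.prems \<open>x \<noteq> x1\<close> by auto
    ultimately show ?thesis using k by (intro exI[of _ "Suc k"]) auto
  qed
qed auto

lemma card_adj: "finite adj" "card adj \<le> (card U)\<^sup>2"
proof -
  have "adj \<subseteq> U \<times> U" by (auto simp: adj_def)
  moreover have "finite (U \<times> U)" "card (U \<times> U) = (card U)\<^sup>2"
    using finite_U by (auto simp: card_cartesian_product power2_eq_square)
  ultimately show "finite adj" "card adj \<le> (card U)\<^sup>2"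
    using finite_subset[of adj "U \<times> U"] card_mono[of "U \<times> U" adj] by simp_all
qed

text \<open>Equal numbers in each component provide, for a misplaced pebble, a place of
  \<open>C'\<close> in the same component that is still free. Pushing towards it takes at most
  \<open>card adj\<close> shifts, hence at most the square of \<open>card U\<close>, and leaves one
  misplaced pebble less.\<close>

lemma short_walk_aux:
  assumes "C \<subseteq> U" "C' \<subseteq> U" "\<And>z. card (C \<inter> adj\<^sup>* `` {z}) = card (C' \<inter> adj\<^sup>* `` {z})"
  shows "\<exists>k\<le>card (C - C') * (card U)\<^sup>2. (C, C') \<in> shift ^^ k"
  using assms
proof (induction "card (C - C')" arbitrary: C)
  case 0
  have fin: "finite C" "finite C'" using 0(2,3) by (blast intro: finite_subset[OF _ finite_U])+
  have sub: "C \<subseteq> C'" using 0(1) fin by simp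
  have "C' \<subseteq> C"
  proof
    fix y assume y: "y \<in> C'"
    show "y \<in> C"
    proof (rule ccontr)
      assume "y \<notin> C"
      with y sub have "C \<inter> adj\<^sup>* `` {y} \<subset> C' \<inter> adj\<^sup>* `` {y}" by auto
      from psubset_card_mono[OF _ this] fin 0(4)[of y] show False by simp
    qed
  qed
  with sub have "C = C'" by blast
  then show ?case by (intro exI[of _ 0]) simp
next
  case (Suc m)
  have fin: "finite C" "finite C'" using Suc.prems(1,2) by (blast intro: finite_subset[OF _ finite_U])+
  obtain x where x: "x \<in> C" "x \<notin> C'" using Suc.hyps(2) by (metis DiffE card.empty ex_in_conv old.nat.distinct(2))
  let ?K = "adj\<^sup>* `` {x}"
  have "\<exists>y. y \<in> C' \<inter> ?K \<and> y \<notin> C"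
  proof (rule ccontr)
    assume "\<not> (\<exists>y. y \<in> C' \<inter> ?K \<and> y \<notin> C)"
    with x have "C' \<inter> ?K \<subset> C \<inter> ?K" by auto
    from psubset_card_mono[OF _ this] fin Suc.prems(3)[of x] show False by simp
  qed
  then obtain y where y: "y \<in> C'" "y \<notin> C" "(x, y) \<in> adj\<^sup>*" by auto
  obtain l where l: "l \<le> card adj" "(x, y) \<in> adj ^^ l" using relpow_card_bound[OF card_adj(1) y(3)] by blast
  from push[OF l(2) Suc.prems(1) x(1) y(2)] obtain k where
    k: "k \<le> l" "(C, insert y (C - {x})) \<in> shift ^^ k" by blast
  let ?C = "insert y (C - {x})"
  have "?C - C' = (C - C') - {x}" using y by auto
  then have m: "card (?C - C') = m" using Suc.hyps(2) x fin by simp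
  have "?C \<subseteq> U" using relpow_subset[OF k(2) Suc.prems(1)] .
  moreover have "card (?C \<inter> adj\<^sup>* `` {z}) = card (C' \<inter> adj\<^sup>* `` {z})" for z
    using relpow_card_component[OF k(2)] Suc.prems(3) by metis
  ultimately obtain k' where k': "k' \<le> m * (card U)\<^sup>2" "(?C, C') \<in> shift ^^ k'"
    using Suc.hyps(1)[of ?C] m Suc.prems(2) by auto
  have "k + k' \<le> (card U)\<^sup>2 + m * (card U)\<^sup>2" using k(1) k'(1) l(1) card_adj(2) by linarith
  with relpow_trans[OF k(2) k'(2)] Suc.hyps(2) show ?case
    by (intro exI[of _ "k + k'"]) (metis mult_Suc)
qed

lemma short_walk:
  assumes "(C, C') \<in> shift ^^ d" "C \<subseteq> U"
  shows "\<exists>k\<le>card U ^ 3. (C, C') \<in> shift ^^ k"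
proof -
  have "card (C - C') \<le> card U" using assms(2) finite_U by (intro card_mono) auto
  then have "card (C - C') * (card U)\<^sup>2 \<le> card U * (card U)\<^sup>2" by (rule mult_right_mono) simp
  also have "\<dots> = card U ^ 3" by (simp add: power2_eq_square power3_eq_cube)
  finally show ?thesis
    using short_walk_aux[OF assms(2) relpow_subset[OF assms] relpow_card_component[OF assms(1)]]
      le_trans by blast
qed

text \<open>A flexible configuration allows to change the parity of a walk through it.\<close>

definition flexible :: "'v set \<Rightarrow> bool" where
  "flexible C \<longleftrightarrow> (\<exists>k\<le>3. odd k \<and> (C, C) \<in> shift ^^ k)"

lemma flexible_adj:
  assumes "C \<subseteq> U" "x \<in> C" "y \<in> C" "(x, y) \<in> adj"
  shows "flexible C"
  unfolding flexible_def using shift_swap[OF assms] by (intro exI[of _ 1]) simp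

text \<open>If two pebbles can move, then either they can do so one after the other and return together,
  or one of them can move next to the other.\<close>

lemma inflexible_lone:
  assumes "C \<subseteq> U" "x \<in> C" "y \<in> C" "(x, x') \<in> adj" "(y, y') \<in> adj"
    and inflexible: "\<And>C'. (C, C') \<in> shift\<^sup>* \<Longrightarrow> \<not> flexible C'"
  shows "x = y"
proof (rule ccontr)
  assume "x \<noteq> y"
  have notin: "x' \<notin> C" "y' \<notin> C" using flexible_adj assms inflexible[of C] by blast+
  let ?C1 = "insert x' (C - {x})"
  have 1: "(C, ?C1) \<in> shift" using shift_single assms notin by blast
  have U1: "?C1 \<subseteq> U" using assms(1,4) by (auto simp: adj_def)
  show False
  proof (cases "x' = y'")
    case True
    then have "flexible ?C1" using flexible_adj[OF U1, of y x'] assms \<open>x \<noteq> y\<close> by auto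
    with inflexible 1 show False by blast
  next
    case False
    let ?C2 = "insert x' (insert y' (C - {x, y}))"
    have "insert y' (?C1 - {y}) = ?C2" using notin assms \<open>x \<noteq> y\<close> by auto
    then have 2: "(?C1, ?C2) \<in> shift"
      using shift_single[OF U1, of y y'] assms notin False \<open>x \<noteq> y\<close> by auto
    have "(?C2, C) \<in> shift" by (rule shift_sym, rule shift_double) (use assms notin False \<open>x \<noteq> y\<close> in auto)
    with 1 2 have "(C, C) \<in> shift ^^ 3" by (auto simp: numeral_3_eq_3)
    then have "flexible C" unfolding flexible_def by (intro exI[of _ 3]) simp
    with inflexible[of C] show False by blast
  qed
qed

text \<open>Some pebble moves, and by \<open>inflexible_lone\<close> it is the only one with a
  neighbouring vertex at all. The others are stuck for ever, so a reachable configuration is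
  determined by a single vertex, and there are at most \<open>card U\<close> of them.\<close>

lemma inflexible_walk:
  assumes "(C, C') \<in> shift ^^ d" "1 \<le> d" "C \<subseteq> U"
    and inflexible: "\<And>C'. (C, C') \<in> shift\<^sup>* \<Longrightarrow> \<not> flexible C'"
  shows "\<exists>l\<le>4 * (card U)\<^sup>2. (even l \<longleftrightarrow> even d) \<and> (C, C') \<in> shift ^^ l"
proof -
  define K where "K = {C'. (C, C') \<in> shift\<^sup>*}"
  obtain C1 where "(C, C1) \<in> shift" using relpow_first_step[OF assms(1,2)] .
  then obtain f x0 where "x0 \<in> C" "f x0 \<noteq> x0" "\<forall>x\<in>C. f x = x \<or> (x, f x) \<in> adj"
    unfolding shift_def by blast
  then obtain x1 where x0: "x0 \<in> C" "(x0, x1) \<in> adj" by blast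
  define rest where "rest = C - {x0}"
  have isolated: "(z, z') \<notin> adj" if "z \<in> rest" for z z'
  proof
    assume "(z, z') \<in> adj"
    from inflexible_lone[OF assms(3) x0(1) _ x0(2) this inflexible] that show False
      by (auto simp: rest_def)
  qed
  have form: "\<exists>v\<in>U. C' = insert v rest" if "(C, C') \<in> shift\<^sup>*" for C'
    using that
  proof (induction rule: rtrancl_induct)
    case base
    then show ?case using x0 assms(3) by (intro bexI[of _ x0]) (auto simp: rest_def)
  next
    case (step C1 C2)
    then obtain v where v: "C1 = insert v rest" by blast
    obtain f where f: "bij_betw f C1 C2" "\<And>x. x \<in> C1 \<Longrightarrow> f x = x \<or> (x, f x) \<in> adj" "C2 \<subseteq> U"
      using step(2) by (auto simp: shift_def)
    have "f z = z" if "z \<in> rest" for z using f(2)[of z] isolated[OF that] that v by blast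
    then have "f ` rest = rest" by simp
    with f(1) v have "C2 = insert (f v) rest" by (auto simp: bij_betw_def)
    with f(3) show ?case by blast
  qed
  have KU: "K \<subseteq> (\<lambda>v. insert v rest) ` U" using form by (auto simp: K_def)
  have K: "finite K" "card K \<le> card U"
    using finite_subset[OF KU finite_imageI[OF finite_U]] surj_card_le[OF finite_U KU] by simp_all
  \<comment> \<open>The graph of reachable configurations with the parity of the number of steps
    attached. A path in it that is no longer than its number of edges is a short walk of the
    prescribed parity.\<close>
  define R where "R = {((C1, b), (C2, \<not> b)) | C1 C2 b. C1 \<in> K \<and> C2 \<in> K \<and> (C1, C2) \<in> shift}"
  let ?KK = "(K \<times> (UNIV :: bool set)) \<times> (K \<times> (UNIV :: bool set))"
  have "R \<subseteq> ?KK" by (auto simp: R_def)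
  moreover have "finite ?KK" using K by simp
  moreover have "card ?KK = 4 * (card K)\<^sup>2"
    by (simp add: card_cartesian_product power2_eq_square)
  ultimately have R: "finite R" "card R \<le> 4 * (card K)\<^sup>2"
    using finite_subset[of R ?KK] card_mono[of ?KK R] by simp_all
  have forth: "((C, True), (C2, even n)) \<in> R\<^sup>*" if "(C, C2) \<in> shift ^^ n" for C2 n
    using that
  proof (induction n arbitrary: C2)
    case (Suc n)
    then obtain C1 where C1: "(C, C1) \<in> shift ^^ n" "(C1, C2) \<in> shift" by auto
    have "(C, C1) \<in> shift\<^sup>*" "(C, C2) \<in> shift\<^sup>*"
      using relpow_imp_rtrancl[OF C1(1)] relpow_imp_rtrancl[OF Suc.prems] by simp_all
    with C1(2) have "((C1, even n), (C2, even (Suc n))) \<in> R"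
      by (simp add: R_def K_def)
    with Suc.IH[OF C1(1)] show ?case by (rule rtrancl_into_rtrancl)
  qed simp
  have project: "(C1, C2) \<in> shift ^^ l \<and> (b2 \<longleftrightarrow> (b1 = even l))" if "((C1, b1), (C2, b2)) \<in> R ^^ l" for C1 b1 C2 b2 l
    using that
  proof (induction l arbitrary: C2 b2)
    case (Suc l)
    then obtain C3 b3 where "((C1, b1), (C3, b3)) \<in> R ^^ l" "((C3, b3), (C2, b2)) \<in> R" by auto
    with Suc.IH[OF this(1)] show ?case by (auto simp: R_def)
  qed simp
  from relpow_card_bound[OF R(1) forth[OF assms(1)]] obtain l where
    l: "l \<le> card R" "((C, True), (C', even d)) \<in> R ^^ l" by blast
  have "(card K)\<^sup>2 \<le> (card U)\<^sup>2" using K(2) by (rule power_mono) simp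
  with l(1) R(2) have "l \<le> 4 * (card U)\<^sup>2" by linarith
  with project[OF l(2)] show ?thesis by auto
qed

text \<open>In the presence of a flexible configuration there are two walks of at most
  \<open>card U ^ 3\<close> shifts and a closed walk of at most 3; the middle summand belongs to the
  other case. The sum serves for both.\<close>

definition walk_bound :: nat where
  "walk_bound = 2 * card U ^ 3 + 4 * (card U)\<^sup>2 + 3"

text \<open>Since shifts can be undone, \<open>C'\<close> is reachable from every configuration that
  is reachable from \<open>C\<close>. So the walk may be led through a flexible one, whose odd
  closed walk is inserted if the parity is wrong. An empty walk is replaced by a shift and its
  reversal, because the first shift of the walk will have to absorb the time that is saved.\<close>

lemma short_walk_parity:
  assumes "(C, C') \<in> shift ^^ d" "1 \<le> d" "C \<subseteq> U"
  shows "\<exists>l. 1 \<le> l \<and> l \<le> walk_bound \<and> (even l \<longleftrightarrow> even d) \<and> (C, C') \<in> shift ^^ l"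
proof -
  have "\<exists>l\<le>walk_bound. (even l \<longleftrightarrow> even d) \<and> (C, C') \<in> shift ^^ l"
  proof (cases "\<exists>C1. (C, C1) \<in> shift\<^sup>* \<and> flexible C1")
    case True
    then obtain C1 where C1: "(C, C1) \<in> shift\<^sup>*" "flexible C1" by blast
    then obtain j where j: "j \<le> 3" "odd j" "(C1, C1) \<in> shift ^^ j" by (auto simp: flexible_def)
    obtain n where n: "(C, C1) \<in> shift ^^ n" using C1(1) rtrancl_imp_relpow by blast
    have C1U: "C1 \<subseteq> U" using relpow_subset[OF n assms(3)] .
    obtain k where k: "k \<le> card U ^ 3" "(C, C1) \<in> shift ^^ k" using short_walk[OF n assms(3)] by blast
    obtain k' where k': "k' \<le> card U ^ 3" "(C1, C') \<in> shift ^^ k'"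
      using short_walk[OF relpow_trans[OF relpow_shift_sym[OF n] assms(1)] C1U] by blast
    show ?thesis
    proof (cases "even (k + k') \<longleftrightarrow> even d")
      case True
      with relpow_trans[OF k(2) k'(2)] k(1) k'(1) show ?thesis
        by (intro exI[of _ "k + k'"]) (simp add: walk_bound_def)
    next
      case False
      with relpow_trans[OF relpow_trans[OF k(2) j(3)] k'(2)] k(1) k'(1) j(1,2) show ?thesis
        by (intro exI[of _ "k + j + k'"]) (auto simp: walk_bound_def)
    qed
  next
    case False
    with inflexible_walk[OF assms] obtain l where
      l: "l \<le> 4 * (card U)\<^sup>2" "even l \<longleftrightarrow> even d" "(C, C') \<in> shift ^^ l" by blast
    then show ?thesis by (intro exI[of _ l]) (simp add: walk_bound_def)
  qed
  then obtain l where l: "l \<le> walk_bound" "even l \<longleftrightarrow> even d" "(C, C') \<in> shift ^^ l" by blast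
  show ?thesis
  proof (cases "l = 0")
    case True
    obtain C1 where "(C, C1) \<in> shift" using relpow_first_step[OF assms(1,2)] .
    with shift_sym have "(C, C) \<in> shift ^^ 2" by (auto simp: numeral_2_eq_2)
    with l True show ?thesis by (intro exI[of _ 2]) (simp add: walk_bound_def)
  next
    case False
    with l show ?thesis by (intro exI[of _ l]) simp
  qed
qed

end

section \<open>Short runs with long steps\<close>

definition reversible :: "('a, 'v) routing_instance \<Rightarrow> ('a \<Rightarrow> 'v option) \<Rightarrow> ('a \<Rightarrow> 'v option) \<Rightarrow> bool" where
  "reversible I X X' \<longleftrightarrow> (\<forall>a\<in>assets I. X' a \<noteq> X a \<longrightarrow>
     X a \<noteq> Some (source I) \<and> X' a \<noteq> Some (target I) \<and> X' a \<noteq> None)"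

text \<open>A long step of odd duration \<open>d\<close> goes back and forth between \<open>X\<close> and \<open>X'\<close>.\<close>

definition long_step :: "('a, 'v) routing_instance \<Rightarrow> nat \<Rightarrow> ('a \<Rightarrow> 'v option) \<Rightarrow> ('v \<Rightarrow> nat) \<Rightarrow>
    ('a \<Rightarrow> 'v option) \<Rightarrow> ('v \<Rightarrow> nat) \<Rightarrow> bool" where
  "long_step I d X \<beta> X' \<beta>' \<longleftrightarrow> move I X \<beta> X' \<and> countdown I d X \<beta> \<beta>' \<and> odd d \<and>
     (d \<noteq> 1 \<longrightarrow> reversible I X X' \<and>
        (\<forall>r\<in>traps I. occupied I X r \<or> occupied I X' r \<longrightarrow> d \<le> \<beta> r))"

lemma asset_move_cong:
  assumes "\<And>r. r \<in> traps I \<Longrightarrow> x = Some r \<Longrightarrow> \<beta> r = 0 \<longleftrightarrow> \<gamma> r = 0"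
  shows "asset_move I \<beta> x x' \<longleftrightarrow> asset_move I \<gamma> x x'"
proof -
  have "(\<exists>r\<in>traps I. x = Some r \<and> \<beta> r = 0) \<longleftrightarrow> (\<exists>r\<in>traps I. x = Some r \<and> \<gamma> r = 0)"
    using assms by blast
  then show ?thesis unfolding asset_move_def by simp
qed

lemma move_cong:
  assumes "\<And>r. r \<in> traps I \<Longrightarrow> occupied I X r \<Longrightarrow> \<beta> r = 0 \<longleftrightarrow> \<gamma> r = 0" "move I X \<beta> X'"
  shows "move I X \<gamma> X'"
proof -
  have "asset_move I \<beta> (X a) (X' a) \<longleftrightarrow> asset_move I \<gamma> (X a) (X' a)" if "a \<in> assets I" for a
    by (rule asset_move_cong, rule assms(1)) (use that in \<open>auto simp: occupied_def\<close>)
  then show ?thesis using assms(2) unfolding move_def by simp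
qed

lemma asset_moveE:
  assumes "asset_move I \<beta> x x'"
  obtains "x' = x" | r where "r \<in> traps I" "x = Some r" "\<beta> r = 0" "x' = None" "\<not> finished I x"
  | u v where "x = Some u" "x' = Some v" "{u, v} \<in> edges I" "v \<noteq> source I" "\<not> finished I x"
  using assms unfolding asset_move_def by (auto split: if_splits)

lemma asset_move_finished: "asset_move I \<beta> x x' \<Longrightarrow> finished I x \<Longrightarrow> x' = x"
  by (simp add: asset_move_def)

text \<open>Nobody has to return to the source or from a final location, and the traps that are now
  occupied are not active, so they let the assets go.\<close>

lemma move_back:
  assumes mv: "move I X \<beta> X'" and rev: "reversible I X X'"
    and safe: "\<And>r. r \<in> traps I \<Longrightarrow> occupied I X' r \<Longrightarrow> \<gamma> r \<noteq> 0"
  shows "move I X' \<gamma> X"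
  unfolding move_def
proof (intro conjI ballI)
  fix a assume a: "a \<in> assets I"
  have alive: "\<not> (\<exists>r\<in>traps I. X' a = Some r \<and> \<gamma> r = 0)"
    using safe a by (auto simp: occupied_def)
  show "asset_move I \<gamma> (X' a) (X a)"
  proof (cases "X' a = X a")
    case True
    with alive have n: "(\<exists>r\<in>traps I. X a = Some r \<and> \<gamma> r = 0) = False" by simp
    show ?thesis unfolding True asset_move_def n by simp
  next
    case False
    with rev a have *: "X a \<noteq> Some (source I)" "\<not> finished I (X' a)" "X' a \<noteq> None"
      by (auto simp: reversible_def finished_def)
    from mv a have "asset_move I \<beta> (X a) (X' a)" by (simp add: move_def)
    then obtain u v where "X a = Some u" "X' a = Some v" "{u, v} \<in> edges I"
      using False *(3) by (auto elim: asset_moveE)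
    with * alive show ?thesis by (auto simp: asset_move_def insert_commute)
  qed
next
  show "\<exists>a\<in>assets I. X a \<noteq> X' a" using mv unfolding move_def by metis
qed (use mv in \<open>auto simp: move_def\<close>)

text \<open>Induction on the number \<open>e\<close> of round trips. A round trip takes two units
  off every positive timer that is large enough; the traps under the assets have to wait at least
  \<open>d\<close> steps, so none of them becomes active in between.\<close>

lemma long_step_wins:
  assumes "long_step I d X \<beta> X' \<beta>'" "wins I n X' \<beta>'"
  shows "\<exists>n. wins I n X \<beta>"
proof -
  from assms(1) obtain e where "d = 2 * e + 1" by (auto simp: long_step_def elim: oddE)
  with assms(1) show ?thesis
  proof (induction e arbitrary: d \<beta>)
    case 0
    with assms(2) have "wins I (Suc n) X \<beta>" by (auto simp: long_step_def)
    then show ?case by blast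
  next
    case (Suc e)
    from Suc.prems have mv: "move I X \<beta> X'" and cd: "countdown I d X \<beta> \<beta>'" and rev: "reversible I X X'"
      and occ: "\<And>r. r \<in> traps I \<Longrightarrow> occupied I X r \<or> occupied I X' r \<Longrightarrow> d \<le> \<beta> r"
      and d: "d = 2 * e + 3" by (auto simp: long_step_def)
    let ?\<beta>1 = "\<lambda>r. \<beta> r - 1" and ?\<beta>2 = "\<lambda>r. \<beta> r - 1 - 1"
    have pos: "?\<beta>1 r \<noteq> 0" "?\<beta>2 r \<noteq> 0" "\<beta> r \<noteq> 0" if "r \<in> traps I" "occupied I X r \<or> occupied I X' r" for r
      using occ[OF that] d by auto
    have 1: "countdown I 1 X \<beta> ?\<beta>1" "countdown I 1 X' ?\<beta>1 ?\<beta>2"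
      unfolding countdown_def using pos(1,3) by (simp_all, blast+)
    have 2: "move I X' ?\<beta>1 X" by (rule move_back[OF mv rev]) (use pos in auto)
    have "long_step I (2 * e + 1) X ?\<beta>2 X' \<beta>'"
      unfolding long_step_def
    proof (intro conjI impI ballI)
      show "move I X ?\<beta>2 X'" by (rule move_cong[OF _ mv]) (use pos in auto)
      show "countdown I (2 * e + 1) X ?\<beta>2 \<beta>'" using cd pos d by (auto simp: countdown_def)
      show "2 * e + 1 \<le> ?\<beta>2 r" if "r \<in> traps I" "occupied I X r \<or> occupied I X' r" for r
        using occ[OF that] d by simp
    qed (use rev in auto)
    from Suc.IH[OF this refl] obtain m where m: "wins I m X ?\<beta>2" by blast
    have "wins I (Suc (Suc m)) X \<beta>"
      unfolding wins.simps using mv 1 2 m by blast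
    then show ?case by blast
  qed
qed

text \<open>A positive timer other than 1 stays positive, so the set of active traps does not
  change. Triggering a trap eliminates an asset and is excluded by \<open>reversible\<close>; the
  last clause excludes entering an active trap, which would eliminate the asset in the following
  step.\<close>

definition quiet_step :: "('a, 'v) routing_instance \<Rightarrow> ('a \<Rightarrow> 'v option) \<Rightarrow> ('v \<Rightarrow> nat) \<Rightarrow>
    ('a \<Rightarrow> 'v option) \<Rightarrow> ('v \<Rightarrow> nat) \<Rightarrow> bool" where
  "quiet_step I X \<beta> X' \<beta>' \<longleftrightarrow> move I X \<beta> X' \<and> countdown I 1 X \<beta> \<beta>' \<and> reversible I X X' \<and>
     (\<forall>r\<in>traps I. \<beta> r \<noteq> 1 \<and> (occupied I X' r \<longrightarrow> \<beta> r \<noteq> 0))"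

fun quiet_run :: "('a, 'v) routing_instance \<Rightarrow> nat \<Rightarrow> ('a \<Rightarrow> 'v option) \<Rightarrow> ('v \<Rightarrow> nat) \<Rightarrow>
    ('a \<Rightarrow> 'v option) \<Rightarrow> ('v \<Rightarrow> nat) \<Rightarrow> bool" where
  "quiet_run I 0 X \<beta> X' \<beta>' \<longleftrightarrow> X' = X \<and> \<beta>' = \<beta>"
| "quiet_run I (Suc d) X \<beta> X' \<beta>' \<longleftrightarrow> (\<exists>X1 \<beta>1. quiet_step I X \<beta> X1 \<beta>1 \<and> quiet_run I d X1 \<beta>1 X' \<beta>')"

lemma wins_split:
  assumes "wins I n X \<beta>"
  shows "\<exists>d X1 \<beta>1. quiet_run I d X \<beta> X1 \<beta>1 \<and> (final I X1 \<or>
    (\<exists>X2 \<beta>2 m. move I X1 \<beta>1 X2 \<and> countdown I 1 X1 \<beta>1 \<beta>2 \<and> \<not> quiet_step I X1 \<beta>1 X2 \<beta>2 \<and> wins I m X2 \<beta>2))"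
  using assms
proof (induction n arbitrary: X \<beta>)
  case (Suc n)
  then obtain X' \<beta>' where *: "move I X \<beta> X'" "countdown I 1 X \<beta> \<beta>'" "wins I n X' \<beta>'" by auto
  show ?case
  proof (cases "quiet_step I X \<beta> X' \<beta>'")
    case True
    from Suc.IH[OF *(3)] obtain d X1 \<beta>1 where "quiet_run I d X' \<beta>' X1 \<beta>1" "final I X1 \<or>
      (\<exists>X2 \<beta>2 m. move I X1 \<beta>1 X2 \<and> countdown I 1 X1 \<beta>1 \<beta>2 \<and> \<not> quiet_step I X1 \<beta>1 X2 \<beta>2 \<and> wins I m X2 \<beta>2)"
      by blast
    with True show ?thesis
      by (intro exI[of _ "Suc d"] exI[of _ X1] exI[of _ \<beta>1] conjI) (simp, blast, assumption)
  next
    case False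
    with * show ?thesis
      by (intro exI[of _ 0] exI[of _ X] exI[of _ \<beta>] conjI) (simp, blast)
  qed
next
  case 0
  then show ?case by (intro exI[of _ 0] exI[of _ X] exI[of _ \<beta>] conjI) simp_all
qed

section \<open>Quiet runs as walks of pebbles\<close>

definition special :: "('a, 'v) routing_instance \<Rightarrow> 'v option \<Rightarrow> bool" where
  "special I x \<longleftrightarrow> x = Some (source I) \<or> x = Some (target I) \<or> x = None"

definition midway :: "('a, 'v) routing_instance \<Rightarrow> ('a \<Rightarrow> 'v option) \<Rightarrow> 'v set" where
  "midway I X = {v. occupied I X v} - {source I, target I}"

text \<open>The vertices of the pebble graph. They stay the same during quiet steps, so that one
  graph serves for a whole quiet run.\<close>

definition passable :: "('a, 'v) routing_instance \<Rightarrow> ('v \<Rightarrow> nat) \<Rightarrow> 'v set" where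
  "passable I \<beta> = vertices I - {source I, target I} - {r \<in> traps I. \<beta> r = 0}"

definition placed :: "('a, 'v) routing_instance \<Rightarrow> ('a \<Rightarrow> 'v option) \<Rightarrow> bool" where
  "placed I X \<longleftrightarrow> (\<forall>a\<in>assets I. \<forall>v. X a = Some v \<longrightarrow> v \<in> vertices I)"

text \<open>If moreover the other assets occupy the same vertices, then they are merely permuted.\<close>

definition same_special :: "('a, 'v) routing_instance \<Rightarrow> ('a \<Rightarrow> 'v option) \<Rightarrow> ('a \<Rightarrow> 'v option) \<Rightarrow> bool" where
  "same_special I X X' \<longleftrightarrow> (\<forall>a\<in>assets I. (special I (X a) \<longrightarrow> X' a = X a) \<and> (special I (X' a) \<longrightarrow> X' a = X a))"

lemma same_specialI:
  assumes "\<And>a. a \<in> assets I \<Longrightarrow> special I (X a) \<Longrightarrow> X' a = X a"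
    "\<And>a. a \<in> assets I \<Longrightarrow> \<not> special I (X a) \<Longrightarrow> \<not> special I (X' a)"
  shows "same_special I X X'"
  using assms unfolding same_special_def by blast

lemma same_specialD:
  assumes "same_special I X X'" "a \<in> assets I"
  shows "special I (X a) \<Longrightarrow> X' a = X a" "special I (X' a) \<longleftrightarrow> special I (X a)"
proof -
  have 1: "special I (X a) \<longrightarrow> X' a = X a" and 2: "special I (X' a) \<longrightarrow> X' a = X a"
    using assms unfolding same_special_def by blast+
  then show "special I (X a) \<Longrightarrow> X' a = X a" by blast
  show "special I (X' a) \<longleftrightarrow> special I (X a)"
  proof
    assume "special I (X' a)"
    with 2 have "X' a = X a" by blast
    with \<open>special I (X' a)\<close> show "special I (X a)" by simp
  next
    assume "special I (X a)"
    with 1 have "X' a = X a" by blast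
    with \<open>special I (X a)\<close> show "special I (X' a)" by simp
  qed
qed

lemma same_special_refl: "same_special I X X"
  by (rule same_specialI) simp_all

lemma midwayI: "a \<in> assets I \<Longrightarrow> \<not> special I (X a) \<Longrightarrow> \<exists>v. X a = Some v \<and> v \<in> midway I X"
  unfolding special_def midway_def occupied_def by (cases "X a") auto

lemma separatedD:
  assumes "separated I X" "a \<in> assets I" "b \<in> assets I" "X a = X b" "\<not> special I (X a)"
  shows "a = b"
proof (rule ccontr)
  assume "a \<noteq> b"
  with assms(1-4) have "X a \<in> {Some (source I), Some (target I), None}" unfolding separated_def by blast
  with assms(5) show False by (simp add: special_def)
qed

lemma same_special_trans:
  assumes "same_special I X Y" "same_special I Y Z"
  shows "same_special I X Z"
proof (rule same_specialI)
  fix a assume a: "a \<in> assets I"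
  note 1 = same_specialD[OF assms(1) a] and 2 = same_specialD[OF assms(2) a]
  show "Z a = X a" if "special I (X a)" using 1 2 that by simp
  show "\<not> special I (Z a)" if "\<not> special I (X a)" using 1(2) 2(2) that by simp
qed

text \<open>Assets at special locations are fixed. In both configurations the others occupy the same
  vertices, each of them once; so one assignment followed by the inverse of the other permutes
  them.\<close>

lemma relabels_of_same_special:
  assumes "separated I Y" "separated I Z" "same_special I X Y" "same_special I X Z" "midway I Y = midway I Z"
  shows "\<exists>\<pi>. relabels I \<pi> Y Z"
proof -
  define M where "M = {a \<in> assets I. \<not> special I (X a)}"
  have nsp: "\<not> special I (Y a)" "\<not> special I (Z a)" if "a \<in> M" for a
    using that same_specialD(2)[OF assms(3)] same_specialD(2)[OF assms(4)] by (simp_all add: M_def)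
  have inj: "inj_on W M" if "separated I W" "\<And>a. a \<in> M \<Longrightarrow> \<not> special I (W a)" for W
  proof (rule inj_onI)
    fix a b assume ab: "a \<in> M" "b \<in> M" "W a = W b"
    then have "a \<in> assets I" "b \<in> assets I" by (simp_all add: M_def)
    from separatedD[OF that(1) this ab(3) that(2)[OF ab(1)]] show "a = b" .
  qed
  note inj = inj[OF assms(1) nsp(1)] inj[OF assms(2) nsp(2)]
  have img: "W ` M = Some ` midway I W" if W: "same_special I X W" for W
  proof (intro equalityI subsetI)
    fix x assume "x \<in> W ` M"
    then obtain a where a: "a \<in> assets I" "\<not> special I (X a)" "x = W a" by (auto simp: M_def)
    then have "\<not> special I (W a)" using same_specialD(2)[OF W] by simp
    then obtain v where "W a = Some v" "v \<noteq> source I" "v \<noteq> target I" by (auto simp: special_def)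
    with a show "x \<in> Some ` midway I W" by (auto simp: midway_def occupied_def)
  next
    fix x assume "x \<in> Some ` midway I W"
    then obtain a v where a: "a \<in> assets I" "W a = Some v" "x = Some v" "v \<noteq> source I" "v \<noteq> target I"
      by (auto simp: midway_def occupied_def)
    then have "\<not> special I (W a)" by (simp add: special_def)
    then have "\<not> special I (X a)" using same_specialD(2)[OF W a(1)] by simp
    with a show "x \<in> W ` M" by (force simp: M_def)
  qed
  have YZ: "Y ` M = Z ` M" using img[OF assms(3)] img[OF assms(4)] assms(5) by simp
  define \<pi> where "\<pi> a = (if a \<in> M then inv_into M Y (Z a) else a)" for a
  have bij: "bij_betw (\<lambda>a. inv_into M Y (Z a)) M M"
  proof -
    have "bij_betw (inv_into M Y \<circ> Z) M M"
    proof (rule bij_betw_trans)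
      show "bij_betw Z M (Z ` M)" using inj(2) by (rule inj_on_imp_bij_betw)
      show "bij_betw (inv_into M Y) (Z ` M) M"
        using bij_betw_inv_into[OF inj_on_imp_bij_betw[OF inj(1)]] unfolding YZ .
    qed
    then show ?thesis by (simp add: comp_def)
  qed
  have "bij_betw \<pi> M M" by (rule bij_betw_cong[THEN iffD1, OF _ bij]) (simp add: \<pi>_def)
  moreover have "bij_betw \<pi> (assets I - M) (assets I - M)"
    by (rule bij_betw_cong[THEN iffD1, OF _ bij_betw_id]) (simp add: \<pi>_def)
  ultimately have "bij_betw \<pi> (M \<union> (assets I - M)) (M \<union> (assets I - M))"
    by (rule bij_betw_combine) auto
  moreover have "M \<union> (assets I - M) = assets I" by (auto simp: M_def)
  moreover have "Z a = Y (\<pi> a)" if "a \<in> assets I" for a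
  proof (cases "a \<in> M")
    case True
    with YZ show ?thesis by (simp add: \<pi>_def f_inv_into_f)
  next
    case False
    with that have "special I (X a)" by (simp add: M_def)
    then have "Z a = X a" "Y a = X a"
      using that same_specialD(1)[OF assms(3)] same_specialD(1)[OF assms(4)] by simp_all
    with False show ?thesis by (simp add: \<pi>_def)
  qed
  ultimately show ?thesis unfolding relabels_def by auto
qed

text \<open>\<open>B\<close> bounds the reload times. It will also bound the timers and the
  durations of long steps, and thereby their number of binary digits.\<close>

locale routing =
  fixes I :: "('a, 'v) routing_instance" and B :: nat
  assumes inst: "routing_instance I" and B: "1 \<le> B" "\<And>r. r \<in> traps I \<Longrightarrow> reload I r \<le> B"
begin

lemma inst_facts:
  "finite (assets I)" "finite (vertices I)" "source I \<noteq> target I" "source I \<in> vertices I"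
  "traps I \<subseteq> vertices I" "source I \<notin> traps I" "target I \<notin> traps I" "finite (traps I)"
  "\<And>u v. {u, v} \<in> edges I \<Longrightarrow> u \<in> vertices I \<and> v \<in> vertices I"
  "\<And>e. e \<in> edges I \<Longrightarrow> card e = 2"
proof -
  have *: "finite (assets I)" "finite (vertices I)" "source I \<noteq> target I" "source I \<in> vertices I"
    "traps I \<subseteq> vertices I - {source I, target I}" "edges I \<subseteq> {e. e \<subseteq> vertices I \<and> card e = 2}"
    using inst by (auto simp: routing_instance_def)
  then show "finite (assets I)" "finite (vertices I)" "source I \<noteq> target I" "source I \<in> vertices I"
    "traps I \<subseteq> vertices I" "source I \<notin> traps I" "target I \<notin> traps I"
    "\<And>u v. {u, v} \<in> edges I \<Longrightarrow> u \<in> vertices I \<and> v \<in> vertices I" "\<And>e. e \<in> edges I \<Longrightarrow> card e = 2"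
    by auto
  show "finite (traps I)" using *(2,5) by (rule finite_subset[rotated, OF finite_Diff])
qed

definition bounded :: "('v \<Rightarrow> nat) \<Rightarrow> bool" where
  "bounded \<beta> \<longleftrightarrow> (\<forall>r\<in>traps I. \<beta> r \<le> B)"

lemma move_placed:
  assumes "move I X \<beta> X'" "placed I X"
  shows "placed I X'"
  unfolding placed_def
proof (intro ballI allI impI)
  fix a v assume a: "a \<in> assets I" "X' a = Some v"
  from assms(1) a(1) have "asset_move I \<beta> (X a) (X' a)" by (simp add: move_def)
  then show "v \<in> vertices I"
  proof (cases rule: asset_moveE)
    case (3 u w)
    with a(2) inst_facts(9) show ?thesis by auto
  qed (use a assms(2) in \<open>auto simp: placed_def\<close>)
qed

lemma countdown_bounded: "countdown I d X \<beta> \<beta>' \<Longrightarrow> bounded \<beta> \<Longrightarrow> bounded \<beta>'"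
  using B(2) by (auto simp: countdown_def bounded_def intro: le_trans[OF diff_le_self])

lemma quiet_step_facts:
  assumes "quiet_step I X \<beta> X' \<beta>'" "placed I X"
  shows "\<And>r. r \<in> traps I \<Longrightarrow> \<beta>' r = \<beta> r - 1 \<and> \<beta> r \<noteq> 1" "passable I \<beta>' = passable I \<beta>"
    "same_special I X X'" "midway I X \<subseteq> passable I \<beta>"
proof -
  from assms(1) have mv: "move I X \<beta> X'" and cd: "countdown I 1 X \<beta> \<beta>'" and rev: "reversible I X X'"
    and n1: "\<And>r. r \<in> traps I \<Longrightarrow> \<beta> r \<noteq> 1" by (auto simp: quiet_step_def)
  have am: "asset_move I \<beta> (X a) (X' a)" if "a \<in> assets I" for a using mv that by (simp add: move_def)
  have unocc: "\<beta> r \<noteq> 0" if "r \<in> traps I" "occupied I X r" for r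
  proof
    assume "\<beta> r = 0"
    from that(2) obtain a where a: "a \<in> assets I" "X a = Some r" by (auto simp: occupied_def)
    have "\<not> finished I (X a)" using a(2) that(1) inst_facts(7) by (auto simp: finished_def)
    with am[OF a(1)] a(2) that(1) \<open>\<beta> r = 0\<close> have "X' a = None" by (auto simp: asset_move_def)
    with rev a show False by (auto simp: reversible_def)
  qed
  show *: "\<beta>' r = \<beta> r - 1 \<and> \<beta> r \<noteq> 1" if "r \<in> traps I" for r
  proof -
    have "\<not> (\<beta> r = 0 \<and> occupied I X r)" using unocc that by blast
    with cd n1 that show ?thesis by (auto simp: countdown_def)
  qed
  have "\<beta>' r = 0 \<longleftrightarrow> \<beta> r = 0" if "r \<in> traps I" for r using *[OF that] by auto
  then show "passable I \<beta>' = passable I \<beta>" by (auto simp: passable_def)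
  show "same_special I X X'"
  proof (rule same_specialI)
    fix a assume a: "a \<in> assets I"
    have "X' a = X a \<or> \<not> special I (X a) \<and> \<not> special I (X' a)"
      using am[OF a]
    proof (cases rule: asset_moveE)
      case (2 r)
      with rev a show ?thesis by (auto simp: reversible_def)
    next
      case (3 u v)
      then show ?thesis using rev a by (auto simp: reversible_def special_def finished_def)
    qed simp
    then show "special I (X a) \<Longrightarrow> X' a = X a" "\<not> special I (X a) \<Longrightarrow> \<not> special I (X' a)"
      by auto
  qed
  show "midway I X \<subseteq> passable I \<beta>"
  proof
    fix v assume v: "v \<in> midway I X"
    then have "v \<in> vertices I" using assms(2) by (auto simp: midway_def occupied_def placed_def)
    with v unocc[of v] show "v \<in> passable I \<beta>" by (auto simp: midway_def passable_def)
  qed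
qed

lemma pebbles: "pebbles (passable I \<beta>) (edges I)"
  by unfold_locales (use inst_facts in \<open>auto simp: passable_def\<close>)

abbreviation "pebble_shift \<beta> \<equiv> pebbles.shift (passable I \<beta>) (edges I)"

lemma shift_iff:
  "(C, C') \<in> pebble_shift \<beta> \<longleftrightarrow> C \<subseteq> passable I \<beta> \<and> C' \<subseteq> passable I \<beta> \<and>
     (\<exists>f. bij_betw f C C' \<and> (\<forall>x\<in>C. f x = x \<or> {x, f x} \<in> edges I) \<and> (\<exists>x\<in>C. f x \<noteq> x))"
proof -
  have "(\<forall>x\<in>C. f x = x \<or> (x, f x) \<in> pebbles.adj (passable I \<beta>) (edges I)) \<longleftrightarrow>
      (\<forall>x\<in>C. f x = x \<or> {x, f x} \<in> edges I)"
    if "C \<subseteq> passable I \<beta>" "C' \<subseteq> passable I \<beta>" "bij_betw f C C'" for f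
    using that bij_betwE[OF that(3)] unfolding pebbles.adj_def[OF pebbles] by blast
  then show ?thesis unfolding pebbles.shift_def[OF pebbles] by blast
qed

text \<open>Away from the special locations a vertex determines the asset that occupies it; the
  bijection sends the vertex to the place where this asset moves.\<close>

lemma quiet_step_shift:
  assumes "quiet_step I X \<beta> X' \<beta>'" "placed I X"
  shows "(midway I X, midway I X') \<in> pebble_shift \<beta>"
  unfolding shift_iff
proof (intro conjI)
  from assms(1) have mv: "move I X \<beta> X'" by (auto simp: quiet_step_def)
  note facts = quiet_step_facts[OF assms]
  show sub: "midway I X \<subseteq> passable I \<beta>" by (rule facts(4))
  have sep: "separated I X" "separated I X'" using mv by (auto simp: move_def)
  have ex1: "\<exists>!a. a \<in> assets I \<and> X a = Some v" if "v \<in> midway I X" for v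
  proof (rule ex_ex1I)
    show "\<exists>a. a \<in> assets I \<and> X a = Some v" using that by (auto simp: midway_def occupied_def)
    fix a b assume "a \<in> assets I \<and> X a = Some v" "b \<in> assets I \<and> X b = Some v"
    with that show "a = b" by (intro separatedD[OF sep(1)]) (auto simp: special_def midway_def)
  qed
  define who where "who v = (THE a. a \<in> assets I \<and> X a = Some v)" for v
  have who: "who v \<in> assets I" "X (who v) = Some v" if "v \<in> midway I X" for v
    using theI'[OF ex1[OF that]] unfolding who_def by auto
  have who_eq: "who v = a" if "a \<in> assets I" "X a = Some v" "v \<in> midway I X" for a v
    using ex1[OF that(3)] who[OF that(3)] that(1,2) by blast
  define f where "f v = the (X' (who v))" for v
  have step: "X' (who v) = Some (f v)" "f v \<in> midway I X'" "f v = v \<or> {v, f v} \<in> edges I"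
    if v: "v \<in> midway I X" for v
  proof -
    note w = who[OF v]
    have "\<not> special I (X (who v))" using v w by (auto simp: special_def midway_def)
    then have nsp: "\<not> special I (X' (who v))" using same_specialD(2)[OF facts(3) w(1)] by simp
    then show *: "X' (who v) = Some (f v)" by (auto simp: special_def f_def)
    with nsp w(1) show "f v \<in> midway I X'" by (auto simp: midway_def occupied_def special_def)
    have "asset_move I \<beta> (X (who v)) (X' (who v))" using mv w(1) by (simp add: move_def)
    then show "f v = v \<or> {v, f v} \<in> edges I" unfolding * w(2) by (auto elim: asset_moveE)
  qed
  have "inj_on f (midway I X)"
  proof (rule inj_onI)
    fix u v assume uv: "u \<in> midway I X" "v \<in> midway I X" "f u = f v"
    have "X' (who u) = X' (who v)" unfolding step(1)[OF uv(1)] step(1)[OF uv(2)] uv(3) ..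
    moreover have "\<not> special I (X' (who u))"
      unfolding step(1)[OF uv(1)] using step(2)[OF uv(1)] unfolding special_def midway_def by blast
    ultimately have "who u = who v" by (rule separatedD[OF sep(2) who(1)[OF uv(1)] who(1)[OF uv(2)]])
    with who(2)[OF uv(1)] who(2)[OF uv(2)] show "u = v" by (metis option.inject)
  qed
  moreover have "f ` midway I X = midway I X'"
  proof (intro equalityI subsetI)
    fix v assume v: "v \<in> midway I X'"
    then obtain a where a: "a \<in> assets I" "X' a = Some v" by (auto simp: midway_def occupied_def)
    have "\<not> special I (X' a)" using v a by (auto simp: special_def midway_def)
    then have "\<not> special I (X a)" using same_specialD(2)[OF facts(3) a(1)] by simp
    then obtain u where u: "X a = Some u" "u \<in> midway I X" using midwayI[OF a(1)] by blast
    with who_eq[OF a(1) u] a(2) have "f u = v" by (simp add: f_def)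
    with u(2) show "v \<in> f ` midway I X" by blast
  next
    fix y assume "y \<in> f ` midway I X"
    with step(2) show "y \<in> midway I X'" by blast
  qed
  ultimately have bij: "bij_betw f (midway I X) (midway I X')" by (simp add: bij_betw_def)
  have "\<exists>v\<in>midway I X. f v \<noteq> v"
  proof -
    obtain a where a: "a \<in> assets I" "X' a \<noteq> X a" using mv by (auto simp: move_def)
    then have "\<not> special I (X a)" using same_specialD(1)[OF facts(3) a(1)] by blast
    then obtain u where u: "X a = Some u" "u \<in> midway I X" using midwayI[OF a(1)] by blast
    from who_eq[OF a(1) u] step(1)[OF u(2)] a(2) u show ?thesis by (intro bexI[of _ u]) auto
  qed
  with bij step(3) show "\<exists>f. bij_betw f (midway I X) (midway I X') \<and>
      (\<forall>x\<in>midway I X. f x = x \<or> {x, f x} \<in> edges I) \<and> (\<exists>x\<in>midway I X. f x \<noteq> x)" by blast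
  show "midway I X' \<subseteq> passable I \<beta>"
  proof
    fix v assume v: "v \<in> midway I X'"
    then obtain a where a: "a \<in> assets I" "X' a = Some v" by (auto simp: midway_def occupied_def)
    then have "v \<in> vertices I" using move_placed[OF mv assms(2)] by (auto simp: placed_def)
    moreover have "\<beta> v \<noteq> 0" if "v \<in> traps I"
      using assms(1) that a by (auto simp: quiet_step_def occupied_def)
    ultimately show "v \<in> passable I \<beta>" using v by (auto simp: passable_def midway_def)
  qed
qed

text \<open>No timer reaches 0 during a quiet run, so a timer that is positive at the beginning
  exceeds the length of the run. This is what bounds the duration when the run is
  compressed.\<close>

lemma quiet_run_facts:
  assumes "quiet_run I d X \<beta> X' \<beta>'" "placed I X" "separated I X"
  shows "placed I X' \<and> separated I X' \<and> same_special I X X' \<and>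
    (\<forall>r\<in>traps I. \<beta>' r = \<beta> r - d \<and> (\<beta> r = 0 \<or> d < \<beta> r)) \<and>
    (midway I X, midway I X') \<in> pebble_shift \<beta> ^^ d"
  using assms
proof (induction d arbitrary: X \<beta>)
  case 0
  then show ?case by (auto simp: same_special_refl)
next
  case (Suc d)
  then obtain X1 \<beta>1 where q: "quiet_step I X \<beta> X1 \<beta>1" "quiet_run I d X1 \<beta>1 X' \<beta>'" by auto
  then have mv: "move I X \<beta> X1" by (simp add: quiet_step_def)
  have "placed I X1" "separated I X1" using move_placed[OF mv Suc.prems(2)] mv by (auto simp: move_def)
  note IH = Suc.IH[OF q(2) this]
  note facts = quiet_step_facts[OF q(1) Suc.prems(2)]
  have "\<beta>' r = \<beta> r - Suc d \<and> (\<beta> r = 0 \<or> Suc d < \<beta> r)" if "r \<in> traps I" for r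
    using IH facts(1)[OF that] that by auto
  moreover have "(midway I X, midway I X') \<in> pebble_shift \<beta> ^^ Suc d"
    using relpow_Suc_I2[OF quiet_step_shift[OF q(1) Suc.prems(2)]] IH facts(2) by simp
  ultimately show ?case using IH same_special_trans[OF facts(3)] by blast
qed

text \<open>The converse of \<open>quiet_step_shift\<close>: each asset on its way follows the
  bijection at its vertex, the others stay.\<close>

lemma move_of_shift:
  assumes sep: "separated I X" and sh: "(midway I X, C) \<in> pebble_shift \<beta>"
  shows "\<exists>X'. move I X \<beta> X' \<and> reversible I X X' \<and> same_special I X X' \<and> midway I X' = C"
proof -
  obtain f where f: "bij_betw f (midway I X) C" "\<And>x. x \<in> midway I X \<Longrightarrow> f x = x \<or> {x, f x} \<in> edges I"
    "\<exists>x\<in>midway I X. f x \<noteq> x" and sub: "midway I X \<subseteq> passable I \<beta>" "C \<subseteq> passable I \<beta>"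
    using sh unfolding shift_iff by blast
  define X' where "X' a = (if special I (X a) then X a else Some (f (the (X a))))" for a
  have mid: "\<exists>v. X a = Some v \<and> v \<in> midway I X \<and> X' a = Some (f v) \<and> f v \<in> C"
    if "a \<in> assets I" "\<not> special I (X a)" for a
  proof -
    from midwayI[of a I X, OF that] obtain v where "X a = Some v" "v \<in> midway I X" by blast
    with that bij_betwE[OF f(1)] show ?thesis by (simp add: X'_def)
  qed
  have C: "v \<noteq> source I" "v \<noteq> target I" "v \<notin> traps I \<or> \<beta> v \<noteq> 0" if "v \<in> C \<or> v \<in> midway I X" for v
    using sub that by (auto simp: passable_def)
  have nsp: "\<not> special I (X' a)" if "a \<in> assets I" "\<not> special I (X a)" for a
  proof -
    from mid[OF that] obtain v where "X' a = Some (f v)" "f v \<in> C" by blast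
    with C[of "f v"] show ?thesis by (simp add: special_def)
  qed
  have sp: "same_special I X X'"
    by (rule same_specialI) (use nsp in \<open>auto simp: X'_def\<close>)
  have "separated I X'"
    unfolding separated_def
  proof (intro ballI impI)
    fix a b assume ab: "a \<in> assets I" "b \<in> assets I" "a \<noteq> b" "X' a = X' b"
    show "X' a \<in> {Some (source I), Some (target I), None}"
    proof (cases "special I (X' a)")
      case False
      then have nsp': "\<not> special I (X a)" "\<not> special I (X b)" using ab(4) by (auto simp: X'_def)
      from mid[OF ab(1) nsp'(1)] mid[OF ab(2) nsp'(2)] ab(4) obtain u v where
        uv: "X a = Some u" "X b = Some v" "u \<in> midway I X" "v \<in> midway I X" "f u = f v" by auto
      with f(1) have "u = v" by (auto simp: bij_betw_def inj_on_def)
      with sep[unfolded separated_def, rule_format, OF ab(1,2,3)] uv nsp'(1) show ?thesis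
        by (simp add: special_def)
    qed (auto simp: special_def)
  qed
  moreover have "asset_move I \<beta> (X a) (X' a)" if a: "a \<in> assets I" for a
  proof (cases "special I (X a)")
    case True
    then have "X' a = X a" by (simp add: X'_def)
    moreover have n: "(\<exists>r\<in>traps I. X a = Some r \<and> \<beta> r = 0) = False"
      using True inst_facts(6,7) by (auto simp: special_def)
    ultimately show ?thesis unfolding asset_move_def n by simp
  next
    case False
    from mid[OF a this] obtain v where v: "X a = Some v" "v \<in> midway I X" "X' a = Some (f v)" "f v \<in> C" by blast
    have n: "(\<exists>r\<in>traps I. X a = Some r \<and> \<beta> r = 0) = False" using v C[of v] by auto
    have "\<not> finished I (X a)" using False by (auto simp: special_def finished_def)
    then show ?thesis using v f(2)[OF v(2)] C[of "f v"] unfolding asset_move_def n by auto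
  qed
  moreover have "\<exists>a\<in>assets I. X' a \<noteq> X a"
  proof -
    from f(3) obtain v a where "v \<in> midway I X" "f v \<noteq> v" "a \<in> assets I" "X a = Some v"
      by (auto simp: midway_def occupied_def)
    then show ?thesis by (intro bexI[of _ a]) (auto simp: X'_def special_def midway_def)
  qed
  ultimately have mv: "move I X \<beta> X'" using sep by (simp add: move_def)
  have "midway I X' = C"
  proof (intro equalityI subsetI)
    fix v assume "v \<in> midway I X'"
    then obtain a where a: "a \<in> assets I" "X' a = Some v" "\<not> special I (X' a)"
      by (auto simp: midway_def occupied_def special_def)
    then have "\<not> special I (X a)" by (auto simp: X'_def)
    from mid[OF a(1) this] a(2) show "v \<in> C" by auto
  next
    fix v assume v: "v \<in> C"
    then obtain u where "u \<in> midway I X" "v = f u" using f(1) by (auto simp: bij_betw_def)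
    moreover then obtain a where "a \<in> assets I" "X a = Some u" "\<not> special I (X a)"
      by (auto simp: midway_def occupied_def special_def)
    ultimately have "occupied I X' v" unfolding occupied_def by (intro bexI[of _ a]) (simp_all add: X'_def)
    with v C[of v] show "v \<in> midway I X'" unfolding midway_def by blast
  qed
  moreover have "reversible I X X'"
    unfolding reversible_def
  proof (intro ballI impI)
    fix a assume a: "a \<in> assets I" "X' a \<noteq> X a"
    then have "\<not> special I (X a)" by (auto simp: X'_def)
    with nsp[OF a(1) this] show "X a \<noteq> Some (source I) \<and> X' a \<noteq> Some (target I) \<and> X' a \<noteq> None"
      by (auto simp: special_def)
  qed
  ultimately show ?thesis using mv sp by blast
qed

section \<open>Replacing a quiet run by few long steps\<close>

fun long_wins :: "nat \<Rightarrow> ('a \<Rightarrow> 'v option) \<Rightarrow> ('v \<Rightarrow> nat) \<Rightarrow> bool" where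
  "long_wins 0 X \<beta> \<longleftrightarrow> final I X"
| "long_wins (Suc n) X \<beta> \<longleftrightarrow>
     (\<exists>d X' \<beta>'. d \<le> B \<and> long_step I d X \<beta> X' \<beta>' \<and> long_wins n X' \<beta>')"

lemma midway_passable_traps:
  assumes "midway I X \<subseteq> passable I \<beta>" "r \<in> traps I" "occupied I X r"
  shows "\<beta> r \<noteq> 0"
proof -
  have "r \<in> midway I X" using assms(2,3) inst_facts(6,7) by (auto simp: midway_def)
  with assms(1,2) show ?thesis by (auto simp: passable_def)
qed

lemma long_step_of_shift:
  assumes "separated I X" "(midway I X, C) \<in> pebble_shift \<beta>" "odd d"
    and "\<And>r. r \<in> traps I \<Longrightarrow> \<beta> r = 0 \<or> d \<le> \<beta> r"
  shows "\<exists>X'. long_step I d X \<beta> X' (\<lambda>r. \<beta> r - d) \<and> same_special I X X' \<and> midway I X' = C \<and> separated I X'"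
proof -
  obtain X' where X': "move I X \<beta> X'" "reversible I X X'" "same_special I X X'" "midway I X' = C"
    using move_of_shift[OF assms(1,2)] by blast
  have "midway I X \<subseteq> passable I \<beta>" "midway I X' \<subseteq> passable I \<beta>"
    using assms(2) unfolding shift_iff X'(4) by auto
  then have occ: "\<beta> r \<noteq> 0" if "r \<in> traps I" "occupied I X r \<or> occupied I X' r" for r
    using midway_passable_traps that by blast
  have "long_step I d X \<beta> X' (\<lambda>r. \<beta> r - d)"
    unfolding long_step_def countdown_def using X'(1,2) assms(3,4) occ by fastforce
  moreover have "separated I X'" using X'(1) by (simp add: move_def)
  ultimately show ?thesis using X' by blast
qed

text \<open>A walk of pebbles is carried out by steps of duration 1. Positive timers exceed the
  length of the walk, so the set of active traps, and with it the pebble graph, is the same in all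
  these steps.\<close>

lemma long_wins_of_walk:
  assumes "separated I X" "(midway I X, C) \<in> pebble_shift \<beta> ^^ k"
    and "\<And>r. r \<in> traps I \<Longrightarrow> \<beta> r = 0 \<or> k < \<beta> r"
  shows "\<exists>X'. same_special I X X' \<and> midway I X' = C \<and> separated I X' \<and>
    (\<forall>n. long_wins n X' (\<lambda>r. \<beta> r - k) \<longrightarrow> long_wins (k + n) X \<beta>)"
  using assms
proof (induction k arbitrary: X \<beta>)
  case 0
  then show ?case by (intro exI[of _ X]) (simp add: same_special_refl)
next
  case (Suc k)
  obtain C1 where C1: "(midway I X, C1) \<in> pebble_shift \<beta>" "(C1, C) \<in> pebble_shift \<beta> ^^ k"
    using relpow_Suc_D2[OF Suc.prems(2)] by blast
  have "\<exists>X'. long_step I 1 X \<beta> X' (\<lambda>r. \<beta> r - 1) \<and> same_special I X X' \<and> midway I X' = C1 \<and> separated I X'"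
    by (rule long_step_of_shift[OF Suc.prems(1) C1(1)]) (use Suc.prems(3) in force)+
  then obtain X1 where X1: "long_step I 1 X \<beta> X1 (\<lambda>r. \<beta> r - 1)" "same_special I X X1"
    "midway I X1 = C1" "separated I X1" by blast
  have pos: "\<beta> r - 1 = 0 \<longleftrightarrow> \<beta> r = 0" "\<beta> r - 1 = 0 \<or> k < \<beta> r - 1" if "r \<in> traps I" for r
    using Suc.prems(3)[OF that] by auto
  have p: "passable I (\<lambda>r. \<beta> r - 1) = passable I \<beta>" using pos(1) unfolding passable_def by blast
  have w: "(midway I X1, C) \<in> pebble_shift (\<lambda>r. \<beta> r - 1) ^^ k" using C1(2) unfolding X1(3) p .
  from Suc.IH[OF X1(4) w pos(2)] obtain X' where X': "same_special I X1 X'" "midway I X' = C" "separated I X'"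
    "\<And>n. long_wins n X' (\<lambda>r. \<beta> r - 1 - k) \<Longrightarrow> long_wins (k + n) X1 (\<lambda>r. \<beta> r - 1)" by blast
  have "long_wins (Suc k + n) X \<beta>" if "long_wins n X' (\<lambda>r. \<beta> r - Suc k)" for n
  proof -
    have "long_wins (k + n) X1 (\<lambda>r. \<beta> r - 1)" by (rule X'(4)) (use that in simp)
    with X1(1) B(1) show ?thesis by auto
  qed
  with X' same_special_trans[OF X1(2)] show ?case by blast
qed

lemma long_wins_cong:
  assumes "long_wins n X \<beta>" "\<And>r. r \<in> traps I \<Longrightarrow> \<gamma> r = \<beta> r"
  shows "long_wins n X \<gamma>"
proof (cases n)
  case (Suc m)
  with assms(1) obtain d X' \<beta>' where *: "d \<le> B" "long_step I d X \<beta> X' \<beta>'" "long_wins m X' \<beta>'" by auto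
  have "move I X \<gamma> X'" by (rule move_cong[of I X \<beta>]) (use * assms(2) in \<open>auto simp: long_step_def\<close>)
  with *(2) assms(2) have "long_step I d X \<gamma> X' \<beta>'" by (simp add: long_step_def countdown_def)
  with * Suc show ?thesis by auto
qed (use assms in simp)

definition walk_length :: nat where
  "walk_length = 2 * card (vertices I) ^ 3 + 4 * (card (vertices I))\<^sup>2 + 3"

lemma walk_bound_le: "pebbles.walk_bound (passable I \<beta>) \<le> walk_length"
proof -
  have "card (passable I \<beta>) \<le> card (vertices I)"
    using inst_facts(2) by (intro card_mono) (auto simp: passable_def)
  then have "card (passable I \<beta>) ^ n \<le> card (vertices I) ^ n" for n by (rule power_mono) simp
  from this[of 3] this[of 2] show ?thesis
    unfolding pebbles.walk_bound_def[OF pebbles] walk_length_def by linarith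
qed

text \<open>The first shift of a short walk of the same parity absorbs the time that is saved, the
  other shifts have duration 1; so the timers end as in the original run. Of the locations only the
  set of occupied vertices is reproduced, hence the permutation \<open>\<pi>\<close>.\<close>

lemma quiet_run_compress:
  assumes run: "quiet_run I d X \<beta> X1 \<beta>1" "1 \<le> d" and X: "placed I X" "separated I X" "bounded \<beta>"
  shows "\<exists>k X2 \<pi>. k \<le> walk_length \<and> relabels I \<pi> X1 X2 \<and>
    (\<forall>n. long_wins n X2 \<beta>1 \<longrightarrow> long_wins (k + n) X \<beta>)"
proof -
  note facts = quiet_run_facts[OF run(1) X(1,2)]
  from run obtain d' Y \<gamma> where "quiet_step I X \<beta> Y \<gamma>" by (cases d) auto
  then have sub: "midway I X \<subseteq> passable I \<beta>" by (rule quiet_step_facts(4)[OF _ X(1)])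
  from facts have walk: "(midway I X, midway I X1) \<in> pebble_shift \<beta> ^^ d" by blast
  obtain l where l: "1 \<le> l" "l \<le> walk_length" "even l \<longleftrightarrow> even d" "l \<le> d"
    "(midway I X, midway I X1) \<in> pebble_shift \<beta> ^^ l"
  proof -
    from pebbles.short_walk_parity[OF pebbles walk run(2) sub] walk_bound_le[of \<beta>] obtain l where
      l: "1 \<le> l" "l \<le> walk_length" "even l \<longleftrightarrow> even d" "(midway I X, midway I X1) \<in> pebble_shift \<beta> ^^ l"
      by (meson le_trans)
    show ?thesis
    proof (cases "l \<le> d")
      case True
      with l show ?thesis by (intro that[of l])
    next
      \<comment> \<open>If the walk that was found is longer than the run, the run itself is short
        enough.\<close>
      case False
      with l run(2) walk show ?thesis by (intro that[of d]) auto
    qed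
  qed
  obtain m where m: "l = Suc m" using l(1) by (cases l) auto
  obtain C1 where C1: "(midway I X, C1) \<in> pebble_shift \<beta>" "(C1, midway I X1) \<in> pebble_shift \<beta> ^^ m"
    using relpow_Suc_D2[OF l(5)[unfolded m]] by blast
  \<comment> \<open>This is odd because \<open>d\<close> and \<open>l\<close> have the same parity.
    If no trap is waiting, \<open>d\<close> is not bounded, but there is no clock to respect either,
    so duration 1 will do. Otherwise a positive timer exceeds \<open>d\<close>, and timers are at
    most \<open>B\<close>, so the duration does not exceed \<open>B\<close>.\<close>
  define e where "e = (if \<exists>r\<in>traps I. \<beta> r \<noteq> 0 then 1 + (d - l) else 1)"
  have "odd e" using l(3,4) by (auto simp: e_def)
  have late: "\<beta> r = 0 \<or> d < \<beta> r" if "r \<in> traps I" for r using facts that by blast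
  have e: "\<beta> r = 0 \<or> e \<le> \<beta> r" "\<beta> r - e = 0 \<longleftrightarrow> \<beta> r = 0" "\<beta> r - e = 0 \<or> m < \<beta> r - e"
    "\<beta> r - e - m = \<beta> r - d" if "r \<in> traps I" for r
    using late[OF that] that l(1,4) m by (auto simp: e_def)
  have "e \<le> B"
  proof (cases "\<exists>r\<in>traps I. \<beta> r \<noteq> 0")
    case True
    then obtain r where r: "r \<in> traps I" "\<beta> r \<noteq> 0" by blast
    with late[OF r(1)] X(3) have "d < B" by (auto simp: bounded_def)
    moreover have "1 + (d - l) \<le> d" using l(1,4) by linarith
    ultimately show ?thesis by (auto simp: e_def)
  qed (use B(1) in \<open>simp add: e_def\<close>)
  obtain Y where Y: "long_step I e X \<beta> Y (\<lambda>r. \<beta> r - e)" "same_special I X Y" "midway I Y = C1" "separated I Y"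
    using long_step_of_shift[OF X(2) C1(1) \<open>odd e\<close> e(1)] by blast
  have p: "passable I (\<lambda>r. \<beta> r - e) = passable I \<beta>" using e(2) unfolding passable_def by blast
  have w: "(midway I Y, midway I X1) \<in> pebble_shift (\<lambda>r. \<beta> r - e) ^^ m" using C1(2) unfolding Y(3) p .
  from long_wins_of_walk[OF Y(4) w e(3)] obtain X2 where X2: "same_special I Y X2"
    "midway I X2 = midway I X1" "separated I X2"
    "\<And>n. long_wins n X2 (\<lambda>r. \<beta> r - e - m) \<Longrightarrow> long_wins (m + n) Y (\<lambda>r. \<beta> r - e)" by blast
  have sp: "same_special I X X1" "separated I X1" using facts by blast+
  obtain \<pi> where \<pi>: "relabels I \<pi> X1 X2"
    using relabels_of_same_special[OF sp(2) X2(3) sp(1) same_special_trans[OF Y(2) X2(1)]] X2(2) by auto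
  have "long_wins (l + n) X \<beta>" if "long_wins n X2 \<beta>1" for n
  proof -
    have "long_wins n X2 (\<lambda>r. \<beta> r - e - m)"
      by (rule long_wins_cong[OF that]) (use facts e(4) in auto)
    from X2(4)[OF this] Y(1) \<open>e \<le> B\<close> show ?thesis unfolding m by auto
  qed
  with l(2) \<pi> show ?thesis by blast
qed

section \<open>A potential that bounds the number of steps that are not quiet\<close>

definition rank :: "('v \<Rightarrow> nat) \<Rightarrow> 'v option \<Rightarrow> nat" where
  "rank \<beta> x = (if x = Some (source I) then 3 else if finished I x then 0
     else if \<exists>r\<in>traps I. x = Some r \<and> \<beta> r = 0 then 1 else 2)"

text \<open>A lexicographic order written as one number: the factor exceeds the number of traps, so
  a drop in the ranks outweighs any change in the number of waiting traps. Ranks drop when an asset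
  leaves the source, enters an active trap, is eliminated or arrives. The second summand drops when
  a trap becomes active and none is triggered; a trap that is triggered starts to wait, but it also
  eliminates an asset.\<close>

definition potential :: "('a \<Rightarrow> 'v option) \<Rightarrow> ('v \<Rightarrow> nat) \<Rightarrow> nat" where
  "potential X \<beta> = (\<Sum>a\<in>assets I. rank \<beta> (X a)) * (card (traps I) + 1) + card {r \<in> traps I. 0 < \<beta> r}"

lemma rank_le:
  assumes "asset_move I \<beta> x x'"
  shows "rank \<beta>' x' \<le> rank \<beta> x"
proof (cases "finished I x \<or> (\<exists>r\<in>traps I. x = Some r \<and> \<beta> r = 0)")
  case True
  then have "finished I x'" using assms unfolding asset_move_def by (auto simp: finished_def split: if_splits)
  then have "rank \<beta>' x' = 0" using inst_facts(3) by (auto simp: rank_def finished_def)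
  then show ?thesis by simp
next
  case False
  have "x' = x \<or> x' \<noteq> Some (source I)" using assms by (rule asset_moveE) auto
  moreover have "2 \<le> rank \<beta> x" using False by (auto simp: rank_def)
  moreover have "rank \<beta>' x' \<le> 2" if "x' \<noteq> Some (source I)" using that by (simp add: rank_def)
  moreover have "rank \<beta>' x = rank \<beta> x" if "x = Some (source I)" using that by (simp add: rank_def)
  ultimately show ?thesis by (metis le_trans order_refl)
qed

lemma potential_quiet:
  assumes "quiet_step I X \<beta> X' \<beta>'" "placed I X"
  shows "potential X' \<beta>' \<le> potential X \<beta>"
proof -
  have "(\<Sum>a\<in>assets I. rank \<beta>' (X' a)) \<le> (\<Sum>a\<in>assets I. rank \<beta> (X a))"
    using assms(1) rank_le by (intro sum_mono) (auto simp: quiet_step_def move_def)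
  moreover have "card {r \<in> traps I. 0 < \<beta>' r} \<le> card {r \<in> traps I. 0 < \<beta> r}"
    using quiet_step_facts(1)[OF assms] inst_facts(8) by (intro card_mono) auto
  ultimately show ?thesis unfolding potential_def by (intro add_mono mult_right_mono) simp_all
qed

lemma potential_quiet_run: "quiet_run I d X \<beta> X' \<beta>' \<Longrightarrow> placed I X \<Longrightarrow> potential X' \<beta>' \<le> potential X \<beta>"
proof (induction d arbitrary: X \<beta>)
  case (Suc d)
  then obtain X1 \<beta>1 where q: "quiet_step I X \<beta> X1 \<beta>1" "quiet_run I d X1 \<beta>1 X' \<beta>'" by auto
  have "placed I X1" using q(1) move_placed Suc.prems(2) by (auto simp: quiet_step_def)
  from Suc.IH[OF q(2) this] potential_quiet[OF q(1) Suc.prems(2)] show ?case by simp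
qed simp

lemma potential_less:
  assumes mv: "move I X \<beta> X'" and cd: "countdown I 1 X \<beta> \<beta>'" and nq: "\<not> quiet_step I X \<beta> X' \<beta>'"
  shows "potential X' \<beta>' < potential X \<beta>"
proof -
  let ?S' = "\<Sum>a\<in>assets I. rank \<beta>' (X' a)" and ?S = "\<Sum>a\<in>assets I. rank \<beta> (X a)"
  let ?c' = "card {r \<in> traps I. 0 < \<beta>' r}" and ?c = "card {r \<in> traps I. 0 < \<beta> r}"
  have am: "asset_move I \<beta> (X a) (X' a)" if "a \<in> assets I" for a using mv that by (simp add: move_def)
  have le: "?S' \<le> ?S" using am rank_le by (intro sum_mono) auto
  have lessI: "?S' * (card (traps I) + 1) + ?c' < ?S * (card (traps I) + 1) + ?c"
    if "a \<in> assets I" "rank \<beta>' (X' a) < rank \<beta> (X a)" for a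
  proof -
    have "?S' < ?S"
      by (rule sum_strict_mono_ex1) (use inst_facts(1) am rank_le that in auto)
    then have "(?S' + 1) * (card (traps I) + 1) \<le> ?S * (card (traps I) + 1)"
      by (intro mult_right_mono) auto
    moreover have "?c' \<le> card (traps I)" using inst_facts(8) by (intro card_mono) auto
    ultimately show ?thesis by simp
  qed
  show ?thesis
  proof (cases "reversible I X X'")
    case False
    then obtain a where a: "a \<in> assets I" "X' a \<noteq> X a"
      "X a = Some (source I) \<or> X' a = Some (target I) \<or> X' a = None" by (auto simp: reversible_def)
    have nf: "\<not> finished I (X a)" using asset_move_finished[OF am[OF a(1)]] a(2) by blast
    have "rank \<beta>' (X' a) < rank \<beta> (X a)"
    proof (cases "X a = Some (source I)")
      case True
      with a(2) show ?thesis by (simp add: rank_def)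
    next
      case False
      with a(3) have "finished I (X' a)" "X' a \<noteq> Some (source I)" using inst_facts(3) by (auto simp: finished_def)
      with nf show ?thesis by (simp add: rank_def)
    qed
    with lessI[OF a(1)] show ?thesis unfolding potential_def .
  next
    case rev: True
    have unocc: "\<beta> r \<noteq> 0" if "r \<in> traps I" "occupied I X r" for r
    proof
      assume "\<beta> r = 0"
      from that(2) obtain a where a: "a \<in> assets I" "X a = Some r" by (auto simp: occupied_def)
      have "\<not> finished I (X a)" using a(2) that(1) inst_facts(7) by (auto simp: finished_def)
      with am[OF a(1)] a(2) that(1) \<open>\<beta> r = 0\<close> have "X' a = None" by (auto simp: asset_move_def)
      with rev a show False by (auto simp: reversible_def)
    qed
    have \<beta>': "\<beta>' r = \<beta> r - 1" if "r \<in> traps I" for r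
      using cd unocc[OF that] that by (auto simp: countdown_def)
    have "\<not> (\<forall>r\<in>traps I. \<beta> r \<noteq> 1 \<and> (occupied I X' r \<longrightarrow> \<beta> r \<noteq> 0))"
      using nq unfolding quiet_step_def by (simp only: mv cd rev simp_thms not_False_eq_True)
    then obtain r where r: "r \<in> traps I" "\<beta> r = 1 \<or> occupied I X' r \<and> \<beta> r = 0" by metis
    show ?thesis
    proof (cases "\<beta> r = 1")
      case True
      have "{r \<in> traps I. 0 < \<beta>' r} \<subseteq> {r \<in> traps I. 0 < \<beta> r}" using \<beta>' by auto
      moreover have "r \<in> {r \<in> traps I. 0 < \<beta> r}" "r \<notin> {r \<in> traps I. 0 < \<beta>' r}"
        using \<beta>'[OF r(1)] r(1) True by auto
      ultimately have "{r \<in> traps I. 0 < \<beta>' r} \<subset> {r \<in> traps I. 0 < \<beta> r}" by blast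
      then have "?c' < ?c" using inst_facts(8) by (intro psubset_card_mono) auto
      moreover have "?S' * (card (traps I) + 1) \<le> ?S * (card (traps I) + 1)" using le by (rule mult_right_mono) simp
      ultimately show ?thesis unfolding potential_def by linarith
    next
      case False
      with r obtain a where a: "a \<in> assets I" "X' a = Some r" "\<beta> r = 0" by (auto simp: occupied_def)
      have "X' a \<noteq> Some (source I)" "\<not> finished I (X' a)" using a(2) r(1) inst_facts(6,7) by (auto simp: finished_def)
      moreover have "\<beta>' r = 0" using \<beta>'[OF r(1)] a(3) by simp
      ultimately have 1: "rank \<beta>' (X' a) = 1" using a(2) r(1) by (auto simp: rank_def)
      have "\<not> finished I (X a)"
        using asset_move_finished[OF am[OF a(1)]] \<open>\<not> finished I (X' a)\<close> by metis
      moreover have "\<not> (\<exists>r\<in>traps I. X a = Some r \<and> \<beta> r = 0)"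
        using unocc a(1) by (auto simp: occupied_def)
      ultimately have "2 \<le> rank \<beta> (X a)" by (auto simp: rank_def)
      with 1 lessI[OF a(1)] show ?thesis unfolding potential_def by simp
    qed
  qed
qed

lemma potential_relabel:
  assumes "relabels I \<pi> X Y"
  shows "potential Y \<beta> = potential X \<beta>"
proof -
  have "(\<Sum>a\<in>assets I. rank \<beta> (Y a)) = (\<Sum>a\<in>assets I. rank \<beta> (X (\<pi> a)))"
    using relabelsD(2)[OF assms] by (intro sum.cong) auto
  also have "\<dots> = (\<Sum>a\<in>assets I. rank \<beta> (X a))"
    using assms unfolding relabels_def by (intro sum.reindex_bij_betw) blast
  finally show ?thesis by (simp add: potential_def)
qed

text \<open>Induction on the potential. A quiet run costs at most \<open>walk_length\<close> long
  steps; the step after it that is not quiet costs one more and lowers the potential. Since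
  compression permutes the assets, the rest of the run is permuted as well.\<close>

lemma long_wins_of_wins:
  assumes "wins I n X \<beta>" "placed I X" "separated I X" "bounded \<beta>"
  shows "\<exists>n'\<le>(potential X \<beta> + 1) * (walk_length + 1). long_wins n' X \<beta>"
  using assms
proof (induction "potential X \<beta>" arbitrary: n X \<beta> rule: less_induct)
  case less
  from wins_split[OF less.prems(1)] obtain d X1 \<beta>1 where run: "quiet_run I d X \<beta> X1 \<beta>1" and
    next_step: "final I X1 \<or> (\<exists>X2 \<beta>2 m. move I X1 \<beta>1 X2 \<and> countdown I 1 X1 \<beta>1 \<beta>2 \<and>
      \<not> quiet_step I X1 \<beta>1 X2 \<beta>2 \<and> wins I m X2 \<beta>2)" by blast
  note facts = quiet_run_facts[OF run less.prems(2,3)]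
  have b1: "bounded \<beta>1" using facts less.prems(4) unfolding bounded_def by (metis diff_le_self le_trans)
  have "\<exists>k Y \<pi>. k \<le> walk_length \<and> relabels I \<pi> X1 Y \<and> (\<forall>n. long_wins n Y \<beta>1 \<longrightarrow> long_wins (k + n) X \<beta>)"
  proof (cases "d = 0")
    case True
    with run show ?thesis by (intro exI[of _ 0] exI[of _ X] exI[of _ id]) (simp add: relabels_id)
  next
    case False
    with quiet_run_compress[OF run _ less.prems(2-4)] show ?thesis by simp
  qed
  then obtain k Y \<pi> where Y: "k \<le> walk_length" "relabels I \<pi> X1 Y"
    "\<And>n. long_wins n Y \<beta>1 \<Longrightarrow> long_wins (k + n) X \<beta>" by blast
  from next_step show ?case
  proof
    assume "final I X1"
    then have "long_wins 0 Y \<beta>1" using final_relabel[OF _ Y(2)] by simp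
    from Y(3)[OF this] Y(1) show ?thesis by (intro exI[of _ k]) simp
  next
    assume "\<exists>X2 \<beta>2 m. move I X1 \<beta>1 X2 \<and> countdown I 1 X1 \<beta>1 \<beta>2 \<and>
      \<not> quiet_step I X1 \<beta>1 X2 \<beta>2 \<and> wins I m X2 \<beta>2"
    then obtain X2 \<beta>2 m where 2: "move I X1 \<beta>1 X2" "countdown I 1 X1 \<beta>1 \<beta>2"
      "\<not> quiet_step I X1 \<beta>1 X2 \<beta>2" "wins I m X2 \<beta>2" by blast
    have rel: "relabels I \<pi> X2 (X2 \<circ> \<pi>)" using Y(2) by (simp add: relabels_def)
    have mv: "move I Y \<beta>1 (X2 \<circ> \<pi>)" and cd: "countdown I 1 Y \<beta>1 \<beta>2"
      using move_relabel[OF 2(1) Y(2)] countdown_relabel[OF 2(2) Y(2)] by simp_all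
    have w: "wins I m (X2 \<circ> \<pi>) \<beta>2" using wins_relabel[OF 2(4) rel] by simp
    have "potential (X2 \<circ> \<pi>) \<beta>2 < potential X1 \<beta>1"
      using potential_less[OF 2(1-3)] potential_relabel[OF rel] by simp
    also have "\<dots> \<le> potential X \<beta>" using potential_quiet_run[OF run less.prems(2)] .
    finally have pot: "potential (X2 \<circ> \<pi>) \<beta>2 < potential X \<beta>" .
    have "placed I X2" using move_placed[OF 2(1)] facts by blast
    then have pl: "placed I (X2 \<circ> \<pi>)" using relabelsD(1)[OF rel] unfolding placed_def comp_def by blast
    have sp: "separated I (X2 \<circ> \<pi>)" using mv by (simp add: move_def)
    from less.hyps[OF pot w pl sp countdown_bounded[OF 2(2) b1]] obtain n' where
      n': "n' \<le> (potential (X2 \<circ> \<pi>) \<beta>2 + 1) * (walk_length + 1)" "long_wins n' (X2 \<circ> \<pi>) \<beta>2" by blast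
    have "long_step I 1 Y \<beta>1 (X2 \<circ> \<pi>) \<beta>2" using mv cd by (simp add: long_step_def)
    with n'(2) B(1) have "long_wins (Suc n') Y \<beta>1" by auto
    from Y(3)[OF this] have "long_wins (k + Suc n') X \<beta>" .
    moreover have "k + Suc n' \<le> (potential X \<beta> + 1) * (walk_length + 1)"
    proof -
      have "(potential (X2 \<circ> \<pi>) \<beta>2 + 1) * (walk_length + 1) \<le> potential X \<beta> * (walk_length + 1)"
        using pot by (intro mult_right_mono) auto
      with n'(1) Y(1) show ?thesis by (simp add: algebra_simps)
    qed
    ultimately show ?thesis by blast
  qed
qed

lemma potential_bound: "potential X \<beta> \<le> 3 * card (assets I) * (card (traps I) + 1) + card (traps I)"
proof -
  have "(\<Sum>a\<in>assets I. rank \<beta> (X a)) \<le> (\<Sum>a\<in>assets I. 3)"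
    by (intro sum_mono) (simp add: rank_def)
  then have "(\<Sum>a\<in>assets I. rank \<beta> (X a)) \<le> 3 * card (assets I)" by simp
  moreover have "card {r \<in> traps I. 0 < \<beta> r} \<le> card (traps I)"
    using inst_facts(8) by (intro card_mono) auto
  ultimately show ?thesis unfolding potential_def by (intro add_mono mult_right_mono) auto
qed

end

section \<open>Certificates as relations\<close>

text \<open>A certificate describes a run of long steps with the configurations \<open>0, \<dots>, N\<close>:
  \<open>L i a p\<close> means that asset \<open>a\<close> is at \<open>p\<close> in configuration \<open>i\<close>, where \<open>d\<close> stands for the location of
  eliminated assets; \<open>W i r b\<close> that trap \<open>r\<close> has to wait \<open>b\<close> steps to be active; \<open>S i \<delta> e\<close> that the step
  leaving configuration \<open>i\<close> has the odd duration \<open>\<delta> = 2 * e + 1\<close>; \<open>C j a\<close> that \<open>a\<close> is the \<open>j\<close>-th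
  survivor.\<close>

definition cert_frame :: "(nat, nat) routing_instance \<Rightarrow> nat \<Rightarrow> nat \<Rightarrow> (nat \<Rightarrow> nat \<Rightarrow> nat \<Rightarrow> bool) \<Rightarrow>
    (nat \<Rightarrow> nat \<Rightarrow> nat \<Rightarrow> bool) \<Rightarrow> (nat \<Rightarrow> nat \<Rightarrow> nat \<Rightarrow> bool) \<Rightarrow> bool" where
  "cert_frame I d N L W S \<longleftrightarrow>
     d \<notin> vertices I \<and> (\<exists>\<delta> e. S 0 \<delta> e) \<and>
     (\<forall>i \<delta> e. S i \<delta> e \<longrightarrow> i = N \<or> (\<exists>\<delta>' e'. S (Suc i) \<delta>' e')) \<and>
     (\<forall>i \<delta> e. S i \<delta> e \<longrightarrow> (\<forall>a\<in>assets I. \<exists>p. L i a p)) \<and>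
     (\<forall>i \<delta> e. S i \<delta> e \<longrightarrow> (\<forall>r\<in>traps I. \<exists>b. W i r b)) \<and>
     (\<forall>i a p p'. L i a p \<longrightarrow> L i a p' \<longrightarrow> p = p') \<and>
     (\<forall>i r b b'. W i r b \<longrightarrow> W i r b' \<longrightarrow> b = b') \<and>
     (\<forall>i a p. L i a p \<longrightarrow> a \<in> assets I) \<and>
     (\<forall>i r b. W i r b \<longrightarrow> r \<in> traps I)"

lemma cert_frameD:
  assumes "cert_frame I d N L W S"
  shows "d \<notin> vertices I" "\<exists>\<delta> e. S 0 \<delta> e"
    "S i \<delta> e \<Longrightarrow> i \<noteq> N \<Longrightarrow> \<exists>\<delta>' e'. S (Suc i) \<delta>' e'"
    "S i \<delta> e \<Longrightarrow> a \<in> assets I \<Longrightarrow> \<exists>p. L i a p" "S i \<delta> e \<Longrightarrow> r \<in> traps I \<Longrightarrow> \<exists>b. W i r b"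
    "L i a p \<Longrightarrow> L i a p' \<Longrightarrow> p = p'" "W i r b \<Longrightarrow> W i r b' \<Longrightarrow> b = b'"
    "L i a p \<Longrightarrow> a \<in> assets I" "W i r b \<Longrightarrow> r \<in> traps I"
  using assms unfolding cert_frame_def by (elim conjE, metis)+

text \<open>Cardinality is not first-order, so survivors are numbered: the number
  \<open>goal I\<close> is in use, below every number in use except 1 the preceding one is in use,
  and no asset bears two numbers. This yields \<open>goal I\<close> distinct survivors.\<close>

definition cert_ends :: "(nat, nat) routing_instance \<Rightarrow> nat \<Rightarrow> nat \<Rightarrow> (nat \<Rightarrow> nat \<Rightarrow> nat \<Rightarrow> bool) \<Rightarrow>
    (nat \<Rightarrow> nat \<Rightarrow> nat \<Rightarrow> bool) \<Rightarrow> (nat \<Rightarrow> nat \<Rightarrow> bool) \<Rightarrow> bool" where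
  "cert_ends I d N L W C \<longleftrightarrow>
     (\<forall>a p. L 0 a p \<longrightarrow> p = source I) \<and> (\<forall>r b. W 0 r b \<longrightarrow> b = 0) \<and>
     (\<forall>a p. L N a p \<longrightarrow> p = target I \<or> p = d) \<and>
     (\<exists>a. C (goal I) a) \<and>
     (\<forall>j a. C j a \<longrightarrow> 1 \<le> j \<and> (j = 1 \<or> (\<exists>b. C (j - 1) b)) \<and> L N a (target I)) \<and>
     (\<forall>j j' a. C j a \<longrightarrow> C j' a \<longrightarrow> j = j')"

definition cert_moves :: "(nat, nat) routing_instance \<Rightarrow> nat \<Rightarrow> (nat \<Rightarrow> nat \<Rightarrow> nat \<Rightarrow> bool) \<Rightarrow>
    (nat \<Rightarrow> nat \<Rightarrow> nat \<Rightarrow> bool) \<Rightarrow> nat \<Rightarrow> nat \<Rightarrow> bool" where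
  "cert_moves I d L W i \<delta> \<longleftrightarrow>
     (\<forall>a p p'. L i a p \<longrightarrow> L (Suc i) a p' \<longrightarrow>
        (if p = target I \<or> p = d then p' = p
         else if W i p 0 then p' = d
         else p' = p \<or> {p, p'} \<in> edges I \<and> p' \<noteq> source I) \<and>
        (\<delta> \<noteq> 1 \<longrightarrow> p' \<noteq> p \<longrightarrow> p \<noteq> source I \<and> p' \<noteq> target I \<and> p' \<noteq> d)) \<and>
     (\<exists>a p p'. L i a p \<and> L (Suc i) a p' \<and> p' \<noteq> p)"

definition cert_waits :: "(nat, nat) routing_instance \<Rightarrow> (nat \<Rightarrow> nat \<Rightarrow> nat \<Rightarrow> bool) \<Rightarrow>
    (nat \<Rightarrow> nat \<Rightarrow> nat \<Rightarrow> bool) \<Rightarrow> nat \<Rightarrow> nat \<Rightarrow> bool" where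
  "cert_waits I L W i \<delta> \<longleftrightarrow>
     (\<forall>r b b'. W i r b \<longrightarrow> W (Suc i) r b' \<longrightarrow>
        (if b = 0 \<and> (\<exists>a. L i a r) then b' = reload I r else b' = b - \<delta>) \<and>
        (\<delta> \<noteq> 1 \<longrightarrow> (\<exists>a. L i a r) \<or> (\<exists>a. L (Suc i) a r) \<longrightarrow> \<delta> \<le> b))"

definition cert_ok :: "(nat, nat) routing_instance \<Rightarrow> nat \<Rightarrow> nat \<Rightarrow> (nat \<Rightarrow> nat \<Rightarrow> nat \<Rightarrow> bool) \<Rightarrow>
    (nat \<Rightarrow> nat \<Rightarrow> nat \<Rightarrow> bool) \<Rightarrow> (nat \<Rightarrow> nat \<Rightarrow> nat \<Rightarrow> bool) \<Rightarrow> (nat \<Rightarrow> nat \<Rightarrow> bool) \<Rightarrow> bool" where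
  "cert_ok I d N L W S C \<longleftrightarrow> cert_frame I d N L W S \<and> cert_ends I d N L W C \<and>
     (\<forall>i a a' p. L i a p \<longrightarrow> L i a' p \<longrightarrow> a \<noteq> a' \<longrightarrow> p = source I \<or> p = target I \<or> p = d) \<and>
     (\<forall>i \<delta> e. S i \<delta> e \<longrightarrow> i \<noteq> N \<longrightarrow>
        \<delta> = 2 * e + 1 \<and> cert_moves I d L W i \<delta> \<and> cert_waits I L W i \<delta>)"

section \<open>Certificates yield winning runs\<close>

definition location :: "nat \<Rightarrow> nat \<Rightarrow> nat option" where
  "location d p = (if p = d then None else Some p)"

lemma location_eq: "location d p = location d p' \<longleftrightarrow> p = p'"
  by (simp add: location_def)

text \<open>The relations come from an arbitrary word and may contain unrelated facts.
  \<open>cert_frame\<close> makes them functions on the configurations up to \<open>N\<close>, and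
  from these alone the run is rebuilt, backwards from the last configuration.\<close>

lemma cert_sound:
  assumes inst: "routing_instance I" and cert: "cert_ok I d N L W S C"
  shows "\<exists>n. wins I n (\<lambda>_. Some (source I)) (\<lambda>_. 0)"
proof -
  have frame: "cert_frame I d N L W S" and ends: "cert_ends I d N L W C" and
    sep: "\<And>i a a' p. L i a p \<Longrightarrow> L i a' p \<Longrightarrow> a \<noteq> a' \<Longrightarrow> p = source I \<or> p = target I \<or> p = d" and
    step: "\<And>i \<delta> e. S i \<delta> e \<Longrightarrow> i \<noteq> N \<Longrightarrow> \<delta> = 2 * e + 1 \<and> cert_moves I d L W i \<delta> \<and> cert_waits I L W i \<delta>"
    using cert unfolding cert_ok_def by blast+
  have inst': "source I \<in> vertices I" "target I \<in> vertices I" "traps I \<subseteq> vertices I"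
    "\<And>u v. {u, v} \<in> edges I \<Longrightarrow> u \<in> vertices I \<and> v \<in> vertices I" "finite (assets I)" "target I \<notin> traps I"
    using inst by (auto simp: routing_instance_def)
  have d: "d \<notin> vertices I" "source I \<noteq> d" "target I \<noteq> d" using frame inst' by (auto simp: cert_frame_def)
  define J where "J i \<longleftrightarrow> (\<exists>\<delta> e. S i \<delta> e)" for i
  define P where "P i a = (THE p. L i a p)" for i a
  define Q where "Q i r = (THE b. W i r b)" for i r
  define X where "X i a = location d (P i a)" for i a
  note Luniq = cert_frameD(6)[OF frame] and Wuniq = cert_frameD(7)[OF frame]
    and LA = cert_frameD(8)[OF frame] and WR = cert_frameD(9)[OF frame]
  have P: "L i a (P i a)" if J: "J i" "a \<in> assets I" for i a
  proof -
    obtain \<delta> e where "S i \<delta> e" using J(1) unfolding J_def by blast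
    from cert_frameD(4)[OF frame this J(2)] obtain p where p: "L i a p" ..
    show ?thesis unfolding P_def by (rule theI[of "L i a", OF p]) (use Luniq p in blast)
  qed
  have Q: "W i r (Q i r)" if J: "J i" "r \<in> traps I" for i r
  proof -
    obtain \<delta> e where "S i \<delta> e" using J(1) unfolding J_def by blast
    from cert_frameD(5)[OF frame this J(2)] obtain b where b: "W i r b" ..
    show ?thesis unfolding Q_def by (rule theI[of "W i r", OF b]) (use Wuniq b in blast)
  qed
  have PL: "L i a p \<longleftrightarrow> p = P i a" if "J i" "a \<in> assets I" for i a p
    using P[OF that] Luniq by blast
  have QW: "W i r b \<longleftrightarrow> b = Q i r" if "J i" "r \<in> traps I" for i r b
    using Q[OF that] Wuniq by blast
  have fin: "finished I (X i a) \<longleftrightarrow> P i a = target I \<or> P i a = d" for i a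
    using d by (auto simp: X_def location_def finished_def)
  have occ: "occupied I (X i) r \<longleftrightarrow> (\<exists>a. L i a r)" if "J i" "r \<in> traps I" for i r
  proof -
    have "r \<noteq> d" using that inst' d by blast
    then have "X i a = Some r \<longleftrightarrow> P i a = r" for a by (auto simp: X_def location_def)
    then show ?thesis using PL[OF that(1)] LA unfolding occupied_def by metis
  qed
  have sepX: "separated I (X i)" if "J i" for i
    unfolding separated_def
  proof (intro ballI impI)
    fix a a' assume a: "a \<in> assets I" "a' \<in> assets I" "a \<noteq> a'" "X i a = X i a'"
    then have "P i a' = P i a" by (simp add: X_def location_eq)
    with P[OF that a(1)] P[OF that a(2)] sep[of i a "P i a" a'] a(3)
    show "X i a \<in> {Some (source I), Some (target I), None}" by (auto simp: X_def location_def)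
  qed
  have long: "\<exists>\<delta>. long_step I \<delta> (X i) (Q i) (X (Suc i)) (Q (Suc i))" if i: "J i" "i \<noteq> N" "J (Suc i)" for i
  proof -
    from i(1) obtain \<delta> e where s: "S i \<delta> e" by (auto simp: J_def)
    from step[OF s i(2)] have \<delta>: "\<delta> = 2 * e + 1" and mv: "cert_moves I d L W i \<delta>" and wt: "cert_waits I L W i \<delta>"
      by auto
    have mva: "(if P i a = target I \<or> P i a = d then P (Suc i) a = P i a
         else if W i (P i a) 0 then P (Suc i) a = d
         else P (Suc i) a = P i a \<or> {P i a, P (Suc i) a} \<in> edges I \<and> P (Suc i) a \<noteq> source I)"
      "\<delta> \<noteq> 1 \<Longrightarrow> P (Suc i) a \<noteq> P i a \<Longrightarrow> P i a \<noteq> source I \<and> P (Suc i) a \<noteq> target I \<and> P (Suc i) a \<noteq> d"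
      if "a \<in> assets I" for a
      using mv P[OF i(1) that] P[OF i(3) that] unfolding cert_moves_def by blast+
    have killed: "(\<exists>r\<in>traps I. X i a = Some r \<and> Q i r = 0) \<longleftrightarrow> W i (P i a) 0" if "P i a \<noteq> d" for a
    proof
      assume w: "W i (P i a) 0"
      have r: "P i a \<in> traps I" using WR[OF w] .
      with QW[OF i(1) r] w that show "\<exists>r\<in>traps I. X i a = Some r \<and> Q i r = 0"
        by (intro bexI[of _ "P i a"]) (simp_all add: X_def location_def)
    next
      assume "\<exists>r\<in>traps I. X i a = Some r \<and> Q i r = 0"
      then obtain r where r: "r \<in> traps I" "X i a = Some r" "Q i r = 0" by blast
      then have "P i a = r" by (simp add: X_def location_def split: if_splits)
      with QW[OF i(1) r(1)] r(3) show "W i (P i a) 0" by simp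
    qed
    have "asset_move I (Q i) (X i a) (X (Suc i) a)" if a: "a \<in> assets I" for a
    proof (cases "P i a = target I \<or> P i a = d")
      case True
      with mva(1)[OF a] have "P (Suc i) a = P i a" by simp
      with True show ?thesis by (simp add: asset_move_def fin X_def[symmetric]) (simp add: X_def)
    next
      case False
      then have nd: "P i a \<noteq> d" by blast
      have nf: "\<not> finished I (X i a)" using False fin by blast
      show ?thesis
      proof (cases "W i (P i a) 0")
        case True
        with mva(1)[OF a] False have "X (Suc i) a = None" by (simp add: X_def location_def)
        moreover have "\<exists>r\<in>traps I. X i a = Some r \<and> Q i r = 0" using killed[OF nd] True by blast
        ultimately show ?thesis using nf unfolding asset_move_def by simp
      next
        case alive: False
        have na: "\<not> (\<exists>r\<in>traps I. X i a = Some r \<and> Q i r = 0)" using killed[OF nd] alive by blast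
        from mva(1)[OF a] False alive consider "P (Suc i) a = P i a"
          | "{P i a, P (Suc i) a} \<in> edges I" "P (Suc i) a \<noteq> source I" by auto
        then have "X (Suc i) a = X i a \<or> (\<exists>u v. X i a = Some u \<and> X (Suc i) a = Some v \<and> {u, v} \<in> edges I \<and> v \<noteq> source I)"
        proof cases
          case 1
          then show ?thesis by (simp add: X_def)
        next
          case 2
          with inst'(4)[OF 2(1)] d(1) have "P i a \<noteq> d" "P (Suc i) a \<noteq> d" by auto
          with 2 show ?thesis by (simp add: X_def location_def)
        qed
        then show ?thesis unfolding asset_move_def if_not_P[OF nf] if_not_P[OF na] .
      qed
    qed
    moreover have "\<exists>a\<in>assets I. X (Suc i) a \<noteq> X i a"
    proof -
      from mv obtain a p p' where a: "L i a p" "L (Suc i) a p'" "p' \<noteq> p" unfolding cert_moves_def by blast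
      from PL[OF i(1) LA[OF a(1)], of p] PL[OF i(3) LA[OF a(1)], of p'] a have "P (Suc i) a \<noteq> P i a" by simp
      with LA[OF a(1)] show ?thesis by (intro bexI[of _ a]) (simp_all add: X_def location_eq)
    qed
    ultimately have move: "move I (X i) (Q i) (X (Suc i))"
      using sepX[OF i(1)] sepX[OF i(3)] by (simp add: move_def)
    have wt: "(if Q i r = 0 \<and> (\<exists>a. L i a r) then Q (Suc i) r = reload I r else Q (Suc i) r = Q i r - \<delta>)"
      "\<delta> \<noteq> 1 \<Longrightarrow> (\<exists>a. L i a r) \<or> (\<exists>a. L (Suc i) a r) \<Longrightarrow> \<delta> \<le> Q i r" if "r \<in> traps I" for r
      using wt Q[OF i(1) that] Q[OF i(3) that] unfolding cert_waits_def by blast+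
    have "countdown I \<delta> (X i) (Q i) (Q (Suc i))"
      unfolding countdown_def
    proof
      fix r assume r: "r \<in> traps I"
      from wt(1)[OF r] show "Q (Suc i) r = (if Q i r = 0 \<and> occupied I (X i) r then reload I r else Q i r - \<delta>)"
        unfolding occ[OF i(1) r] by (simp split: if_splits)
    qed
    moreover have "reversible I (X i) (X (Suc i))" if "\<delta> \<noteq> 1"
      unfolding reversible_def
    proof (intro ballI impI)
      fix a assume a: "a \<in> assets I" "X (Suc i) a \<noteq> X i a"
      then have "P (Suc i) a \<noteq> P i a" by (auto simp: X_def)
      from mva(2)[OF a(1) that this] show "X i a \<noteq> Some (source I) \<and> X (Suc i) a \<noteq> Some (target I) \<and> X (Suc i) a \<noteq> None"
        by (auto simp: X_def location_def)
    qed
    moreover have "\<forall>r\<in>traps I. occupied I (X i) r \<or> occupied I (X (Suc i)) r \<longrightarrow> \<delta> \<le> Q i r" if "\<delta> \<noteq> 1"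
      using wt(2)[OF _ that] occ[OF i(1)] occ[OF i(3)] by blast
    ultimately have "long_step I \<delta> (X i) (Q i) (X (Suc i)) (Q (Suc i))"
      using move \<delta> unfolding long_step_def by simp
    then show ?thesis ..
  qed
  have J: "J i" if "i \<le> N" for i
    using that
  proof (induction i)
    case 0
    then show ?case using cert_frameD(2)[OF frame] by (simp add: J_def)
  next
    case (Suc i)
    then have "J i" "i \<noteq> N" by auto
    then show ?case using cert_frameD(3)[OF frame] unfolding J_def by metis
  qed
  have final: "final I (X N)"
    unfolding final_def
  proof
    have "P N a = target I \<or> P N a = d" if "a \<in> assets I" for a
      using ends P[OF J[OF order_refl] that] unfolding cert_ends_def by blast
    then show "\<forall>a\<in>assets I. finished I (X N a)" using fin by blast
    have C: "1 \<le> j" "j = 1 \<or> (\<exists>b. C (j - 1) b)" "L N a (target I)" if "C j a" for j a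
      using ends that unfolding cert_ends_def by blast+
    \<comment> \<open>Counting down from the goal shows that all the numbers 1, ...,
      \<open>goal I\<close> are in use.\<close>
    have ex: "\<exists>a. C (goal I - i) a" if "i < goal I" for i
      using that
    proof (induction i)
      case 0
      then show ?case using ends unfolding cert_ends_def by simp
    next
      case (Suc i)
      then obtain a where "C (goal I - i) a" by auto
      from C(2)[OF this] Suc.prems show ?case by auto
    qed
    have "\<exists>a. C j a" if "j \<in> {1..goal I}" for j using ex[of "goal I - j"] that by simp
    then obtain g where g: "\<And>j. j \<in> {1..goal I} \<Longrightarrow> C j (g j)" by metis
    have "inj_on g {1..goal I}"
      using g ends unfolding inj_on_def cert_ends_def by metis
    moreover have "g ` {1..goal I} \<subseteq> {a \<in> assets I. X N a = Some (target I)}"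
    proof
      fix a assume "a \<in> g ` {1..goal I}"
      then obtain j where "C j a" using g by blast
      then have L: "L N a (target I)" by (rule C(3))
      have a: "a \<in> assets I" using LA[OF L] .
      have "P N a = target I" using PL[OF J[OF order_refl] a, of "target I"] L by simp
      with a d(3) show "a \<in> {a \<in> assets I. X N a = Some (target I)}" by (simp add: X_def location_def)
    qed
    moreover have "finite {a \<in> assets I. X N a = Some (target I)}" using inst' by simp
    ultimately have "card {1..goal I} \<le> card {a \<in> assets I. X N a = Some (target I)}" by (rule card_inj_on_le)
    then show "goal I \<le> card {a \<in> assets I. X N a = Some (target I)}" by simp
  qed
  have "\<exists>n. wins I n (X i) (Q i)" if "i \<le> N" for i
    using that
  proof (induction rule: inc_induct)
    case base
    from final show ?case by (intro exI[of _ 0]) simp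
  next
    case (step i)
    then have "J i" "i \<noteq> N" "J (Suc i)" using J by auto
    from long[OF this] long_step_wins step.IH show ?case by blast
  qed
  from this[of 0] obtain n where n: "wins I n (X 0) (Q 0)" by blast
  have J0: "J 0" using J by simp
  have rel: "relabels I id (X 0) (\<lambda>_. Some (source I))"
  proof (rule relabels_id)
    fix a assume "a \<in> assets I"
    then have "P 0 a = source I" using P[OF J0] ends unfolding cert_ends_def by blast
    then show "Some (source I) = X 0 a" using d by (simp add: X_def location_def)
  qed
  have "wins I n (\<lambda>_. Some (source I)) (\<lambda>_. 0)"
  proof (rule wins_relabel[OF n rel])
    fix r assume "r \<in> traps I"
    from Q[OF J0 this] ends show "0 = Q 0 r" unfolding cert_ends_def by metis
  qed
  then show ?thesis ..
qed

section \<open>Winning runs yield certificates\<close>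

context routing
begin

lemma long_wins_run:
  assumes "long_wins n X \<beta>"
  shows "\<exists>Xs \<beta>s ds. Xs 0 = X \<and> \<beta>s 0 = \<beta> \<and> final I (Xs n) \<and>
    (\<forall>j<n. ds j \<le> B \<and> long_step I (ds j) (Xs j) (\<beta>s j) (Xs (Suc j)) (\<beta>s (Suc j)))"
  using assms
proof (induction n arbitrary: X \<beta>)
  case (Suc n)
  then obtain d X' \<beta>' where *: "d \<le> B" "long_step I d X \<beta> X' \<beta>'" "long_wins n X' \<beta>'" by auto
  from Suc.IH[OF *(3)] obtain Xs \<beta>s ds where run: "Xs 0 = X'" "\<beta>s 0 = \<beta>'" "final I (Xs n)"
    "\<And>j. j < n \<Longrightarrow> ds j \<le> B \<and> long_step I (ds j) (Xs j) (\<beta>s j) (Xs (Suc j)) (\<beta>s (Suc j))" by blast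
  have "case_nat d ds j \<le> B \<and> long_step I (case_nat d ds j) (case_nat X Xs j) (case_nat \<beta> \<beta>s j)
      (case_nat X Xs (Suc j)) (case_nat \<beta> \<beta>s (Suc j))" if "j < Suc n" for j
    using that * run by (cases j) simp_all
  then show ?case
    by (intro exI[of _ "case_nat X Xs"] exI[of _ "case_nat \<beta> \<beta>s"] exI[of _ "case_nat d ds"])
      (simp add: run(3))
next
  case 0
  then show ?case by (intro exI[of _ "\<lambda>_. X"] exI[of _ "\<lambda>_. \<beta>"] exI) simp
qed

end

definition code :: "nat \<Rightarrow> nat option \<Rightarrow> nat" where
  "code d x = (case x of None \<Rightarrow> d | Some v \<Rightarrow> v)"

text \<open>Besides the certificate this gives a common bound \<open>M\<close> on its numbers, from
  which the width of the records will be chosen.\<close>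

lemma cert_complete:
  assumes "routing I B" and d: "d \<notin> vertices I" "d \<le> M"
    and M: "B \<le> M" "\<And>v. v \<in> vertices I \<Longrightarrow> v \<le> M" "\<And>a. a \<in> assets I \<Longrightarrow> a \<le> M" "n \<le> M" "goal I \<le> M"
    and wins: "routing.long_wins I B n (\<lambda>_. Some (source I)) (\<lambda>_. 0)"
  shows "\<exists>Xs \<beta>s ds g. cert_ok I d n
     (\<lambda>i a p. i \<le> n \<and> a \<in> assets I \<and> p = code d (Xs i a))
     (\<lambda>i r b. i \<le> n \<and> r \<in> traps I \<and> b = \<beta>s i r)
     (\<lambda>i \<delta> e. i \<le> n \<and> \<delta> = ds i \<and> e = ds i div 2)
     (\<lambda>j a. j \<in> {1..goal I} \<and> a = g j) \<and>
     (\<forall>i\<le>n. (\<forall>a\<in>assets I. code d (Xs i a) \<le> M) \<and> (\<forall>r\<in>traps I. \<beta>s i r \<le> M) \<and> ds i \<le> M) \<and>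
     (\<forall>j\<in>{1..goal I}. g j \<le> M)"
proof -
  interpret routing I B by fact
  from long_wins_run[OF wins] obtain Xs \<beta>s ds' where run: "Xs 0 = (\<lambda>_. Some (source I))" "\<beta>s 0 = (\<lambda>_. 0)"
    "final I (Xs n)" "\<And>j. j < n \<Longrightarrow> ds' j \<le> B \<and> long_step I (ds' j) (Xs j) (\<beta>s j) (Xs (Suc j)) (\<beta>s (Suc j))"
    by blast
  \<comment> \<open>\<open>cert_frame\<close> asks for a step entry at the last configuration too,
    where no step starts; it gets the duration 1.\<close>
  define ds where "ds i = (if i < n then ds' i else 1)" for i
  have goal: "1 \<le> goal I" using inst by (simp add: routing_instance_def)
  have target: "target I \<in> vertices I" using inst by (simp add: routing_instance_def)
  have placed: "placed I (Xs i)" if "i \<le> n" for i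
    using that
  proof (induction i)
    case 0
    then show ?case using run(1) inst_facts(4) by (simp add: placed_def)
  next
    case (Suc i)
    then have "move I (Xs i) (\<beta>s i) (Xs (Suc i))" using run(4)[of i] by (simp add: long_step_def)
    from move_placed[OF this] Suc show ?case by simp
  qed
  have bounded: "bounded (\<beta>s i)" if "i \<le> n" for i
    using that
  proof (induction i)
    case 0
    then show ?case by (simp add: run(2) bounded_def)
  next
    case (Suc i)
    then have "countdown I (ds' i) (Xs i) (\<beta>s i) (\<beta>s (Suc i))" using run(4)[of i] by (simp add: long_step_def)
    from countdown_bounded[OF this] Suc show ?case by simp
  qed
  have sep: "separated I (Xs i)" if "i \<le> n" for i
  proof (cases "i = 0")
    case True
    then show ?thesis by (simp add: run(1) separated_def)
  next
    case False
    with that run(4)[of "i - 1"] show ?thesis by (simp add: long_step_def move_def)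
  qed
  have code_vert: "code d (Xs i a) = v \<longleftrightarrow> Xs i a = Some v" if "v \<in> vertices I" for i a v
    using that d(1) by (cases "Xs i a") (auto simp: code_def)
  have code_d: "code d (Xs i a) = d \<longleftrightarrow> Xs i a = None" if "i \<le> n" "a \<in> assets I" for i a
    using placed[OF that(1)] that(2) d(1) by (cases "Xs i a") (auto simp: code_def placed_def)
  have code_inj: "code d (Xs i a) = code d (Xs j b) \<longleftrightarrow> Xs i a = Xs j b"
    if "i \<le> n" "j \<le> n" "a \<in> assets I" "b \<in> assets I" for i j a b
  proof -
    have "v \<noteq> d" if "Xs i a = Some v \<or> Xs j b = Some v" for v
      using that placed[OF \<open>i \<le> n\<close>] placed[OF \<open>j \<le> n\<close>] \<open>a \<in> assets I\<close> \<open>b \<in> assets I\<close> d(1)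
      unfolding placed_def by blast
    then show ?thesis by (cases "Xs i a"; cases "Xs j b") (auto simp: code_def)
  qed
  have fin: "finished I (Xs i a) \<longleftrightarrow> code d (Xs i a) = target I \<or> code d (Xs i a) = d" if "i \<le> n" "a \<in> assets I" for i a
    using code_d[OF that] code_vert[OF target] by (auto simp: finished_def)
  have occ: "occupied I (Xs i) r \<longleftrightarrow> (\<exists>a. a \<in> assets I \<and> r = code d (Xs i a))" if "r \<in> traps I" for i r
  proof -
    have "r \<in> vertices I" using that inst_facts(5) by blast
    then have "r = code d (Xs i a) \<longleftrightarrow> Xs i a = Some r" for a using code_vert[of r i a] by auto
    then show ?thesis unfolding occupied_def by auto
  qed
  obtain g where g: "inj_on g {1..goal I}" "g ` {1..goal I} \<subseteq> {a \<in> assets I. Xs n a = Some (target I)}"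
  proof -
    let ?T = "{a \<in> assets I. Xs n a = Some (target I)}"
    have "card {1..goal I} \<le> card ?T" using run(3) by (simp add: final_def)
    moreover have "finite ?T" using inst_facts(1) by simp
    ultimately show ?thesis using that card_le_inj[of "{1..goal I}" ?T] by blast
  qed
  have gT: "g j \<in> assets I" "Xs n (g j) = Some (target I)" if "j \<in> {1..goal I}" for j
    using subsetD[OF g(2) imageI[OF that]] by auto
  let ?L = "\<lambda>i a p. i \<le> n \<and> a \<in> assets I \<and> p = code d (Xs i a)"
  let ?W = "\<lambda>i r b. i \<le> n \<and> r \<in> traps I \<and> b = \<beta>s i r"
  let ?S = "\<lambda>i \<delta> e. i \<le> n \<and> \<delta> = ds i \<and> e = ds i div 2"
  let ?C = "\<lambda>j a. j \<in> {1..goal I} \<and> a = g j"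
  have frame: "cert_frame I d n ?L ?W ?S"
    unfolding cert_frame_def using d(1) by (auto simp: Suc_le_eq)
  have ends: "cert_ends I d n ?L ?W ?C"
    unfolding cert_ends_def
  proof (intro conjI allI impI)
    fix a p assume "?L 0 a p"
    then show "p = source I" by (simp add: run(1) code_def)
  next
    fix r b assume "?W 0 r b"
    then show "b = 0" by (simp add: run(2))
  next
    fix a p assume "?L n a p"
    with run(3) fin[of n a] show "p = target I \<or> p = d" by (simp add: final_def)
  next
    show "\<exists>a. ?C (goal I) a" using goal by auto
  next
    fix j a assume j: "?C j a"
    then show "1 \<le> j" by simp
    show "j = 1 \<or> (\<exists>b. ?C (j - 1) b)"
    proof (cases "j = 1")
      case False
      with j have "j - 1 \<in> {1..goal I}" by auto
      then show ?thesis by simp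
    qed simp
  next
    fix j a assume "?C j a"
    then have "Xs n a = Some (target I)" "a \<in> assets I" using gT[of j] by blast+
    then show "n \<le> n" "a \<in> assets I" "target I = code d (Xs n a)" by (simp_all add: code_def)
  next
    fix j j' a assume "?C j a" "?C j' a"
    then show "j = j'" using inj_onD[OF g(1), of j j'] by simp
  qed
  have sepL: "p = source I \<or> p = target I \<or> p = d" if "?L i a p" "?L i a' p" "a \<noteq> a'" for i a a' p
  proof -
    have "Xs i a = Xs i a'" using that code_inj[of i i a a'] by simp
    with sep[of i] that have "Xs i a \<in> {Some (source I), Some (target I), None}"
      unfolding separated_def by blast
    with that show ?thesis by (auto simp: code_def)
  qed
  have steps: "\<delta> = 2 * e + 1 \<and> cert_moves I d ?L ?W i \<delta> \<and> cert_waits I ?L ?W i \<delta>"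
    if s: "?S i \<delta> e" "i \<noteq> n" for i \<delta> e
  proof -
    have i: "i < n" "i \<le> n" "Suc i \<le> n" using s by auto
    with s run(4)[of i] have long: "long_step I \<delta> (Xs i) (\<beta>s i) (Xs (Suc i)) (\<beta>s (Suc i))" and \<delta>: "\<delta> = ds i"
      by (auto simp: ds_def)
    then have mv: "move I (Xs i) (\<beta>s i) (Xs (Suc i))" and cd: "countdown I \<delta> (Xs i) (\<beta>s i) (\<beta>s (Suc i))"
      and odd: "odd \<delta>" and rev: "\<delta> \<noteq> 1 \<Longrightarrow> reversible I (Xs i) (Xs (Suc i))"
      and late: "\<And>r. \<delta> \<noteq> 1 \<Longrightarrow> r \<in> traps I \<Longrightarrow> occupied I (Xs i) r \<or> occupied I (Xs (Suc i)) r \<Longrightarrow> \<delta> \<le> \<beta>s i r"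
      unfolding long_step_def by blast+
    have "\<delta> = 2 * e + 1" using odd s by (simp add: \<delta>)
    moreover have "cert_moves I d ?L ?W i \<delta>"
      unfolding cert_moves_def
    proof (intro conjI allI impI)
      fix a p p' assume "?L i a p" "?L (Suc i) a p'"
      then have a: "a \<in> assets I" and p: "p = code d (Xs i a)" "p' = code d (Xs (Suc i) a)" by auto
      have am: "asset_move I (\<beta>s i) (Xs i a) (Xs (Suc i) a)" using mv a by (simp add: move_def)
      have eq: "p' = p \<longleftrightarrow> Xs (Suc i) a = Xs i a" unfolding p using code_inj[OF i(3,2) a a] .
      have w: "?W i p 0 \<longleftrightarrow> (\<exists>r\<in>traps I. Xs i a = Some r \<and> \<beta>s i r = 0)"
      proof -
        have 1: "p = r" if "Xs i a = Some r" for r using that p(1) by (simp add: code_def)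
        have 2: "Xs i a = Some p" if "p \<in> traps I"
          using code_vert[of p i a] p(1) inst_facts(5) that by auto
        show ?thesis using 1 2 i(2) by metis
      qed
      show "if p = target I \<or> p = d then p' = p else if ?W i p 0 then p' = d
         else p' = p \<or> {p, p'} \<in> edges I \<and> p' \<noteq> source I"
      proof (cases "p = target I \<or> p = d")
        case True
        with fin[OF i(2) a] p(1) have "finished I (Xs i a)" by simp
        from asset_move_finished[OF am this] True eq show ?thesis by simp
      next
        case nf: False
        show ?thesis
        proof (cases "?W i p 0")
          case True
          with am nf fin[OF i(2) a] p(1) w have "Xs (Suc i) a = None" by (simp add: asset_move_def)
          with nf True show ?thesis by (simp add: p(2) code_def)
        next
          case False
          with am nf fin[OF i(2) a] p(1) w have "Xs (Suc i) a = Xs i a \<or>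
              (\<exists>u v. Xs i a = Some u \<and> Xs (Suc i) a = Some v \<and> {u, v} \<in> edges I \<and> v \<noteq> source I)"
            unfolding asset_move_def by presburger
          then have "p' = p \<or> {p, p'} \<in> edges I \<and> p' \<noteq> source I"
            using eq by (auto simp: p code_def)
          then show ?thesis unfolding if_not_P[OF nf] if_not_P[OF False] .
        qed
      qed
      assume "\<delta> \<noteq> 1" "p' \<noteq> p"
      with rev a eq have *: "Xs i a \<noteq> Some (source I)" "Xs (Suc i) a \<noteq> Some (target I)" "Xs (Suc i) a \<noteq> None"
        by (auto simp: reversible_def)
      show "p \<noteq> source I" using *(1) code_vert[OF inst_facts(4), of i a] p(1) by simp
      show "p' \<noteq> target I" using *(2) code_vert[OF target, of "Suc i" a] p(2) by simp
      show "p' \<noteq> d" using *(3) code_d[OF i(3) a] p(2) by simp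
    next
      from mv obtain a where a: "a \<in> assets I" "Xs (Suc i) a \<noteq> Xs i a" by (auto simp: move_def)
      with code_inj[OF i(3,2) a(1) a(1)] i show "\<exists>a p p'. ?L i a p \<and> ?L (Suc i) a p' \<and> p' \<noteq> p" by auto
    qed
    moreover have "cert_waits I ?L ?W i \<delta>"
      unfolding cert_waits_def
    proof (intro allI impI)
      fix r b b' assume "?W i r b" "?W (Suc i) r b'"
      then have r: "r \<in> traps I" and b: "b = \<beta>s i r" "b' = \<beta>s (Suc i) r" by auto
      have o: "(\<exists>a. ?L i a r) \<longleftrightarrow> occupied I (Xs i) r" "(\<exists>a. ?L (Suc i) a r) \<longleftrightarrow> occupied I (Xs (Suc i)) r"
        unfolding occ[OF r] using i by auto
      show "(if b = 0 \<and> (\<exists>a. ?L i a r) then b' = reload I r else b' = b - \<delta>) \<and>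
        (\<delta> \<noteq> 1 \<longrightarrow> (\<exists>a. ?L i a r) \<or> (\<exists>a. ?L (Suc i) a r) \<longrightarrow> \<delta> \<le> b)"
        unfolding o b using cd late r by (simp add: countdown_def)
    qed
    ultimately show ?thesis by blast
  qed
  have "cert_ok I d n ?L ?W ?S ?C"
    unfolding cert_ok_def
  proof (intro conjI)
    show "\<forall>i a a' p. ?L i a p \<longrightarrow> ?L i a' p \<longrightarrow> a \<noteq> a' \<longrightarrow> p = source I \<or> p = target I \<or> p = d"
      by (intro allI impI) (rule sepL)
    show "\<forall>i \<delta> e. ?S i \<delta> e \<longrightarrow> i \<noteq> n \<longrightarrow>
        \<delta> = 2 * e + 1 \<and> cert_moves I d ?L ?W i \<delta> \<and> cert_waits I ?L ?W i \<delta>"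
      by (intro allI impI) (rule steps)
  qed (rule frame, rule ends)
  moreover have "code d (Xs i a) \<le> M" if "i \<le> n" "a \<in> assets I" for i a
    using placed[OF that(1)] that(2) d(2) M(2) by (auto simp: code_def placed_def split: option.split)
  moreover have "\<beta>s i r \<le> M" if "i \<le> n" "r \<in> traps I" for i r
    using bounded[OF that(1)] that(2) M(1) by (auto simp: bounded_def)
  moreover have "ds i \<le> M" for i
    using run(4)[of i] M(1) B(1) by (auto simp: ds_def)
  moreover have "g j \<le> M" if "j \<in> {1..goal I}" for j using gT[OF that] M(3) by blast
  ultimately show ?thesis
    by (intro exI[of _ Xs] exI[of _ \<beta>s] exI[of _ ds] exI[of _ g] conjI allI impI ballI)
qed

section \<open>The verifying formula\<close>

definition Or :: "fm \<Rightarrow> fm \<Rightarrow> fm" where "Or f g = Neg (And (Neg f) (Neg g))"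
definition Imp :: "fm \<Rightarrow> fm \<Rightarrow> fm" where "Imp f g = Neg (And f (Neg g))"
definition Cond :: "fm \<Rightarrow> fm \<Rightarrow> fm \<Rightarrow> fm" where "Cond h f g = And (Imp h f) (Imp (Neg h) g)"
definition Eq :: "nat \<Rightarrow> nat \<Rightarrow> nat \<Rightarrow> nat \<Rightarrow> fm" where
  "Eq x i y j = And (At (Lin [(1, x, i), (-1, y, j)] 0)) (At (Lin [(-1, x, i), (1, y, j)] 0))"
definition Is :: "nat \<Rightarrow> nat \<Rightarrow> int \<Rightarrow> fm" where
  "Is x i c = And (At (Lin [(1, x, i)] (- c))) (At (Lin [(-1, x, i)] c))"
definition Next :: "nat \<Rightarrow> nat \<Rightarrow> nat \<Rightarrow> nat \<Rightarrow> fm" where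
  "Next x i y j = And (At (Lin [(1, x, i), (-1, y, j)] 1)) (At (Lin [(-1, x, i), (1, y, j)] (-1)))"
text \<open>The case distinction accounts for the truncation of subtraction, since linear
  inequalities see the true difference.\<close>

definition Diff :: "nat \<Rightarrow> nat \<Rightarrow> nat \<Rightarrow> nat \<Rightarrow> nat \<Rightarrow> nat \<Rightarrow> fm" where
  "Diff z l x i y j = Cond (At (Lin [(1, x, i), (-1, y, j)] 0))
     (And (At (Lin [(1, x, i), (-1, y, j), (-1, z, l)] 0)) (At (Lin [(-1, x, i), (1, y, j), (1, z, l)] 0)))
     (Is z l 0)"
definition ExT :: "nat \<Rightarrow> nat \<Rightarrow> fm \<Rightarrow> fm" where "ExT x T f = Ex x (And (At (Tag x T)) f)"
definition AllT :: "nat \<Rightarrow> nat \<Rightarrow> fm \<Rightarrow> fm" where "AllT x T f = Neg (ExT x T (Neg f))"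
text \<open>Variable 19 is reserved for the record that must not lie in between.\<close>

definition ExP :: "nat \<Rightarrow> nat \<Rightarrow> nat \<Rightarrow> fm \<Rightarrow> fm" where
  "ExP x y T f = Ex x (Ex y (And (And (And (At (Tag x T)) (At (Tag y (T + 1)))) (And (At (Less x y))
     (Neg (Ex 19 (And (At (Less x 19)) (At (Less 19 y))))))) f))"

lemma dsat_simps:
  "dsat D \<eta> (Or f g) \<longleftrightarrow> dsat D \<eta> f \<or> dsat D \<eta> g"
  "dsat D \<eta> (Imp f g) \<longleftrightarrow> (dsat D \<eta> f \<longrightarrow> dsat D \<eta> g)"
  "dsat D \<eta> (Cond h f g) \<longleftrightarrow> (if dsat D \<eta> h then dsat D \<eta> f else dsat D \<eta> g)"
  "dsat D \<eta> (Eq x i y j) \<longleftrightarrow> num i (\<eta> x) = num j (\<eta> y)"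
  "dsat D \<eta> (Is x i c) \<longleftrightarrow> int (num i (\<eta> x)) = c"
  "dsat D \<eta> (Next x i y j) \<longleftrightarrow> num j (\<eta> y) = Suc (num i (\<eta> x))"
  "dsat D \<eta> (Diff z l x i y j) \<longleftrightarrow> num l (\<eta> z) = num i (\<eta> x) - num j (\<eta> y)"
  by (auto simp: Or_def Imp_def Cond_def Eq_def Is_def Next_def Diff_def)

lemma wf_fm_simps:
  "wf_fm K V (Or f g) \<longleftrightarrow> wf_fm K V f \<and> wf_fm K V g"
  "wf_fm K V (Imp f g) \<longleftrightarrow> wf_fm K V f \<and> wf_fm K V g"
  "wf_fm K V (Cond h f g) \<longleftrightarrow> wf_fm K V h \<and> wf_fm K V f \<and> wf_fm K V g"
  "wf_fm K V (Eq x i y j) \<longleftrightarrow> x \<in> V \<and> y \<in> V"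
  "wf_fm K V (Is x i c) \<longleftrightarrow> x \<in> V"
  "wf_fm K V (Next x i y j) \<longleftrightarrow> x \<in> V \<and> y \<in> V"
  "wf_fm K V (Diff z l x i y j) \<longleftrightarrow> x \<in> V \<and> y \<in> V \<and> z \<in> V"
  "wf_fm K V (ExT x T f) \<longleftrightarrow> 2 \<le> x \<and> x < K \<and> x \<notin> V \<and> wf_fm K (insert x V) f"
  "wf_fm K V (AllT x T f) \<longleftrightarrow> 2 \<le> x \<and> x < K \<and> x \<notin> V \<and> wf_fm K (insert x V) f"
  by (auto simp: Or_def Imp_def Cond_def Eq_def Is_def Next_def Diff_def ExT_def AllT_def)

lemma wf_fm_ExP:
  assumes "x \<noteq> y" "x \<noteq> 19" "y \<noteq> 19" "19 < K" "19 \<notin> V"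
  shows "wf_fm K V (ExP x y T f) \<longleftrightarrow>
    2 \<le> x \<and> x < K \<and> x \<notin> V \<and> 2 \<le> y \<and> y < K \<and> y \<notin> V \<and> wf_fm K (insert y (insert x V)) f"
  using assms by (auto simp: ExP_def)

text \<open>A formula is \<open>blind\<close> if it uses the positions only of the variables in \<open>V\<close>; the values of other
  variables may be replaced by records with the same numbers.\<close>

fun blind :: "nat set \<Rightarrow> fm \<Rightarrow> bool" where
  "blind V (At (Tag x T)) \<longleftrightarrow> True"
| "blind V (At (Less x y)) \<longleftrightarrow> x \<in> V \<and> y \<in> V"
| "blind V (At (Lin ls c)) \<longleftrightarrow> (\<forall>(k, x, j)\<in>set ls. j < 3)"
| "blind V (Neg f) \<longleftrightarrow> blind V f"
| "blind V (And f g) \<longleftrightarrow> blind V f \<and> blind V g"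
| "blind V (Ex x f) \<longleftrightarrow> blind (insert x V) f"

lemma blind_simps:
  "blind V (Or f g) \<longleftrightarrow> blind V f \<and> blind V g"
  "blind V (Imp f g) \<longleftrightarrow> blind V f \<and> blind V g"
  "blind V (Cond h f g) \<longleftrightarrow> blind V h \<and> blind V f \<and> blind V g"
  "blind V (Eq x i y j) \<longleftrightarrow> i < 3 \<and> j < 3"
  "blind V (Is x i c) \<longleftrightarrow> i < 3"
  "blind V (Next x i y j) \<longleftrightarrow> i < 3 \<and> j < 3"
  "blind V (Diff z l x i y j) \<longleftrightarrow> i < 3 \<and> j < 3 \<and> l < 3"
  "blind V (ExT x T f) \<longleftrightarrow> blind (insert x V) f"
  "blind V (AllT x T f) \<longleftrightarrow> blind (insert x V) f"
  "blind V (ExP x y T f) \<longleftrightarrow> blind (insert y (insert x V)) f"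
  by (auto simp: Or_def Imp_def Cond_def Eq_def Is_def Next_def Diff_def ExT_def AllT_def ExP_def)

lemma dsat_blind:
  assumes "blind V f" "\<And>x. tag (\<eta> x) = tag (\<eta>' x) \<and> (\<forall>j<3. num j (\<eta> x) = num j (\<eta>' x))"
    "\<And>x. x \<in> V \<Longrightarrow> \<eta> x = \<eta>' x"
  shows "dsat D \<eta> f \<longleftrightarrow> dsat D \<eta>' f"
  using assms
proof (induction V f arbitrary: \<eta> \<eta>' rule: blind.induct)
  case (3 V ls c)
  have "(\<Sum>(k, x, j)\<leftarrow>ls. k * int (num j (\<eta> x))) = (\<Sum>(k, x, j)\<leftarrow>ls. k * int (num j (\<eta>' x)))"
    using 3 by (intro arg_cong[of _ _ sum_list] map_cong) auto
  then show ?case by simp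
next
  case (4 V f)
  have "dsat D \<eta> f \<longleftrightarrow> dsat D \<eta>' f" by (rule "4.IH") (use "4.prems" in auto)
  then show ?case by simp
next
  case (5 V f g)
  have "dsat D \<eta> f \<longleftrightarrow> dsat D \<eta>' f" by (rule "5.IH"(1)) (use "5.prems" in auto)
  moreover have "dsat D \<eta> g \<longleftrightarrow> dsat D \<eta>' g" by (rule "5.IH"(2)) (use "5.prems" in auto)
  ultimately show ?case by simp
next
  case (6 V x f)
  have "dsat D (\<eta>(x := z)) f \<longleftrightarrow> dsat D (\<eta>'(x := z)) f" for z
    by (rule "6.IH") (use "6.prems" in auto)
  then show ?case by simp
qed auto

section \<open>Quantifiers over numbers instead of entries\<close>

definition rel :: "entry set \<Rightarrow> nat \<Rightarrow> nat \<Rightarrow> nat \<Rightarrow> nat \<Rightarrow> bool" where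
  "rel D T a b c \<longleftrightarrow> (\<exists>z\<in>D. tag z = T \<and> num 0 z = a \<and> num 1 z = b \<and> num 2 z = c)"

text \<open>A stand-in for an entry of which only the head and the numbers on the three tracks
  matter; its position is a dummy.\<close>

definition virtual :: "nat \<Rightarrow> nat \<Rightarrow> nat \<Rightarrow> nat \<Rightarrow> entry" where
  "virtual T a b c = (0, T, \<lambda>j. if j = 0 then a else if j = 1 then b else c)"

lemma virtual_simps [simp]:
  "tag (virtual T a b c) = T" "num 0 (virtual T a b c) = a" "num 1 (virtual T a b c) = b"
  "num (Suc 0) (virtual T a b c) = b" "num 2 (virtual T a b c) = c"
  by (simp_all add: virtual_def tag_def num_def)

text \<open>Of an entry, a formula that never looks at positions sees the head and three numbers. So
  a quantifier over entries with a given head becomes one over triples in a relation, which is the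
  form of the conditions in \<open>cert_ok\<close>.\<close>

lemma dsat_ExT:
  assumes "blind {} f"
  shows "dsat D \<eta> (ExT x T f) \<longleftrightarrow> (\<exists>a b c. rel D T a b c \<and> dsat D (\<eta>(x := virtual T a b c)) f)"
proof -
  have eq: "dsat D (\<eta>(x := z)) f \<longleftrightarrow> dsat D (\<eta>(x := virtual T (num 0 z) (num 1 z) (num 2 z))) f"
    if "tag z = T" for z
  proof (rule dsat_blind[OF assms])
    have *: "(\<forall>j<3. P j) \<longleftrightarrow> P 0 \<and> P 1 \<and> P 2" for P :: "nat \<Rightarrow> bool"
      by (auto simp: numeral_3_eq_3 numeral_2_eq_2 less_Suc_eq)
    show "tag ((\<eta>(x := z)) y) = tag ((\<eta>(x := virtual T (num 0 z) (num 1 z) (num 2 z))) y) \<and>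
      (\<forall>j<3. num j ((\<eta>(x := z)) y) = num j ((\<eta>(x := virtual T (num 0 z) (num 1 z) (num 2 z))) y))" for y
      unfolding * using that by simp
  qed simp
  have "dsat D \<eta> (ExT x T f) \<longleftrightarrow> (\<exists>z\<in>D. tag z = T \<and> dsat D (\<eta>(x := z)) f)"
    by (simp add: ExT_def)
  also have "\<dots> \<longleftrightarrow> (\<exists>a b c. rel D T a b c \<and> dsat D (\<eta>(x := virtual T a b c)) f)"
    unfolding rel_def using eq by blast
  finally show ?thesis .
qed

lemma dsat_AllT:
  assumes "blind {} f"
  shows "dsat D \<eta> (AllT x T f) \<longleftrightarrow> (\<forall>a b c. rel D T a b c \<longrightarrow> dsat D (\<eta>(x := virtual T a b c)) f)"
  using dsat_ExT[of "Neg f"] assms by (simp add: AllT_def)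

lemma dsat_ExP:
  assumes "x \<noteq> y" "x \<noteq> 19" "y \<noteq> 19"
  shows "dsat D \<eta> (ExP x y T f) \<longleftrightarrow>
    (\<exists>z\<in>D. \<exists>z'\<in>D. paired D T z z' \<and> dsat D (\<eta>(x := z, y := z')) f)"
  using assms by (auto simp: ExP_def paired_def)

text \<open>Variables 16, 17 and 18 are reserved for these macros, which can therefore be used under
  quantifiers over 2, ..., 10 without capture. Together with 19 they account for the total of 20
  tapes.\<close>

definition Vertex :: "nat \<Rightarrow> nat \<Rightarrow> fm" where
  "Vertex x i = ExT 16 vertex_tag (Eq 16 0 x i)"
definition Edge :: "nat \<Rightarrow> nat \<Rightarrow> nat \<Rightarrow> nat \<Rightarrow> fm" where
  "Edge x i y j = ExP 17 18 edge_tag (Or (And (Eq 17 0 x i) (Eq 18 0 y j)) (And (Eq 17 0 y j) (Eq 18 0 x i)))"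
definition Reload :: "nat \<Rightarrow> nat \<Rightarrow> nat \<Rightarrow> nat \<Rightarrow> fm" where
  "Reload x i y j = ExP 17 18 trap_tag (And (Eq 17 0 x i) (Eq 18 0 y j))"

definition distinct_fm :: "nat \<Rightarrow> fm" where
  "distinct_fm T = Neg (Ex 7 (Ex 8 (And (At (Tag 7 T)) (And (At (Tag 8 T)) (And (At (Less 7 8)) (Eq 7 0 8 0))))))"

text \<open>The variables \<open>2, \<dots>, 6\<close> stand for the location of eliminated assets, the last configuration,
  the source, the target and the goal.\<close>

definition instance_fm :: fm where
  "instance_fm =
     And (Neg (ExT 7 error_tag (Eq 7 0 7 0)))
    (And (distinct_fm asset_tag)
    (And (distinct_fm vertex_tag)
    (And (distinct_fm trap_tag)
    (And (Neg (ExP 7 8 edge_tag (ExP 9 10 edge_tag (And (At (Less 7 9))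
            (Or (And (Eq 7 0 9 0) (Eq 8 0 10 0)) (And (Eq 7 0 10 0) (Eq 8 0 9 0)))))))
    (And (Neg (ExP 7 8 edge_tag (Neg (And (Vertex 7 0) (And (Vertex 8 0) (Neg (Eq 7 0 8 0)))))))
    (And (Neg (ExP 7 8 trap_tag (Neg (And (Vertex 7 0) (And (Neg (Eq 7 0 4 0)) (And (Neg (Eq 7 0 5 0)) (Neg (Is 8 0 0))))))))
    (And (Vertex 4 0) (And (Vertex 5 0) (Neg (Eq 4 0 5 0))))))))))"

abbreviation (input) "loc_tag \<equiv> 16 :: nat"
abbreviation (input) "wait_tag \<equiv> 17 :: nat"
abbreviation (input) "step_tag \<equiv> 18 :: nat"
abbreviation (input) "count_tag \<equiv> 19 :: nat"
abbreviation (input) "dead_tag \<equiv> 20 :: nat"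
abbreviation (input) "end_tag \<equiv> 21 :: nat"

definition frame_fm :: fm where
  "frame_fm =
     And (Neg (Vertex 2 0))
    (And (ExT 7 step_tag (Is 7 0 0))
    (And (AllT 7 step_tag (Or (Eq 7 0 3 0) (ExT 8 step_tag (Next 7 0 8 0))))
    (And (AllT 7 step_tag (AllT 8 asset_tag (ExT 9 loc_tag (And (Eq 9 0 7 0) (Eq 9 1 8 0)))))
    (And (AllT 7 step_tag (AllT 8 trap_tag (ExT 9 wait_tag (And (Eq 9 0 7 0) (Eq 9 1 8 0)))))
    (And (AllT 7 loc_tag (AllT 8 loc_tag (Imp (And (Eq 7 0 8 0) (Eq 7 1 8 1)) (Eq 7 2 8 2))))
    (And (AllT 7 wait_tag (AllT 8 wait_tag (Imp (And (Eq 7 0 8 0) (Eq 7 1 8 1)) (Eq 7 2 8 2))))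
    (And (AllT 7 loc_tag (ExT 8 asset_tag (Eq 8 0 7 1)))
         (AllT 7 wait_tag (ExT 8 trap_tag (Eq 8 0 7 1))))))))))"

definition ends_fm :: fm where
  "ends_fm =
     And (AllT 7 loc_tag (Imp (Is 7 0 0) (Eq 7 2 4 0)))
    (And (AllT 7 wait_tag (Imp (Is 7 0 0) (Is 7 2 0)))
    (And (AllT 7 loc_tag (Imp (Eq 7 0 3 0) (Or (Eq 7 2 5 0) (Eq 7 2 2 0))))
    (And (ExT 7 count_tag (Eq 7 0 6 0))
    (And (AllT 7 count_tag (And (Neg (Is 7 0 0)) (And (Or (Is 7 0 1) (ExT 8 count_tag (Next 8 0 7 0)))
            (ExT 9 loc_tag (And (Eq 9 0 3 0) (And (Eq 9 1 7 1) (Eq 9 2 5 0)))))))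
         (AllT 7 count_tag (AllT 8 count_tag (Imp (Eq 7 1 8 1) (Eq 7 0 8 0))))))))"

definition separated_fm :: fm where
  "separated_fm = AllT 7 loc_tag (AllT 8 loc_tag (Imp (And (Eq 7 0 8 0) (And (Eq 7 2 8 2) (Neg (Eq 7 1 8 1))))
     (Or (Eq 7 2 4 0) (Or (Eq 7 2 5 0) (Eq 7 2 2 0)))))"

definition moves_fm :: fm where
  "moves_fm =
     And (AllT 8 loc_tag (AllT 9 loc_tag (Imp (And (Eq 8 0 7 0) (And (Next 7 0 9 0) (Eq 8 1 9 1)))
       (And (Cond (Or (Eq 8 2 5 0) (Eq 8 2 2 0)) (Eq 9 2 8 2)
              (Cond (ExT 10 wait_tag (And (Eq 10 0 8 0) (And (Eq 10 1 8 2) (Is 10 2 0)))) (Eq 9 2 2 0)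
                (Or (Eq 9 2 8 2) (And (Edge 8 2 9 2) (Neg (Eq 9 2 4 0))))))
            (Imp (And (Neg (Is 7 1 1)) (Neg (Eq 9 2 8 2)))
              (And (Neg (Eq 8 2 4 0)) (And (Neg (Eq 9 2 5 0)) (Neg (Eq 9 2 2 0)))))))))
     (ExT 8 loc_tag (ExT 9 loc_tag (And (Eq 8 0 7 0) (And (Next 7 0 9 0) (And (Eq 8 1 9 1) (Neg (Eq 9 2 8 2)))))))"

definition waits_fm :: fm where
  "waits_fm = AllT 8 wait_tag (AllT 9 wait_tag (Imp (And (Eq 8 0 7 0) (And (Next 7 0 9 0) (Eq 8 1 9 1)))
     (And (Cond (And (Is 8 2 0) (ExT 10 loc_tag (And (Eq 10 0 7 0) (Eq 10 2 8 1)))) (Reload 8 1 9 2)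
            (Diff 9 2 8 2 7 1))
          (Imp (And (Neg (Is 7 1 1)) (Or (ExT 10 loc_tag (And (Eq 10 0 7 0) (Eq 10 2 8 1)))
                 (ExT 10 loc_tag (And (Next 7 0 10 0) (Eq 10 2 8 1)))))
            (At (Lin [(1, 8, 2), (-1, 7, 1)] 0))))))"

definition steps_fm :: fm where
  "steps_fm = AllT 7 step_tag (Imp (Neg (Eq 7 0 3 0))
     (And (And (At (Lin [(1, 7, 1), (-2, 7, 2)] (-1))) (At (Lin [(-1, 7, 1), (2, 7, 2)] 1)))
     (And moves_fm waits_fm)))"

definition cert_fm :: fm where
  "cert_fm = And frame_fm (And ends_fm (And separated_fm steps_fm))"

definition routing_fm :: fm where
  "routing_fm = ExT 4 source_tag (ExT 5 target_tag (ExT 6 goal_tag (And instance_fm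
     (ExT 2 dead_tag (ExT 3 end_tag cert_fm)))))"

lemmas macro_defs = Vertex_def Edge_def Reload_def distinct_fm_def

lemma blind_fms:
  "blind V instance_fm" "blind V (Vertex x i) \<longleftrightarrow> i < 3" "blind V (Edge x i y j) \<longleftrightarrow> i < 3 \<and> j < 3"
  "blind V (Reload x i y j) \<longleftrightarrow> i < 3 \<and> j < 3"
  "blind V moves_fm" "blind V waits_fm" "blind V cert_fm"
  by (auto simp: macro_defs instance_fm_def moves_fm_def waits_fm_def cert_fm_def frame_fm_def ends_fm_def
      separated_fm_def steps_fm_def blind_simps)

lemma wf_routing_fm: "wf_fm 20 {} routing_fm"
  by (simp add: routing_fm_def macro_defs instance_fm_def moves_fm_def waits_fm_def cert_fm_def frame_fm_def
      ends_fm_def separated_fm_def steps_fm_def wf_fm_simps wf_fm_ExP)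

section \<open>The meaning of the verifying formula over the database of an instance\<close>

context instance_db
begin

lemma rel_instance:
  "rel D asset_tag a b c \<longleftrightarrow> a \<in> set as \<and> b = 0 \<and> c = 0"
  "rel D vertex_tag a b c \<longleftrightarrow> a \<in> set vs \<and> b = 0 \<and> c = 0"
  "rel D source_tag a b c \<longleftrightarrow> a = s \<and> b = 0 \<and> c = 0"
  "rel D target_tag a b c \<longleftrightarrow> a = t \<and> b = 0 \<and> c = 0"
  "rel D goal_tag a b c \<longleftrightarrow> a = k \<and> b = 0 \<and> c = 0"
  "rel D trap_tag a b c \<longleftrightarrow> a \<in> fst ` set rs \<and> b = 0 \<and> c = 0"
  "\<not> rel D error_tag a b c"
  unfolding rel_def single[of "\<lambda>x y z. x = a \<and> y = b \<and> z = c"] by auto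

lemma dsat_Vertex: "x \<noteq> 16 \<Longrightarrow> i < 3 \<Longrightarrow> dsat D \<eta> (Vertex x i) \<longleftrightarrow> num i (\<eta> x) \<in> set vs"
  by (auto simp: Vertex_def dsat_ExT blind_simps rel_instance dsat_simps)

lemma dsat_Edge:
  assumes "x \<notin> {17, 18}" "y \<notin> {17, 18}"
  shows "dsat D \<eta> (Edge x i y j) \<longleftrightarrow> {num i (\<eta> x), num j (\<eta> y)} \<in> set (map (\<lambda>(u, v). {u, v}) es)"
proof -
  have "dsat D \<eta> (Edge x i y j) \<longleftrightarrow> (\<exists>z\<in>D. \<exists>z'\<in>D. paired D edge_tag z z' \<and>
      {num 0 z, num 0 z'} = {num i (\<eta> x), num j (\<eta> y)})"
    using assms by (simp add: Edge_def dsat_ExP dsat_simps doubleton_eq_iff)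
  also have "\<dots> \<longleftrightarrow> (\<exists>(u, v)\<in>set es. {u, v} = {num i (\<eta> x), num j (\<eta> y)})"
    by (rule pair(1)[of "\<lambda>u v. {u, v} = {num i (\<eta> x), num j (\<eta> y)}"])
  finally show ?thesis by (auto simp: image_iff eq_commute)
qed

lemma dsat_Reload:
  assumes "x \<notin> {17, 18}" "y \<notin> {17, 18}"
  shows "dsat D \<eta> (Reload x i y j) \<longleftrightarrow> (num i (\<eta> x), num j (\<eta> y)) \<in> set rs"
proof -
  have "dsat D \<eta> (Reload x i y j) \<longleftrightarrow> (\<exists>z\<in>D. \<exists>z'\<in>D. paired D trap_tag z z' \<and>
      (num 0 z = num i (\<eta> x) \<and> num 0 z' = num j (\<eta> y)))"
    using assms by (simp add: Reload_def dsat_ExP dsat_simps)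
  also have "\<dots> \<longleftrightarrow> (\<exists>(u, v)\<in>set rs. u = num i (\<eta> x) \<and> v = num j (\<eta> y))"
    by (rule pair(2)[of "\<lambda>u v. u = num i (\<eta> x) \<and> v = num j (\<eta> y)"])
  finally show ?thesis by auto
qed

definition I :: "(nat, nat) routing_instance" where
  "I = \<lparr>assets = set as, vertices = set vs, edges = set (map (\<lambda>(u, v). {u, v}) es), source = s, target = t,
    traps = fst ` set rs, reload = (\<lambda>r. the (map_of rs r)), goal = k\<rparr>"

lemma I_simps [simp]:
  "assets I = set as" "vertices I = set vs" "edges I = set (map (\<lambda>(u, v). {u, v}) es)" "source I = s"
  "target I = t" "traps I = fst ` set rs" "reload I r = the (map_of rs r)" "goal I = k"
  by (simp_all add: I_def)

lemma dsat_instance_fm: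
  assumes "num 0 (\<eta> 4) = s" "num 0 (\<eta> 5) = t"
  shows "dsat D \<eta> instance_fm \<longleftrightarrow>
    distinct as \<and> distinct vs \<and> distinct (map fst rs) \<and> distinct (map (\<lambda>(u, v). {u, v}) es) \<and>
    (\<forall>(u, v)\<in>set es. u \<in> set vs \<and> v \<in> set vs \<and> u \<noteq> v) \<and>
    (\<forall>(r, c)\<in>set rs. r \<in> set vs \<and> r \<noteq> s \<and> r \<noteq> t \<and> c \<noteq> 0) \<and>
    s \<in> set vs \<and> t \<in> set vs \<and> s \<noteq> t"
proof -
  have 1: "\<not> dsat D \<eta> (ExT 7 error_tag (Eq 7 0 7 0))"
    by (simp add: dsat_ExT blind_simps rel_instance)
  have 2: "dsat D \<eta> (distinct_fm T) \<longleftrightarrow>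
      (\<forall>z\<in>D. \<forall>z'\<in>D. tag z = T \<longrightarrow> tag z' = T \<longrightarrow> pos z < pos z' \<longrightarrow> num 0 z \<noteq> num 0 z')" for T
    by (simp add: distinct_fm_def dsat_simps) blast
  have 3: "dsat D \<eta> (Neg (ExP 7 8 edge_tag (ExP 9 10 edge_tag (And (At (Less 7 9))
        (Or (And (Eq 7 0 9 0) (Eq 8 0 10 0)) (And (Eq 7 0 10 0) (Eq 8 0 9 0))))))) \<longleftrightarrow>
      (\<forall>z\<in>D. \<forall>z'\<in>D. \<forall>y\<in>D. \<forall>y'\<in>D. paired D edge_tag z z' \<longrightarrow> paired D edge_tag y y' \<longrightarrow> pos z < pos y \<longrightarrow>
          {num 0 z, num 0 z'} \<noteq> {num 0 y, num 0 y'})"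
    by (simp add: dsat_ExP dsat_simps doubleton_eq_iff) blast
  have "dsat D \<eta> (ExP 7 8 edge_tag (Neg (And (Vertex 7 0) (And (Vertex 8 0) (Neg (Eq 7 0 8 0)))))) \<longleftrightarrow>
      (\<exists>z\<in>D. \<exists>z'\<in>D. paired D edge_tag z z' \<and>
        (\<not> (num 0 z \<in> set vs \<and> num 0 z' \<in> set vs \<and> num 0 z \<noteq> num 0 z')))"
    by (simp add: dsat_ExP dsat_simps dsat_Vertex)
  then have 4: "dsat D \<eta> (ExP 7 8 edge_tag (Neg (And (Vertex 7 0) (And (Vertex 8 0) (Neg (Eq 7 0 8 0)))))) \<longleftrightarrow>
      (\<exists>(u, v)\<in>set es. \<not> (u \<in> set vs \<and> v \<in> set vs \<and> u \<noteq> v))"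
    unfolding pair(1)[of "\<lambda>u v. \<not> (u \<in> set vs \<and> v \<in> set vs \<and> u \<noteq> v)"] .
  have "dsat D \<eta> (ExP 7 8 trap_tag (Neg (And (Vertex 7 0) (And (Neg (Eq 7 0 4 0)) (And (Neg (Eq 7 0 5 0)) (Neg (Is 8 0 0))))))) \<longleftrightarrow>
      (\<exists>z\<in>D. \<exists>z'\<in>D. paired D trap_tag z z' \<and>
        (\<not> (num 0 z \<in> set vs \<and> num 0 z \<noteq> s \<and> num 0 z \<noteq> t \<and> num 0 z' \<noteq> 0)))"
    using assms by (simp add: dsat_ExP dsat_simps dsat_Vertex)
  then have 5: "dsat D \<eta> (ExP 7 8 trap_tag (Neg (And (Vertex 7 0) (And (Neg (Eq 7 0 4 0)) (And (Neg (Eq 7 0 5 0)) (Neg (Is 8 0 0))))))) \<longleftrightarrow>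
      (\<exists>(r, c)\<in>set rs. \<not> (r \<in> set vs \<and> r \<noteq> s \<and> r \<noteq> t \<and> c \<noteq> 0))"
    unfolding pair(2)[of "\<lambda>r c. \<not> (r \<in> set vs \<and> r \<noteq> s \<and> r \<noteq> t \<and> c \<noteq> 0)"] .
  have 6: "dsat D \<eta> (Vertex 4 0) \<longleftrightarrow> s \<in> set vs" "dsat D \<eta> (Vertex 5 0) \<longleftrightarrow> t \<in> set vs"
    "dsat D \<eta> (Eq 4 0 5 0) \<longleftrightarrow> s = t"
    using assms by (simp_all add: dsat_Vertex dsat_simps)
  show ?thesis
    unfolding instance_fm_def dsat.simps(4,5)[of D \<eta>] 2 dist(1-3) 3[unfolded dsat.simps(4)] dist(4) 4 5 6
    using 1 by blast
qed

abbreviation "loc \<equiv> rel D loc_tag"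
abbreviation "wait \<equiv> rel D wait_tag"
abbreviation "steps \<equiv> rel D step_tag"
abbreviation "chosen j a \<equiv> \<exists>x. rel D count_tag j a x"

lemmas dsat_fms = dsat_ExT dsat_AllT blind_simps blind_fms dsat_simps dsat_Vertex rel_instance

context
  fixes \<eta> :: "nat \<Rightarrow> entry" and d N :: nat
  assumes \<eta>: "num 0 (\<eta> 2) = d" "num 0 (\<eta> 3) = N" "num 0 (\<eta> 4) = s" "num 0 (\<eta> 5) = t" "num 0 (\<eta> 6) = k"
begin

lemma dsat_frame_fm: "dsat D \<eta> frame_fm \<longleftrightarrow> cert_frame I d N loc wait steps"
proof -
  have traps: "(\<exists>p\<in>set rs. fst p = r) \<longleftrightarrow> r \<in> fst ` set rs" for r by auto
  show ?thesis unfolding frame_fm_def cert_frame_def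
    by (simp add: dsat_fms \<eta> traps, intro arg_cong2[of _ _ _ _ conj] refl) blast+
qed

lemma dsat_ends_fm: "dsat D \<eta> ends_fm \<longleftrightarrow> cert_ends I d N loc wait chosen"
proof -
  have Suc: "(\<exists>i. Q i \<and> j = Suc i) \<longleftrightarrow> 1 \<le> j \<and> Q (j - 1)" for j Q
    by (cases j) auto
  have pos: "0 < j \<longleftrightarrow> 1 \<le> j" for j :: nat by auto
  show ?thesis unfolding ends_fm_def cert_ends_def
    by (simp add: dsat_fms \<eta> Suc[unfolded One_nat_def] pos[unfolded One_nat_def]) blast
qed

lemma dsat_separated_fm: "dsat D \<eta> separated_fm \<longleftrightarrow>
    (\<forall>i a a' p. loc i a p \<longrightarrow> loc i a' p \<longrightarrow> a \<noteq> a' \<longrightarrow> p = s \<or> p = t \<or> p = d)"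
  unfolding separated_fm_def by (simp add: dsat_fms \<eta>) blast

lemma dsat_moves_fm:
  "dsat D (\<eta>(7 := virtual step_tag i \<delta> e)) moves_fm \<longleftrightarrow> cert_moves I d loc wait i \<delta>"
proof -
  define P where "P p p' \<longleftrightarrow>
      (if p = target I \<or> p = d then p' = p
       else if wait i p 0 then p' = d
       else p' = p \<or> {p, p'} \<in> edges I \<and> p' \<noteq> source I) \<and>
      (\<delta> \<noteq> 1 \<longrightarrow> p' \<noteq> p \<longrightarrow> p \<noteq> source I \<and> p' \<noteq> target I \<and> p' \<noteq> d)" for p p'
  let ?A = "AllT 8 loc_tag (AllT 9 loc_tag (Imp (And (Eq 8 0 7 0) (And (Next 7 0 9 0) (Eq 8 1 9 1)))
       (And (Cond (Or (Eq 8 2 5 0) (Eq 8 2 2 0)) (Eq 9 2 8 2)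
              (Cond (ExT 10 wait_tag (And (Eq 10 0 8 0) (And (Eq 10 1 8 2) (Is 10 2 0)))) (Eq 9 2 2 0)
                (Or (Eq 9 2 8 2) (And (Edge 8 2 9 2) (Neg (Eq 9 2 4 0))))))
            (Imp (And (Neg (Is 7 1 1)) (Neg (Eq 9 2 8 2)))
              (And (Neg (Eq 8 2 4 0)) (And (Neg (Eq 9 2 5 0)) (Neg (Eq 9 2 2 0)))))))) "
  have "dsat D (\<eta>(7 := virtual step_tag i \<delta> e)) ?A \<longleftrightarrow>
      (\<forall>j a p j' a' p'. loc j a p \<longrightarrow> loc j' a' p' \<longrightarrow> j = i \<and> j' = Suc i \<and> a = a' \<longrightarrow> P p p')"
    by (simp add: dsat_fms dsat_Edge \<eta> P_def if_bool_eq_conj imp_conjL cong: conj_cong imp_cong)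
  then have "dsat D (\<eta>(7 := virtual step_tag i \<delta> e)) ?A \<longleftrightarrow>
      (\<forall>a p p'. loc i a p \<longrightarrow> loc (Suc i) a p' \<longrightarrow> P p p')"
    by blast
  moreover have "dsat D (\<eta>(7 := virtual step_tag i \<delta> e)) (ExT 8 loc_tag (ExT 9 loc_tag
      (And (Eq 8 0 7 0) (And (Next 7 0 9 0) (And (Eq 8 1 9 1) (Neg (Eq 9 2 8 2))))))) \<longleftrightarrow>
      (\<exists>a p p'. loc i a p \<and> loc (Suc i) a p' \<and> p' \<noteq> p)"
    by (simp add: dsat_fms) blast
  ultimately show ?thesis
    unfolding moves_fm_def cert_moves_def P_def[symmetric] dsat.simps(5) by (rule arg_cong2[of _ _ _ _ conj])
qed

text \<open>The instance has a function for reload times where the input has a table. They agree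
  wherever the table is consulted, because the names of the traps are distinct and, by
  \<open>cert_frame\<close>, waiting times are recorded for traps only.\<close>

lemma dsat_waits_fm:
  assumes "cert_frame I d N loc wait steps" "distinct (map fst rs)"
  shows "dsat D (\<eta>(7 := virtual step_tag i \<delta> e)) waits_fm \<longleftrightarrow> cert_waits I loc wait i \<delta>"
proof -
  define P where "P r b b' \<longleftrightarrow>
      (if b = 0 \<and> (\<exists>a. loc i a r) then b' = reload I r else b' = b - \<delta>) \<and>
      (\<delta> \<noteq> 1 \<longrightarrow> (\<exists>a. loc i a r) \<or> (\<exists>a. loc (Suc i) a r) \<longrightarrow> \<delta> \<le> b)" for r b b'
  have Reload: "(r, b) \<in> set rs \<longleftrightarrow> b = the (map_of rs r)" if "wait j r c" for j r b c
  proof -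
    have "r \<in> traps I" using cert_frameD(9)[OF assms(1) that] .
    then obtain b' where "(r, b') \<in> set rs" by auto
    with assms(2) have "map_of rs r = Some b'" by simp
    then show ?thesis unfolding map_of_eq_Some_iff[OF assms(2), symmetric] by auto
  qed
  have "dsat D (\<eta>(7 := virtual step_tag i \<delta> e)) waits_fm \<longleftrightarrow>
      (\<forall>j r b j' r' b'. wait j r b \<longrightarrow> wait j' r' b' \<longrightarrow> j = i \<and> j' = Suc i \<and> r = r' \<longrightarrow> P r b b')"
    unfolding waits_fm_def
    by (simp add: dsat_fms dsat_Reload Reload \<eta> P_def if_bool_eq_conj imp_conjL cong: conj_cong imp_cong)
  then show ?thesis unfolding cert_waits_def P_def
    by blast
qed

lemma dsat_cert_fm:
  assumes "distinct (map fst rs)"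
  shows "dsat D \<eta> cert_fm \<longleftrightarrow> cert_ok I d N loc wait steps chosen"
proof -
  \<comment> \<open>The steps are interpreted under the frame condition, which both sides of the
    equivalence contain as a conjunct.\<close>
  have "dsat D \<eta> steps_fm \<longleftrightarrow> (\<forall>i \<delta> e. steps i \<delta> e \<longrightarrow> i \<noteq> N \<longrightarrow>
      \<delta> = 2 * e + 1 \<and> cert_moves I d loc wait i \<delta> \<and> cert_waits I loc wait i \<delta>)"
    if "cert_frame I d N loc wait steps"
  proof -
    have odd: "2 * int e < int \<delta> \<and> 0 \<le> 1 + (2 * int e - int \<delta>) \<and> X \<longleftrightarrow> \<delta> = 2 * e + 1 \<and> X" for \<delta> e X
      by linarith
    show ?thesis unfolding steps_fm_def
      using odd by (simp add: dsat_AllT blind_simps blind_fms dsat_simps \<eta> dsat_moves_fm dsat_waits_fm[OF that assms])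
  qed
  then show ?thesis
    unfolding cert_fm_def cert_ok_def I_simps dsat.simps dsat_frame_fm dsat_ends_fm dsat_separated_fm by blast
qed

end

definition well_formed :: bool where
  "well_formed \<longleftrightarrow>
    distinct as \<and> distinct vs \<and> distinct (map fst rs) \<and> distinct (map (\<lambda>(u, v). {u, v}) es) \<and>
    (\<forall>(u, v)\<in>set es. u \<in> set vs \<and> v \<in> set vs \<and> u \<noteq> v) \<and>
    (\<forall>(r, c)\<in>set rs. r \<in> set vs \<and> r \<noteq> s \<and> r \<noteq> t \<and> c \<noteq> 0) \<and>
    s \<in> set vs \<and> t \<in> set vs \<and> s \<noteq> t"

lemma dsat_routing_fm:
  "dsat D \<eta> routing_fm \<longleftrightarrow> well_formed \<and>
    (\<exists>d N. (\<exists>b c. rel D dead_tag d b c) \<and> (\<exists>b c. rel D end_tag N b c) \<and>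
      cert_ok I d N loc wait steps chosen)"
proof -
  define \<eta>1 where "\<eta>1 = \<eta>(4 := virtual source_tag s 0 0, 5 := virtual target_tag t 0 0, 6 := virtual goal_tag k 0 0)"
  have "dsat D \<eta> routing_fm \<longleftrightarrow> dsat D \<eta>1 instance_fm \<and> dsat D \<eta>1 (ExT 2 dead_tag (ExT 3 end_tag cert_fm))"
    unfolding routing_fm_def \<eta>1_def
    by (subst dsat_ExT, simp add: blind_simps blind_fms, simp add: rel_instance)+
  moreover have "dsat D \<eta>1 instance_fm \<longleftrightarrow> well_formed"
    unfolding well_formed_def by (rule dsat_instance_fm) (simp_all add: \<eta>1_def)
  moreover have "dsat D \<eta>1 (ExT 2 dead_tag (ExT 3 end_tag cert_fm)) \<longleftrightarrow>
      (\<exists>d N. (\<exists>b c. rel D dead_tag d b c) \<and> (\<exists>b c. rel D end_tag N b c) \<and>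
      cert_ok I d N loc wait steps chosen)" if "well_formed"
  proof -
    have "dsat D (\<eta>1(2 := virtual dead_tag d b c, 3 := virtual end_tag N b' c')) cert_fm \<longleftrightarrow>
        cert_ok I d N loc wait steps chosen" for d b c N b' c'
      using that by (intro dsat_cert_fm) (simp_all add: \<eta>1_def well_formed_def)
    then show ?thesis by (simp add: dsat_ExT blind_simps blind_fms)
  qed
  ultimately show ?thesis by blast
qed

end

section \<open>Certificates as words\<close>

text \<open>Unlike those of the instance, numbers of a certificate may have leading zeros, so all
  records can have the same width \<open>n\<close>.\<close>

fun columns :: "nat \<Rightarrow> nat \<Rightarrow> nat \<Rightarrow> nat \<Rightarrow> bool list list" where
  "columns 0 a b c = []"
| "columns (Suc n) a b c = [odd a, odd b, odd c] # columns n (a div 2) (b div 2) (c div 2)"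

definition tracks :: "nat \<Rightarrow> nat \<Rightarrow> nat \<Rightarrow> nat \<Rightarrow> nat list" where
  "tracks n a b c = map (\<lambda>bs. decode (bs @ [True])) (columns n a b c)"

text \<open>The record \<open>(u, a, b, c)\<close> gets the head \<open>16 + u\<close> and numbers of \<open>n\<close> bits.\<close>

fun cert_record :: "nat \<Rightarrow> nat \<times> nat \<times> nat \<times> nat \<Rightarrow> bool list" where
  "cert_record n (u, a, b, c) = [odd u, odd (u div 2), odd (u div 4), False] @
     concat (map (\<lambda>bs. bs @ [True]) (columns n a b c))"

definition cert_word :: "nat \<Rightarrow> (nat \<times> nat \<times> nat \<times> nat) list \<Rightarrow> bool list" where
  "cert_word n us = concat (map (cert_record n) us)"

definition cert_recs :: "nat \<Rightarrow> (nat \<times> nat \<times> nat \<times> nat) list \<Rightarrow> (nat \<times> nat list) list" where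
  "cert_recs n us = map (\<lambda>(u, a, b, c). (16 + u, tracks n a b c)) us"

lemma length_cert_word: "length (cert_word n us) = 4 * (n + 1) * length us"
proof -
  have "length (concat (map (\<lambda>bs. bs @ [True]) (columns n a b c))) = 4 * n" for a b c
    by (induction n arbitrary: a b c) simp_all
  then have "length (cert_record n r) = 4 * (n + 1)" for r
    by (cases r) simp
  then show ?thesis unfolding cert_word_def
    by (induction us) simp_all
qed

lemma columns_triple: "bs \<in> set (columns n a b c) \<Longrightarrow> \<exists>b0 b1 b2. bs = [b0, b1, b2]"
  by (induction n arbitrary: a b c) auto

lemma tracks_digit: "\<forall>s\<in>set (tracks n a b c). is_digit s"
  using columns_triple digit_less by (fastforce simp: tracks_def is_digit_def)

lemma parse_nibble:
  "transduce parse (Cert []) (map bit_code ([b0, b1, b2, b3] @ y)) =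
    decode [b0, b1, b2, b3] # transduce parse (Cert []) (map bit_code y)"
  by (cases b0; cases b1; cases b2; cases b3) (simp_all add: digit_def)

lemma parse_columns:
  "transduce parse (Cert []) (map bit_code (concat (map (\<lambda>bs. bs @ [True]) (columns n a b c)) @ y)) =
    tracks n a b c @ transduce parse (Cert []) (map bit_code y)"
proof (induction n arbitrary: a b c)
  case (Suc n)
  have "concat (map (\<lambda>bs. bs @ [True]) (columns (Suc n) a b c)) @ y =
      [odd a, odd b, odd c, True] @ (concat (map (\<lambda>bs. bs @ [True]) (columns n (a div 2) (b div 2) (c div 2))) @ y)"
    by simp
  moreover have "tracks (Suc n) a b c =
      decode [odd a, odd b, odd c, True] # tracks n (a div 2) (b div 2) (c div 2)"
    by (simp add: tracks_def)
  ultimately show ?case by (simp only: parse_nibble Suc.IH) (simp only: append_Cons)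
qed (simp add: tracks_def)

lemma parse_cert_word:
  assumes "\<And>r. r \<in> set us \<Longrightarrow> fst r < 8"
  shows "transduce parse (Cert []) (map bit_code (cert_word n us)) = flat (cert_recs n us)"
  using assms
proof (induction us)
  case (Cons r us)
  obtain u a b c where r: "r = (u, a, b, c)" by (cases r)
  have u: "u < 8" using Cons.prems[of r] r by simp
  have head: "decode [odd u, odd (u div 2), odd (u div 4), False] = 16 + u"
  proof -
    have "u = 0 \<or> u = 1 \<or> u = 2 \<or> u = 3 \<or> u = 4 \<or> u = 5 \<or> u = 6 \<or> u = 7" using u by linarith
    then show ?thesis by (elim disjE) (simp_all add: digit_def)
  qed
  have "cert_word n (r # us) = [odd u, odd (u div 2), odd (u div 4), False] @
      (concat (map (\<lambda>bs. bs @ [True]) (columns n a b c)) @ cert_word n us)"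
    by (simp add: cert_word_def r)
  moreover have "transduce parse (Cert []) (map bit_code (cert_word n us)) = flat (cert_recs n us)"
    using Cons by simp
  ultimately have "transduce parse (Cert []) (map bit_code (cert_word n (r # us))) =
      (16 + u) # tracks n a b c @ flat (cert_recs n us)"
    by (simp only: parse_nibble parse_columns head)
  then show ?case by (simp add: cert_recs_def r)
qed (simp add: cert_word_def cert_recs_def)

lemma val_tracks:
  assumes "a < 2 ^ n" "b < 2 ^ n" "c < 2 ^ n"
  shows "val 0 (tracks n a b c) = a" "val 1 (tracks n a b c) = b" "val 2 (tracks n a b c) = c"
proof -
  have "val 0 (tracks n a b c) = a \<and> val 1 (tracks n a b c) = b \<and> val 2 (tracks n a b c) = c"
    using assms
  proof (induction n arbitrary: a b c)
    case (Suc n)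
    have bits: "bit (digit b0 b1 b2) 0 = b0" "bit (digit b0 b1 b2) 1 = b1" "bit (digit b0 b1 b2) 2 = b2" for b0 b1 b2
      by (cases b0; cases b1; cases b2; simp add: digit_def bit_iff_odd)+
    have "is_digit (digit b0 b1 b2)" for b0 b1 b2 using digit_less by (simp add: is_digit_def)
    moreover have "tracks (Suc n) a b c = digit (odd a) (odd b) (odd c) # tracks n (a div 2) (b div 2) (c div 2)"
      by (simp add: tracks_def)
    moreover have "of_bool (odd m) + 2 * (m div 2) = m" for m :: nat by (simp add: odd_two_times_div_two_nat)
    moreover have "m < 2 ^ Suc n \<Longrightarrow> m div 2 < 2 ^ n" for m :: nat by auto
    ultimately show ?case using Suc bits by simp
  qed (simp add: tracks_def)
  then show "val 0 (tracks n a b c) = a" "val 1 (tracks n a b c) = b" "val 2 (tracks n a b c) = c" by auto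
qed

text \<open>The records of the certificate have heads 16, ..., 23, those of the instance and of the
  separator at least 24. So each relation consists of the listed facts and nothing else.\<close>

lemma rel_cert:
  assumes D: "D = db (flat (instance_recs as vs es s t rs k @ (cert_tag, []) # cert_recs n us))"
    and u: "u < 8" "\<And>r. r \<in> set us \<Longrightarrow> fst r < 8"
    and less: "\<And>u a b c. (u, a, b, c) \<in> set us \<Longrightarrow> a < 2 ^ n \<and> b < 2 ^ n \<and> c < 2 ^ n"
  shows "rel D (16 + u) a b c \<longleftrightarrow> (u, a, b, c) \<in> set us"
proof -
  let ?recs = "instance_recs as vs es s t rs k @ (cert_tag, []) # cert_recs n us"
  have wf: "wf_recs ?recs"
  proof -
    have "wf_recs (cert_recs n us)" using tracks_digit by (auto simp: wf_recs_def cert_recs_def is_head_def)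
    then show ?thesis using wf_instance_recs by (simp add: is_head_def)
  qed
  have "rel D (16 + u) a b c \<longleftrightarrow>
      (\<exists>r\<in>set ?recs. fst r = 16 + u \<and> val 0 (snd r) = a \<and> val 1 (snd r) = b \<and> val 2 (snd r) = c)"
    unfolding rel_def using bex_db_rec[OF wf D, of "\<lambda>T f. T = 16 + u \<and> f 0 = a \<and> f 1 = b \<and> f 2 = c"] .
  also have "\<dots> \<longleftrightarrow> (\<exists>r\<in>set (cert_recs n us). fst r = 16 + u \<and> val 0 (snd r) = a \<and> val 1 (snd r) = b \<and> val 2 (snd r) = c)"
    using u(1) by (auto simp: instance_recs_def)
  also have "\<dots> \<longleftrightarrow> (\<exists>(u', a', b', c')\<in>set us. u' = u \<and> a' = a \<and> b' = b \<and> c' = c)"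
  proof -
    have "fst ((\<lambda>(u, a, b, c). (16 + u, tracks n a b c)) r) = 16 + u \<and>
        val 0 (snd ((\<lambda>(u, a, b, c). (16 + u, tracks n a b c)) r)) = a \<and>
        val 1 (snd ((\<lambda>(u, a, b, c). (16 + u, tracks n a b c)) r)) = b \<and>
        val 2 (snd ((\<lambda>(u, a, b, c). (16 + u, tracks n a b c)) r)) = c \<longleftrightarrow>
        (case r of (u', a', b', c') \<Rightarrow> u' = u \<and> a' = a \<and> b' = b \<and> c' = c)" if "r \<in> set us" for r
    proof (cases r)
      case (fields u' a' b' c')
      with that less have "a' < 2 ^ n" "b' < 2 ^ n" "c' < 2 ^ n" by blast+
      from val_tracks[OF this] show ?thesis unfolding fields by simp
    qed
    then show ?thesis unfolding cert_recs_def set_map bex_simps(7) by (rule bex_cong[OF refl])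
  qed
  finally show ?thesis by auto
qed

section \<open>Sizes of numbers and lists in an encoding, and transfer between instances\<close>

lemma less_power_bits: "n < 2 ^ length (bits n)"
proof (induction n rule: less_induct)
  case (less n)
  show ?case
  proof (cases "n = 0")
    case False
    with less[of "n div 2"] show ?thesis by (simp add: bits.simps[of n])
  qed simp
qed

lemma length_enc_list:
  "length xs \<le> length (enc_list f xs)" "x \<in> set xs \<Longrightarrow> length (f x) \<le> length (enc_list f xs)"
proof -
  show "length xs \<le> length (enc_list f xs)" unfolding enc_list_def by (induction xs) auto
  show "x \<in> set xs \<Longrightarrow> length (f x) \<le> length (enc_list f xs)" unfolding enc_list_def by (induction xs) auto
qed

lemma less_power_enc_nat: "length (enc_nat n) \<le> m \<Longrightarrow> n < 2 ^ m"
proof -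
  assume "length (enc_nat n) \<le> m"
  then have "length (bits n) \<le> m"
    using length_enc_list(1)[of "bits n" "\<lambda>b. [b]"] by (simp add: enc_nat_def)
  then have "2 ^ length (bits n) \<le> (2 :: nat) ^ m" by (rule power_increasing) simp
  with less_power_bits[of n] show ?thesis by linarith
qed

lemma encoding_bounds:
  fixes as vs :: "nat list" and es rs :: "(nat \<times> nat) list" and s t k :: nat
  defines "m \<equiv> length (encoding as vs es s t rs k)"
  shows "length as \<le> m" "length vs \<le> m" "length rs \<le> m" "a \<in> set as \<Longrightarrow> a < 2 ^ m" "v \<in> set vs \<Longrightarrow> v < 2 ^ m"
    "(r, c) \<in> set rs \<Longrightarrow> c < 2 ^ m"
proof -
  have m: "length (enc_list enc_nat as) \<le> m" "length (enc_list enc_nat vs) \<le> m" "length (enc_list enc_pair rs) \<le> m"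
    by (simp_all add: m_def encoding_def)
  show "length as \<le> m" "length vs \<le> m" "length rs \<le> m"
    by (rule order_trans[OF length_enc_list(1) m(1)], rule order_trans[OF length_enc_list(1) m(2)],
        rule order_trans[OF length_enc_list(1) m(3)])
  show "a \<in> set as \<Longrightarrow> a < 2 ^ m" "v \<in> set vs \<Longrightarrow> v < 2 ^ m"
    by (rule less_power_enc_nat[OF order_trans[OF length_enc_list(2) m(1)]], assumption)
      (rule less_power_enc_nat[OF order_trans[OF length_enc_list(2) m(2)]])
  have "length (enc_nat c) \<le> length (enc_pair (r, c))" by (simp add: enc_pair_def)
  then show "(r, c) \<in> set rs \<Longrightarrow> c < 2 ^ m"
    using m length_enc_list(2)[of "(r, c)" rs enc_pair] by (intro less_power_enc_nat) linarith
qed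

text \<open>The word determines reload times at traps only, so the instance that is read from it may
  differ elsewhere from the given one. This does no harm, since certificates record waiting times
  for traps only.\<close>

lemma cert_ok_cong:
  assumes "assets I = assets J" "vertices I = vertices J" "edges I = edges J" "source I = source J"
    "target I = target J" "traps I = traps J" "goal I = goal J" "\<And>r. r \<in> traps I \<Longrightarrow> reload I r = reload J r"
    and ok: "cert_ok I d N L W S C"
  shows "cert_ok J d N L W S C"
proof -
  note eq = assms(1-7)[symmetric]
  have frame: "cert_frame I d N L W S" using ok by (simp add: cert_ok_def)
  have "cert_waits J L W i \<delta>" if "cert_waits I L W i \<delta>" for i \<delta>
    using that assms(8) cert_frameD(9)[OF frame] unfolding cert_waits_def by metis
  moreover have "cert_frame J d N L W S" using frame by (simp add: cert_frame_def eq)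
  moreover have "cert_ends I d N L W C \<longleftrightarrow> cert_ends J d N L W C" by (simp add: cert_ends_def eq)
  moreover have "cert_moves I d L W i \<delta> \<longleftrightarrow> cert_moves J d L W i \<delta>" for i \<delta> by (simp add: cert_moves_def eq)
  ultimately show ?thesis using ok unfolding cert_ok_def eq by blast
qed

text \<open>The formula does not compare the goal with the number of assets. That the goal is in its
  range follows from the numbering of the survivors.\<close>

lemma cert_goal:
  assumes "finite (assets I)" "cert_ok I d N L W S C"
  shows "1 \<le> goal I" "goal I \<le> card (assets I)"
proof -
  have frame: "cert_frame I d N L W S" and ends: "cert_ends I d N L W C"
    using assms(2) by (simp_all add: cert_ok_def)
  have top: "\<exists>a. C (goal I) a"
    and C: "\<And>j a. C j a \<Longrightarrow> 1 \<le> j \<and> (j = 1 \<or> (\<exists>b. C (j - 1) b)) \<and> L N a (target I)"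
    and inj: "\<And>j j' a. C j a \<Longrightarrow> C j' a \<Longrightarrow> j = j'"
    using ends unfolding cert_ends_def by blast+
  show "1 \<le> goal I" using top C by blast
  have "\<exists>a. C (goal I - i) a" if "i < goal I" for i
    using that
  proof (induction i)
    case (Suc i)
    then obtain a where a: "C (goal I - i) a" by auto
    have "goal I - i \<noteq> 1" "goal I - i - 1 = goal I - Suc i" using Suc.prems by auto
    with C[OF a] show ?case by metis
  qed (use top in simp)
  then have "\<forall>i<goal I. \<exists>a. C (goal I - i) a" by blast
  then obtain g where g: "\<And>i. i < goal I \<Longrightarrow> C (goal I - i) (g i)" by metis
  have "inj_on g {..<goal I}"
  proof
    fix i j assume ij: "i \<in> {..<goal I}" "j \<in> {..<goal I}" "g i = g j"
    then have "goal I - i = goal I - j" by (metis inj g lessThan_iff)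
    with ij show "i = j" by auto
  qed
  moreover have "g ` {..<goal I} \<subseteq> assets I"
    using g C cert_frameD(8)[OF frame] by blast
  ultimately have "card {..<goal I} \<le> card (assets I)"
    using assms(1) by (rule card_inj_on_le)
  then show "goal I \<le> card (assets I)" by simp
qed

section \<open>Membership in NP\<close>

context instance_db
begin

lemma routing_instance_I:
  assumes "well_formed" "cert_ok I d N L W S C"
  shows "routing_instance I"
proof -
  have "edges I \<subseteq> {e. e \<subseteq> vertices I \<and> card e = 2}"
  proof
    fix e assume "e \<in> edges I"
    then obtain u v where "(u, v) \<in> set es" "e = {u, v}" by auto
    with assms(1) show "e \<in> {e. e \<subseteq> vertices I \<and> card e = 2}" by (auto simp: well_formed_def)
  qed
  moreover have "0 < reload I r \<and> r \<in> set vs \<and> r \<noteq> s \<and> r \<noteq> t" if "r \<in> traps I" for r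
  proof -
    from that obtain c where c: "(r, c) \<in> set rs" by auto
    with assms(1) have "map_of rs r = Some c" by (simp add: well_formed_def)
    with c assms(1) show ?thesis by (auto simp: well_formed_def)
  qed
  moreover have "1 \<le> goal I" "goal I \<le> card (assets I)"
    using cert_goal[OF _ assms(2)] by simp_all
  ultimately show ?thesis
    using assms(1) unfolding routing_instance_def by (auto simp: well_formed_def)
qed

lemma encodes_I:
  assumes "well_formed"
  shows "encodes (encoding as vs es s t rs k) I"
proof -
  have "map (\<lambda>r. (r, reload I r)) (map fst rs) = rs"
    using assms by (auto simp: well_formed_def intro: map_idI)
  then show ?thesis unfolding encodes_def
    using assms by (intro exI[of _ as] exI[of _ vs] exI[of _ es] exI[of _ "map fst rs"])
      (simp add: well_formed_def encoding_def)
qed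

end

section \<open>Soundness and completeness of the verifying formula\<close>

lemma tokens_pair_word: "transduce parse (List asset_tag) (pair_word x y) = tokens (List asset_tag) x y"
  by (simp add: tokens_def pair_word_def)

lemma routing_fm_sound:
  assumes "holds routing_fm (tokens (List asset_tag) x y)"
  shows "x \<in> ROUTING_PLAN"
proof -
  define w where "w = tokens (List asset_tag) x y"
  define \<eta> :: "nat \<Rightarrow> entry" where "\<eta> = (\<lambda>_. virtual 0 0 0 0)"
  have sat: "dsat (db w) \<eta> routing_fm"
    using assms unfolding w_def tokens_def
    by (rule holds_iff_dsat[OF wf_routing_fm transduce_nonzero, THEN iffD1])
  \<comment> \<open>The meaning of the formula is available only once the input is known to be an
    encoding. So the absence of error tokens is read off the raw database.\<close>
  then obtain \<eta>' where "dsat (db w) \<eta>' instance_fm"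
    by (auto simp: routing_fm_def ExT_def)
  then have no_error: "\<not> dsat (db w) \<eta>' (ExT 7 error_tag (Eq 7 0 7 0))"
    by (simp add: instance_fm_def)
  have "error_tag \<notin> set w"
  proof
    assume "error_tag \<in> set w"
    then obtain p where p: "p < length w" "w ! p = error_tag" by (auto simp: in_set_conv_nth)
    then have "entry w p \<in> db w" by (auto simp: db_def is_head_def)
    moreover have "tag (entry w p) = error_tag" using p by (simp add: entry_def tag_def)
    ultimately show False using no_error by (auto simp: ExT_def dsat_simps)
  qed
  then obtain as vs es s t rs k where x: "x = encoding as vs es s t rs k"
    using error_free_encoding unfolding w_def by blast
  have symbols: "\<forall>c\<in>set (transduce parse (Cert []) (map bit_code y)). 8 \<le> c \<and> c < 24"
    using set_cert_tokens[of "[]" y] by auto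
  then have "\<forall>c\<in>set (transduce parse (Cert []) (map bit_code y)). is_digit c \<or> is_head c"
    by (auto simp: is_digit_def is_head_def)
  \<comment> \<open>Digits at the beginning of the certificate become the number of the separator's
    record, to which the formula never refers.\<close>
  from flat_decompose[OF this] obtain ds recs where
    recs: "transduce parse (Cert []) (map bit_code y) = ds @ flat recs" "\<forall>c\<in>set ds. is_digit c" "wf_recs recs"
    "fst ` set recs \<subseteq> set (transduce parse (Cert []) (map bit_code y))" by metis
  have "w = flat (instance_recs as vs es s t rs k @ (cert_tag, ds) # recs)"
    unfolding w_def x flat_instance_recs recs(1) by simp
  moreover have "instance_db (db (flat (instance_recs as vs es s t rs k @ (cert_tag, ds) # recs))) as vs es s t rs k"
  proof (rule instance_db[OF refl])
    show "wf_recs ((cert_tag, ds) # recs)" using recs(2,3) by (simp add: is_head_def)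
    show "fst r = cert_tag \<or> fst r < asset_tag" if "r \<in> set ((cert_tag, ds) # recs)" for r
      using that recs(4) symbols by fastforce
  qed
  ultimately have "instance_db (db w) as vs es s t rs k" by simp
  then interpret instance_db "db w" as vs es s t rs k .
  from sat obtain d N where "well_formed" and cert: "cert_ok I d N loc wait steps chosen"
    unfolding dsat_routing_fm by blast
  then have "routing_instance I" "encodes x I" using routing_instance_I encodes_I x by blast+
  moreover have "yes_instance I"
    using cert_sound[OF \<open>routing_instance I\<close> cert] plan_of_wins[OF \<open>routing_instance I\<close>] by blast
  ultimately show ?thesis unfolding ROUTING_PLAN_def by blast
qed

text \<open>One record for each fact of the relations. The leading component plus 16 is the head;
  kinds 4 and 5 name the location of eliminated assets and the last configuration.\<close>

lemma cert_list:
  fixes I :: "(nat, nat) routing_instance" and X :: "nat \<Rightarrow> nat \<Rightarrow> nat" and \<beta> :: "nat \<Rightarrow> nat \<Rightarrow> nat"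
  assumes "finite (assets I)" "finite (traps I)"
  obtains us :: "(nat \<times> nat \<times> nat \<times> nat) list" where
    "\<And>i a p. (0, i, a, p) \<in> set us \<longleftrightarrow> i \<le> N \<and> a \<in> assets I \<and> p = X i a"
    "\<And>i r b. (1, i, r, b) \<in> set us \<longleftrightarrow> i \<le> N \<and> r \<in> traps I \<and> b = \<beta> i r"
    "\<And>i \<delta> e. (2, i, \<delta>, e) \<in> set us \<longleftrightarrow> i \<le> N \<and> \<delta> = ds i \<and> e = ds i div 2"
    "\<And>j a c. (3, j, a, c) \<in> set us \<longleftrightarrow> j \<in> {1..goal I} \<and> a = g j \<and> c = 0"
    "\<And>a b c. (4, a, b, c) \<in> set us \<longleftrightarrow> a = d \<and> b = 0 \<and> c = 0"
    "\<And>a b c. (5, a, b, c) \<in> set us \<longleftrightarrow> a = N \<and> b = 0 \<and> c = 0"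
    "\<And>u. u \<in> set us \<Longrightarrow> fst u < 6"
    "length us \<le> (N + 1) * (card (assets I) + card (traps I) + 1) + goal I + 2"
proof -
  define U0 where "U0 = (\<lambda>(i, a). (0 :: nat, i, a, X i a)) ` ({..N} \<times> assets I)"
  define U1 where "U1 = (\<lambda>(i, r). (1 :: nat, i, r, \<beta> i r)) ` ({..N} \<times> traps I)"
  define U2 where "U2 = (\<lambda>i. (2 :: nat, i, ds i, ds i div 2)) ` {..N}"
  define U3 where "U3 = (\<lambda>j. (3 :: nat, j, g j, 0 :: nat)) ` {1..goal I}"
  define U4 where "U4 = {(4 :: nat, d, 0 :: nat, 0 :: nat), (5, N, 0, 0)}"
  note U = U0_def U1_def U2_def U3_def U4_def
  have fin: "finite U0" "finite U1" "finite U2" "finite U3" "finite U4"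
    using assms by (simp_all add: U)
  then have "finite (U0 \<union> U1 \<union> U2 \<union> U3 \<union> U4)" by simp
  from finite_distinct_list[OF this] obtain us where us: "set us = U0 \<union> U1 \<union> U2 \<union> U3 \<union> U4" "distinct us"
    by blast
  have le: "card U0 \<le> (N + 1) * card (assets I)" "card U1 \<le> (N + 1) * card (traps I)" "card U2 \<le> N + 1"
    "card U3 \<le> goal I" "card U4 \<le> 2"
  proof -
    show "card U0 \<le> (N + 1) * card (assets I)" unfolding U0_def
      by (rule order_trans[OF card_image_le]) (use assms in \<open>simp_all add: card_cartesian_product\<close>)
    show "card U1 \<le> (N + 1) * card (traps I)" unfolding U1_def
      by (rule order_trans[OF card_image_le]) (use assms in \<open>simp_all add: card_cartesian_product\<close>)
    show "card U2 \<le> N + 1" unfolding U2_def by (rule order_trans[OF card_image_le]) simp_all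
    show "card U3 \<le> goal I" unfolding U3_def by (rule order_trans[OF card_image_le]) simp_all
    show "card U4 \<le> 2" by (simp add: U4_def)
  qed
  have "length us = card (U0 \<union> U1 \<union> U2 \<union> U3 \<union> U4)" using us distinct_card by metis
  also have "\<dots> \<le> card U0 + card U1 + card U2 + card U3 + card U4"
    by (intro order_trans[OF card_Un_le] add_mono order_refl)
  also have "\<dots> \<le> (N + 1) * (card (assets I) + card (traps I) + 1) + goal I + 2"
    using le by (simp add: algebra_simps)
  finally have len: "length us \<le> (N + 1) * (card (assets I) + card (traps I) + 1) + goal I + 2" .
  show ?thesis
  proof (rule that[of us])
    show "fst u < 6" if "u \<in> set us" for u using that unfolding us U by auto
  qed (use len in \<open>auto simp: us(1) U\<close>)
qed

text \<open>With at most \<open>l\<close> assets, vertices and traps, the factors in the bound on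
  \<open>N\<close> are one more than bounds on the potential and on \<open>walk_length\<close>.
  There are at most \<open>84 * m ^ 6\<close> records, each of \<open>42 * m ^ 5 + 1\<close> blocks
  of four bits; 20000 rounds up 4 * 43 * 84.\<close>

lemma power_bounds:
  fixes l :: nat
  defines "m \<equiv> l + 1"
  assumes N: "N \<le> (3 * l * (l + 1) + l + 1) * (2 * l ^ 3 + 4 * l\<^sup>2 + 4)"
    and u: "u \<le> (N + 1) * (l + l + 1) + l + 2"
  shows "N \<le> 40 * m ^ 5" "4 * (42 * m ^ 5 + 1) * u \<le> 20000 * m ^ 11"
proof -
  have l: "l \<le> m" "1 \<le> m" by (simp_all add: m_def)
  have pow: "m ^ i \<le> m ^ j" if "i \<le> j" for i j using l(2) that by (rule power_increasing[rotated])
  have "3 * l * (l + 1) + l + 1 = 3 * (l * m) + m" by (simp add: m_def algebra_simps)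
  also have "\<dots> \<le> 3 * (m * m) + m * m" using l by (intro add_mono mult_le_mono) auto
  finally have 1: "3 * l * (l + 1) + l + 1 \<le> 4 * m ^ 2" by (simp add: power2_eq_square)
  have "l ^ 3 \<le> m ^ 3" "l\<^sup>2 \<le> m ^ 3" "1 \<le> m ^ 3"
    using power_mono[OF l(1), of 3] order_trans[OF power_mono[OF l(1), of 2] pow[of 2 3]] pow[of 0 3] by simp_all
  then have 2: "2 * l ^ 3 + 4 * l\<^sup>2 + 4 \<le> 10 * m ^ 3" by linarith
  have "N \<le> (4 * m ^ 2) * (10 * m ^ 3)" using order_trans[OF N mult_le_mono[OF 1 2]] .
  also have "\<dots> = 40 * m ^ 5" by (simp add: power_add[symmetric])
  finally show N: "N \<le> 40 * m ^ 5" .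
  have one: "1 \<le> m ^ 5" using pow[of 0 5] by simp
  have "N + 1 \<le> 41 * m ^ 5" "l + l + 1 \<le> 2 * m" using N one by (linarith, simp add: m_def)
  then have "(N + 1) * (l + l + 1) \<le> (41 * m ^ 5) * (2 * m)" by (rule mult_le_mono)
  then have "(N + 1) * (l + l + 1) + l + 2 \<le> (41 * m ^ 5) * (2 * m) + 2 * m" by (simp add: m_def)
  also have "\<dots> \<le> 84 * m ^ 6"
  proof -
    have "m \<le> m ^ 6" using pow[of 1 6] by simp
    moreover have "m ^ 5 * m = m ^ 6" by (simp add: power_Suc2[symmetric] del: power_Suc2 power_Suc)
    ultimately show ?thesis by (simp add: mult.assoc[symmetric] mult.commute)
  qed
  finally have u': "u \<le> 84 * m ^ 6" using u by linarith
  have "4 * (42 * m ^ 5 + 1) * u \<le> (172 * m ^ 5) * (84 * m ^ 6)"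
  proof (rule mult_le_mono[OF _ u'])
    have "1 \<le> q \<Longrightarrow> 4 * (42 * q + 1) \<le> 172 * q" for q :: nat by simp
    then show "4 * (42 * m ^ 5 + 1) \<le> 172 * m ^ 5" using one .
  qed
  also have "\<dots> = 14448 * m ^ 11" by (simp add: power_add[symmetric])
  finally show "4 * (42 * m ^ 5 + 1) * u \<le> 20000 * m ^ 11" by linarith
qed

lemma routing_fm_complete:
  assumes "x \<in> ROUTING_PLAN"
  shows "\<exists>y. length y \<le> 20000 * (length x + 1) ^ 11 \<and> holds routing_fm (tokens (List asset_tag) x y)"
proof -
  obtain J where "encodes x J" and inst: "routing_instance J" and yes: "yes_instance J"
    using assms by (auto simp: ROUTING_PLAN_def)
  then obtain as vs es rs' where listed: "distinct as" "set as = assets J" "distinct vs" "set vs = vertices J"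
    "distinct (map (\<lambda>(u, v). {u, v}) es)" "set (map (\<lambda>(u, v). {u, v}) es) = edges J"
    "distinct rs'" "set rs' = traps J"
    "x = enc_list enc_nat as @ enc_list enc_nat vs @ enc_list enc_pair es @ enc_nat (source J) @ enc_nat (target J) @
      enc_list enc_pair (map (\<lambda>r. (r, reload J r)) rs') @ enc_nat (goal J)"
    unfolding encodes_def by blast
  define rs where "rs = map (\<lambda>r. (r, reload J r)) rs'"
  have x: "x = encoding as vs es (source J) (target J) rs (goal J)"
    using listed(9) by (simp add: encoding_def rs_def)
  define l where "l = length x"
  note small = encoding_bounds[where as = as and vs = vs and es = es and s = "source J" and t = "target J" and rs = rs and k = "goal J",
     folded x l_def]
  have fin: "finite (assets J)" "finite (vertices J)" "finite (traps J)"
    using listed by (metis List.finite_set)+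
  have J: "source J \<in> vertices J" "source J \<noteq> target J" "target J \<in> vertices J"
    "traps J \<subseteq> vertices J - {source J, target J}" "\<forall>r\<in>traps J. 0 < reload J r" "1 \<le> goal J"
    "goal J \<le> card (assets J)" "edges J \<subseteq> {e. e \<subseteq> vertices J \<and> card e = 2}"
    using inst by (auto simp: routing_instance_def)
  have card: "card (assets J) \<le> l" "card (vertices J) \<le> l" "card (traps J) \<le> l"
    using small(1-3) listed distinct_card[of as] distinct_card[of vs] distinct_card[of rs'] by (simp_all add: rs_def)
  \<comment> \<open>A name that no vertex bears. Names of vertices are below \<open>2 ^ l\<close>,
    so it is at most \<open>2 ^ l\<close>.\<close>
  define d where "d = Suc (Max (vertices J))"
  define B where "B = Max (insert 1 (reload J ` traps J))"
  \<comment> \<open>The first summand covers names, timers, durations and the goal, the second the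
    numbers of the configurations.\<close>
  define M where "M = 2 ^ l + 40 * (l + 1) ^ 5"
  have d: "d \<notin> vertices J" "d \<le> 2 ^ l"
  proof -
    show "d \<notin> vertices J" using Max_ge[OF fin(2), of d] by (auto simp: d_def)
    have "Max (vertices J) \<in> vertices J" using fin(2) J(1) by (intro Max_in) auto
    then show "d \<le> 2 ^ l" using small(5)[of "Max (vertices J)"] listed(4) by (simp add: d_def)
  qed
  have B_facts: "1 \<le> B" "\<And>r. r \<in> traps J \<Longrightarrow> reload J r \<le> B" "B \<le> 2 ^ l"
  proof -
    have fin': "finite (insert 1 (reload J ` traps J))" using fin by simp
    show "1 \<le> B" "\<And>r. r \<in> traps J \<Longrightarrow> reload J r \<le> B"
      unfolding B_def by (rule Max_ge[OF fin']; simp)+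
    have "reload J r \<le> 2 ^ l" if "r \<in> traps J" for r
      using small(6)[of r "reload J r"] that listed(8) by (auto simp: rs_def intro: less_imp_le)
    then show "B \<le> 2 ^ l" unfolding B_def by (subst Max_le_iff[OF fin']) auto
  qed
  interpret routing J B by unfold_locales (use inst B_facts in auto)
  obtain N0 where "wins J N0 (\<lambda>_. Some (source J)) (\<lambda>_. 0)" using wins_of_plan[OF inst yes] by blast
  moreover have "placed J (\<lambda>_. Some (source J))" "separated J (\<lambda>_. Some (source J))" "bounded (\<lambda>_. 0)"
    using J by (simp_all add: placed_def separated_def bounded_def)
  ultimately obtain N where N: "N \<le> (potential (\<lambda>_. Some (source J)) (\<lambda>_. 0) + 1) * (walk_length + 1)"
    "long_wins N (\<lambda>_. Some (source J)) (\<lambda>_. 0)"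
    using long_wins_of_wins by blast
  have N_le: "N \<le> (3 * l * (l + 1) + l + 1) * (2 * l ^ 3 + 4 * l\<^sup>2 + 4)"
  proof -
    have "potential (\<lambda>_. Some (source J)) (\<lambda>_. 0) \<le> 3 * l * (l + 1) + l"
      by (rule order_trans[OF potential_bound], intro add_mono mult_le_mono card) (simp_all add: card)
    moreover have "walk_length \<le> 2 * l ^ 3 + 4 * l\<^sup>2 + 3"
      unfolding walk_length_def by (intro add_mono mult_le_mono power_mono card) simp_all
    ultimately have "(potential (\<lambda>_. Some (source J)) (\<lambda>_. 0) + 1) * (walk_length + 1) \<le>
        (3 * l * (l + 1) + l + 1) * (2 * l ^ 3 + 4 * l\<^sup>2 + 4)"
      by (intro mult_le_mono) simp_all
    with N(1) show ?thesis by linarith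
  qed
  have N40: "N \<le> 40 * (l + 1) ^ 5" using power_bounds(1)[OF N_le, of 0] by simp
  have pow: "2 ^ l \<le> M" "l < 2 ^ l" by (simp_all add: M_def)
  have "\<exists>Xs \<beta>s ds g. cert_ok J d N
     (\<lambda>i a p. i \<le> N \<and> a \<in> assets J \<and> p = code d (Xs i a))
     (\<lambda>i r b. i \<le> N \<and> r \<in> traps J \<and> b = \<beta>s i r)
     (\<lambda>i \<delta> e. i \<le> N \<and> \<delta> = ds i \<and> e = ds i div 2)
     (\<lambda>j a. j \<in> {1..goal J} \<and> a = g j) \<and>
     (\<forall>i\<le>N. (\<forall>a\<in>assets J. code d (Xs i a) \<le> M) \<and> (\<forall>r\<in>traps J. \<beta>s i r \<le> M) \<and> ds i \<le> M) \<and>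
     (\<forall>j\<in>{1..goal J}. g j \<le> M)"
  proof (rule cert_complete[OF routing_axioms d(1)])
    show "d \<le> M" "B \<le> M" using d(2) B_facts(3) pow by linarith+
    show "v \<le> M" if "v \<in> vertices J" for v using small(5)[of v] that listed(4) pow by simp
    show "a \<le> M" if "a \<in> assets J" for a using small(4)[of a] that listed(2) pow by simp
    show "N \<le> M" using N40 by (simp add: M_def)
    show "goal J \<le> M" using J(7) card(1) pow by linarith
  qed (rule N(2))
  then obtain X \<beta> ds g where cert: "cert_ok J d N
     (\<lambda>i a p. i \<le> N \<and> a \<in> assets J \<and> p = code d (X i a))
     (\<lambda>i r b. i \<le> N \<and> r \<in> traps J \<and> b = \<beta> i r)
     (\<lambda>i \<delta> e. i \<le> N \<and> \<delta> = ds i \<and> e = ds i div 2)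
     (\<lambda>j a. j \<in> {1..goal J} \<and> a = g j)"
    and le_M: "\<And>i a. i \<le> N \<Longrightarrow> a \<in> assets J \<Longrightarrow> code d (X i a) \<le> M"
      "\<And>i r. i \<le> N \<Longrightarrow> r \<in> traps J \<Longrightarrow> \<beta> i r \<le> M" "\<And>i. i \<le> N \<Longrightarrow> ds i \<le> M"
      "\<And>j. j \<in> {1..goal J} \<Longrightarrow> g j \<le> M"
    by blast
  obtain us :: "(nat \<times> nat \<times> nat \<times> nat) list" where
    us: "\<And>i a p. (0, i, a, p) \<in> set us \<longleftrightarrow> i \<le> N \<and> a \<in> assets J \<and> p = code d (X i a)"
      "\<And>i r b. (1, i, r, b) \<in> set us \<longleftrightarrow> i \<le> N \<and> r \<in> traps J \<and> b = \<beta> i r"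
      "\<And>i \<delta> e. (2, i, \<delta>, e) \<in> set us \<longleftrightarrow> i \<le> N \<and> \<delta> = ds i \<and> e = ds i div 2"
      "\<And>j a c. (3, j, a, c) \<in> set us \<longleftrightarrow> j \<in> {1..goal J} \<and> a = g j \<and> c = 0"
      "\<And>a b c. (4, a, b, c) \<in> set us \<longleftrightarrow> a = d \<and> b = 0 \<and> c = 0"
      "\<And>a b c. (5, a, b, c) \<in> set us \<longleftrightarrow> a = N \<and> b = 0 \<and> c = 0"
    and us_tag: "\<And>u. u \<in> set us \<Longrightarrow> fst u < 6"
    and us_len: "length us \<le> (N + 1) * (card (assets J) + card (traps J) + 1) + goal J + 2"
    by (erule cert_list[OF fin(1,3), where N = N and X = "\<lambda>i a. code d (X i a)" and \<beta> = \<beta> and ds = ds and g = g and d = d])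
  \<comment> \<open>Chosen such that \<open>M < 2 ^ n\<close>: as
    \<open>l + 1 + 40 * (l + 1) ^ 5 \<le> n\<close>, one summand of \<open>M\<close> is at most and
    the other less than half of \<open>2 ^ n\<close>.\<close>
  define n where "n = 42 * (l + 1) ^ 5"
  define y where "y = cert_word n us"
  have us_len': "length us \<le> (N + 1) * (l + l + 1) + l + 2"
  proof -
    have "(N + 1) * (card (assets J) + card (traps J) + 1) + goal J + 2 \<le> (N + 1) * (l + l + 1) + l + 2"
      using J(7) card by (intro add_mono mult_le_mono) simp_all
    with us_len show ?thesis by linarith
  qed
  have length_y: "length y \<le> 20000 * (length x + 1) ^ 11"
    using power_bounds(2)[OF N_le us_len'] by (simp add: y_def length_cert_word n_def l_def)
  have M_less: "M < 2 ^ n"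
  proof -
    have "(l + 1) ^ 1 \<le> (l + 1) ^ 5" by (rule power_increasing) simp_all
    then have n: "l + 1 + 40 * (l + 1) ^ 5 \<le> n" by (simp add: n_def)
    have "40 * (l + 1) ^ 5 < 2 ^ (40 * (l + 1) ^ 5)" by simp
    also have "\<dots> \<le> (2 :: nat) ^ (n - 1)" using n by (intro power_increasing) auto
    finally have "40 * (l + 1) ^ 5 < (2 :: nat) ^ (n - 1)" .
    moreover have "(2 :: nat) ^ l \<le> 2 ^ (n - 1)" using n by (intro power_increasing) auto
    moreover have "(2 :: nat) ^ n = 2 ^ (n - 1) + 2 ^ (n - 1)"
      using n by (cases n) simp_all
    ultimately show ?thesis unfolding M_def by linarith
  qed
  have us_less: "a < 2 ^ n \<and> b < 2 ^ n \<and> c < 2 ^ n" if mem: "(u, a, b, c) \<in> set us" for u a b c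
  proof -
    have le: "i \<le> M" if "i \<le> N" for i using that N40 by (simp add: M_def)
    have "u < 6" using us_tag[OF mem] by simp
    then have "u = 0 \<or> u = 1 \<or> u = 2 \<or> u = 3 \<or> u = 4 \<or> u = 5" by linarith
    moreover have "a' \<le> M" if "a' \<in> assets J" for a' using small(4)[of a'] that listed(2) pow by simp
    moreover have "r \<le> M" if "r \<in> traps J" for r
      using small(5)[of r] that listed(4) pow J(4) by auto
    moreover have "d \<le> M" "goal J \<le> M" using d(2) pow J(7) card(1) by linarith+
    ultimately have "a \<le> M \<and> b \<le> M \<and> c \<le> M"
      using mem le le_M us by (elim disjE) (auto simp del: One_nat_def intro: order_trans[OF div_le_dividend])
    with M_less show ?thesis by linarith
  qed
  define D where "D = db (flat (instance_recs as vs es (source J) (target J) rs (goal J) @ (cert_tag, []) # cert_recs n us))"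
  have us_tag': "fst r < 8" if "r \<in> set us" for r using us_tag[OF that] by simp
  have tokens: "tokens (List asset_tag) x y =
      flat (instance_recs as vs es (source J) (target J) rs (goal J) @ (cert_tag, []) # cert_recs n us)"
    unfolding x flat_instance_recs y_def using parse_cert_word[of us n] us_tag' by simp
  have "instance_db D as vs es (source J) (target J) rs (goal J)"
    unfolding D_def
  proof (rule instance_db[OF refl])
    show "wf_recs ((cert_tag, []) # cert_recs n us)"
      using tracks_digit by (auto simp: wf_recs_def cert_recs_def is_head_def)
    show "fst r = cert_tag \<or> fst r < asset_tag" if "r \<in> set ((cert_tag, []) # cert_recs n us)" for r
      using that us_tag' by (fastforce simp: cert_recs_def)
  qed
  then interpret db: instance_db D as vs es "source J" "target J" rs "goal J" .
  have rel: "rel D (16 + u) a b c \<longleftrightarrow> (u, a, b, c) \<in> set us" if "u < 8" for u a b c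
    by (rule rel_cert[OF D_def that us_tag' us_less])
  have rels: "rel D 16 = (\<lambda>i a p. i \<le> N \<and> a \<in> assets J \<and> p = code d (X i a))"
    "rel D 17 = (\<lambda>i r b. i \<le> N \<and> r \<in> traps J \<and> b = \<beta> i r)"
    "rel D 18 = (\<lambda>i \<delta> e. i \<le> N \<and> \<delta> = ds i \<and> e = ds i div 2)"
    "(\<lambda>j a. \<exists>c. rel D 19 j a c) = (\<lambda>j a. j \<in> {1..goal J} \<and> a = g j)"
    "\<exists>b c. rel D 20 d b c" "\<exists>b c. rel D 21 N b c"
    using rel[of 0] rel[of 1] rel[of 2] rel[of 3] rel[of 4] rel[of 5]
    by (simp_all add: us[unfolded One_nat_def] us fun_eq_iff)
  have fst_rs: "map fst rs = rs'" by (simp add: rs_def comp_def)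
  have wf: db.well_formed
    unfolding db.well_formed_def fst_rs
  proof (intro conjI)
    show "\<forall>(u, v)\<in>set es. u \<in> set vs \<and> v \<in> set vs \<and> u \<noteq> v"
    proof -
      have "u \<in> set vs \<and> v \<in> set vs \<and> u \<noteq> v" if "(u, v) \<in> set es" for u v
      proof -
        have "{u, v} \<in> edges J" using that listed(6) by force
        then have "{u, v} \<subseteq> vertices J" "card {u, v} = 2" using J(8) by blast+
        then show ?thesis using listed(4) by auto
      qed
      then show ?thesis by blast
    qed
  qed (use listed J in \<open>auto simp: rs_def\<close>)
  have "cert_ok db.I d N db.loc db.wait db.steps db.chosen"
    unfolding rels
  proof (rule cert_ok_cong[OF _ _ _ _ _ _ _ _ cert])
    have traps: "fst ` set rs = traps J" using fst_rs listed(8) by (metis set_map)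
    show "assets J = assets db.I" "vertices J = vertices db.I" "edges J = edges db.I" "source J = source db.I"
      "target J = target db.I" "traps J = traps db.I" "goal J = goal db.I"
      using listed traps by simp_all
    show "reload J r = reload db.I r" if "r \<in> traps J" for r
    proof -
      have "map_of rs r = Some (reload J r)"
        using that listed(8) by (simp add: rs_def map_of_map_restrict)
      then show ?thesis by simp
    qed
  qed
  then have "dsat D (\<lambda>_. virtual 0 0 0 0) routing_fm"
    unfolding db.dsat_routing_fm using wf rels(5,6) by blast
  then have "holds routing_fm (tokens (List asset_tag) x y)"
    unfolding D_def tokens[symmetric] unfolding tokens_def
    by (rule holds_iff_dsat[OF wf_routing_fm transduce_nonzero, THEN iffD2])
  with length_y show ?thesis by blast
qed

theorem theorem2: "ROUTING_PLAN \<in> NP"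
proof (rule NP_of_formula[where \<tau> = parse and S = parse_states and ?s0.0 = "List asset_tag" and G = 64 and K = 20 and
      f = routing_fm and p = "[:20000:] * [:1, 1:] ^ 11"])
  show "List asset_tag \<in> parse_states" by (auto simp: parse_states_def)
  show "x \<in> ROUTING_PLAN \<longleftrightarrow> (\<exists>y. length y \<le> poly ([:20000:] * [:1, 1:] ^ 11) (length x) \<and>
      holds routing_fm (transduce parse (List asset_tag) (pair_word x y)))" for x
    using routing_fm_sound routing_fm_complete unfolding tokens_pair_word
    by (simp only: poly_mult poly_power) (auto simp: add.commute)
qed (simp_all add: finite_parse_states parse_closed wf_routing_fm)

end
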